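(* Let $n\ge 2$ and $1<p<\infty$. Let $\Omega$ be a bounded domain in $\mathbb{R}^n$ with smooth boundary $M$, and let $R>0$ be such that $\mathrm{Vol}(\Omega)=\mathrm{Vol}(B(R))$. Let $\mu_{1,p}$ be the first non-zero eigenvalue of the Steklov eigenvalue problem $$\Delta_p u=0\ \text{ in }\Omega,\qquad |\nabla u|^{p-2}\frac{\partial u}{\partial\nu}=\mu_p\,|u|^{p-2}u\ \text{ on }M .$$ Then: (i) for $1<p<2$, $$\mu_{1,p}\le\frac{1}{R^{p-1}};$$ (ii) for $p\ge 2$, $$\mu_{1,p}\le\frac{n^{p-2}}{R^{p-1}} .$$ Furthermore, for $p=2$, equality $\mu_{1,2}=\frac1R$ holds if and only if $M$ is a geodesic sphere of radius $R$. Moreover, if equality holds in the inequality among (i), (ii) that applies to the given $p$, then $M$ is a geodesic sphere of radius $R$ and $p=2$.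
   Context: $\mathbb{R}^n$ carries its Euclidean metric. $B(R)$ is a ball of radius $R$ in $\mathbb{R}^n$; $\mathrm{Vol}$ denotes $n$-dimensional volume for domains. A geodesic sphere of radius $R$ in $\mathbb{R}^n$ is a round sphere $\{x:|x-q|=R\}$ for some center $q$. The $p$-Laplace operator is $\Delta_p u=-\mathrm{div}\left(|\nabla u|^{p-2}\nabla u\right)$, and $\nu$ is the outward unit normal on $M=\partial\Omega$. The first non-zero eigenvalue $\mu_{1,p}$ of the Steklov problem is given by the variational characterization $$\mu_{1,p}=\inf\left\{\frac{\int_\Omega\|\nabla u\|^p}{\int_M|u|^p}\ :\ \int_M|u|^{p-2}u=0,\ u\in C^1(\overline\Omega),\ u\not\equiv 0\text{ on }M\right\},$$ where integrals over $M$ are with respect to its induced $(n-1)$-dimensional Riemannian volume measure and integrals over $\Omega$ are with respect to Lebesgue measure. *)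

theory Defs
  imports "HOL-Analysis.Analysis"
begin

definition grad :: "('a::real_inner \<Rightarrow> real) \<Rightarrow> 'a \<Rightarrow> 'a" where
  "grad u x = (THE D. GDERIV u x :> D)"

fun C_k :: "nat \<Rightarrow> (real ^ 'n \<Rightarrow> real) \<Rightarrow> bool" where
  "C_k 0 f \<longleftrightarrow> continuous_on UNIV f"
| "C_k (Suc k) f \<longleftrightarrow> (\<forall>x. f differentiable (at x)) \<and> (\<forall>i. C_k k (\<lambda>x. grad f x $ i))"

definition C_infinity :: "(real ^ 'n \<Rightarrow> real) \<Rightarrow> bool" where
  "C_infinity f \<longleftrightarrow> (\<forall>k. C_k k f)"

(* A smooth function of the n - 1 coordinates other than x $ k, encoded as a smooth function
   on the whole space that does not depend on x $ k. *)
definition smooth_graph_function :: "'n \<Rightarrow> (real ^ 'n \<Rightarrow> real) \<Rightarrow> bool" where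
  "smooth_graph_function k \<gamma> \<longleftrightarrow>
     C_infinity \<gamma> \<and> (\<forall>x t. \<gamma> (x + t *\<^sub>R axis k 1) = \<gamma> x)"

(* Near each boundary point, \<Omega> is the strict epigraph or the strict hypograph of a smooth function
   of n - 1 of the coordinates. *)
definition smooth_boundary :: "(real ^ 'n) set \<Rightarrow> bool" where
  "smooth_boundary \<Omega> \<longleftrightarrow>
     (\<forall>x0\<in>frontier \<Omega>. \<exists>r>0. \<exists>k \<gamma>. smooth_graph_function k \<gamma> \<and>
        (\<Omega> \<inter> ball x0 r = {x \<in> ball x0 r. x $ k > \<gamma> x} \<or>
         \<Omega> \<inter> ball x0 r = {x \<in> ball x0 r. x $ k < \<gamma> x}))"

(* (n-1)-dimensional Lebesgue measure on the coordinate hyperplane x $ k = 0, regarded as a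
   Borel measure on the whole space. *)
definition hyperplane_lborel :: "'n \<Rightarrow> (real ^ 'n) measure" where
  "hyperplane_lborel k =
     distr (\<Pi>\<^sub>M i\<in>UNIV - {k}. lborel) borel (\<lambda>f. \<chi> i. if i = k then 0 else f i)"

lemma measurable_hyperplane_embedding:
  "(\<lambda>f. (\<chi> i. if i = k then 0 else f i) :: real ^ 'n)
     \<in> borel_measurable (\<Pi>\<^sub>M i\<in>UNIV - {k}. lborel)"
proof (rule borel_measurable_euclidean_space[THEN iffD2], rule ballI)
  fix b :: "real ^ 'n"
  assume "b \<in> Basis"
  then obtain j where b: "b = axis j 1"
    by (auto simp: Basis_vec_def)
  have "(\<lambda>f. if j = k then 0 else f j) \<in> borel_measurable (\<Pi>\<^sub>M i\<in>UNIV - {k}. lborel :: real measure)"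
    by (cases "j = k") (auto intro!: measurable_component_singleton simp flip: measurable_lborel1)
  then show "(\<lambda>f. ((\<chi> i. if i = k then 0 else f i) :: real ^ 'n) \<bullet> b)
      \<in> borel_measurable (\<Pi>\<^sub>M i\<in>UNIV - {k}. lborel)"
    by (simp add: b inner_axis)
qed

(* The parametrization y \<mapsto> y + \<gamma> y *\<^sub>R axis k 1 of M \<inter> W over the hyperplane has the metric
   I + \<nabla>\<gamma> \<nabla>\<gamma>\<^sup>T, so its Riemannian volume density is the square root of the determinant
   1 + |\<nabla>\<gamma>|\<^sup>2. As \<gamma> does not depend on x $ k, grad \<gamma> is the gradient in the other coordinates. *)
definition graph_patch ::
    "(real ^ 'n) set \<Rightarrow> (real ^ 'n) set \<Rightarrow> 'n \<Rightarrow> (real ^ 'n \<Rightarrow> real) \<Rightarrow> bool" where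
  "graph_patch M W k \<gamma> \<longleftrightarrow>
     open W \<and> smooth_graph_function k \<gamma> \<and> M \<inter> W = {x \<in> W. x $ k = \<gamma> x}"

definition graph_area :: "'n \<Rightarrow> (real ^ 'n \<Rightarrow> real) \<Rightarrow> (real ^ 'n) set \<Rightarrow> ennreal" where
  "graph_area k \<gamma> A =
     (\<integral>\<^sup>+ y. ennreal (sqrt (1 + (norm (grad \<gamma> y))\<^sup>2)) * indicator A (y + \<gamma> y *\<^sub>R axis k 1)
        \<partial>hyperplane_lborel k)"

definition is_riemannian_volume :: "(real ^ 'n) set \<Rightarrow> (real ^ 'n) measure \<Rightarrow> bool" where
  "is_riemannian_volume M \<sigma> \<longleftrightarrow>
     sets \<sigma> = sets (restrict_space borel M) \<and>
     (\<forall>W k \<gamma>. graph_patch M W k \<gamma> \<longrightarrow>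
        (\<forall>A\<in>sets borel. A \<subseteq> M \<inter> W \<longrightarrow> emeasure \<sigma> A = graph_area k \<gamma> A))"

(* For a smooth hypersurface M the measure exists and is unique: graph patches cover M, and
   their volume densities agree on overlaps. *)
definition surface_measure :: "(real ^ 'n) set \<Rightarrow> (real ^ 'n) measure" where
  "surface_measure M = (THE \<sigma>. is_riemannian_volume M \<sigma>)"

(* u is continuously differentiable in \<Omega>, and u and its gradient extend continuously to the
   closure; the boundary values of u are those of the extension. *)
definition C1_closure :: "(real ^ 'n) set \<Rightarrow> (real ^ 'n \<Rightarrow> real) \<Rightarrow> bool" where
  "C1_closure \<Omega> u \<longleftrightarrow>
     continuous_on (closure \<Omega>) u \<and> (\<forall>x\<in>\<Omega>. u differentiable (at x)) \<and>
     (\<exists>G. continuous_on (closure \<Omega>) G \<and> (\<forall>x\<in>\<Omega>. G x = grad u x))"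

(* Since 0 powr a = 0, the integrand |u|\<^sup>p\<^sup>-\<^sup>2 u is 0 at the zeros of u also for p < 2. *)
definition steklov_admissible :: "real \<Rightarrow> (real ^ 'n) set \<Rightarrow> (real ^ 'n \<Rightarrow> real) \<Rightarrow> bool" where
  "steklov_admissible p \<Omega> u \<longleftrightarrow>
     C1_closure \<Omega> u \<and> (\<exists>x\<in>frontier \<Omega>. u x \<noteq> 0) \<and>
     (LINT x|surface_measure (frontier \<Omega>). \<bar>u x\<bar> powr (p - 2) * u x) = 0"

definition steklov_quotient :: "real \<Rightarrow> (real ^ 'n) set \<Rightarrow> (real ^ 'n \<Rightarrow> real) \<Rightarrow> real" where
  "steklov_quotient p \<Omega> u =
     (LINT x:\<Omega>|lebesgue. norm (grad u x) powr p) /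
     (LINT x|surface_measure (frontier \<Omega>). \<bar>u x\<bar> powr p)"

(* The first non-zero eigenvalue of the Steklov problem for the p-Laplacian, given by its
   variational characterization. *)
definition steklov_mu1 :: "real \<Rightarrow> (real ^ 'n) set \<Rightarrow> real" where
  "steklov_mu1 p \<Omega> = Inf {steklov_quotient p \<Omega> u | u. steklov_admissible p \<Omega> u}"

definition is_geodesic_sphere :: "real \<Rightarrow> (real ^ 'n) set \<Rightarrow> bool" where
  "is_geodesic_sphere R M \<longleftrightarrow> (\<exists>q. M = sphere q R)"

end

theory Submission
  imports Defs "HOL-Probability.Probability" "HOL-Real_Asymp.Real_Asymp"
begin

text \<open>
  By the intermediate value theorem there is a centre q such that every coordinate function
  x $ i - q $ i is balanced for the weight s \<mapsto> |s| powr (p - 2) * s. Its gradient has norm 1, so summing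
  its Steklov quotients bounds mu times the boundary integral of sum_i |x_i - q_i| powr p by n times the volume.
  Pointwise, this sum dominates |x - q| powr p for p \<le> 2, and n powr (1 - p/2) times it for p \<ge> 2.
  The divergence theorem for |x - q| powr (p - 1) * (x - q), and the fact that among all sets of
  given volume the ball around q has the least moment of |x - q| powr (p - 1), bound the boundary integral of
  |x - q| powr p from below by n * R powr (p - 1) times the volume. For p < 2 the pointwise comparison is
  strict at boundary points off the axes, for p > 2 one has p/2 - 1 < p - 2, and for p = 2 equality in the moment
  comparison forces the domain to be the ball.

  That the ball attains 1/R for p = 2 amounts to the sharp trace inequality for functions of mean zero on the
  sphere. It is obtained without spherical harmonics: the Gaussian Poincare inequality, applied to
  functions that are homogeneous of degree 0, yields the Poincare inequality on spheres with the sharp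
  constant n - 1, which controls the tangential part of the energy; the radial part is handled in one dimension.
\<close>

subsection \<open>Integration over coordinate hyperplanes\<close>

lemma borel_measurable_vec_lambda:
  "(\<lambda>f. (\<chi> i. f i) :: real ^ 'n) \<in> borel_measurable (\<Pi>\<^sub>M i\<in>UNIV. lborel)"
proof (rule borel_measurable_euclidean_space[THEN iffD2], rule ballI)
  fix b :: "real ^ 'n"
  assume "b \<in> Basis"
  then obtain j where b: "b = axis j 1"
    by (auto simp: Basis_vec_def)
  have "(\<lambda>f. f j) \<in> borel_measurable (\<Pi>\<^sub>M i\<in>UNIV. lborel :: real measure)"
    by (auto intro!: measurable_component_singleton simp flip: measurable_lborel1)
  then show "(\<lambda>f. ((\<chi> i. f i) :: real ^ 'n) \<bullet> b) \<in> borel_measurable (\<Pi>\<^sub>M i\<in>UNIV. lborel)"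
    by (simp add: b inner_axis)
qed

lemma vec_box_eq: "box l u = {x :: real ^ 'n. \<forall>i. l $ i < x $ i \<and> x $ i < u $ i}"
  by (auto simp: box_def Basis_vec_def inner_axis)

interpretation lb: product_sigma_finite "\<lambda>_::'i. lborel :: real measure" ..

lemma lborel_vec_eq_distr:
  "(lborel :: (real ^ 'n) measure) = distr (\<Pi>\<^sub>M i\<in>UNIV. lborel) borel (\<lambda>f. \<chi> i. f i)"
proof (rule lborel_eqI)
  fix l u :: "real ^ 'n"
  assume le: "\<And>b. b \<in> Basis \<Longrightarrow> l \<bullet> b \<le> u \<bullet> b"
  then have le': "l $ i \<le> u $ i" for i
    using le[of "axis i 1"] by (simp add: inner_axis)
  have "(\<lambda>f. \<chi> i. f i) -` box l u \<inter> space (\<Pi>\<^sub>M i\<in>UNIV. lborel)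
     = (\<Pi>\<^sub>E i\<in>UNIV. {l $ i <..< u $ i})"
    by (auto simp: vec_box_eq space_PiM PiE_iff)
  then have "emeasure (distr (\<Pi>\<^sub>M i\<in>UNIV. lborel) borel (\<lambda>f. \<chi> i. f i)) (box l u)
     = emeasure (\<Pi>\<^sub>M i\<in>UNIV. lborel) (\<Pi>\<^sub>E i\<in>UNIV. {l $ i <..< u $ i})"
    by (subst emeasure_distr[OF borel_measurable_vec_lambda]) simp_all
  also have "\<dots> = (\<Prod>i\<in>UNIV. ennreal (u $ i - l $ i))"
    using le' by (subst lb.emeasure_PiM) auto
  also have "\<dots> = ennreal (\<Prod>i\<in>UNIV. (u - l) $ i)"
    using le' by (simp add: prod_ennreal)
  also have "(\<Prod>i\<in>UNIV. (u - l) $ i) = (\<Prod>b\<in>Basis. (u - l) \<bullet> b)"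
  proof -
    have *: "Basis = range (\<lambda>i. axis i 1 :: real ^ 'n)"
      by (auto simp: Basis_vec_def)
    have "inj (\<lambda>i. axis i 1 :: real ^ 'n)"
      by (simp add: inj_def axis_eq_axis)
    then show ?thesis
      unfolding * by (subst prod.reindex) (simp_all add: inner_axis)
  qed
  finally show "emeasure (distr (\<Pi>\<^sub>M i\<in>UNIV. lborel) borel (\<lambda>f. \<chi> i. f i)) (box l u)
     = (\<Prod>b\<in>Basis. (u - l) \<bullet> b)" .
qed simp

lemma sets_hyperplane_lborel [simp, measurable_cong]: "sets (hyperplane_lborel k) = sets borel"
  and space_hyperplane_lborel [simp]: "space (hyperplane_lborel k) = UNIV"
  by (simp_all add: hyperplane_lborel_def)

lemma nn_integral_hyperplane_lborel:
  fixes f :: "real ^ 'n \<Rightarrow> ennreal"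
  assumes [measurable]: "f \<in> borel_measurable borel"
  shows "(\<integral>\<^sup>+ x. f x \<partial>lborel) = (\<integral>\<^sup>+ y. \<integral>\<^sup>+ s. f (y + s *\<^sub>R axis k 1) \<partial>lborel \<partial>hyperplane_lborel k)"
proof -
  have m: "(\<lambda>g. f (\<chi> i. g i)) \<in> borel_measurable (\<Pi>\<^sub>M i\<in>UNIV. lborel)"
    using measurable_compose[OF borel_measurable_vec_lambda assms] by simp
  have "(\<integral>\<^sup>+ x. f x \<partial>lborel) = (\<integral>\<^sup>+ g. f (\<chi> i. g i) \<partial>(\<Pi>\<^sub>M i\<in>UNIV. lborel))"
    by (subst lborel_vec_eq_distr, subst nn_integral_distr[OF borel_measurable_vec_lambda])
       simp_all
  also have "\<dots> = (\<integral>\<^sup>+ g. f (\<chi> i. g i) \<partial>(\<Pi>\<^sub>M i\<in>insert k (UNIV - {k}). lborel))"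
    by (simp add: insert_absorb)
  also have "\<dots> = (\<integral>\<^sup>+ g. \<integral>\<^sup>+ s. f (\<chi> i. (g(k := s)) i) \<partial>lborel \<partial>(\<Pi>\<^sub>M i\<in>UNIV - {k}. lborel))"
    by (subst lb.product_nn_integral_insert) (auto simp: insert_absorb m)
  also have "\<dots> = (\<integral>\<^sup>+ g. \<integral>\<^sup>+ s. f ((\<chi> i. if i = k then 0 else g i) + s *\<^sub>R axis k 1) \<partial>lborel \<partial>(\<Pi>\<^sub>M i\<in>UNIV - {k}. lborel))"
    by (intro nn_integral_cong arg_cong[of _ _ f]) (auto simp: vec_eq_iff axis_def)
  also have "\<dots> = (\<integral>\<^sup>+ y. \<integral>\<^sup>+ s. f (y + s *\<^sub>R axis k 1) \<partial>lborel \<partial>hyperplane_lborel k)"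
    unfolding hyperplane_lborel_def
    by (subst nn_integral_distr[OF measurable_hyperplane_embedding]) simp_all
  finally show ?thesis .
qed

lemma emeasure_hyperplane_lborel_bounded:
  fixes A :: "(real ^ 'n) set"
  assumes "bounded A"
  shows "emeasure (hyperplane_lborel k) A < \<infinity>"
proof -
  obtain a where A: "A \<subseteq> cbox (-a) a"
    using bounded_subset_cbox_symmetric[OF assms] by blast
  have "(\<lambda>f. (\<chi> i. if i = k then 0 else f i) :: real ^ 'n) -` cbox (-a) a \<inter> space (\<Pi>\<^sub>M i\<in>UNIV - {k}. lborel)
     \<subseteq> (\<Pi>\<^sub>E i\<in>UNIV - {k}. {- a $ i .. a $ i})"
  proof
    fix f assume f: "f \<in> (\<lambda>f. (\<chi> i. if i = k then 0 else f i) :: real ^ 'n) -` cbox (-a) a \<inter> space (\<Pi>\<^sub>M i\<in>UNIV - {k}. lborel)"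
    then have "- a $ i \<le> (if i = k then 0 else f i) \<and> (if i = k then 0 else f i) \<le> a $ i" for i
      by (simp add: mem_box_cart)
    then have "- a $ i \<le> f i \<and> f i \<le> a $ i" if "i \<noteq> k" for i
      using that by metis
    then show "f \<in> (\<Pi>\<^sub>E i\<in>UNIV - {k}. {- a $ i .. a $ i})"
      using f by (auto simp: space_PiM PiE_iff)
  qed
  then have "emeasure (hyperplane_lborel k) (cbox (-a) a)
     \<le> emeasure (\<Pi>\<^sub>M i\<in>UNIV - {k}. lborel) (\<Pi>\<^sub>E i\<in>UNIV - {k}. {- a $ i .. a $ i})"
    unfolding hyperplane_lborel_def
    by (subst emeasure_distr[OF measurable_hyperplane_embedding]) (auto intro!: emeasure_mono)
  also have "\<dots> < \<infinity>"
    by (subst lb.emeasure_PiM) (auto simp: emeasure_lborel_Icc_eq less_top[symmetric] ennreal_prod_eq_top)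
  finally show ?thesis
    using emeasure_mono[OF A, of "hyperplane_lborel k"] by (auto simp: le_less_trans)
qed

lemma sigma_finite_hyperplane_lborel: "sigma_finite_measure (hyperplane_lborel k)"
proof
  let ?A = "range (\<lambda>n. cball (0 :: real ^ 'n) (real n))"
  have "\<Union>?A = UNIV"
    by (auto simp: real_arch_simple)
  then show "\<exists>A. countable A \<and> A \<subseteq> sets (hyperplane_lborel k) \<and> \<Union>A = space (hyperplane_lborel k)
     \<and> (\<forall>a\<in>A. emeasure (hyperplane_lborel k) a \<noteq> \<infinity>)"
    using emeasure_hyperplane_lborel_bounded[of "cball 0 _" k]
    by (intro exI[of _ ?A]) (auto simp: less_top)
qed

lemma lborel_eq_distr_shear:
  fixes \<gamma> :: "real ^ 'n \<Rightarrow> real"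
  assumes [measurable]: "\<gamma> \<in> borel_measurable borel"
  shows "lborel = distr (hyperplane_lborel k \<Otimes>\<^sub>M lborel) borel (\<lambda>(y, s). y + (\<gamma> y + s) *\<^sub>R axis k 1)"
    (is "_ = ?D")
proof (rule measure_eqI)
  interpret sigma_finite_measure "hyperplane_lborel k"
    by (rule sigma_finite_hyperplane_lborel)
  fix A :: "(real ^ 'n) set"
  assume "A \<in> sets lborel"
  then have [measurable]: "A \<in> sets borel" by simp
  have "emeasure ?D A = (\<integral>\<^sup>+ z. indicator A z \<partial>?D)"
    by simp
  also have "\<dots> = (\<integral>\<^sup>+ z. indicator A (case z of (y, s) \<Rightarrow> y + (\<gamma> y + s) *\<^sub>R axis k 1) \<partial>(hyperplane_lborel k \<Otimes>\<^sub>M lborel))"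
    by (subst nn_integral_distr) simp_all
  also have "\<dots> = (\<integral>\<^sup>+ y. \<integral>\<^sup>+ s. indicator A (y + (\<gamma> y + s) *\<^sub>R axis k 1) \<partial>lborel \<partial>hyperplane_lborel k)"
    by (subst lborel.nn_integral_fst[symmetric]) simp_all
  also have "\<dots> = (\<integral>\<^sup>+ y. \<integral>\<^sup>+ s. indicator A (y + s *\<^sub>R axis k 1) \<partial>lborel \<partial>hyperplane_lborel k)"
  proof (rule nn_integral_cong)
    fix y :: "real ^ 'n"
    show "(\<integral>\<^sup>+ s. indicator A (y + (\<gamma> y + s) *\<^sub>R axis k 1) \<partial>lborel) = (\<integral>\<^sup>+ s. indicator A (y + s *\<^sub>R axis k 1) \<partial>lborel)"
      by (subst nn_integral_real_affine[of _ 1 "\<gamma> y"]) simp_all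
  qed
  also have "\<dots> = (\<integral>\<^sup>+ x. indicator A x \<partial>lborel)"
    by (rule nn_integral_hyperplane_lborel[symmetric]) simp
  finally show "emeasure lborel A = emeasure ?D A"
    by simp
qed simp

subsection \<open>Continuously differentiable functions\<close>

definition C1 :: "('a::euclidean_space \<Rightarrow> real) \<Rightarrow> bool" where
  "C1 f \<longleftrightarrow> (\<forall>x. f differentiable (at x)) \<and> continuous_on UNIV (grad f)"

lemma grad_eqI:
  assumes "GDERIV f x :> D"
  shows "grad f x = D"
  unfolding grad_def
proof (rule the_equality)
  fix E assume "GDERIV f x :> E"
  with assms have "(\<lambda>h. h \<bullet> D) = (\<lambda>h. h \<bullet> E)"
    unfolding gderiv_def using has_derivative_unique by blast
  then have "(D - E) \<bullet> (D - E) = 0"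
    by (metis inner_diff_right right_minus_eq)
  then show "E = D" by simp
qed fact

lemma GDERIV_grad:
  fixes f :: "'a::euclidean_space \<Rightarrow> real"
  assumes "f differentiable (at x)"
  shows "GDERIV f x :> grad f x"
proof -
  obtain f' where f': "(f has_derivative f') (at x)"
    using assms by (auto simp: differentiable_def)
  interpret f': linear f'
    using f' by (rule has_derivative_linear)
  have "f' = (\<lambda>h. h \<bullet> (\<Sum>b\<in>Basis. f' b *\<^sub>R b))"
  proof
    fix h
    have "f' h = f' (\<Sum>b\<in>Basis. (h \<bullet> b) *\<^sub>R b)"
      by (simp add: euclidean_representation)
    then show "f' h = h \<bullet> (\<Sum>b\<in>Basis. f' b *\<^sub>R b)"
      by (simp add: f'.sum f'.scale inner_sum_right mult.commute)
  qed
  then have "GDERIV f x :> (\<Sum>b\<in>Basis. f' b *\<^sub>R b)"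
    using f' by (simp add: gderiv_def)
  then show ?thesis
    by (simp add: grad_eqI)
qed

lemma C1I:
  assumes "\<And>x. GDERIV f x :> D x" and "continuous_on UNIV D"
  shows "C1 f"
proof -
  have "grad f = D"
    using assms(1) by (auto intro: grad_eqI)
  then show ?thesis
    using assms by (auto simp: C1_def gderiv_def differentiable_def)
qed

lemma C1_GDERIV: "C1 f \<Longrightarrow> GDERIV f x :> grad f x"
  by (auto simp: C1_def intro: GDERIV_grad)

lemma C1_has_derivative: "C1 f \<Longrightarrow> (f has_derivative (\<lambda>h. h \<bullet> grad f x)) (at x)"
  using C1_GDERIV[of f x] by (simp add: gderiv_def)

lemma C1_continuous_grad: "C1 f \<Longrightarrow> continuous_on UNIV (grad f)"
  by (simp add: C1_def)

lemma C1_continuous: "C1 f \<Longrightarrow> continuous_on UNIV f"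
  by (metis C1_has_derivative continuous_at_imp_continuous_on has_derivative_continuous)

lemma C1_continuous_compose:
  assumes "C1 f" "continuous_on A g"
  shows "continuous_on A (\<lambda>x. f (g x))" "continuous_on A (\<lambda>x. grad f (g x))"
  using assms continuous_on_compose2[OF C1_continuous[OF assms(1)]]
    continuous_on_compose2[OF C1_continuous_grad[OF assms(1)]] by auto

lemma C1_const [simp]: "C1 (\<lambda>x. c)"
  by (rule C1I[OF GDERIV_const]) auto

lemma C1_add: "C1 f \<Longrightarrow> C1 g \<Longrightarrow> C1 (\<lambda>x. f x + g x)"
  using C1_continuous[of f] C1_continuous[of g] C1_continuous_grad[of f] C1_continuous_grad[of g]
  by (intro C1I[OF GDERIV_add]) (auto intro: C1_GDERIV intro!: continuous_intros)

lemma C1_mult: "C1 f \<Longrightarrow> C1 g \<Longrightarrow> C1 (\<lambda>x. f x * g x)"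
  using C1_continuous[of f] C1_continuous[of g] C1_continuous_grad[of f] C1_continuous_grad[of g]
  by (intro C1I[OF GDERIV_mult]) (auto intro: C1_GDERIV intro!: continuous_intros)

lemma C1_sum: "(\<And>i. i \<in> I \<Longrightarrow> C1 (f i)) \<Longrightarrow> C1 (\<lambda>x. \<Sum>i\<in>I. f i x)"
  by (induction I rule: infinite_finite_induct) (auto intro: C1_add)

lemma C1_power: "C1 f \<Longrightarrow> C1 (\<lambda>x. f x ^ n)"
  by (induction n) (auto intro: C1_mult)

lemma C1_minus: "C1 f \<Longrightarrow> C1 (\<lambda>x. - f x)"
  using C1_continuous_grad[of f]
  by (intro C1I[OF GDERIV_minus]) (auto intro: C1_GDERIV intro!: continuous_intros)

lemma C1_diff: "C1 f \<Longrightarrow> C1 g \<Longrightarrow> C1 (\<lambda>x. f x - g x)"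
  using C1_continuous[of f] C1_continuous[of g] C1_continuous_grad[of f] C1_continuous_grad[of g]
  by (intro C1I[OF GDERIV_diff]) (auto intro: C1_GDERIV intro!: continuous_intros)

lemma C1_compose:
  assumes f: "C1 f" and g: "\<And>x. DERIV g (f x) :> g' (f x)"
    and g': "continuous_on UNIV (\<lambda>x. g' (f x))"
  shows "C1 (\<lambda>x. g (f x))"
  by (rule C1I[OF GDERIV_DERIV_compose[OF C1_GDERIV[OF f] g]])
     (use C1_continuous_grad[OF f] in \<open>intro continuous_intros g'\<close>)

lemma C1_inverse:
  assumes f: "C1 f" and "\<And>x. f x \<noteq> 0"
  shows "C1 (\<lambda>x. inverse (f x))"
  by (rule C1I[OF GDERIV_inverse[OF C1_GDERIV[OF f]]])
     (use assms C1_continuous[OF f] C1_continuous_grad[OF f] in \<open>auto intro!: continuous_intros\<close>)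

lemma C1_inner: "C1 (\<lambda>x. x \<bullet> a)"
  by (rule C1I[of _ "\<lambda>_. a"]) (auto simp: gderiv_def intro!: derivative_eq_intros)

lemma C1_component: "C1 (\<lambda>x :: real ^ 'n. x $ i)"
  by (rule C1I[of _ "\<lambda>_. axis i 1"])
     (auto simp: gderiv_def inner_axis intro: bounded_linear_imp_has_derivative)

lemma grad_component: "grad (\<lambda>x :: real ^ 'n. x $ i) x = axis i 1"
  by (rule grad_eqI) (auto simp: gderiv_def inner_axis intro: bounded_linear_imp_has_derivative)

lemma grad_mult: "C1 f \<Longrightarrow> C1 g \<Longrightarrow> grad (\<lambda>x. f x * g x) x = f x *\<^sub>R grad g x + g x *\<^sub>R grad f x"
  by (rule grad_eqI[OF GDERIV_mult]) (auto intro: C1_GDERIV)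

lemma grad_add: "C1 f \<Longrightarrow> C1 g \<Longrightarrow> grad (\<lambda>x. f x + g x) x = grad f x + grad g x"
  by (rule grad_eqI[OF GDERIV_add]) (auto intro: C1_GDERIV)

lemma grad_minus: "C1 f \<Longrightarrow> grad (\<lambda>x. - f x) x = - grad f x"
  by (rule grad_eqI[OF GDERIV_minus]) (auto intro: C1_GDERIV)

lemma grad_const [simp]: "grad (\<lambda>x. c) x = 0"
  by (rule grad_eqI[OF GDERIV_const])

lemma grad_sum: "(\<And>i. i \<in> I \<Longrightarrow> C1 (f i)) \<Longrightarrow> grad (\<lambda>x. \<Sum>i\<in>I. f i x) x = (\<Sum>i\<in>I. grad (f i) x)"
  by (induction I rule: infinite_finite_induct) (auto simp: grad_add C1_sum)

lemma grad_cong_open: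
  assumes "open S" "x \<in> S" "\<And>y. y \<in> S \<Longrightarrow> f y = g y"
  shows "grad f x = grad g x"
proof -
  have "GDERIV f x :> D \<longleftrightarrow> GDERIV g x :> D" for D
    unfolding gderiv_def using has_derivative_transform_within_open[OF _ assms(1,2)] assms(3)
    by metis
  then show ?thesis
    by (simp add: grad_def)
qed

lemma C1_DERIV_line:
  assumes "C1 f"
  shows "((\<lambda>s. f (y + s *\<^sub>R e)) has_real_derivative (grad f (y + s *\<^sub>R e) \<bullet> e)) (at s)"
proof -
  have "((\<lambda>s. f (y + s *\<^sub>R e)) has_derivative (\<lambda>h. (h *\<^sub>R e) \<bullet> grad f (y + s *\<^sub>R e))) (at s)"
    by (rule has_derivative_compose[OF _ C1_has_derivative[OF assms], of "\<lambda>s. y + s *\<^sub>R e" "\<lambda>h. h *\<^sub>R e"])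
       (auto intro!: derivative_eq_intros)
  then show ?thesis
    by (simp add: has_field_derivative_def inner_commute mult_commute_abs)
qed

lemma C1_borel:
  assumes "C1 f"
  shows "g \<in> borel_measurable M \<Longrightarrow> (\<lambda>x. f (g x)) \<in> borel_measurable M"
    and "g \<in> borel_measurable M \<Longrightarrow> (\<lambda>x. grad f (g x)) \<in> borel_measurable M"
  using borel_measurable_continuous_onI[OF C1_continuous[OF assms]]
    borel_measurable_continuous_onI[OF C1_continuous_grad[OF assms]]
  by (auto intro: measurable_compose)

lemma borel_measurable_vec_nth [measurable (raw)]:
  "g \<in> borel_measurable M \<Longrightarrow> (\<lambda>x. (g x :: real ^ 'n) $ i) \<in> borel_measurable M"
  by (rule borel_measurable_continuous_on[OF continuous_on_component[OF continuous_on_id]])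

lemma integrable_continuous_bounded_support:
  fixes f :: "'a::euclidean_space \<Rightarrow> real"
  assumes cont: "continuous_on UNIV f" and supp: "bounded {x. f x \<noteq> 0}" and sets: "sets M = sets borel"
    and fin: "\<And>A. bounded A \<Longrightarrow> emeasure M A < \<infinity>"
  shows "integrable M f"
proof -
  obtain B where B: "{x. f x \<noteq> 0} \<subseteq> cball 0 B"
    using bounded_subset_ballD[OF supp, of 0] ball_subset_cball by blast
  have "compact (f ` cball 0 B)"
    by (rule compact_continuous_image[OF continuous_on_subset[OF cont subset_UNIV] compact_cball])
  from compact_imp_bounded[OF this] obtain C where C: "\<And>x. x \<in> cball 0 B \<Longrightarrow> norm (f x) \<le> C"
    unfolding bounded_iff by (metis imageI)
  show ?thesis
  proof (rule integrableI_bounded_set[where A = "cball 0 B" and B = C])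
    show "f \<in> borel_measurable M"
      unfolding measurable_cong_sets[OF sets refl] by (rule borel_measurable_continuous_onI[OF cont])
    show "AE x in M. x \<notin> cball 0 B \<longrightarrow> f x = 0"
      using B by (intro AE_I2) blast
    show "cball 0 B \<in> sets M" using sets by simp
    show "emeasure M (cball 0 B) < \<infinity>" by (rule fin) simp
    show "AE x in M. x \<in> cball 0 B \<longrightarrow> norm (f x) \<le> C"
      using C by (intro AE_I2) blast
  qed
qed

lemma integrable_lborel_continuous_bounded_support:
  fixes f :: "'a::euclidean_space \<Rightarrow> real"
  assumes "continuous_on UNIV f" "bounded {x. f x \<noteq> 0}"
  shows "integrable lborel f"
  using assms emeasure_bounded_finite by (intro integrable_continuous_bounded_support) auto

lemma integral_deriv_bounded_support:
  fixes h h' :: "real \<Rightarrow> real"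
  assumes h: "\<And>s. DERIV h s :> h' s" and h': "continuous_on UNIV h'"
    and supp: "bounded {s. h s \<noteq> 0}"
  shows "(LINT s|lborel. h' s) = 0" and "(LINT s|lborel. indicator {0<..} s * h' s) = - h 0"
proof -
  obtain B0 where B0: "{s. h s \<noteq> 0} \<subseteq> cball 0 B0"
    using bounded_subset_ballD[OF supp, of 0] ball_subset_cball by blast
  define B where "B = max B0 0 + 1"
  have h0: "h s = 0" if "\<bar>s\<bar> > B - 1" for s
    using that B0 by (force simp: B_def)
  have h'0: "h' s = 0" if "\<bar>s\<bar> > B - 1" for s
  proof -
    have "open {s. \<bar>s\<bar> > B - 1}"
      by (intro open_Collect_less continuous_intros)
    then have "((\<lambda>_. 0) has_field_derivative h' s) (at s)"
      using h0 that by (intro has_field_derivative_transform_within_open[OF h[of s]]) auto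
    then show ?thesis
      using DERIV_unique[OF _ DERIV_const] by blast
  qed
  have B: "B \<ge> 1" by (simp add: B_def)
  have FTC: "(LINT s|lborel. indicator {a..B} s *\<^sub>R h' s) = h B - h a" if "a \<le> B" for a
    by (rule integral_FTC_atLeastAtMost[OF that])
       (use continuous_on_subset[OF h'] has_field_derivative_at_within[OF h]
         in \<open>auto simp: has_real_derivative_iff_has_vector_derivative[symmetric]\<close>)
  have "(LINT s|lborel. h' s) = (LINT s|lborel. indicator {-B..B} s *\<^sub>R h' s)"
    by (intro Bochner_Integration.integral_cong) (auto simp: indicator_def intro!: h'0)
  then show "(LINT s|lborel. h' s) = 0"
    using FTC[of "-B"] h0[of B] h0[of "-B"] B by simp
  have m: "h' \<in> borel_measurable borel"
    by (rule borel_measurable_continuous_onI[OF h'])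
  have "(LINT s|lborel. indicator {0<..} s * h' s) = (LINT s|lborel. indicator {0..B} s *\<^sub>R h' s)"
  proof (rule integral_cong_AE)
    show "AE s in lborel. indicator {0<..} s * h' s = indicator {0..B} s *\<^sub>R h' s"
      using AE_lborel_singleton[of "0::real"]
      by eventually_elim (auto simp: indicator_def intro!: h'0)
  qed (use m in auto)
  then show "(LINT s|lborel. indicator {0<..} s * h' s) = - h 0"
    using FTC[of 0] h0[of B] B by simp
qed

lemma
  fixes f :: "real ^ 'n \<Rightarrow> real"
  assumes [measurable]: "\<gamma> \<in> borel_measurable borel" and f: "integrable lborel f"
  shows integral_hyperplane_shear:
    "(LINT x|lborel. f x) = (LINT y|hyperplane_lborel k. LINT s|lborel. f (y + (\<gamma> y + s) *\<^sub>R axis k 1))"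
   and integrable_hyperplane_shear:
    "integrable (hyperplane_lborel k) (\<lambda>y. LINT s|lborel. f (y + (\<gamma> y + s) *\<^sub>R axis k 1))"
   and AE_integrable_hyperplane_shear:
    "AE y in hyperplane_lborel k. integrable lborel (\<lambda>s. f (y + (\<gamma> y + s) *\<^sub>R axis k 1))"
proof -
  interpret h: sigma_finite_measure "hyperplane_lborel k"
    by (rule sigma_finite_hyperplane_lborel)
  interpret pair_sigma_finite "hyperplane_lborel k" lborel ..
  have [measurable]: "f \<in> borel_measurable borel"
    using f by auto
  define T :: "_ \<Rightarrow> real ^ 'n" where "T = (\<lambda>(y, s). y + (\<gamma> y + s) *\<^sub>R axis k 1)"
  have [measurable]: "T \<in> borel_measurable (hyperplane_lborel k \<Otimes>\<^sub>M lborel)"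
    unfolding T_def by measurable
  have D: "lborel = distr (hyperplane_lborel k \<Otimes>\<^sub>M lborel) borel T"
    unfolding T_def by (rule lborel_eq_distr_shear) measurable
  have int: "integrable (hyperplane_lborel k \<Otimes>\<^sub>M lborel) (\<lambda>z. f (T z))"
    using f by (subst (asm) D, subst (asm) integrable_distr_eq) simp_all
  have "(LINT x|lborel. f x) = (LINT z|(hyperplane_lborel k \<Otimes>\<^sub>M lborel). f (T z))"
    by (subst D, subst integral_distr) simp_all
  also have "\<dots> = (LINT y|hyperplane_lborel k. LINT s|lborel. f (T (y, s)))"
    using integral_fst'[OF int] by simp
  finally show "(LINT x|lborel. f x) = (LINT y|hyperplane_lborel k. LINT s|lborel. f (y + (\<gamma> y + s) *\<^sub>R axis k 1))"
    by (simp add: T_def)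
  show "integrable (hyperplane_lborel k) (\<lambda>y. LINT s|lborel. f (y + (\<gamma> y + s) *\<^sub>R axis k 1))"
    using integrable_fst'[OF int] by (simp add: T_def)
  show "AE y in hyperplane_lborel k. integrable lborel (\<lambda>s. f (y + (\<gamma> y + s) *\<^sub>R axis k 1))"
    using AE_integrable_fst'[OF int] by (simp add: T_def)
qed

lemma AE_hyperplane_lborel: "AE y in hyperplane_lborel k. y $ k = 0"
  unfolding hyperplane_lborel_def
  by (subst AE_distr_iff[OF measurable_hyperplane_embedding]) auto

lemma bounded_support_grad:
  assumes "bounded {x. f x \<noteq> 0}"
  shows "bounded {x. grad f x \<noteq> 0}"
proof -
  have "{x. grad f x \<noteq> 0} \<subseteq> closure {x. f x \<noteq> 0}"
  proof (rule subsetI, rule ccontr)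
    fix x assume x: "x \<in> {x. grad f x \<noteq> 0}" "x \<notin> closure {x. f x \<noteq> 0}"
    have "grad f x = grad (\<lambda>x. 0) x"
      by (rule grad_cong_open[of "- closure {x. f x \<noteq> 0}"]) (use x closure_subset[of "{x. f x \<noteq> 0}"] in auto)
    with x show False by simp
  qed
  then show ?thesis
    using assms bounded_closure bounded_subset by blast
qed

lemma bounded_support_line:
  fixes \<psi> :: "'a::real_normed_vector \<Rightarrow> real"
  assumes "bounded {x. \<psi> x \<noteq> 0}" "norm e = 1"
  shows "bounded {s. \<psi> (y + s *\<^sub>R e) \<noteq> 0}"
proof -
  obtain B where B: "\<And>x. \<psi> x \<noteq> 0 \<Longrightarrow> norm x \<le> B"
    using assms(1) unfolding bounded_iff by auto
  have "\<bar>s\<bar> \<le> B + norm y" if "\<psi> (y + s *\<^sub>R e) \<noteq> 0" for s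
  proof -
    have "\<bar>s\<bar> = norm ((y + s *\<^sub>R e) - y)"
      using assms(2) by simp
    also have "\<dots> \<le> norm (y + s *\<^sub>R e) + norm y"
      by (rule norm_triangle_ineq4)
    finally show ?thesis using B[OF that] by simp
  qed
  then show ?thesis
    unfolding bounded_iff by auto
qed

lemma bounded_support_nth: "bounded {x. (F x :: real ^ 'n) \<noteq> 0} \<Longrightarrow> bounded {x. F x $ i \<noteq> 0}"
  by (rule bounded_subset) auto

lemma C1_continuous_grad_nth: "C1 f \<Longrightarrow> continuous_on UNIV (\<lambda>x :: real ^ 'n. grad f x $ i)"
  by (intro continuous_on_component C1_continuous_grad)

lemma integrable_grad_nth:
  fixes \<psi> :: "real ^ 'n \<Rightarrow> real"
  assumes "C1 \<psi>" "bounded {x. \<psi> x \<noteq> 0}"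
  shows "integrable lborel (\<lambda>x. grad \<psi> x $ i)"
  by (intro integrable_lborel_continuous_bounded_support C1_continuous_grad_nth
      bounded_support_nth bounded_support_grad assms)

lemma integral_line_grad:
  fixes \<psi> :: "real ^ 'n \<Rightarrow> real"
  assumes "C1 \<psi>" "bounded {x. \<psi> x \<noteq> 0}"
  shows "(LINT s|lborel. grad \<psi> (y + s *\<^sub>R axis i 1) $ i) = 0"
    and "(LINT s|lborel. indicator {0<..} s * (grad \<psi> (y + s *\<^sub>R axis i 1) $ i)) = - \<psi> y"
proof -
  have D: "((\<lambda>s. \<psi> (y + s *\<^sub>R axis i 1)) has_real_derivative (grad \<psi> (y + s *\<^sub>R axis i 1) $ i)) (at s)" for s
    using C1_DERIV_line[OF assms(1), of y "axis i 1" s] by (simp add: inner_axis)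
  have c: "continuous_on UNIV (\<lambda>s. grad \<psi> (y + s *\<^sub>R axis i 1) $ i)"
    by (intro continuous_on_component C1_continuous_compose(2)[OF assms(1)] continuous_intros)
  have b: "bounded {s. \<psi> (y + s *\<^sub>R axis i 1) \<noteq> 0}"
    by (intro bounded_support_line assms) (simp add: norm_axis_1)
  show "(LINT s|lborel. grad \<psi> (y + s *\<^sub>R axis i 1) $ i) = 0"
    "(LINT s|lborel. indicator {0<..} s * (grad \<psi> (y + s *\<^sub>R axis i 1) $ i)) = - \<psi> y"
    using integral_deriv_bounded_support[OF D c b] by simp_all
qed

lemma integral_grad_UNIV:
  fixes \<psi> :: "real ^ 'n \<Rightarrow> real"
  assumes "C1 \<psi>" "bounded {x. \<psi> x \<noteq> 0}"
  shows "(LINT x|lborel. grad \<psi> x $ i) = 0"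
  by (subst integral_hyperplane_shear[of "\<lambda>_. 0" _ i])
     (simp_all add: integrable_grad_nth integral_line_grad assms)

lemma integral_grad_half_space:
  fixes \<psi> :: "real ^ 'n \<Rightarrow> real"
  assumes "C1 \<psi>" "bounded {x. \<psi> x \<noteq> 0}"
  shows "(LINT x|lborel. indicator {x. x $ k > 0} x * (grad \<psi> x $ i))
    = - (if i = k then LINT y|hyperplane_lborel k. \<psi> y else 0)"
proof -
  have [measurable]: "{x :: real ^ 'n. x $ k > 0} \<in> sets borel"
    by measurable
  have int: "integrable lborel (\<lambda>x. indicator {x. x $ k > 0} x * (grad \<psi> x $ i))"
    using integrable_mult_indicator[OF _ integrable_grad_nth[OF assms, of i], of "{x. x $ k > 0}"] by simp
  have m: "(\<lambda>y. LINT s|lborel. indicator {x. x $ k > 0} (y + (0 + s) *\<^sub>R axis i 1) * (grad \<psi> (y + (0 + s) *\<^sub>R axis i 1) $ i)) \<in> borel_measurable (hyperplane_lborel i)"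
    using integrable_hyperplane_shear[of "\<lambda>_. 0" _ i, OF _ int] by simp
  have "(LINT x|lborel. indicator {x. x $ k > 0} x * (grad \<psi> x $ i))
    = (LINT y|hyperplane_lborel i. LINT s|lborel. indicator {x. x $ k > 0} (y + (0 + s) *\<^sub>R axis i 1) * (grad \<psi> (y + (0 + s) *\<^sub>R axis i 1) $ i))"
    by (rule integral_hyperplane_shear[OF _ int]) simp
  also have "\<dots> = (LINT y|hyperplane_lborel i. (if i = k then - \<psi> y else 0))"
  proof (rule integral_cong_AE[OF m])
    show "(\<lambda>y. if i = k then - \<psi> y else 0) \<in> borel_measurable (hyperplane_lborel i)"
      using C1_borel(1)[OF assms(1), of "\<lambda>x. x" borel] by simp
    show "AE y in hyperplane_lborel i. (LINT s|lborel. indicator {x. x $ k > 0} (y + (0 + s) *\<^sub>R axis i 1) * (grad \<psi> (y + (0 + s) *\<^sub>R axis i 1) $ i)) = (if i = k then - \<psi> y else 0)"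
      using AE_hyperplane_lborel[of i]
    proof eventually_elim
      fix y :: "real ^ 'n" assume y: "y $ i = 0"
      show "(LINT s|lborel. indicator {x. x $ k > 0} (y + (0 + s) *\<^sub>R axis i 1) * (grad \<psi> (y + (0 + s) *\<^sub>R axis i 1) $ i)) = (if i = k then - \<psi> y else 0)"
      proof (cases "i = k")
        case True
        have "indicator {x. x $ k > 0} (y + s *\<^sub>R axis i 1) = (indicator {0<..} s :: real)" for s
          using y True by (simp add: indicator_def axis_def)
        then show ?thesis
          using True integral_line_grad(2)[OF assms, of y k] by simp
      next
        case False
        then have "indicator {x. x $ k > 0} (y + s *\<^sub>R axis i 1) = (indicator {x. x $ k > 0} y :: real)" for s
          by (simp add: indicator_def axis_def)
        then show ?thesis
          using False integral_line_grad(1)[OF assms, of y i] by simp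
      qed
    qed
  qed
  also have "\<dots> = - (if i = k then LINT y|hyperplane_lborel k. \<psi> y else 0)"
    by simp
  finally show ?thesis .
qed

lemma C1_shear:
  fixes \<phi> \<gamma> :: "'a::euclidean_space \<Rightarrow> real"
  assumes \<phi>: "C1 \<phi>" and \<gamma>: "C1 \<gamma>"
  shows "C1 (\<lambda>x. \<phi> (x + \<gamma> x *\<^sub>R e))"
    and "grad (\<lambda>x. \<phi> (x + \<gamma> x *\<^sub>R e)) x
       = grad \<phi> (x + \<gamma> x *\<^sub>R e) + (grad \<phi> (x + \<gamma> x *\<^sub>R e) \<bullet> e) *\<^sub>R grad \<gamma> x"
proof -
  let ?T = "\<lambda>x. x + \<gamma> x *\<^sub>R e"
  have D: "GDERIV (\<lambda>x. \<phi> (?T x)) x :> grad \<phi> (?T x) + (grad \<phi> (?T x) \<bullet> e) *\<^sub>R grad \<gamma> x" for x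
  proof -
    have "(?T has_derivative (\<lambda>h. h + (h \<bullet> grad \<gamma> x) *\<^sub>R e)) (at x)"
      using C1_has_derivative[OF \<gamma>, of x] by (auto intro!: derivative_eq_intros)
    from has_derivative_compose[OF this C1_has_derivative[OF \<phi>]]
    show ?thesis
      by (simp add: gderiv_def inner_simps algebra_simps inner_commute)
  qed
  have "continuous_on UNIV ?T"
    using C1_continuous[OF \<gamma>] by (intro continuous_intros) auto
  then have "continuous_on UNIV (\<lambda>x. grad \<phi> (?T x) + (grad \<phi> (?T x) \<bullet> e) *\<^sub>R grad \<gamma> x)"
    using C1_continuous_compose(2)[OF \<phi>] C1_continuous_grad[OF \<gamma>] by (intro continuous_intros) auto
  with D show "C1 (\<lambda>x. \<phi> (x + \<gamma> x *\<^sub>R e))"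
    by (rule C1I)
  show "grad (\<lambda>x. \<phi> (x + \<gamma> x *\<^sub>R e)) x
       = grad \<phi> (x + \<gamma> x *\<^sub>R e) + (grad \<phi> (x + \<gamma> x *\<^sub>R e) \<bullet> e) *\<^sub>R grad \<gamma> x"
    by (rule grad_eqI[OF D])
qed

definition graph_function :: "'n \<Rightarrow> (real ^ 'n \<Rightarrow> real) \<Rightarrow> bool" where
  "graph_function k \<gamma> \<longleftrightarrow> C1 \<gamma> \<and> (\<forall>x t. \<gamma> (x + t *\<^sub>R axis k 1) = \<gamma> x)"

lemma graph_function_grad:
  assumes "graph_function k \<gamma>"
  shows "grad \<gamma> (x + t *\<^sub>R axis k 1) = grad \<gamma> x" and "grad \<gamma> x $ k = 0"
proof -
  have inv: "\<gamma> (x + t *\<^sub>R axis k 1) = \<gamma> x" for x t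
    using assms by (simp add: graph_function_def)
  have C1: "C1 \<gamma>"
    using assms by (simp add: graph_function_def)
  have "((\<lambda>x. \<gamma> (x + t *\<^sub>R axis k 1)) has_derivative (\<lambda>h. h \<bullet> grad \<gamma> (x + t *\<^sub>R axis k 1))) (at x)"
    by (rule has_derivative_compose[OF _ C1_has_derivative[OF C1]]) (auto intro!: derivative_eq_intros)
  then have "GDERIV \<gamma> x :> grad \<gamma> (x + t *\<^sub>R axis k 1)"
    by (simp add: inv gderiv_def)
  then show "grad \<gamma> (x + t *\<^sub>R axis k 1) = grad \<gamma> x"
    by (metis grad_eqI)
  have "((\<lambda>s. \<gamma> x) has_real_derivative (grad \<gamma> x \<bullet> axis k 1)) (at 0)"
    using C1_DERIV_line[OF C1, of x "axis k 1" 0] by (simp add: inv)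
  then show "grad \<gamma> x $ k = 0"
    using DERIV_unique[OF _ DERIV_const] by (auto simp: inner_axis)
qed

lemma bounded_support_shear:
  fixes \<phi> :: "real ^ 'n \<Rightarrow> 'b::zero"
  assumes \<gamma>: "graph_function k \<gamma>" and "bounded {x. \<phi> x \<noteq> 0}"
  shows "bounded {x. \<phi> (x + \<gamma> x *\<^sub>R axis k 1) \<noteq> 0}"
proof -
  obtain B where B: "{x. \<phi> x \<noteq> 0} \<subseteq> cball 0 B"
    using bounded_subset_ballD[OF assms(2), of 0] ball_subset_cball by blast
  have C1: "C1 \<gamma>" and inv: "\<And>x t. \<gamma> (x + t *\<^sub>R axis k 1) = \<gamma> x"
    using \<gamma> by (auto simp: graph_function_def)
  have "compact ((\<lambda>x. x - \<gamma> x *\<^sub>R axis k 1) ` cball 0 B)"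
    using continuous_on_subset[OF C1_continuous[OF C1]]
    by (intro compact_continuous_image continuous_intros) auto
  moreover have "{x. \<phi> (x + \<gamma> x *\<^sub>R axis k 1) \<noteq> 0} \<subseteq> (\<lambda>x. x - \<gamma> x *\<^sub>R axis k 1) ` cball 0 B"
  proof
    fix x assume "x \<in> {x. \<phi> (x + \<gamma> x *\<^sub>R axis k 1) \<noteq> 0}"
    with B have "x + \<gamma> x *\<^sub>R axis k 1 \<in> cball 0 B" by blast
    then show "x \<in> (\<lambda>x. x - \<gamma> x *\<^sub>R axis k 1) ` cball 0 B"
      by (rule rev_image_eqI) (simp add: inv)
  qed
  ultimately show ?thesis
    using compact_imp_bounded bounded_subset by blast
qed

lemma integral_grad_epigraph:
  fixes \<phi> :: "real ^ 'n \<Rightarrow> real"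
  assumes \<gamma>: "graph_function k \<gamma>" and \<phi>: "C1 \<phi>" and supp: "bounded {x. \<phi> x \<noteq> 0}"
  shows "(LINT x|lborel. indicator {x. x $ k > \<gamma> x} x * (grad \<phi> x $ i))
    = (LINT y|hyperplane_lborel k. \<phi> (y + \<gamma> y *\<^sub>R axis k 1) * (grad \<gamma> y $ i - axis k 1 $ i))"
proof -
  have C1: "C1 \<gamma>" and inv: "\<And>x t. \<gamma> (x + t *\<^sub>R axis k 1) = \<gamma> x"
    using \<gamma> by (auto simp: graph_function_def)
  note \<gamma>_inv = graph_function_grad[OF \<gamma>]
  have \<gamma>_meas [measurable]: "\<gamma> \<in> borel_measurable borel"
    using C1_borel(1)[OF C1, of "\<lambda>x. x"] by simp
  define \<psi> where "\<psi> x = \<phi> (x + \<gamma> x *\<^sub>R axis k 1)" for x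
  have \<psi>: "C1 \<psi>" and \<psi>_grad: "\<And>x. grad \<psi> x = grad \<phi> (x + \<gamma> x *\<^sub>R axis k 1) + (grad \<phi> (x + \<gamma> x *\<^sub>R axis k 1) $ k) *\<^sub>R grad \<gamma> x"
    using C1_shear[OF \<phi> C1, of "axis k 1"] by (simp_all add: \<psi>_def[abs_def] inner_axis)
  have \<psi>_supp: "bounded {x. \<psi> x \<noteq> 0}"
    unfolding \<psi>_def by (rule bounded_support_shear[OF \<gamma> supp])
  have \<psi>_k: "grad \<psi> x $ k = grad \<phi> (x + \<gamma> x *\<^sub>R axis k 1) $ k" for x
    by (simp add: \<psi>_grad \<gamma>_inv)
  have [measurable]: "{x :: real ^ 'n. x $ k > 0} \<in> sets borel" "{x. x $ k > \<gamma> x} \<in> sets borel"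
    by measurable
  let ?f = "\<lambda>x. indicator {x. x $ k > \<gamma> x} x * (grad \<phi> x $ i)"
  let ?g = "\<lambda>x. indicator {x. x $ k > 0} x * (grad \<psi> x $ i)"
  let ?h = "\<lambda>y. grad \<gamma> y $ i * \<psi> y"
  have f: "integrable lborel ?f"
    using integrable_mult_indicator[OF _ integrable_grad_nth[OF \<phi> supp, of i], of "{x. x $ k > \<gamma> x}"] by simp
  have g: "integrable lborel (\<lambda>x. indicator {x. x $ k > 0} x * (grad \<psi> x $ j))" for j
    using integrable_mult_indicator[OF _ integrable_grad_nth[OF \<psi> \<psi>_supp, of j], of "{x. x $ k > 0}"] by simp
  have h: "integrable (hyperplane_lborel k) (\<lambda>y. c y * \<psi> y)" if "continuous_on UNIV c" for c
    using that C1_continuous[OF \<psi>] emeasure_hyperplane_lborel_bounded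
    by (intro integrable_continuous_bounded_support bounded_subset[OF \<psi>_supp]) (auto intro!: continuous_intros)
  note h' = h[OF C1_continuous_grad_nth[OF C1, of i]]
  have [measurable]: "?f \<in> borel_measurable borel" "?g \<in> borel_measurable borel"
     "?h \<in> borel_measurable borel"
    using f g[of i] h' by auto
  have "(LINT x|lborel. ?f x) = (LINT y|hyperplane_lborel k. LINT s|lborel. ?f (y + (\<gamma> y + s) *\<^sub>R axis k 1))"
    by (rule integral_hyperplane_shear[OF _ f]) simp
  also have "\<dots> = (LINT y|hyperplane_lborel k. (LINT s|lborel. ?g (y + s *\<^sub>R axis k 1)) + ?h y)"
  proof (rule integral_cong_AE)
    show "(\<lambda>y. LINT s|lborel. ?f (y + (\<gamma> y + s) *\<^sub>R axis k 1)) \<in> borel_measurable (hyperplane_lborel k)"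
      using integrable_hyperplane_shear[OF _ f, of \<gamma> k] by simp
    show "(\<lambda>y. (LINT s|lborel. ?g (y + s *\<^sub>R axis k 1)) + ?h y) \<in> borel_measurable (hyperplane_lborel k)"
      using integrable_hyperplane_shear[OF _ g, of "\<lambda>_. 0" k i] h' by simp
    have "AE y in hyperplane_lborel k. integrable lborel (\<lambda>s. ?g (y + s *\<^sub>R axis k 1))"
      using AE_integrable_hyperplane_shear[OF _ g, of "\<lambda>_. 0" k i] by simp
    moreover have "AE y in hyperplane_lborel k. integrable lborel (\<lambda>s. indicator {x. x $ k > 0} (y + s *\<^sub>R axis k 1) * (grad \<psi> (y + s *\<^sub>R axis k 1) $ k))"
      using AE_integrable_hyperplane_shear[OF _ g, of "\<lambda>_. 0" k k] by simp
    ultimately show "AE y in hyperplane_lborel k. (LINT s|lborel. ?f (y + (\<gamma> y + s) *\<^sub>R axis k 1))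
      = (LINT s|lborel. ?g (y + s *\<^sub>R axis k 1)) + ?h y"
      using AE_hyperplane_lborel[of k]
    proof eventually_elim
      fix y assume i1: "integrable lborel (\<lambda>s. ?g (y + s *\<^sub>R axis k 1))"
        and i2: "integrable lborel (\<lambda>s. indicator {x. x $ k > 0} (y + s *\<^sub>R axis k 1) * (grad \<psi> (y + s *\<^sub>R axis k 1) $ k))"
        and y: "y $ k = 0"
      let ?p = "\<lambda>s. y + s *\<^sub>R axis k 1"
      have ind: "indicator {x. x $ k > 0} (?p s) = (indicator {0<..} s :: real)"
         "indicator {x. x $ k > \<gamma> x} (y + (\<gamma> y + s) *\<^sub>R axis k 1) = (indicator {0<..} s :: real)" for s
        using y by (simp_all add: indicator_def inv)
      have "?f (y + (\<gamma> y + s) *\<^sub>R axis k 1)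
         = ?g (?p s) - grad \<gamma> y $ i * (indicator {0<..} s * (grad \<psi> (?p s) $ k))" for s
      proof -
        have e: "y + (\<gamma> y + s) *\<^sub>R axis k 1 = ?p s + \<gamma> (?p s) *\<^sub>R axis k 1"
          by (simp add: inv algebra_simps)
        have "grad \<phi> (y + (\<gamma> y + s) *\<^sub>R axis k 1) $ i
            = grad \<psi> (?p s) $ i - (grad \<psi> (?p s) $ k) * (grad \<gamma> y $ i)"
          unfolding e by (simp add: \<psi>_grad \<gamma>_inv)
        then show ?thesis
          unfolding ind by (simp only: right_diff_distrib mult.assoc mult.left_commute mult.commute)
      qed
      then have "(LINT s|lborel. ?f (y + (\<gamma> y + s) *\<^sub>R axis k 1))
         = (LINT s|lborel. ?g (?p s)) - grad \<gamma> y $ i * (LINT s|lborel. indicator {0<..} s * (grad \<psi> (?p s) $ k))"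
        using i1 i2 by (simp add: ind)
      then show "(LINT s|lborel. ?f (y + (\<gamma> y + s) *\<^sub>R axis k 1)) = (LINT s|lborel. ?g (?p s)) + ?h y"
        using integral_line_grad(2)[OF \<psi> \<psi>_supp, of y k] by simp
    qed
  qed
  also have "\<dots> = (LINT x|lborel. ?g x) + (LINT y|hyperplane_lborel k. ?h y)"
    using integrable_hyperplane_shear[OF _ g, of "\<lambda>_. 0" k i] h' integral_hyperplane_shear[OF _ g, of "\<lambda>_. 0" i k]
    by (subst Bochner_Integration.integral_add) auto
  also have "(LINT x|lborel. ?g x) = - (LINT y|hyperplane_lborel k. axis k 1 $ i * \<psi> y)"
    by (simp add: integral_grad_half_space[OF \<psi> \<psi>_supp] axis_def)
  also have "- (LINT y|hyperplane_lborel k. axis k 1 $ i * \<psi> y) + (LINT y|hyperplane_lborel k. ?h y)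
     = (LINT y|hyperplane_lborel k. ?h y - axis k 1 $ i * \<psi> y)"
    using h'[THEN Bochner_Integration.integral_diff, OF h[of "\<lambda>_. axis k 1 $ i"]] by simp
  finally show ?thesis
    by (simp add: \<psi>_def algebra_simps)
qed

subsection \<open>The divergence theorem on epigraphs\<close>

definition C1_field :: "(real ^ 'n \<Rightarrow> real ^ 'n) \<Rightarrow> bool" where
  "C1_field F \<longleftrightarrow> (\<forall>i. C1 (\<lambda>x. F x $ i))"

definition divergence :: "(real ^ 'n \<Rightarrow> real ^ 'n) \<Rightarrow> real ^ 'n \<Rightarrow> real" where
  "divergence F x = (\<Sum>i\<in>UNIV. grad (\<lambda>x. F x $ i) x $ i)"

lemma continuous_on_vecI:
  fixes f :: "'a::topological_space \<Rightarrow> real ^ 'n"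
  assumes "\<And>i. continuous_on A (\<lambda>x. f x $ i)"
  shows "continuous_on A f"
  using continuous_on_vec_lambda[of A "\<lambda>i x. f x $ i"] assms by simp

lemma C1_field_continuous: "C1_field F \<Longrightarrow> continuous_on UNIV F"
  by (intro continuous_on_vecI C1_continuous) (simp add: C1_field_def)

lemma C1_field_scale: "C1 \<phi> \<Longrightarrow> C1_field F \<Longrightarrow> C1_field (\<lambda>x. \<phi> x *\<^sub>R F x)"
  by (auto simp: C1_field_def intro: C1_mult)

lemma integrable_divergence:
  assumes "C1_field F" "bounded {x. F x \<noteq> 0}"
  shows "integrable lborel (divergence F)"
  unfolding divergence_def[abs_def] using assms
  by (intro Bochner_Integration.integrable_sum integrable_grad_nth bounded_support_nth) (auto simp: C1_field_def)

lemma integral_divergence_UNIV: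
  assumes F: "C1_field F" "bounded {x. F x \<noteq> 0}"
  shows "(LINT x|lborel. divergence F x) = 0"
proof -
  have C1: "C1 (\<lambda>x. F x $ i)" for i using F by (simp add: C1_field_def)
  show ?thesis
    unfolding divergence_def
    using integrable_grad_nth[OF C1 bounded_support_nth[OF F(2)]] integral_grad_UNIV[OF C1 bounded_support_nth[OF F(2)]]
    by (subst Bochner_Integration.integral_sum) auto
qed

lemma integral_divergence_epigraph:
  assumes \<gamma>: "graph_function k \<gamma>" and F: "C1_field F" "bounded {x. F x \<noteq> 0}"
  shows "(LINT x|lborel. indicator {x. x $ k > \<gamma> x} x * divergence F x)
    = (LINT y|hyperplane_lborel k. F (y + \<gamma> y *\<^sub>R axis k 1) \<bullet> (grad \<gamma> y - axis k 1))"
proof -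
  have C1: "C1 (\<lambda>x. F x $ i)" for i using F by (simp add: C1_field_def)
  have C1\<gamma>: "C1 \<gamma>" using \<gamma> by (simp add: graph_function_def)
  have [measurable]: "\<gamma> \<in> borel_measurable borel"
    using C1_borel(1)[OF C1\<gamma>, of "\<lambda>x. x"] by simp
  have [measurable]: "{x. x $ k > \<gamma> x} \<in> sets borel"
    by measurable
  have int: "integrable lborel (\<lambda>x. indicator {x. x $ k > \<gamma> x} x * (grad (\<lambda>x. F x $ i) x $ i))" for i
    using integrable_mult_indicator[OF _ integrable_grad_nth[OF C1 bounded_support_nth[OF F(2)], of i i], of "{x. x $ k > \<gamma> x}"] by simp
  have int': "integrable (hyperplane_lborel k) (\<lambda>y. F (y + \<gamma> y *\<^sub>R axis k 1) $ i * (grad \<gamma> y $ i - axis k 1 $ i))" for i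
  proof (rule integrable_continuous_bounded_support)
    have "continuous_on UNIV (\<lambda>y. F (y + \<gamma> y *\<^sub>R axis k 1) $ i)"
      by (rule C1_continuous_compose(1)[OF C1]) (intro continuous_intros C1_continuous_compose(1)[OF C1\<gamma>])
    then show "continuous_on UNIV (\<lambda>y. F (y + \<gamma> y *\<^sub>R axis k 1) $ i * (grad \<gamma> y $ i - axis k 1 $ i))"
      using C1_continuous_grad_nth[OF C1\<gamma>, of i] by (intro continuous_on_mult continuous_on_diff continuous_on_const)
    show "bounded {y. F (y + \<gamma> y *\<^sub>R axis k 1) $ i * (grad \<gamma> y $ i - axis k 1 $ i) \<noteq> 0}"
      by (rule bounded_subset[OF bounded_support_shear[OF \<gamma> F(2)]]) auto
  qed (auto intro: emeasure_hyperplane_lborel_bounded[simplified])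
  have "(LINT x|lborel. indicator {x. x $ k > \<gamma> x} x * divergence F x)
     = (\<Sum>i\<in>UNIV. LINT x|lborel. indicator {x. x $ k > \<gamma> x} x * (grad (\<lambda>x. F x $ i) x $ i))"
    unfolding divergence_def sum_distrib_left by (rule Bochner_Integration.integral_sum[OF int])
  also have "\<dots> = (\<Sum>i\<in>UNIV. LINT y|hyperplane_lborel k. F (y + \<gamma> y *\<^sub>R axis k 1) $ i * (grad \<gamma> y $ i - axis k 1 $ i))"
    by (intro sum.cong refl integral_grad_epigraph[OF \<gamma> C1 bounded_support_nth[OF F(2)]])
  also have "\<dots> = (LINT y|hyperplane_lborel k. F (y + \<gamma> y *\<^sub>R axis k 1) \<bullet> (grad \<gamma> y - axis k 1))"
    unfolding inner_vec_def by (subst Bochner_Integration.integral_sum[OF int', symmetric]) simp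
  finally show ?thesis .
qed

lemma null_graph:
  fixes \<gamma> :: "real ^ 'n \<Rightarrow> real"
  assumes \<gamma>: "graph_function k \<gamma>"
  shows "AE x in lborel. x $ k \<noteq> \<gamma> x"
proof -
  have C1\<gamma>: "C1 \<gamma>" and inv: "\<And>x t. \<gamma> (x + t *\<^sub>R axis k 1) = \<gamma> x" using \<gamma> by (auto simp: graph_function_def)
  have [measurable]: "\<gamma> \<in> borel_measurable borel"
    using C1_borel(1)[OF C1\<gamma>, of "\<lambda>x. x"] by simp
  have [measurable]: "{x. x $ k = \<gamma> x} \<in> sets borel"
    by measurable
  have "emeasure lborel {x. x $ k = \<gamma> x} = (\<integral>\<^sup>+ x. indicator {x. x $ k = \<gamma> x} x \<partial>lborel)"
    by simp
  also have "\<dots> = (\<integral>\<^sup>+ y. \<integral>\<^sup>+ s. indicator {x. x $ k = \<gamma> x} (y + s *\<^sub>R axis k 1) \<partial>lborel \<partial>hyperplane_lborel k)"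
    by (rule nn_integral_hyperplane_lborel) simp
  also have "\<dots> = (\<integral>\<^sup>+ y. \<integral>\<^sup>+ s. indicator {\<gamma> y - y $ k} s \<partial>lborel \<partial>hyperplane_lborel k)"
    by (intro nn_integral_cong) (auto simp: indicator_def inv)
  also have "\<dots> = 0"
    by simp
  finally show ?thesis
    by (intro AE_I[of _ _ "{x. x $ k = \<gamma> x}"]) auto
qed

lemma integral_divergence_hypograph:
  assumes \<gamma>: "graph_function k \<gamma>" and F: "C1_field F" "bounded {x. F x \<noteq> 0}"
  shows "(LINT x|lborel. indicator {x. x $ k < \<gamma> x} x * divergence F x)
    = - (LINT y|hyperplane_lborel k. F (y + \<gamma> y *\<^sub>R axis k 1) \<bullet> (grad \<gamma> y - axis k 1))"
proof -
  have C1\<gamma>: "C1 \<gamma>" using \<gamma> by (simp add: graph_function_def)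
  have [measurable]: "\<gamma> \<in> borel_measurable borel"
    using C1_borel(1)[OF C1\<gamma>, of "\<lambda>x. x"] by simp
  have [measurable]: "{x. x $ k > \<gamma> x} \<in> sets borel" "{x. x $ k < \<gamma> x} \<in> sets borel"
    by measurable
  note int = integrable_divergence[OF F]
  have [measurable]: "divergence F \<in> borel_measurable borel"
    using int by auto
  have "(LINT x|lborel. indicator {x. x $ k < \<gamma> x} x * divergence F x)
    = (LINT x|lborel. divergence F x - indicator {x. x $ k > \<gamma> x} x * divergence F x)"
  proof (rule integral_cong_AE)
    show "AE x in lborel. indicator {x. x $ k < \<gamma> x} x * divergence F x = divergence F x - indicator {x. x $ k > \<gamma> x} x * divergence F x"
      using null_graph[OF \<gamma>] by eventually_elim (auto simp: indicator_def)
  qed simp_all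
  also have "\<dots> = - (LINT x|lborel. indicator {x. x $ k > \<gamma> x} x * divergence F x)"
    using int integrable_mult_indicator[OF _ int, of "{x. x $ k > \<gamma> x}"]
    by (subst Bochner_Integration.integral_diff) (auto simp: integral_divergence_UNIV[OF F])
  finally show ?thesis
    by (simp add: integral_divergence_epigraph[OF assms])
qed

definition graph_measure :: "'n \<Rightarrow> (real ^ 'n \<Rightarrow> real) \<Rightarrow> (real ^ 'n) measure" where
  "graph_measure k \<gamma> =
     distr (density (hyperplane_lborel k) (\<lambda>y. ennreal (sqrt (1 + (norm (grad \<gamma> y))\<^sup>2)))) borel
       (\<lambda>y. y + \<gamma> y *\<^sub>R axis k 1)"

definition graph_normal :: "'n \<Rightarrow> (real ^ 'n \<Rightarrow> real) \<Rightarrow> real ^ 'n \<Rightarrow> real ^ 'n" where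
  "graph_normal k \<gamma> x = inverse (sqrt (1 + (norm (grad \<gamma> x))\<^sup>2)) *\<^sub>R (grad \<gamma> x - axis k 1)"

lemma sets_graph_measure [simp, measurable_cong]: "sets (graph_measure k \<gamma>) = sets borel"
  and space_graph_measure [simp]: "space (graph_measure k \<gamma>) = UNIV"
  by (simp_all add: graph_measure_def)

lemma norm_graph_normal:
  assumes "graph_function k \<gamma>"
  shows "norm (graph_normal k \<gamma> x) = 1"
proof -
  have "(norm (grad \<gamma> x - axis k 1))\<^sup>2 = 1 + (norm (grad \<gamma> x))\<^sup>2"
    by (simp add: power2_norm_eq_inner inner_diff_left inner_diff_right inner_axis inner_axis'
        graph_function_grad[OF assms])
  then have "norm (grad \<gamma> x - axis k 1) = sqrt (1 + (norm (grad \<gamma> x))\<^sup>2)"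
    by (metis norm_ge_zero real_sqrt_unique)
  moreover have "sqrt (1 + (norm (grad \<gamma> x))\<^sup>2) > 0"
    by (simp add: add_pos_nonneg)
  ultimately show ?thesis
    by (simp add: graph_normal_def)
qed

lemma graph_function_borel:
  assumes "graph_function k \<gamma>"
  shows "\<gamma> \<in> borel_measurable borel" "grad \<gamma> \<in> borel_measurable borel"
  using assms C1_borel[of \<gamma> "\<lambda>x. x" borel] by (auto simp: graph_function_def)

lemma emeasure_graph_measure:
  assumes "graph_function k \<gamma>" and [measurable]: "A \<in> sets borel"
  shows "emeasure (graph_measure k \<gamma>) A = graph_area k \<gamma> A"
proof -
  note [measurable] = graph_function_borel[OF assms(1)]
  have "(\<lambda>y. y + \<gamma> y *\<^sub>R axis k 1) -` A \<in> sets borel"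
    using measurable_sets[of "\<lambda>y. y + \<gamma> y *\<^sub>R axis k 1" borel borel A] by simp
  then show ?thesis
    unfolding graph_measure_def graph_area_def
    by (subst emeasure_distr, simp, simp, subst emeasure_density)
       (auto intro!: nn_integral_cong simp: indicator_def)
qed

lemma integral_graph_measure:
  fixes f :: "real ^ 'n \<Rightarrow> real"
  assumes "graph_function k \<gamma>" and [measurable]: "f \<in> borel_measurable borel"
  shows "(LINT x|graph_measure k \<gamma>. f x)
    = (LINT y|hyperplane_lborel k. sqrt (1 + (norm (grad \<gamma> y))\<^sup>2) * f (y + \<gamma> y *\<^sub>R axis k 1))"
proof -
  note [measurable] = graph_function_borel[OF assms(1)]
  show ?thesis
    unfolding graph_measure_def
    by (subst integral_distr, simp, simp, subst integral_density) auto
qed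

lemma emeasure_graph_measure_bounded:
  assumes \<gamma>: "graph_function k \<gamma>" and A: "bounded A"
  shows "emeasure (graph_measure k \<gamma>) A < \<infinity>"
proof -
  obtain B where B: "A \<subseteq> cball 0 B"
    using bounded_subset_ballD[OF A, of 0] ball_subset_cball by blast
  have C1\<gamma>: "C1 \<gamma>" using \<gamma> by (simp add: graph_function_def)
  let ?Y = "{y. y + \<gamma> y *\<^sub>R axis k 1 \<in> cball 0 B}"
  note [measurable] = graph_function_borel[OF \<gamma>]
  have Y: "bounded ?Y"
    using bounded_support_shear[OF \<gamma> bounded_subset[OF bounded_cball[of 0 B]], of "\<lambda>x. if x \<in> cball 0 B then 1 else 0 :: real"]
    by (rule bounded_subset) auto
  have [measurable]: "?Y \<in> sets borel"
    using measurable_sets[of "\<lambda>y. y + \<gamma> y *\<^sub>R axis k 1" borel borel "cball 0 B"] by (simp add: vimage_def)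
  have "compact ((\<lambda>y. norm (grad \<gamma> y)) ` closure ?Y)"
    using Y continuous_on_subset[OF C1_continuous_grad[OF C1\<gamma>]]
    by (intro compact_continuous_image continuous_intros) auto
  from compact_imp_bounded[OF this] obtain C where C: "\<And>y. y \<in> ?Y \<Longrightarrow> norm (grad \<gamma> y) \<le> C"
    unfolding bounded_iff using closure_subset[of ?Y] by auto
  have "emeasure (graph_measure k \<gamma>) A \<le> emeasure (graph_measure k \<gamma>) (cball 0 B)"
    by (rule emeasure_mono[OF B]) simp
  also have "\<dots> \<le> (\<integral>\<^sup>+ y. ennreal (sqrt (1 + C\<^sup>2)) * indicator ?Y y \<partial>hyperplane_lborel k)"
    unfolding emeasure_graph_measure[OF \<gamma> borel_closed[OF closed_cball]] graph_area_def
    using C by (intro nn_integral_mono) (auto simp: indicator_def intro!: ennreal_leI power_mono)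
  also have "\<dots> = ennreal (sqrt (1 + C\<^sup>2)) * emeasure (hyperplane_lborel k) ?Y"
    by (simp add: nn_integral_cmult)
  also have "\<dots> < \<infinity>"
    using emeasure_hyperplane_lborel_bounded[OF Y, of k] by (simp add: ennreal_mult_less_top)
  finally show ?thesis .
qed

lemma integral_hyperplane_flux:
  fixes F :: "real ^ 'n \<Rightarrow> real ^ 'n"
  assumes \<gamma>: "graph_function k \<gamma>" and F: "C1_field F"
  shows "(LINT y|hyperplane_lborel k. F (y + \<gamma> y *\<^sub>R axis k 1) \<bullet> (grad \<gamma> y - axis k 1))
    = (LINT x|graph_measure k \<gamma>. F x \<bullet> graph_normal k \<gamma> x)"
proof -
  note [measurable] = graph_function_borel[OF \<gamma>]
  have [measurable]: "F \<in> borel_measurable borel"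
    by (rule borel_measurable_continuous_onI[OF C1_field_continuous[OF F]])
  have *: "c \<noteq> 0 \<Longrightarrow> c * (v \<bullet> (inverse c *\<^sub>R w)) = v \<bullet> w" for c and v w :: "real ^ 'n"
    by simp
  have "sqrt (1 + (norm (grad \<gamma> y))\<^sup>2) \<noteq> 0" for y
    by (metis add_pos_nonneg less_irrefl real_sqrt_eq_zero_cancel_iff zero_le_power2 zero_less_one)
  note ** = *[OF this]
  show ?thesis
    unfolding graph_normal_def
    by (subst integral_graph_measure[OF \<gamma>], simp)
       (simp only: graph_function_grad[OF \<gamma>] **)
qed

definition one_sided :: "(real ^ 'n) set \<Rightarrow> (real ^ 'n) set \<Rightarrow> 'n \<Rightarrow> (real ^ 'n \<Rightarrow> real) \<Rightarrow> real \<Rightarrow> bool" where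
  "one_sided \<Omega> U k \<gamma> s \<longleftrightarrow> s = 1 \<and> \<Omega> \<inter> U = {x \<in> U. x $ k > \<gamma> x} \<or> s = -1 \<and> \<Omega> \<inter> U = {x \<in> U. x $ k < \<gamma> x}"

lemma divergence_eq_0:
  assumes "closed K" "\<And>x. x \<notin> K \<Longrightarrow> F x = 0" "x \<notin> K"
  shows "divergence F x = 0"
proof -
  have "grad (\<lambda>x. F x $ i) x = grad (\<lambda>x. 0) x" for i
    by (rule grad_cong_open[of "- K"]) (use assms in auto)
  then show ?thesis
    by (simp add: divergence_def)
qed

lemma integral_divergence_one_sided:
  fixes F :: "real ^ 'n \<Rightarrow> real ^ 'n"
  assumes os: "one_sided \<Omega> U k \<gamma> s" and \<gamma>: "graph_function k \<gamma>" and F: "C1_field F"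
    and K: "compact K" "K \<subseteq> U" "\<And>x. x \<notin> K \<Longrightarrow> F x = 0"
  shows "(LINT x|lborel. indicator \<Omega> x * divergence F x)
    = s * (LINT x|graph_measure k \<gamma>. F x \<bullet> graph_normal k \<gamma> x)"
proof -
  have supp: "bounded {x. F x \<noteq> 0}"
    using compact_imp_bounded[OF K(1)] by (rule bounded_subset) (use K(3) in auto)
  have 0: "divergence F x = 0" if "x \<notin> U" for x
    using divergence_eq_0[OF compact_imp_closed[OF K(1)], of F x] that K(2,3) by blast
  from os consider "s = 1" "\<Omega> \<inter> U = {x \<in> U. x $ k > \<gamma> x}" | "s = -1" "\<Omega> \<inter> U = {x \<in> U. x $ k < \<gamma> x}"
    unfolding one_sided_def by blast
  then show ?thesis
  proof cases
    case 1
    have "x \<in> \<Omega> \<longleftrightarrow> x $ k > \<gamma> x" if "x \<in> U" for x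
      using 1(2) that by blast
    then have *: "indicator \<Omega> x * divergence F x = indicator {x. x $ k > \<gamma> x} x * divergence F x" for x
      using 0 by (cases "x \<in> U") (auto simp: indicator_def)
    show ?thesis
      unfolding *
      using integral_divergence_epigraph[OF \<gamma> F supp] integral_hyperplane_flux[OF \<gamma> F] 1(1) by simp
  next
    case 2
    have "x \<in> \<Omega> \<longleftrightarrow> x $ k < \<gamma> x" if "x \<in> U" for x
      using 2(2) that by blast
    then have *: "indicator \<Omega> x * divergence F x = indicator {x. x $ k < \<gamma> x} x * divergence F x" for x
      using 0 by (cases "x \<in> U") (auto simp: indicator_def)
    show ?thesis
      unfolding *
      using integral_divergence_hypograph[OF \<gamma> F supp] integral_hyperplane_flux[OF \<gamma> F] 2(1) by simp
  qed
qed

lemma C1_prod: "(\<And>i. i \<in> I \<Longrightarrow> C1 (f i)) \<Longrightarrow> C1 (\<lambda>x. \<Prod>i\<in>I. f i x)"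
  by (induction I rule: infinite_finite_induct) (auto intro: C1_mult)

lemma DERIV_max_0_power2: "DERIV (\<lambda>t. (max 0 t)\<^sup>2) t :> 2 * max 0 (t :: real)"
proof (cases t "0 :: real" rule: linorder_cases)
  case less
  have "((\<lambda>t. 0) has_field_derivative 2 * max 0 t) (at t)"
    using less by simp
  then show ?thesis
    by (rule has_field_derivative_transform_within_open[of _ _ _ "{..<0}"]) (use less in auto)
next
  case equal
  have "(\<lambda>h. (max 0 (0 + h :: real) ^ 2 - max 0 0 ^ 2) / h) = max 0"
    by (auto simp: max_def power2_eq_square)
  moreover have "(max 0 \<longlongrightarrow> (max 0 0 :: real)) (at 0)"
    by (intro tendsto_max tendsto_intros)
  ultimately show ?thesis
    by (simp add: equal DERIV_def)
next
  case greater
  have "((\<lambda>t. t\<^sup>2) has_field_derivative 2 * max 0 t) (at t)"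
    using greater by (auto intro!: derivative_eq_intros)
  then show ?thesis
    by (rule has_field_derivative_transform_within_open[of _ _ _ "{0<..}"]) (use greater in auto)
qed

lemma C1_max_0_power2:
  assumes "C1 f"
  shows "C1 (\<lambda>x. (max 0 (f x))\<^sup>2)"
  by (rule C1_compose[OF assms DERIV_max_0_power2])
     (use C1_continuous[OF assms] in \<open>auto intro!: continuous_intros\<close>)

lemma smooth_graph_functionD:
  assumes "smooth_graph_function k \<gamma>"
  shows "graph_function k \<gamma>" and "C1 (\<lambda>x. grad \<gamma> x $ i)"
proof -
  have "C_k (Suc (Suc 0)) \<gamma>"
    using assms unfolding smooth_graph_function_def C_infinity_def by blast
  then have *: "\<gamma> differentiable (at x)" "(\<lambda>x. grad \<gamma> x $ i) differentiable (at x)"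
     "continuous_on UNIV (\<lambda>x. grad (\<lambda>x. grad \<gamma> x $ i) x $ j)" for x i j
    by auto
  then show C: "C1 (\<lambda>x. grad \<gamma> x $ i)" for i
    unfolding C1_def by (auto intro: continuous_on_vecI)
  have "C1 \<gamma>"
    unfolding C1_def using * C1_continuous[OF C] by (auto intro: continuous_on_vecI)
  then show "graph_function k \<gamma>"
    using assms by (simp add: smooth_graph_function_def graph_function_def)
qed

lemma C1_field_graph_normal:
  assumes "smooth_graph_function k \<gamma>"
  shows "C1_field (graph_normal k \<gamma>)"
proof -
  note C = smooth_graph_functionD(2)[OF assms]
  have *: "(norm (grad \<gamma> x))\<^sup>2 = (\<Sum>i\<in>UNIV. grad \<gamma> x $ i * grad \<gamma> x $ i)" for x
    by (simp add: power2_norm_eq_inner inner_vec_def)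
  have 1: "C1 (\<lambda>x. 1 + (norm (grad \<gamma> x))\<^sup>2)"
    unfolding * by (intro C1_add C1_const C1_sum C1_mult C)
  have pos: "1 + (norm (grad \<gamma> x))\<^sup>2 > 0" for x
    by (simp add: add_pos_nonneg)
  have "C1 (\<lambda>x. sqrt (1 + (norm (grad \<gamma> x))\<^sup>2))"
  proof (rule C1_compose[OF 1 DERIV_real_sqrt])
    show "continuous_on UNIV (\<lambda>x. inverse (sqrt (1 + (norm (grad \<gamma> x))\<^sup>2)) / 2)"
      using pos by (intro continuous_on_divide continuous_on_inverse continuous_on_real_sqrt C1_continuous[OF 1]
          continuous_on_const) (auto simp: less_le)
  qed (rule pos)
  then have "C1 (\<lambda>x. inverse (sqrt (1 + (norm (grad \<gamma> x))\<^sup>2)))"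
    by (rule C1_inverse) (use pos in \<open>auto simp: less_le\<close>)
  then show ?thesis
    unfolding C1_field_def graph_normal_def
    by (auto intro!: C1_mult C1_diff C)
qed

lemma emeasure_box_eq_by_test_functions:
  fixes \<mu> \<nu> :: "(real ^ 'n) measure"
  assumes sets: "sets \<mu> = sets borel" "sets \<nu> = sets borel"
    and fin: "\<And>A. bounded A \<Longrightarrow> emeasure \<mu> A < \<infinity>" "\<And>A. bounded A \<Longrightarrow> emeasure \<nu> A < \<infinity>"
    and eq: "\<And>\<phi>. C1 \<phi> \<Longrightarrow> (\<And>x. \<phi> x \<ge> 0) \<Longrightarrow> (\<And>x. x \<notin> cbox a b \<Longrightarrow> \<phi> x = 0) \<Longrightarrow>
      (LINT x|\<mu>. \<phi> x) = (LINT x|\<nu>. \<phi> x)"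
  shows "emeasure \<mu> (box a b) = emeasure \<nu> (box a b)"
proof -
  define f where "f x = (\<Prod>i\<in>UNIV. (max 0 (x $ i - a $ i))\<^sup>2 * (max 0 (b $ i - x $ i))\<^sup>2)" for x :: "real ^ 'n"
  have f: "C1 f"
    unfolding f_def[abs_def]
    by (intro C1_prod C1_mult C1_max_0_power2 C1_diff C1_component C1_const)
  have f0: "f x \<ge> 0" for x
    unfolding f_def by (intro prod_nonneg) auto
  have fpos: "f x \<noteq> 0 \<longleftrightarrow> x \<in> box a b" for x
  proof -
    have "max 0 t = 0 \<longleftrightarrow> t \<le> 0" for t :: real by auto
    then show ?thesis
      by (auto simp: f_def vec_box_eq not_le)
  qed
  define h where "h n x = real n * f x * inverse (1 + real n * f x)" for n x
  have pos: "1 + real n * f x > 0" for n x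
    using f0 by (simp add: add_pos_nonneg)
  have h: "C1 (h n)" for n
    unfolding h_def[abs_def] using pos
    by (intro C1_mult C1_inverse C1_add C1_const f) (auto simp: less_le)
  have h01: "0 \<le> h n x" "h n x \<le> indicator (box a b) x" for n x
    using pos[of n x] f0[of x] fpos[of x] by (auto simp: h_def field_simps indicator_def)
  have h_out: "h n x = 0" if "x \<notin> box a b" for n x
    using fpos[of x] that by (simp add: h_def)
  have lim: "(\<lambda>n. h n x) \<longlonglongrightarrow> indicator (box a b) x" for x
  proof (cases "x \<in> box a b")
    case True
    then have fx: "f x > 0"
      using fpos[of x] f0[of x] by simp
    have "(\<lambda>n. 1 - inverse (1 + real n * f x)) \<longlonglongrightarrow> 1 - 0"
      by (intro tendsto_intros tendsto_inverse_0_at_top filterlim_tendsto_add_at_top[OF tendsto_const]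
          filterlim_at_top_mult_tendsto_pos[OF tendsto_const fx] filterlim_real_sequentially)
    moreover have "h n x = 1 - inverse (1 + real n * f x)" for n
      using pos[of n x] by (simp add: h_def field_simps)
    ultimately show ?thesis
      using True by simp
  qed (simp add: h_out)
  have lim_int: "(\<lambda>n. LINT x|M. h n x) \<longlonglongrightarrow> measure M (box a b)"
    if s: "sets M = sets borel" and fin: "\<And>A. bounded A \<Longrightarrow> emeasure M A < \<infinity>" for M
  proof -
    have "(\<lambda>n. LINT x|M. h n x) \<longlonglongrightarrow> (LINT x|M. indicator (box a b) x)"
    proof (rule integral_dominated_convergence[where w = "indicator (box a b)"])
      show "h n \<in> borel_measurable M" for n
        unfolding measurable_cong_sets[OF s refl] using C1_borel(1)[OF h, of "\<lambda>x. x" borel] by simp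
      show "integrable M (indicat_real (box a b))"
        using fin[of "box a b"] s by (intro integrable_real_indicator) auto
    qed (use s lim h01 in \<open>auto simp: measurable_cong_sets[OF s refl]\<close>)
    then show ?thesis
      using s sets_eq_imp_space_eq[OF s] by simp
  qed
  have "(LINT x|\<mu>. h n x) = (LINT x|\<nu>. h n x)" for n
    by (intro eq h h01(1) h_out) (use box_subset_cbox in blast)
  then have "measure \<mu> (box a b) = measure \<nu> (box a b)"
    using LIMSEQ_unique[OF lim_int[OF sets(1) fin(1)]] lim_int[OF sets(2) fin(2)] by simp
  then show ?thesis
    using fin[of "box a b"] by (simp add: emeasure_eq_ennreal_measure less_top)
qed

lemma emeasure_eq_by_test_functions:
  fixes \<mu> \<nu> :: "(real ^ 'n) measure"
  assumes sets: "sets \<mu> = sets borel" "sets \<nu> = sets borel"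
    and fin: "\<And>A. bounded A \<Longrightarrow> emeasure \<mu> A < \<infinity>" "\<And>A. bounded A \<Longrightarrow> emeasure \<nu> A < \<infinity>"
    and eq: "\<And>\<phi>. C1 \<phi> \<Longrightarrow> (\<And>x. \<phi> x \<ge> 0) \<Longrightarrow> (\<And>x. x \<notin> cbox a b \<Longrightarrow> \<phi> x = 0) \<Longrightarrow>
      (LINT x|\<mu>. \<phi> x) = (LINT x|\<nu>. \<phi> x)"
    and A: "A \<in> sets borel" "A \<subseteq> box a b"
  shows "emeasure \<mu> A = emeasure \<nu> A"
proof -
  let ?D = "\<lambda>M. density M (indicator (box a b))"
  have m: "indicator (box a b) \<in> borel_measurable M" if "sets M = sets borel" for M :: "(real ^ 'n) measure"
    using that by (auto simp: measurable_cong_sets[OF that refl])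
  have D: "emeasure (?D M) B = emeasure M (box a b \<inter> B)" if "sets M = sets borel" "B \<in> sets borel" for M B
    using that by (subst emeasure_density[OF m]) (auto simp: indicator_inter_arith[symmetric])
  have "?D \<mu> = ?D \<nu>"
  proof (rule measure_eqI_generator_eq[where E = "range (\<lambda>(c, d). box c d)" and \<Omega> = UNIV and A = "\<lambda>n. box (- (real n *\<^sub>R One)) (real n *\<^sub>R One)"])
    show "Int_stable (range (\<lambda>(c, d). box c d :: (real ^ 'n) set))"
      by (auto simp: Int_stable_def Int_interval box_Int_box)
    show "emeasure (?D \<mu>) X = emeasure (?D \<nu>) X" if "X \<in> range (\<lambda>(c, d). box c d)" for X
    proof -
      from that obtain c d where X: "X = box c d" by auto
      obtain c' d' where I: "box a b \<inter> box c d = box c' d'"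
        by (auto simp: box_Int_box)
      have "emeasure \<mu> (box c' d') = emeasure \<nu> (box c' d')"
      proof (cases "box c' d' = {}")
        case False
        have "cbox c' d' \<subseteq> cbox a b"
          using False I by (metis closure_box closure_mono Int_lower1 box_subset_cbox closed_cbox closure_minimal order_trans)
        then show ?thesis
          by (intro emeasure_box_eq_by_test_functions[OF sets fin] eq) auto
      qed simp
      then show ?thesis
        using sets by (simp add: D X I)
    qed
    show "sets (?D \<mu>) = sigma_sets UNIV (range (\<lambda>(c, d). box c d))" "sets (?D \<nu>) = sigma_sets UNIV (range (\<lambda>(c, d). box c d))"
      using sets by (simp_all add: borel_eq_box case_prod_unfold)
    show "(\<Union>i. box (- (real i *\<^sub>R One)) (real i *\<^sub>R One) :: (real ^ 'n) set) = UNIV"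
      by (rule UN_box_eq_UNIV)
    show "emeasure (?D \<mu>) (box (- (real i *\<^sub>R One)) (real i *\<^sub>R One)) \<noteq> \<infinity>" for i
      using fin(1)[of "box a b \<inter> box (- (real i *\<^sub>R One)) (real i *\<^sub>R One)"] sets by (simp add: D bounded_Int)
  qed auto
  then have "emeasure (?D \<mu>) A = emeasure (?D \<nu>) A"
    by simp
  then show ?thesis
    using A sets by (simp add: D Int_absorb1)
qed

lemma emeasure_eq_locally:
  fixes \<mu> \<nu> :: "'a::second_countable_topology measure"
  assumes sets: "sets \<mu> = sets borel" "sets \<nu> = sets borel" and A: "A \<in> sets borel"
    and loc: "\<And>x. x \<in> A \<Longrightarrow> \<exists>V. open V \<and> x \<in> V \<and> (\<forall>B\<in>sets borel. B \<subseteq> A \<inter> V \<longrightarrow> emeasure \<mu> B = emeasure \<nu> B)"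
  shows "emeasure \<mu> A = emeasure \<nu> A"
proof -
  let ?F = "{V. open V \<and> (\<forall>B\<in>sets borel. B \<subseteq> A \<inter> V \<longrightarrow> emeasure \<mu> B = emeasure \<nu> B)}"
  obtain F' where F': "F' \<subseteq> ?F" "countable F'" "\<Union>F' = \<Union>?F"
    using Lindelof[of ?F] by auto
  have A_sub: "A \<subseteq> \<Union>F'"
    using loc F'(3) by blast
  show ?thesis
  proof (cases "F' = {}")
    case False
    define V where "V = from_nat_into F'"
    have V: "open (V n)" "\<And>B. B \<in> sets borel \<Longrightarrow> B \<subseteq> A \<inter> V n \<Longrightarrow> emeasure \<mu> B = emeasure \<nu> B" for n
      using from_nat_into[OF False, of n] F'(1) unfolding V_def by blast+
    have UN: "(\<Union>n. V n) = \<Union>F'"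
      unfolding V_def using range_from_nat_into[OF False F'(2)] by simp
    let ?B = "\<lambda>n. A \<inter> disjointed V n"
    have B: "?B n \<in> sets borel" for n
    proof -
      have "range V \<subseteq> sets borel" using V(1) by auto
      then show ?thesis
        using A sets.range_disjointed_sets[of V borel] by auto
    qed
    have A_eq: "A = (\<Union>n. ?B n)"
      using A_sub UN UN_disjointed_eq[of V] by auto
    have disj: "disjoint_family ?B"
      using disjoint_family_disjointed[of V] by (auto simp: disjoint_family_on_def)
    have sum: "(\<Sum>n. emeasure M (?B n)) = emeasure M (\<Union>n. ?B n)" if "sets M = sets borel" for M :: "'a measure"
      by (rule suminf_emeasure[OF _ disj]) (use B that in blast)
    have "emeasure \<mu> (?B n) = emeasure \<nu> (?B n)" for n
      using disjointed_subset[of V n] by (intro V(2)[of _ n] B) auto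
    moreover have "emeasure M A = (\<Sum>n. emeasure M (?B n))" if "sets M = sets borel" for M
      by (rule trans[OF arg_cong[OF A_eq, of "emeasure M"] sum[OF that, symmetric]])
    ultimately show ?thesis
      using sets by simp
  qed (use A_sub in simp)
qed

subsection \<open>The Riemannian volume of a smooth boundary\<close>

lemma one_sided_cases:
  assumes "one_sided \<Omega> U k \<gamma> s"
  obtains "s = 1" "\<Omega> \<inter> U = {x \<in> U. x $ k > \<gamma> x}" | "s = -1" "\<Omega> \<inter> U = {x \<in> U. x $ k < \<gamma> x}"
  using assms unfolding one_sided_def by (elim disjE conjE) blast+

lemma one_sided_sign: "one_sided \<Omega> U k \<gamma> s \<Longrightarrow> s = 1 \<or> s = -1"
  by (erule one_sided_cases) simp_all

lemma one_sided_subset: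
  assumes "one_sided \<Omega> V k \<gamma> s" "U \<subseteq> V"
  shows "one_sided \<Omega> U k \<gamma> s"
proof -
  have *: "\<Omega> \<inter> U = (\<Omega> \<inter> V) \<inter> U"
    using assms(2) by blast
  from assms(1) show ?thesis
  proof (cases rule: one_sided_cases)
    case 1
    have "\<Omega> \<inter> U = {x \<in> U. x $ k > \<gamma> x}"
      unfolding * 1(2) using assms(2) by blast
    with 1(1) show ?thesis by (simp add: one_sided_def)
  next
    case 2
    have "\<Omega> \<inter> U = {x \<in> U. x $ k < \<gamma> x}"
      unfolding * 2(2) using assms(2) by blast
    with 2(1) show ?thesis by (simp add: one_sided_def)
  qed
qed

lemma graph_function_continuous: "graph_function k \<gamma> \<Longrightarrow> continuous_on A \<gamma>"
  by (rule continuous_on_subset[OF C1_continuous subset_UNIV]) (simp add: graph_function_def)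

lemma one_sided_iff:
  assumes "one_sided \<Omega> U k \<gamma> s" "x \<in> U"
  shows "x \<in> \<Omega> \<longleftrightarrow> s * (x $ k - \<gamma> x) > 0"
proof -
  have *: "x \<in> \<Omega> \<longleftrightarrow> x \<in> \<Omega> \<inter> U"
    using assms(2) by simp
  from assms(1) show ?thesis
    by (cases rule: one_sided_cases) (simp_all only: *, simp_all add: assms(2))
qed

lemma open_contains_segment:
  fixes v :: "'a::real_normed_vector"
  assumes "open U" "x \<in> U"
  obtains e where "e > 0" "\<And>t. \<bar>t\<bar> < e \<Longrightarrow> x + t *\<^sub>R v \<in> U"
proof -
  obtain d where d: "d > 0" "ball x d \<subseteq> U"
    using assms open_contains_ball by blast
  have "x + t *\<^sub>R v \<in> U" if "\<bar>t\<bar> < d / (norm v + 1)" for t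
  proof -
    have "\<bar>t\<bar> * norm v \<le> \<bar>t\<bar> * (norm v + 1)"
      by (intro mult_left_mono) auto
    also have "\<dots> < d"
      using that by (simp add: pos_less_divide_eq add_nonneg_pos)
    finally show ?thesis
      using d(2) by (auto simp: dist_norm subset_eq)
  qed
  moreover have "d / (norm v + 1) > 0"
    using d(1) by (simp add: add_nonneg_pos)
  ultimately show ?thesis
    using that by blast
qed

lemma frontier_one_sided:
  assumes \<Omega>: "open \<Omega>" and U: "open U" and \<gamma>: "graph_function k \<gamma>" and os: "one_sided \<Omega> U k \<gamma> s"
  shows "frontier \<Omega> \<inter> U = {x \<in> U. x $ k = \<gamma> x}"
proof (intro equalityI subsetI)
  have inv: "\<And>x t. \<gamma> (x + t *\<^sub>R axis k 1) = \<gamma> x"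
    using \<gamma> by (auto simp: graph_function_def)
  have s: "s = 1 \<or> s = -1"
    by (rule one_sided_sign[OF os])
  {
    fix x assume x: "x \<in> frontier \<Omega> \<inter> U"
    then have "x \<notin> \<Omega>"
      using \<Omega> by (simp add: frontier_def interior_open)
    then have "s * (x $ k - \<gamma> x) \<le> 0"
      using one_sided_iff[OF os] x by auto
    moreover have "\<not> s * (x $ k - \<gamma> x) < 0"
    proof
      assume neg: "s * (x $ k - \<gamma> x) < 0"
      let ?V = "U \<inter> {x. s * (x $ k - \<gamma> x) < 0}"
      have "open ?V"
        by (intro open_Int U open_Collect_less continuous_intros graph_function_continuous[OF \<gamma>])
      moreover have "\<Omega> \<inter> ?V = {}"
        using one_sided_iff[OF os] by fastforce
      ultimately have "closure \<Omega> \<inter> ?V = {}"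
        by (metis Int_commute open_Int_closure_eq_empty)
      with x neg show False
        by (auto simp: frontier_def)
    qed
    ultimately have "s * (x $ k - \<gamma> x) = 0" by simp
    with s x show "x \<in> {x \<in> U. x $ k = \<gamma> x}" by auto
  next
    fix x assume x: "x \<in> {x \<in> U. x $ k = \<gamma> x}"
    then have "x \<notin> \<Omega>"
      using one_sided_iff[OF os] by auto
    moreover have "x \<in> closure \<Omega>"
      unfolding closure_approachable
    proof (intro allI impI)
      fix e :: real assume e: "e > 0"
      obtain d where d: "d > 0" "\<And>t. \<bar>t\<bar> < d \<Longrightarrow> x + t *\<^sub>R axis k 1 \<in> U"
        using open_contains_segment[OF U] x by blast
      let ?t = "s * (min d e / 2)"
      have "\<bar>?t\<bar> < d"
        using s d(1) e by auto
      then have "x + ?t *\<^sub>R axis k 1 \<in> U"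
        by (rule d(2))
      moreover have "s * (s * (min d e / 2)) > 0"
        using s d(1) e by auto
      ultimately have "x + ?t *\<^sub>R axis k 1 \<in> \<Omega>"
        using one_sided_iff[OF os, of "x + ?t *\<^sub>R axis k 1"] x by (simp add: inv)
      moreover have "dist (x + ?t *\<^sub>R axis k 1) x < e"
        using s d(1) e by (auto simp: dist_norm)
      ultimately show "\<exists>y\<in>\<Omega>. dist y x < e" by blast
    qed
    ultimately show "x \<in> frontier \<Omega> \<inter> U"
      using x \<Omega> by (simp add: frontier_def interior_open)
  }
qed

lemma smooth_boundary_patch:
  assumes \<Omega>: "open \<Omega>" and sm: "smooth_boundary \<Omega>" and c: "c \<in> frontier \<Omega>"
  obtains r k \<gamma> s where "r > 0" "smooth_graph_function k \<gamma>" "one_sided \<Omega> (ball c r) k \<gamma> s"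
    "graph_patch (frontier \<Omega>) (ball c r) k \<gamma>"
proof -
  obtain r k \<gamma> where r: "r > 0" and \<gamma>: "smooth_graph_function k \<gamma>"
    and os: "\<Omega> \<inter> ball c r = {x \<in> ball c r. x $ k > \<gamma> x} \<or> \<Omega> \<inter> ball c r = {x \<in> ball c r. x $ k < \<gamma> x}"
    using bspec[OF sm[unfolded smooth_boundary_def] c] by (elim exE conjE) (rule that, assumption+)
  from os obtain s where "one_sided \<Omega> (ball c r) k \<gamma> s"
  proof
    assume "\<Omega> \<inter> ball c r = {x \<in> ball c r. x $ k > \<gamma> x}"
    then show ?thesis by (intro that[of 1]) (simp add: one_sided_def)
  next
    assume "\<Omega> \<inter> ball c r = {x \<in> ball c r. x $ k < \<gamma> x}"
    then show ?thesis by (intro that[of "-1"]) (simp add: one_sided_def)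
  qed
  with r \<gamma> show ?thesis
    using that frontier_one_sided[OF \<Omega> open_ball smooth_graph_functionD(1)[OF \<gamma>]]
    unfolding graph_patch_def by blast
qed

lemma graph_patch_one_sided:
  assumes \<Omega>: "open \<Omega>" and sm: "smooth_boundary \<Omega>" and x: "x \<in> frontier \<Omega> \<inter> W"
    and patch: "graph_patch (frontier \<Omega>) W k \<gamma>"
  obtains r s where "r > 0" "ball x r \<subseteq> W" "one_sided \<Omega> (ball x r) k \<gamma> s"
proof -
  have W: "open W" and \<gamma>: "graph_function k \<gamma>" and M: "frontier \<Omega> \<inter> W = {x \<in> W. x $ k = \<gamma> x}"
    using patch smooth_graph_functionD(1) by (auto simp: graph_patch_def)
  have inv: "\<And>x t. \<gamma> (x + t *\<^sub>R axis k 1) = \<gamma> x"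
    using \<gamma> by (auto simp: graph_function_def)
  have inv': "\<And>x t. \<gamma> (x - t *\<^sub>R axis k 1) = \<gamma> x"
    using inv[of _ "- _"] by simp
  define S where "S x = x - \<gamma> x *\<^sub>R axis k 1" for x
  define T where "T x = x + \<gamma> x *\<^sub>R axis k 1" for x
  have TS: "T (S x) = x" and ST: "S (T x) = x" for x
    by (simp_all add: S_def T_def inv inv')
  have contT: "continuous_on A T" and contS: "continuous_on A S" for A
    unfolding S_def[abs_def] T_def[abs_def] by (intro continuous_intros graph_function_continuous[OF \<gamma>])+
  have "open (T -` W)"
    using contT W by (simp add: open_vimage)
  moreover have "S x \<in> T -` W"
    using x by (simp add: TS)
  ultimately obtain \<rho> where \<rho>: "\<rho> > 0" "ball (S x) \<rho> \<subseteq> T -` W"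
    using open_contains_ball by blast
  define V where "V = S -` ball (S x) \<rho>"
  have V_open: "open V"
    unfolding V_def using contS by (simp add: open_vimage)
  have xV: "x \<in> V"
    using \<rho> by (simp add: V_def)
  have VW: "V \<subseteq> W"
    using \<rho>(2) TS unfolding V_def by (metis subsetI subsetD vimageE)
  have M': "y \<in> frontier \<Omega> \<longleftrightarrow> y $ k = \<gamma> y" if "y \<in> V" for y
  proof -
    have "y \<in> frontier \<Omega> \<longleftrightarrow> y \<in> frontier \<Omega> \<inter> W"
      using that VW by blast
    then show ?thesis
      unfolding M using that VW by blast
  qed
  have side: "{y \<in> V. s * (y $ k - \<gamma> y) > 0} \<subseteq> \<Omega> \<or> {y \<in> V. s * (y $ k - \<gamma> y) > 0} \<inter> \<Omega> = {}"
    if s: "s = 1 \<or> s = -1" for s :: real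
  proof -
    let ?H = "{z :: real ^ 'a. s * (z $ k) > 0}"
    have eq: "{y \<in> V. s * (y $ k - \<gamma> y) > 0} = T ` (ball (S x) \<rho> \<inter> ?H)" (is "?L = _")
    proof (intro equalityI subsetI)
      fix y assume "y \<in> ?L"
      then have "S y \<in> ball (S x) \<rho> \<inter> ?H"
        by (simp add: V_def S_def)
      then show "y \<in> T ` (ball (S x) \<rho> \<inter> ?H)"
        by (rule rev_image_eqI) (simp add: TS)
    next
      fix y assume "y \<in> T ` (ball (S x) \<rho> \<inter> ?H)"
      then obtain z where z: "z \<in> ball (S x) \<rho>" "s * (z $ k) > 0" "y = T z" by blast
      then show "y \<in> ?L"
        by (simp add: V_def ST) (simp add: T_def inv)
    qed
    have "?H = {z. axis k s \<bullet> z > 0}"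
      by (simp add: inner_commute[of "axis k s"] inner_axis mult.commute)
    then have "convex ?H"
      using convex_halfspace_gt[of 0 "axis k s"] by simp
    then have "connected ?L"
      unfolding eq by (intro connected_continuous_image contT convex_connected convex_Int) auto
    moreover have "?L \<inter> frontier \<Omega> = {}"
      using M' by auto
    ultimately show ?thesis
      using connected_Int_frontier[of ?L \<Omega>] by blast
  qed
  have not\<Omega>: "y \<notin> \<Omega>" if "y \<in> V" "y $ k = \<gamma> y" for y
    using M'[OF that(1)] that(2) \<Omega> by (simp add: frontier_def interior_open)
  have ne: "V \<inter> \<Omega> \<noteq> {}"
    using x V_open xV by (metis IntD1 Int_commute Int_iff empty_iff frontier_def DiffD1 open_Int_closure_eq_empty)
  have not_both: "\<not> ({y \<in> V. 1 * (y $ k - \<gamma> y) > 0} \<subseteq> \<Omega> \<and> {y \<in> V. -1 * (y $ k - \<gamma> y) > 0} \<subseteq> \<Omega>)"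
  proof
    assume both: "{y \<in> V. 1 * (y $ k - \<gamma> y) > 0} \<subseteq> \<Omega> \<and> {y \<in> V. -1 * (y $ k - \<gamma> y) > 0} \<subseteq> \<Omega>"
    obtain r' k' \<gamma>' s' where p': "r' > 0" "smooth_graph_function k' \<gamma>'" "one_sided \<Omega> (ball x r') k' \<gamma>' s'"
       "graph_patch (frontier \<Omega>) (ball x r') k' \<gamma>'"
      using smooth_boundary_patch[OF \<Omega> sm] x by blast
    have \<gamma>': "graph_function k' \<gamma>'" and s': "s' = 1 \<or> s' = -1"
      using smooth_graph_functionD(1)[OF p'(2)] one_sided_sign[OF p'(3)] by blast+
    have "x \<in> frontier \<Omega> \<inter> ball x r'"
      using x p'(1) by simp
    then have x': "x $ k' = \<gamma>' x"
      using p'(4) unfolding graph_patch_def by blast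
    define O' where "O' = V \<inter> ball x r' \<inter> {y. s' * (y $ k' - \<gamma>' y) < 0}"
    have O': "open O'"
      unfolding O'_def
      by (intro open_Int V_open open_ball open_Collect_less continuous_intros graph_function_continuous[OF \<gamma>'])
    have disj: "O' \<inter> \<Omega> = {}"
      using one_sided_iff[OF p'(3)] by (fastforce simp: O'_def)
    obtain e where e: "e > 0" "\<And>t. \<bar>t\<bar> < e \<Longrightarrow> x + t *\<^sub>R axis k' 1 \<in> V \<inter> ball x r'"
      using open_contains_segment[of "V \<inter> ball x r'" x "axis k' 1"] V_open xV p'(1) by auto
    have "x + (- s' * (e / 2)) *\<^sub>R axis k' 1 \<in> V \<inter> ball x r'"
      using s' e(1) by (intro e(2)) auto
    moreover have "\<gamma>' (x + (- s' * (e / 2)) *\<^sub>R axis k' 1) = \<gamma>' x"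
      using \<gamma>' unfolding graph_function_def by blast
    ultimately have yO: "x + (- s' * (e / 2)) *\<^sub>R axis k' 1 \<in> O'" (is "?y \<in> _")
      using s' e(1) x' by (auto simp: O'_def)
    obtain d where d: "d > 0" "\<And>t. \<bar>t\<bar> < d \<Longrightarrow> ?y + t *\<^sub>R axis k 1 \<in> O'"
      using open_contains_segment[OF O' yO] by blast
    have graph: "y $ k = \<gamma> y" if "y \<in> O'" for y
    proof (rule ccontr)
      assume "y $ k \<noteq> \<gamma> y"
      then have "1 * (y $ k - \<gamma> y) > 0 \<or> -1 * (y $ k - \<gamma> y) > 0" by auto
      moreover have "y \<in> V" using that by (simp add: O'_def)
      ultimately have "y \<in> \<Omega>" using both by blast
      with that disj show False by blast
    qed
    have "?y $ k = \<gamma> ?y"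
      using graph yO by blast
    moreover have "(?y + (d / 2) *\<^sub>R axis k 1) $ k = \<gamma> (?y + (d / 2) *\<^sub>R axis k 1)"
      using d(1) by (intro graph d(2)) auto
    ultimately show False
      using d(1) unfolding inv by simp
  qed
  have "\<exists>s. one_sided \<Omega> V k \<gamma> s"
  proof -
    have sp: "y $ k = \<gamma> y \<or> y \<in> {y \<in> V. 1 * (y $ k - \<gamma> y) > 0} \<or> y \<in> {y \<in> V. -1 * (y $ k - \<gamma> y) > 0}" if "y \<in> V" for y
      using that by auto
    consider "{y \<in> V. 1 * (y $ k - \<gamma> y) > 0} \<subseteq> \<Omega>" "{y \<in> V. -1 * (y $ k - \<gamma> y) > 0} \<inter> \<Omega> = {}"
      | "{y \<in> V. 1 * (y $ k - \<gamma> y) > 0} \<inter> \<Omega> = {}" "{y \<in> V. -1 * (y $ k - \<gamma> y) > 0} \<subseteq> \<Omega>"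
      using side[of 1] side[of "-1"] not_both ne sp not\<Omega> by blast
    then show ?thesis
    proof cases
      case 1
      then have "\<Omega> \<inter> V = {x \<in> V. x $ k > \<gamma> x}"
        using sp not\<Omega> by auto
      then show ?thesis by (auto simp: one_sided_def)
    next
      case 2
      then have "\<Omega> \<inter> V = {x \<in> V. x $ k < \<gamma> x}"
        using sp not\<Omega> by auto
      then show ?thesis by (auto simp: one_sided_def)
    qed
  qed
  then obtain s where s: "one_sided \<Omega> V k \<gamma> s" by blast
  obtain r where "r > 0" "ball x r \<subseteq> V"
    using V_open xV open_contains_ball by blast
  then show ?thesis
    using that one_sided_subset[OF s] VW by blast
qed

lemma graph_normal_unit: "graph_function k \<gamma> \<Longrightarrow> graph_normal k \<gamma> x \<bullet> graph_normal k \<gamma> x = 1"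
  using norm_graph_normal[of k \<gamma> x] by (simp add: norm_eq_1)

lemma integrable_graph_measure:
  fixes f :: "real ^ 'n \<Rightarrow> real"
  assumes "graph_function k \<gamma>" "continuous_on UNIV f" "compact K" "\<And>x. x \<notin> K \<Longrightarrow> f x = 0"
  shows "integrable (graph_measure k \<gamma>) f"
proof (rule integrable_continuous_bounded_support[OF assms(2)])
  show "bounded {x. f x \<noteq> 0}"
    by (rule bounded_subset[OF compact_imp_bounded[OF assms(3)]]) (use assms(4) in auto)
qed (use emeasure_graph_measure_bounded[OF assms(1)] in auto)

lemma integral_graph_measure_le:
  fixes \<phi> :: "real ^ 'n \<Rightarrow> real"
  assumes os1: "one_sided \<Omega> U k \<gamma> s" and \<gamma>: "smooth_graph_function k \<gamma>"
    and os2: "one_sided \<Omega> U l \<delta> t" and \<delta>: "smooth_graph_function l \<delta>"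
    and \<phi>: "C1 \<phi>" "\<And>x. \<phi> x \<ge> 0" and K: "compact K" "K \<subseteq> U" "\<And>x. x \<notin> K \<Longrightarrow> \<phi> x = 0"
  shows "(LINT x|graph_measure k \<gamma>. \<phi> x) \<le> (LINT x|graph_measure l \<delta>. \<phi> x)"
proof -
  note g = smooth_graph_functionD(1)[OF \<gamma>] and d = smooth_graph_functionD(1)[OF \<delta>]
  let ?n = "graph_normal k \<gamma>" and ?m = "graph_normal l \<delta>"
  let ?F = "\<lambda>x. \<phi> x *\<^sub>R s *\<^sub>R ?n x"
  have F: "C1_field ?F"
    by (intro C1_field_scale \<phi> C1_const C1_field_graph_normal \<gamma>)
  have F0: "\<And>x. x \<notin> K \<Longrightarrow> ?F x = 0" using K(3) by simp
  have s: "s = 1 \<or> s = -1" and t: "t = 1 \<or> t = -1"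
    using one_sided_sign os1 os2 by blast+
  have nm: "s * t * (?n x \<bullet> ?m x) \<le> 1" for x
  proof -
    have "\<bar>?n x \<bullet> ?m x\<bar> \<le> 1"
      using Cauchy_Schwarz_ineq2[of "?n x" "?m x"] by (simp add: norm_graph_normal g d)
    then show ?thesis
      using s t by auto
  qed
  have "(LINT x|graph_measure k \<gamma>. \<phi> x) = s * (LINT x|graph_measure k \<gamma>. ?F x \<bullet> ?n x)"
    using s by (auto simp: graph_normal_unit[OF g])
  also have "\<dots> = (LINT x|lborel. indicator \<Omega> x * divergence ?F x)"
    by (rule integral_divergence_one_sided[OF os1 g F K(1,2) F0, symmetric])
  also have "\<dots> = t * (LINT x|graph_measure l \<delta>. ?F x \<bullet> ?m x)"
    by (rule integral_divergence_one_sided[OF os2 d F K(1,2) F0])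
  also have "\<dots> = (LINT x|graph_measure l \<delta>. \<phi> x * (s * t * (?n x \<bullet> ?m x)))"
    using s t by (auto simp: mult_ac)
  also have "\<dots> \<le> (LINT x|graph_measure l \<delta>. \<phi> x)"
  proof (rule integral_mono)
    have "continuous_on UNIV (\<lambda>x. \<phi> x * (s * t * (?n x \<bullet> ?m x)))"
      using C1_continuous[OF \<phi>(1)] C1_field_continuous[OF C1_field_graph_normal[OF \<gamma>]]
        C1_field_continuous[OF C1_field_graph_normal[OF \<delta>]]
      by (intro continuous_on_mult continuous_on_const continuous_on_inner)
    then show "integrable (graph_measure l \<delta>) (\<lambda>x. \<phi> x * (s * t * (?n x \<bullet> ?m x)))"
      by (rule integrable_graph_measure[OF d _ K(1)]) (simp add: K(3))
    show "integrable (graph_measure l \<delta>) \<phi>"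
      by (rule integrable_graph_measure[OF d C1_continuous[OF \<phi>(1)] K(1,3)])
    show "\<phi> x * (s * t * (?n x \<bullet> ?m x)) \<le> \<phi> x" for x
      using mult_left_mono[OF nm \<phi>(2), of x x] by simp
  qed
  finally show ?thesis .
qed

lemma small_box:
  fixes x :: "'a::euclidean_space"
  assumes "r > 0"
  obtains a b where "x \<in> box a b" "cbox a b \<subseteq> ball x r"
proof -
  obtain a b where ab: "x \<in> box a b" "box a b \<subseteq> ball x (r / 2)"
    using rational_boxes[of "r / 2" x] assms by auto
  have "cbox a b = closure (box a b)"
    using ab(1) by (intro closure_box[symmetric]) auto
  also have "\<dots> \<subseteq> cball x (r / 2)"
    using ab(2) ball_subset_cball by (intro closure_minimal) blast+
  also have "\<dots> \<subseteq> ball x r"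
    using assms by auto
  finally show ?thesis
    using that ab(1) by blast
qed

text \<open>The two graphs bound the same domain, so the divergence theorem identifies both area integrals as fluxes.\<close>

lemma graph_measure_consistent:
  assumes \<Omega>: "open \<Omega>" and sm: "smooth_boundary \<Omega>"
    and p: "graph_patch (frontier \<Omega>) W k \<gamma>" and q: "graph_patch (frontier \<Omega>) W' l \<delta>"
    and A: "A \<in> sets borel" "A \<subseteq> frontier \<Omega> \<inter> W" "A \<subseteq> W'"
  shows "emeasure (graph_measure k \<gamma>) A = emeasure (graph_measure l \<delta>) A"
proof (rule emeasure_eq_locally)
  have g: "smooth_graph_function k \<gamma>" and d: "smooth_graph_function l \<delta>"
    using p q by (auto simp: graph_patch_def)
  note g' = smooth_graph_functionD(1)[OF g] and d' = smooth_graph_functionD(1)[OF d]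
  fix x assume "x \<in> A"
  then have x: "x \<in> frontier \<Omega> \<inter> W" "x \<in> frontier \<Omega> \<inter> W'"
    using A by auto
  obtain r s where r: "r > 0" "one_sided \<Omega> (ball x r) k \<gamma> s"
    using graph_patch_one_sided[OF \<Omega> sm x(1) p] by metis
  obtain r' s' where r': "r' > 0" "one_sided \<Omega> (ball x r') l \<delta> s'"
    using graph_patch_one_sided[OF \<Omega> sm x(2) q] by metis
  let ?U = "ball x (min r r')"
  have os1: "one_sided \<Omega> ?U k \<gamma> s"
    by (rule one_sided_subset[OF r(2)]) (simp add: subset_ball)
  have os2: "one_sided \<Omega> ?U l \<delta> s'"
    by (rule one_sided_subset[OF r'(2)]) (simp add: subset_ball)
  obtain a b where ab: "x \<in> box a b" "cbox a b \<subseteq> ?U"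
    using small_box[of "min r r'" x] r(1) r'(1) by auto
  have "emeasure (graph_measure k \<gamma>) B = emeasure (graph_measure l \<delta>) B"
    if "B \<in> sets borel" "B \<subseteq> box a b" for B
  proof (rule emeasure_eq_by_test_functions[OF _ _ _ _ _ that])
    fix \<phi> :: "real ^ 'a \<Rightarrow> real" assume \<phi>: "C1 \<phi>" "\<And>x. \<phi> x \<ge> 0" "\<And>x. x \<notin> cbox a b \<Longrightarrow> \<phi> x = 0"
    show "(LINT x|graph_measure k \<gamma>. \<phi> x) = (LINT x|graph_measure l \<delta>. \<phi> x)"
      by (intro antisym integral_graph_measure_le[OF os1 g os2 d \<phi>(1,2) compact_cbox ab(2) \<phi>(3)]
          integral_graph_measure_le[OF os2 d os1 g \<phi>(1,2) compact_cbox ab(2) \<phi>(3)])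
  qed (use emeasure_graph_measure_bounded[OF g'] emeasure_graph_measure_bounded[OF d'] in auto)
  then show "\<exists>V. open V \<and> x \<in> V \<and> (\<forall>B\<in>sets borel. B \<subseteq> A \<inter> V \<longrightarrow> emeasure (graph_measure k \<gamma>) B = emeasure (graph_measure l \<delta>) B)"
    using ab(1) by (intro exI[of _ "box a b"]) auto
qed (use A in auto)

lemma smooth_boundary_finite_atlas:
  fixes \<Omega> :: "(real ^ 'n) set"
  assumes \<Omega>: "open \<Omega>" "bounded \<Omega>" and sm: "smooth_boundary \<Omega>"
  obtains m :: nat and W :: "nat \<Rightarrow> (real ^ 'n) set" and D :: "nat \<Rightarrow> (real ^ 'n) set"
     and k :: "nat \<Rightarrow> 'n" and \<gamma> :: "nat \<Rightarrow> real ^ 'n \<Rightarrow> real"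
  where "\<And>j. j < m \<Longrightarrow> graph_patch (frontier \<Omega>) (W j) (k j) (\<gamma> j)"
    "\<And>j. j < m \<Longrightarrow> D j \<subseteq> frontier \<Omega> \<inter> W j" "\<And>j. D j \<in> sets borel" "disjoint_family_on D {..<m}"
    "frontier \<Omega> = (\<Union>j<m. D j)"
proof -
  let ?M = "frontier \<Omega>"
  have "\<exists>r k \<gamma>. r > 0 \<and> graph_patch ?M (ball x r) k \<gamma>" if "x \<in> ?M" for x
    using smooth_boundary_patch[OF \<Omega>(1) sm that] by metis
  then obtain r k \<gamma> where rk\<gamma>: "\<And>x. x \<in> ?M \<Longrightarrow> r x > 0 \<and> graph_patch ?M (ball x (r x)) (k x) (\<gamma> x)"
    by metis
  have "compact ?M"
    using \<Omega>(2) by (rule compact_frontier_bounded)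
  moreover have "?M \<subseteq> (\<Union>x\<in>?M. ball x (r x))"
    using rk\<gamma> by force
  ultimately obtain C where C: "C \<subseteq> ?M" "finite C" "?M \<subseteq> (\<Union>x\<in>C. ball x (r x))"
    using compactE_image[of ?M ?M "\<lambda>x. ball x (r x)"] by (metis open_ball)
  obtain c :: "nat \<Rightarrow> real ^ 'n" where c: "bij_betw c {..<card C} C"
    using ex_bij_betw_nat_finite[OF C(2)] by (auto simp: atLeast0LessThan)
  define W where "W j = ball (c j) (r (c j))" for j
  define D where "D j = ?M \<inter> W j - (\<Union>i<j. W i)" for j
  show ?thesis
  proof (rule that[of "card C" W "\<lambda>j. k (c j)" "\<lambda>j. \<gamma> (c j)" D])
    show "graph_patch ?M (W j) (k (c j)) (\<gamma> (c j))" if "j < card C" for j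
      using rk\<gamma> bij_betwE[OF c] C(1) that unfolding W_def by blast
    show "disjoint_family_on D {..<card C}"
      unfolding disjoint_family_on_def
    proof (intro ballI impI)
      fix i j :: nat assume "i \<noteq> j"
      then show "D i \<inter> D j = {}"
        by (cases i j rule: linorder_cases) (auto simp: D_def)
    qed
    show "D j \<in> sets borel" for j
      unfolding D_def W_def by (intro sets.Diff sets.Int sets.countable_UN'' borel_open borel_closed) auto
    show "?M = (\<Union>j<card C. D j)"
    proof (intro equalityI subsetI)
      fix x assume x: "x \<in> ?M"
      with C(3) obtain y where y: "y \<in> C" "x \<in> ball y (r y)" by blast
      then obtain j where "j < card C" "y = c j"
        using bij_betw_imp_surj_on[OF c] by blast
      with y have j: "j < card C" "x \<in> W j"
        by (simp_all add: W_def)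
      define i where "i = (LEAST j. x \<in> W j)"
      have "x \<in> W i" "i \<le> j" "\<And>i'. i' < i \<Longrightarrow> x \<notin> W i'"
        unfolding i_def using j(2) by (auto intro: LeastI Least_le dest: not_less_Least)
      then show "x \<in> (\<Union>j<card C. D j)"
        using x j(1) by (auto simp: D_def intro!: bexI[of _ i])
    qed (auto simp: D_def)
  qed (auto simp: D_def)
qed

lemma emeasure_atlas:
  assumes D: "disjoint_family_on D {..<m :: nat}" "\<And>j. j < m \<Longrightarrow> A \<inter> D j \<in> sets \<mu>" and A: "A \<subseteq> (\<Union>j<m. D j)"
  shows "emeasure \<mu> A = (\<Sum>j<m. emeasure \<mu> (A \<inter> D j))"
proof -
  have "(\<Sum>j<m. emeasure \<mu> (A \<inter> D j)) = emeasure \<mu> (\<Union>j<m. A \<inter> D j)"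
  proof (rule sum_emeasure)
    show "disjoint_family_on (\<lambda>j. A \<inter> D j) {..<m}"
      using D(1) unfolding disjoint_family_on_def by blast
  qed (use D(2) in auto)
  also have "(\<Union>j<m. A \<inter> D j) = A"
    using A by blast
  finally show ?thesis by simp
qed

lemma surface_measure_exists_unique:
  fixes \<Omega> :: "(real ^ 'n) set"
  assumes \<Omega>: "open \<Omega>" "bounded \<Omega>" and sm: "smooth_boundary \<Omega>"
  shows "\<exists>!\<sigma>. is_riemannian_volume (frontier \<Omega>) \<sigma>"
proof -
  let ?M = "frontier \<Omega>"
  obtain m W D k \<gamma> where patch: "\<And>j. j < m \<Longrightarrow> graph_patch ?M (W j) (k j) (\<gamma> j)"
    and D: "\<And>j. j < m \<Longrightarrow> D j \<subseteq> ?M \<inter> W j" "\<And>j. D j \<in> sets borel" "disjoint_family_on D {..<m :: nat}"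
    and M: "?M = (\<Union>j<m. D j)"
    by (rule smooth_boundary_finite_atlas[OF \<Omega> sm]) (rule that; assumption)
  have M_borel: "?M \<in> sets borel"
    by (intro borel_closed frontier_closed)
  have patch_graph: "graph_function k \<gamma>" if "graph_patch ?M W k \<gamma>" for W k \<gamma>
    using that smooth_graph_functionD(1) unfolding graph_patch_def by blast
  define \<mu> where "\<mu> A = (\<Sum>j<m. emeasure (graph_measure (k j) (\<gamma> j)) (A \<inter> D j))" for A
  define \<tau> where "\<tau> = measure_of UNIV (sets borel) \<mu>"
  have sets_\<tau>: "sets \<tau> = sets borel"
    unfolding \<tau>_def using sets.space_closed[of borel]
    by (simp add: sets_measure_of sets.sigma_sets_eq[of borel, simplified])
  have \<tau>: "emeasure \<tau> A = \<mu> A" if "A \<in> sets borel" for A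
    unfolding \<tau>_def
  proof (rule emeasure_measure_of_sigma[OF _ _ _ that])
    show "sigma_algebra UNIV (sets (borel :: (real ^ 'n) measure))"
      using sets.sigma_algebra_axioms[of "borel :: (real ^ 'n) measure"] by simp
    show "positive (sets borel) \<mu>"
      by (simp add: positive_def \<mu>_def)
    show "countably_additive (sets borel) \<mu>"
      unfolding countably_additive_def
    proof (intro allI impI)
      fix A :: "nat \<Rightarrow> (real ^ 'n) set"
      assume A: "range A \<subseteq> sets borel" "disjoint_family A"
      have "(\<Sum>i. \<mu> (A i)) = (\<Sum>j<m. \<Sum>i. emeasure (graph_measure (k j) (\<gamma> j)) (A i \<inter> D j))"
        unfolding \<mu>_def by (rule suminf_sum) simp
      also have "\<dots> = (\<Sum>j<m. emeasure (graph_measure (k j) (\<gamma> j)) (\<Union>i. A i \<inter> D j))"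
        by (intro sum.cong refl suminf_emeasure)
           (use A D(2) in \<open>auto simp: disjoint_family_on_def\<close>)
      finally show "(\<Sum>i. \<mu> (A i)) = \<mu> (\<Union>i. A i)"
        by (simp add: \<mu>_def)
    qed
  qed
  have \<tau>_patch: "emeasure \<tau> A = emeasure (graph_measure k' \<gamma>') A"
    if p: "graph_patch ?M W' k' \<gamma>'" and A: "A \<in> sets borel" "A \<subseteq> ?M \<inter> W'" for W' k' \<gamma>' A
  proof -
    have "emeasure \<tau> A = (\<Sum>j<m. emeasure (graph_measure k' \<gamma>') (A \<inter> D j))"
      unfolding \<tau>[OF A(1)] \<mu>_def
      by (intro sum.cong refl graph_measure_consistent[OF \<Omega>(1) sm patch p])
         (use A D in auto)
    also have "\<dots> = emeasure (graph_measure k' \<gamma>') A"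
      by (rule emeasure_atlas[OF D(3), symmetric]) (use A D(2) M in auto)
    finally show ?thesis .
  qed
  have iff: "is_riemannian_volume ?M \<sigma> \<longleftrightarrow> sets \<sigma> = sets (restrict_space borel ?M) \<and>
       (\<forall>A\<in>sets borel. A \<subseteq> ?M \<longrightarrow> emeasure \<sigma> A = emeasure \<tau> A)" for \<sigma>
  proof
    assume \<sigma>: "is_riemannian_volume ?M \<sigma>"
    then have s: "sets \<sigma> = sets (restrict_space borel ?M)"
      by (simp add: is_riemannian_volume_def)
    have "emeasure \<sigma> A = emeasure \<tau> A" if A: "A \<in> sets borel" "A \<subseteq> ?M" for A
    proof -
      have in_sets: "B \<in> sets \<sigma>" if "B \<in> sets borel" "B \<subseteq> ?M" for B
        unfolding s using that M_borel by (auto simp: sets_restrict_space_iff)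
      have "emeasure \<sigma> A = (\<Sum>j<m. emeasure \<sigma> (A \<inter> D j))"
        using A D(2) M by (intro emeasure_atlas[OF D(3)] in_sets) auto
      also have "\<dots> = (\<Sum>j<m. emeasure \<tau> (A \<inter> D j))"
      proof (intro sum.cong refl)
        fix j assume "j \<in> {..<m}"
        then have j: "j < m" by simp
        have sub: "A \<inter> D j \<in> sets borel" "A \<inter> D j \<subseteq> ?M \<inter> W j"
          using A D(1)[OF j] D(2) by auto
        then have "emeasure \<sigma> (A \<inter> D j) = graph_area (k j) (\<gamma> j) (A \<inter> D j)"
          using \<sigma> patch[OF j] unfolding is_riemannian_volume_def by blast
        then show "emeasure \<sigma> (A \<inter> D j) = emeasure \<tau> (A \<inter> D j)"
          using \<tau>_patch[OF patch[OF j] sub] emeasure_graph_measure[OF patch_graph[OF patch[OF j]] sub(1)] by simp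
      qed
      also have "\<dots> = emeasure \<tau> A"
        by (rule emeasure_atlas[OF D(3), symmetric]) (use A D(2) M sets_\<tau> in auto)
      finally show ?thesis .
    qed
    with s show "sets \<sigma> = sets (restrict_space borel ?M) \<and>
       (\<forall>A\<in>sets borel. A \<subseteq> ?M \<longrightarrow> emeasure \<sigma> A = emeasure \<tau> A)" by blast
  next
    assume \<sigma>: "sets \<sigma> = sets (restrict_space borel ?M) \<and>
       (\<forall>A\<in>sets borel. A \<subseteq> ?M \<longrightarrow> emeasure \<sigma> A = emeasure \<tau> A)"
    show "is_riemannian_volume ?M \<sigma>"
      unfolding is_riemannian_volume_def
    proof (intro conjI allI impI ballI)
      fix W' k' \<gamma>' A assume p: "graph_patch ?M W' k' \<gamma>'" and A: "A \<in> sets borel" "A \<subseteq> ?M \<inter> W'"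
      then have "emeasure \<sigma> A = emeasure \<tau> A"
        using \<sigma> by blast
      then show "emeasure \<sigma> A = graph_area k' \<gamma>' A"
        using \<tau>_patch[OF p A] emeasure_graph_measure[OF patch_graph[OF p] A(1)] by simp
    qed (use \<sigma> in blast)
  qed
  show ?thesis
  proof (rule ex1I[of _ "restrict_space \<tau> ?M"])
    show "is_riemannian_volume ?M (restrict_space \<tau> ?M)"
      unfolding iff using M_borel sets_\<tau>
      by (auto simp: emeasure_restrict_space intro!: sets_restrict_space_cong)
    fix \<sigma> assume \<sigma>: "is_riemannian_volume ?M \<sigma>"
    show "\<sigma> = restrict_space \<tau> ?M"
    proof (rule measure_eqI)
      show s: "sets \<sigma> = sets (restrict_space \<tau> ?M)"
        using \<sigma> sets_restrict_space_cong[OF sets_\<tau>, of ?M] unfolding iff by simp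
      fix A assume "A \<in> sets \<sigma>"
      then have "A \<in> sets borel" "A \<subseteq> ?M"
        using M_borel sets_\<tau> unfolding s by (auto simp: sets_restrict_space_iff)
      then show "emeasure \<sigma> A = emeasure (restrict_space \<tau> ?M) A"
        using \<sigma> M_borel sets_\<tau> unfolding iff by (simp add: emeasure_restrict_space)
    qed
  qed
qed

subsection \<open>The divergence theorem on smooth domains\<close>

locale smooth_domain =
  fixes \<Omega> :: "(real ^ 'n) set"
  assumes open_domain: "open \<Omega>" and bounded_domain: "bounded \<Omega>" and smooth: "smooth_boundary \<Omega>"
begin

abbreviation "M \<equiv> frontier \<Omega>"
abbreviation "\<sigma> \<equiv> surface_measure M"

lemma is_riemannian_volume_surface_measure: "is_riemannian_volume M \<sigma>"
  unfolding surface_measure_def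
  by (rule theI', rule surface_measure_exists_unique) (fact open_domain bounded_domain smooth)+

lemma compact_boundary: "compact M"
  by (rule compact_frontier_bounded[OF bounded_domain])

lemma boundary_borel [measurable]: "M \<in> sets borel"
  by (intro borel_closed frontier_closed)

lemma sets_surface_measure: "sets \<sigma> = sets (restrict_space borel M)"
  using is_riemannian_volume_surface_measure by (simp add: is_riemannian_volume_def)

lemma space_surface_measure [simp]: "space \<sigma> = M"
  using sets_eq_imp_space_eq[OF sets_surface_measure] by (simp add: space_restrict_space)

lemma in_sets_surface_measure: "A \<in> sets \<sigma> \<longleftrightarrow> A \<in> sets borel \<and> A \<subseteq> M"
  unfolding sets_surface_measure by (subst sets_restrict_space_iff) auto

lemma borel_measurable_surface_measure:
  "f \<in> borel_measurable borel \<Longrightarrow> f \<in> borel_measurable \<sigma>"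
  unfolding measurable_cong_sets[OF sets_surface_measure refl] by (rule measurable_restrict_space1)

lemma emeasure_surface_measure:
  assumes p: "graph_patch M W k \<gamma>" and A: "A \<in> sets borel" "A \<subseteq> M \<inter> W"
  shows "emeasure \<sigma> A = emeasure (graph_measure k \<gamma>) A"
proof -
  have "graph_function k \<gamma>"
    using p smooth_graph_functionD(1) unfolding graph_patch_def by blast
  then show ?thesis
    using is_riemannian_volume_surface_measure p A emeasure_graph_measure
    unfolding is_riemannian_volume_def by metis
qed

lemma finite_surface_measure: "finite_measure \<sigma>"
proof
  obtain m W D k \<gamma> where patch: "\<And>j. j < m \<Longrightarrow> graph_patch M (W j) (k j) (\<gamma> j)"
    and D: "\<And>j. j < m \<Longrightarrow> D j \<subseteq> M \<inter> W j" "\<And>j. D j \<in> sets borel" "disjoint_family_on D {..<m :: nat}"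
    and M: "M = (\<Union>j<m. D j)"
    by (rule smooth_boundary_finite_atlas[OF open_domain bounded_domain smooth]) (rule that; assumption)
  have "emeasure \<sigma> M = (\<Sum>j<m. emeasure \<sigma> (M \<inter> D j))"
  proof (rule emeasure_atlas[OF D(3)])
    show "M \<inter> D j \<in> sets \<sigma>" for j
      using sets.Int[OF boundary_borel D(2)] unfolding in_sets_surface_measure by blast
    show "M \<subseteq> (\<Union>j<m. D j)"
      using M by (rule equalityD1)
  qed
  also have "\<dots> < \<infinity>"
    unfolding infinity_ennreal_def
  proof (subst ennreal_sum_less_top, simp, intro ballI)
    fix j assume "j \<in> {..<m}"
    then have j: "j < m" by simp
    have g: "graph_function (k j) (\<gamma> j)"
      using patch[OF j] smooth_graph_functionD(1) unfolding graph_patch_def by blast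
    have "bounded (M \<inter> D j)"
      using compact_imp_bounded[OF compact_boundary] by (simp add: bounded_Int)
    then have "emeasure (graph_measure (k j) (\<gamma> j)) (M \<inter> D j) < \<infinity>"
      by (rule emeasure_graph_measure_bounded[OF g])
    moreover have "emeasure \<sigma> (M \<inter> D j) = emeasure (graph_measure (k j) (\<gamma> j)) (M \<inter> D j)"
      using D(1)[OF j] D(2) by (intro emeasure_surface_measure[OF patch[OF j]]) auto
    ultimately show "emeasure \<sigma> (M \<inter> D j) < top" by simp
  qed
  finally show "emeasure \<sigma> (space \<sigma>) \<noteq> \<infinity>" by simp
qed

lemma integrable_surface_measure:
  fixes f :: "real ^ 'n \<Rightarrow> real"
  assumes "continuous_on M f"
  shows "integrable \<sigma> f"
proof -
  interpret finite_measure \<sigma> by (rule finite_surface_measure)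
  have "compact (f ` M)"
    by (rule compact_continuous_image[OF assms compact_boundary])
  from compact_imp_bounded[OF this] obtain B where B: "\<And>x. x \<in> M \<Longrightarrow> norm (f x) \<le> B"
    unfolding bounded_iff by (metis imageI)
  have "f \<in> borel_measurable \<sigma>"
    unfolding measurable_cong_sets[OF sets_surface_measure refl]
    by (rule borel_measurable_continuous_on_restrict[OF assms])
  with B show ?thesis
    by (intro integrable_const_bound[where B = B] AE_I2) auto
qed

lemma integral_surface_measure_patch:
  fixes f :: "real ^ 'n \<Rightarrow> real"
  assumes p: "graph_patch M W k \<gamma>" and f [measurable]: "f \<in> borel_measurable borel" and f0: "\<And>x. x \<notin> W \<Longrightarrow> f x = 0"
  shows "(LINT x|\<sigma>. f x) = (LINT x|graph_measure k \<gamma>. f x)"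
proof -
  let ?S = "M \<inter> W"
  have \<gamma>: "graph_function k \<gamma>" and W: "open W" and MW: "M \<inter> W = {x \<in> W. x $ k = \<gamma> x}"
    using p smooth_graph_functionD(1) unfolding graph_patch_def by blast+
  have inv: "\<And>x t. \<gamma> (x + t *\<^sub>R axis k 1) = \<gamma> x"
    using \<gamma> by (auto simp: graph_function_def)
  have S [measurable]: "?S \<in> sets borel"
    using W by auto
  have S\<sigma>: "?S \<in> sets \<sigma>"
    using S in_sets_surface_measure by auto
  have Int_M: "?S \<inter> space \<sigma> \<in> sets \<sigma>"
    using S\<sigma> by (metis Int_absorb2 inf_le1 space_surface_measure)
  have eq: "restrict_space \<sigma> ?S = restrict_space (graph_measure k \<gamma>) ?S"
  proof (rule measure_eqI)
    show s: "sets (restrict_space \<sigma> ?S) = sets (restrict_space (graph_measure k \<gamma>) ?S)"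
      using S S\<sigma> by (auto simp: sets_restrict_space_iff in_sets_surface_measure)
    fix A assume "A \<in> sets (restrict_space \<sigma> ?S)"
    then have A: "A \<in> sets borel" "A \<subseteq> M \<inter> W"
      using S\<sigma> by (auto simp: sets_restrict_space_iff in_sets_surface_measure)
    have "emeasure (restrict_space \<sigma> ?S) A = emeasure \<sigma> A"
      by (rule emeasure_restrict_space[OF Int_M A(2)])
    moreover have "emeasure (restrict_space (graph_measure k \<gamma>) ?S) A = emeasure (graph_measure k \<gamma>) A"
      by (rule emeasure_restrict_space[OF _ A(2)]) (use S in auto)
    ultimately show "emeasure (restrict_space \<sigma> ?S) A = emeasure (restrict_space (graph_measure k \<gamma>) ?S) A"
      using emeasure_surface_measure[OF p A] by simp
  qed
  have "(LINT x|\<sigma>. f x) = (LINT x|\<sigma>. indicator ?S x *\<^sub>R f x)"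
    using f0 by (intro Bochner_Integration.integral_cong) (auto simp: indicator_def)
  also have "\<dots> = (LINT x|restrict_space \<sigma> ?S. f x)"
    by (rule integral_restrict_space[OF Int_M, symmetric])
  also have "\<dots> = (LINT x|graph_measure k \<gamma>. indicator ?S x *\<^sub>R f x)"
    unfolding eq by (intro integral_restrict_space) auto
  also have "\<dots> = (LINT x|graph_measure k \<gamma>. f x)"
  proof (rule integral_cong_AE)
    note [measurable] = graph_function_borel[OF \<gamma>]
    have "AE x in graph_measure k \<gamma>. x $ k = \<gamma> x"
      unfolding graph_measure_def using AE_hyperplane_lborel[of k]
      by (subst AE_distr_iff) (auto simp: AE_density inv)
    then show "AE x in graph_measure k \<gamma>. indicator ?S x *\<^sub>R f x = f x"
    proof eventually_elim
      fix x assume x: "x $ k = \<gamma> x"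
      show "indicator ?S x *\<^sub>R f x = f x"
      proof (cases "x \<in> W")
        case True
        then have "x \<in> M \<inter> W" unfolding MW using x by simp
        then show ?thesis by simp
      qed (simp add: f0)
    qed
  qed auto
  finally show ?thesis .
qed

end

lemma divergence_cong_open:
  assumes "open S" "x \<in> S" "\<And>y. y \<in> S \<Longrightarrow> F y = G y"
  shows "divergence F x = divergence G x"
  unfolding divergence_def using assms by (intro sum.cong refl arg_cong[of _ _ "\<lambda>v. v $ _"] grad_cong_open[of S]) auto

lemma divergence_sum:
  assumes "\<And>c. c \<in> C \<Longrightarrow> C1_field (F c)"
  shows "divergence (\<lambda>x. \<Sum>c\<in>C. F c x) x = (\<Sum>c\<in>C. divergence (F c) x)"
proof -
  have "grad (\<lambda>x. (\<Sum>c\<in>C. F c x) $ i) x = (\<Sum>c\<in>C. grad (\<lambda>x. F c x $ i) x)" for i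
    unfolding sum_component using assms by (intro grad_sum) (simp add: C1_field_def)
  then show ?thesis
    unfolding divergence_def by (simp add: sum_component sum.swap[of _ UNIV C])
qed

lemma C1_partition_of_unity:
  fixes K :: "(real ^ 'n) set"
  assumes K: "compact K" and r: "\<And>x. x \<in> K \<Longrightarrow> r x > 0"
  obtains C w where "finite C" "C \<subseteq> K" "\<And>c. C1 (w c)" "\<And>c x. w c x \<ge> 0"
    "\<And>c x. x \<notin> cball c (r c / 2) \<Longrightarrow> w c x = 0" "\<And>x. x \<in> K \<Longrightarrow> (\<Sum>c\<in>C. w c x) = 1"
proof -
  obtain C where C: "C \<subseteq> K" "finite C" "K \<subseteq> (\<Union>c\<in>C. ball c (r c / 2))"
  proof (rule compactE_image[of K K "\<lambda>x. ball x (r x / 2)"])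
    show "K \<subseteq> (\<Union>c\<in>K. ball c (r c / 2))"
      using r by force
  qed (use K in auto)
  define b where "b c x = (if r c > 0 then (max 0 ((r c / 2)\<^sup>2 - (\<Sum>i\<in>UNIV. (x $ i - c $ i)\<^sup>2)))\<^sup>2 else 0)" for c x :: "real ^ 'n"
  have b: "C1 (b c)" for c
  proof -
    have "C1 (\<lambda>x. (r c / 2)\<^sup>2 - (\<Sum>i\<in>UNIV. (x $ i - c $ i)\<^sup>2))"
      by (intro C1_diff C1_sum C1_power C1_component C1_const)
    from C1_max_0_power2[OF this] show ?thesis
      unfolding b_def[abs_def] by (cases "r c > 0") simp_all
  qed
  have b0: "b c x \<ge> 0" for c x
    by (simp add: b_def)
  have norm_eq: "(\<Sum>i\<in>UNIV. (x $ i - c $ i)\<^sup>2) = (dist c x)\<^sup>2" for c x :: "real ^ 'n"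
    unfolding dist_norm norm_minus_commute[of c x] power2_norm_eq_inner
    by (simp add: inner_vec_def power2_eq_square)
  have b_out: "b c x = 0" if "x \<notin> cball c (r c / 2)" for c x
  proof -
    have "(r c / 2)\<^sup>2 \<le> (dist c x)\<^sup>2" if "r c > 0"
      using \<open>x \<notin> _\<close> that by (intro power_mono) auto
    then show ?thesis
      by (auto simp: b_def norm_eq)
  qed
  have b_pos: "b c x > 0" if "x \<in> ball c (r c / 2)" for c x
  proof -
    have "dist c x < r c / 2" using that by simp
    then have "(dist c x)\<^sup>2 < (r c / 2)\<^sup>2"
      by (intro power_strict_mono) simp_all
    moreover have "r c > 0"
      using \<open>dist c x < r c / 2\<close> zero_le_dist[of c x] by linarith
    ultimately have "r c > 0" "max 0 ((r c / 2)\<^sup>2 - (dist c x)\<^sup>2) > 0"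
      by auto
    then show ?thesis
      unfolding b_def norm_eq by (simp only: if_True zero_less_power)
  qed
  define B where "B x = (\<Sum>c\<in>C. b c x)" for x
  have B: "C1 B" and B0: "\<And>x. B x \<ge> 0"
    unfolding B_def[abs_def] by (auto intro: C1_sum b sum_nonneg b0)
  have B_pos: "B x > 0" if "x \<in> K" for x
  proof -
    from that C(3) obtain c where "c \<in> C" "x \<in> ball c (r c / 2)" by blast
    then show ?thesis
      unfolding B_def using b_pos b0 C(2) by (intro sum_pos2[of C c]) auto
  qed
  obtain m where m: "m > 0" "\<And>x. x \<in> K \<Longrightarrow> m \<le> B x"
  proof (cases "K = {}")
    case False
    then obtain x where "x \<in> K" "\<forall>y\<in>K. B x \<le> B y"
      using continuous_attains_inf[OF K False continuous_on_subset[OF C1_continuous[OF B] subset_UNIV]] by blast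
    then show ?thesis
      using that[of "B x"] B_pos by blast
  qed (use that[of 1] in auto)
  define N where "N x = B x + (max 0 (m - B x))\<^sup>2" for x
  have N: "C1 N"
    unfolding N_def[abs_def] by (intro C1_add C1_max_0_power2 C1_diff C1_const B)
  have N_pos: "N x > 0" for x
    using m(1) B0[of x] by (cases "B x > 0") (auto simp: N_def add_pos_nonneg)
  have N_eq: "N x = B x" if "x \<in> K" for x
    using m(2)[OF that] by (simp add: N_def)
  show ?thesis
  proof (rule that[of C "\<lambda>c x. b c x * inverse (N x)"])
    show "C1 (\<lambda>x. b c x * inverse (N x))" for c
      using N_pos by (intro C1_mult b C1_inverse N) (simp add: less_imp_neq[symmetric])
    show "b c x * inverse (N x) \<ge> 0" for c x
      using b0 N_pos[of x] by (simp add: less_imp_le)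
    show "(\<Sum>c\<in>C. b c x * inverse (N x)) = 1" if "x \<in> K" for x
      using B_pos[OF that] by (simp add: N_eq[OF that] sum_distrib_right[symmetric] B_def[symmetric])
  qed (use C b_out in auto)
qed

context smooth_domain
begin

lemma integral_divergence_le:
  assumes F: "C1_field F" and h: "continuous_on UNIV h"
    and le: "\<And>c r k \<gamma> s x. smooth_graph_function k \<gamma> \<Longrightarrow> one_sided \<Omega> (ball c r) k \<gamma> s \<Longrightarrow> x \<in> M \<Longrightarrow> x \<in> ball c r \<Longrightarrow>
       s * (F x \<bullet> graph_normal k \<gamma> x) \<le> h x"
  shows "(LINT x|lborel. indicator \<Omega> x * divergence F x) \<le> (LINT x|\<sigma>. h x)"
proof -
  let ?P = "\<lambda>c r. r > 0 \<and> (ball c r \<subseteq> \<Omega> \<or> (\<exists>k \<gamma> s. smooth_graph_function k \<gamma> \<and> one_sided \<Omega> (ball c r) k \<gamma> s \<and> graph_patch M (ball c r) k \<gamma>))"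
  have "\<exists>r. ?P c r" if "c \<in> closure \<Omega>" for c
  proof (cases "c \<in> \<Omega>")
    case True
    then show ?thesis using open_domain open_contains_ball by blast
  next
    case False
    with that have "c \<in> M" using open_domain by (simp add: frontier_def interior_open)
    then show ?thesis using smooth_boundary_patch[OF open_domain smooth] by metis
  qed
  then obtain r where r: "\<And>c. c \<in> closure \<Omega> \<Longrightarrow> ?P c (r c)" by metis
  have compact: "compact (closure \<Omega>)"
    using bounded_domain by simp
  obtain C w where C: "finite C" "C \<subseteq> closure \<Omega>" and w: "\<And>c. C1 (w c)" "\<And>c x. w c x \<ge> 0"
    "\<And>c x. x \<notin> cball c (r c / 2) \<Longrightarrow> w c x = 0" and sum1: "\<And>x. x \<in> closure \<Omega> \<Longrightarrow> (\<Sum>c\<in>C. w c x) = 1"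
    using C1_partition_of_unity[OF compact, of r] r by metis
  let ?F = "\<lambda>c x. w c x *\<^sub>R F x"
  have Fw: "C1_field (?F c)" for c
    by (intro C1_field_scale w F)
  have Fw0: "\<And>c x. x \<notin> cball c (r c / 2) \<Longrightarrow> ?F c x = 0"
    using w(3) by simp
  have supp: "bounded {x. ?F c x \<noteq> 0}" for c
    by (rule bounded_subset[OF bounded_cball[of c "r c / 2"]]) (use Fw0 in blast)
  have int: "integrable lborel (\<lambda>x. indicator \<Omega> x * divergence (?F c) x)" for c
    using integrable_mult_indicator[OF _ integrable_divergence[OF Fw supp], of \<Omega> c] open_domain by simp
  have cont: "continuous_on A (\<lambda>x. w c x * h x)" for c A
    using continuous_on_subset[OF C1_continuous[OF w(1)]] continuous_on_subset[OF h]
    by (intro continuous_on_mult) auto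
  have *: "(LINT x|lborel. indicator \<Omega> x * divergence (?F c) x) \<le> (LINT x|\<sigma>. w c x * h x)" if "c \<in> C" for c
  proof -
    have "r c > 0" using r that C(2) by blast
    then have sub: "cball c (r c / 2) \<subseteq> ball c (r c)" by auto
    from r that C(2) consider "ball c (r c) \<subseteq> \<Omega>" |
      k \<gamma> s where "smooth_graph_function k \<gamma>" "one_sided \<Omega> (ball c (r c)) k \<gamma> s" "graph_patch M (ball c (r c)) k \<gamma>"
      by blast
    then show ?thesis
    proof cases
      case 1
      have "divergence (?F c) x = 0" if "x \<notin> cball c (r c / 2)" for x
        by (rule divergence_eq_0[OF closed_cball Fw0 that])
      then have **: "indicator \<Omega> x * divergence (?F c) x = divergence (?F c) x" for x
        using subset_trans[OF sub 1] by (cases "x \<in> \<Omega>") (auto simp del: mem_cball)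
      have "(LINT x|lborel. indicator \<Omega> x * divergence (?F c) x) = 0"
        unfolding ** by (simp add: integral_divergence_UNIV[OF Fw supp])
      moreover have "(LINT x|\<sigma>. w c x * h x) = (LINT x|\<sigma>. 0)"
      proof (rule Bochner_Integration.integral_cong)
        fix x assume "x \<in> space \<sigma>"
        then have "x \<in> M" by simp
        then have "x \<notin> \<Omega>" using open_domain by (simp add: frontier_def interior_open)
        then have "w c x = 0" using 1 sub by (intro w(3)) blast
        then show "w c x * h x = 0" by simp
      qed simp
      ultimately show ?thesis by simp
    next
      case 2
      note g = smooth_graph_functionD(1)[OF 2(1)]
      let ?n = "graph_normal k \<gamma>"
      have cn: "continuous_on UNIV (\<lambda>x. ?F c x \<bullet> ?n x)"
        using C1_field_continuous[OF Fw] C1_field_continuous[OF C1_field_graph_normal[OF 2(1)]]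
        by (intro continuous_on_inner)
      have "(LINT x|lborel. indicator \<Omega> x * divergence (?F c) x) = s * (LINT x|graph_measure k \<gamma>. ?F c x \<bullet> ?n x)"
        by (rule integral_divergence_one_sided[OF 2(2) g Fw compact_cball sub Fw0])
      also have "(LINT x|graph_measure k \<gamma>. ?F c x \<bullet> ?n x) = (LINT x|\<sigma>. ?F c x \<bullet> ?n x)"
      proof (rule integral_surface_measure_patch[OF 2(3), symmetric])
        show "(\<lambda>x. ?F c x \<bullet> ?n x) \<in> borel_measurable borel"
          by (rule borel_measurable_continuous_onI[OF cn])
        show "?F c x \<bullet> ?n x = 0" if "x \<notin> ball c (r c)" for x
        proof -
          have "x \<notin> cball c (r c / 2)" using that sub by blast
          then have "?F c x = 0" by (rule Fw0)
          then show ?thesis by (simp only: inner_zero_left)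
        qed
      qed
      also have "s * (LINT x|\<sigma>. ?F c x \<bullet> ?n x) = (LINT x|\<sigma>. s * (?F c x \<bullet> ?n x))"
        by simp
      also have "\<dots> \<le> (LINT x|\<sigma>. w c x * h x)"
      proof (rule integral_mono)
        show "integrable \<sigma> (\<lambda>x. s * (?F c x \<bullet> ?n x))"
          using cn by (intro integrable_mult_right integrable_surface_measure) (auto intro: continuous_on_subset)
        show "integrable \<sigma> (\<lambda>x. w c x * h x)"
          by (intro integrable_surface_measure cont)
        fix x assume x: "x \<in> space \<sigma>"
        show "s * (?F c x \<bullet> ?n x) \<le> w c x * h x"
        proof (cases "x \<in> ball c (r c)")
          case True
          then have "s * (F x \<bullet> ?n x) \<le> h x"
            using le[OF 2(1,2)] x by simp
          from mult_left_mono[OF this w(2)[of c x]] show ?thesis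
            by (simp add: mult_ac)
        next
          case False
          then have "w c x = 0" using sub by (intro w(3)) blast
          then show ?thesis by simp
        qed
      qed
      finally show ?thesis .
    qed
  qed
  have "indicator \<Omega> x * divergence F x = (\<Sum>c\<in>C. indicator \<Omega> x * divergence (?F c) x)" for x
  proof (cases "x \<in> \<Omega>")
    case True
    have "divergence F x = divergence (\<lambda>x. \<Sum>c\<in>C. ?F c x) x"
      using sum1[OF subsetD[OF closure_subset]]
      by (intro divergence_cong_open[OF open_domain True]) (simp add: scaleR_left.sum[symmetric])
    also have "\<dots> = (\<Sum>c\<in>C. divergence (?F c) x)"
      by (rule divergence_sum[OF Fw])
    finally show ?thesis using True by simp
  qed simp
  then have "(LINT x|lborel. indicator \<Omega> x * divergence F x) = (\<Sum>c\<in>C. LINT x|lborel. indicator \<Omega> x * divergence (?F c) x)"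
    using int by (simp add: Bochner_Integration.integral_sum)
  also have "\<dots> \<le> (\<Sum>c\<in>C. LINT x|\<sigma>. w c x * h x)"
    by (intro sum_mono *)
  also have "\<dots> = (LINT x|\<sigma>. (\<Sum>c\<in>C. w c x * h x))"
    by (intro Bochner_Integration.integral_sum[symmetric] integrable_surface_measure cont)
  also have "\<dots> = (LINT x|\<sigma>. h x)"
  proof (rule Bochner_Integration.integral_cong)
    fix x assume "x \<in> space \<sigma>"
    then have "x \<in> M" by simp
    then have "x \<in> closure \<Omega>" by (simp add: frontier_def)
    then show "(\<Sum>c\<in>C. w c x * h x) = h x"
      by (simp add: sum1 sum_distrib_right[symmetric])
  qed simp
  finally show ?thesis .
qed

end

subsection \<open>The Gaussian Poincare inequality\<close>

abbreviation std_normal :: "real measure" where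
  "std_normal \<equiv> density lborel (\<lambda>x. ennreal (std_normal_density x))"

interpretation std_normal: prob_space std_normal
  by (rule prob_space_normal_density) simp

lemma measure_std_normal_UNIV: "measure std_normal UNIV = 1"
  using std_normal.prob_space by simp

lemma integrable_std_normal_iff:
  fixes f :: "real \<Rightarrow> real"
  assumes "f \<in> borel_measurable borel"
  shows "integrable std_normal f \<longleftrightarrow> integrable lborel (\<lambda>x. std_normal_density x * f x)"
  using assms by (subst integrable_density) auto

lemma integral_std_normal:
  fixes f :: "real \<Rightarrow> real"
  assumes "f \<in> borel_measurable borel"
  shows "(LINT x|std_normal. f x) = (LINT x|lborel. std_normal_density x * f x)"
  using assms by (subst integral_density) auto

lemma integrable_std_normal_power: "integrable std_normal (\<lambda>x. x ^ k)"
  using integrable_std_normal_moment[of k] by (simp add: integrable_std_normal_iff)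

lemma integrable_std_normal_abs: "integrable std_normal (\<lambda>x. \<bar>x\<bar>)"
  using integrable_std_normal_moment_abs[of 1] by (simp add: integrable_std_normal_iff)

lemma std_normal_tail_moment:
  "(LINT x|std_normal. indicator {t..} x * x) = std_normal_density t"
proof -
  let ?\<phi> = std_normal_density
  have D: "DERIV (\<lambda>x. - ?\<phi> x) x :> ?\<phi> x * x" for x
    unfolding std_normal_density_def by (auto intro!: derivative_eq_intros simp: field_simps)
  have int: "integrable lborel (\<lambda>x. ?\<phi> x * x)"
    using integrable_std_normal_moment[of 1] by simp
  have FTC: "(LINT x|lborel. indicator {t..t + real n} x *\<^sub>R (?\<phi> x * x)) = - ?\<phi> (t + real n) - (- ?\<phi> t)" for n
    by (rule integral_FTC_atLeastAtMost)
       (use has_field_derivative_at_within[OF D] in \<open>auto simp: std_normal_density_def has_real_derivative_iff_has_vector_derivative[symmetric] intro!: continuous_intros\<close>)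
  have "(\<lambda>n. LINT x|lborel. indicator {t..t + real n} x *\<^sub>R (?\<phi> x * x)) \<longlonglongrightarrow> (LINT x|lborel. indicator {t..} x * (?\<phi> x * x))"
  proof (rule integral_dominated_convergence[where w = "\<lambda>x. \<bar>?\<phi> x * x\<bar>"])
    show "AE x in lborel. (\<lambda>n. indicator {t..t + real n} x *\<^sub>R (?\<phi> x * x)) \<longlonglongrightarrow> indicator {t..} x * (?\<phi> x * x)"
    proof (rule AE_I2)
      fix x
      obtain m where m: "x - t \<le> real m" using real_arch_simple by blast
      have "eventually (\<lambda>n. indicator {t..t + real n} x = (indicator {t..} x :: real)) sequentially"
        using eventually_ge_at_top[of m]
      proof eventually_elim
        case (elim n)
        then have "real m \<le> real n" by simp
        with m show ?case by (auto simp: indicator_def)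
      qed
      then show "(\<lambda>n. indicator {t..t + real n} x *\<^sub>R (?\<phi> x * x)) \<longlonglongrightarrow> indicator {t..} x * (?\<phi> x * x)"
        by (intro tendsto_eventually) (auto elim: eventually_mono)
    qed
    show "AE x in lborel. norm (indicator {t..t + real n} x *\<^sub>R (?\<phi> x * x)) \<le> \<bar>?\<phi> x * x\<bar>" for n
      by (auto simp: indicator_def)
  qed (use int in auto)
  moreover have "(\<lambda>n. - ?\<phi> (t + real n) - (- ?\<phi> t)) \<longlonglongrightarrow> ?\<phi> t"
  proof -
    have "(\<lambda>n. ?\<phi> (t + real n)) \<longlonglongrightarrow> 0"
      unfolding std_normal_density_def by real_asymp
    from tendsto_diff[OF tendsto_minus[OF this] tendsto_const[of "- ?\<phi> t"]] show ?thesis by simp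
  qed
  ultimately have "(LINT x|lborel. indicator {t..} x * (?\<phi> x * x)) = ?\<phi> t"
    unfolding FTC by (rule LIMSEQ_unique)
  then show ?thesis
    by (subst integral_std_normal) (simp_all add: mult_ac)
qed

lemma set_integral_square_le:
  fixes g :: "real \<Rightarrow> real"
  assumes "a < b" and g: "set_integrable lborel {a..b} g" and g2: "set_integrable lborel {a..b} (\<lambda>t. (g t)\<^sup>2)"
  shows "(LINT t:{a..b}|lborel. g t)\<^sup>2 \<le> (b - a) * (LINT t:{a..b}|lborel. (g t)\<^sup>2)"
proof -
  let ?I = "LINT t:{a..b}|lborel. g t" and ?J = "LINT t:{a..b}|lborel. (g t)\<^sup>2"
  define m where "m = ?I / (b - a)"
  have c: "set_integrable lborel {a..b} (\<lambda>t. m\<^sup>2)"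
    by (intro borel_integrable_atLeastAtMost' continuous_intros)
  have g': "set_integrable lborel {a..b} (\<lambda>t. 2 * m * g t)"
    using g by auto
  have "0 \<le> (LINT t:{a..b}|lborel. (g t - m)\<^sup>2)"
    unfolding set_lebesgue_integral_def by (intro integral_nonneg_AE) auto
  also have "(LINT t:{a..b}|lborel. (g t - m)\<^sup>2) = (LINT t:{a..b}|lborel. (g t)\<^sup>2 - 2 * m * g t + m\<^sup>2)"
    by (simp add: power2_diff algebra_simps)
  also have "\<dots> = ?J - 2 * m * ?I + m\<^sup>2 * (b - a)"
    using g2 g' c assms(1) by (simp add: set_integral_add set_integral_diff set_integral_const)
  also have "\<dots> = ?J - ?I\<^sup>2 / (b - a)"
  proof -
    have "m * (b - a) = ?I" using assms(1) by (simp add: m_def)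
    then have "m\<^sup>2 * (b - a) = m * ?I" "?I\<^sup>2 / (b - a) = m * ?I"
      by (simp_all add: power2_eq_square mult.assoc) (simp add: m_def)
    then show ?thesis by simp
  qed
  finally show ?thesis
    using assms(1) by (simp add: field_simps)
qed

lemma integral_std_normal_id: "(LINT x|std_normal. x) = 0"
  using integral_std_normal_moment_odd[of 0] by (subst integral_std_normal) simp_all

lemma measurable_std_normal_density_ennreal: "(\<lambda>x. ennreal (std_normal_density x)) \<in> borel_measurable lborel"
  by simp

lemma AE_std_normal_neq: "AE x in std_normal. x \<noteq> t"
  unfolding AE_density[OF measurable_std_normal_density_ennreal]
  using AE_lborel_singleton[of t] by eventually_elim simp

lemma
  shows has_integral_std_normal_pos_part: "has_bochner_integral std_normal (\<lambda>x. indicator {t..} x * (x - t)) (std_normal_density t - t * measure std_normal {t..})"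
    and has_integral_std_normal_neg_part: "has_bochner_integral std_normal (\<lambda>x. indicator {..t} x * (t - x)) (std_normal_density t + t * measure std_normal {..t})"
proof -
  have ind: "integrable std_normal (\<lambda>x. indicator A x * x)" if "A \<in> sets borel" for A
    using integrable_mult_indicator[OF _ integrable_std_normal_power[of 1], of A] that by simp
  have ind': "integrable std_normal (\<lambda>x. indicator A x :: real)" if "A \<in> sets borel" for A
    using that by (intro integrable_real_indicator) (auto simp: std_normal.emeasure_eq_measure)
  have e1: "indicator {t..} x * (x - t) = indicator {t..} x * x - t * indicator {t..} x" for x :: real
    by (simp add: algebra_simps)
  show "has_bochner_integral std_normal (\<lambda>x. indicator {t..} x * (x - t)) (std_normal_density t - t * measure std_normal {t..})"
    unfolding e1 has_bochner_integral_iff using ind[of "{t..}"] ind'[of "{t..}"] by (simp add: std_normal_tail_moment)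
  have e2: "indicator {..t} x * (t - x) = t * indicator {..t} x - indicator {..t} x * x" for x :: real
    by (simp add: algebra_simps)
  have "(LINT x|std_normal. indicator {..t} x * x) = (LINT x|std_normal. x - indicator {t..} x * x)"
  proof (rule integral_cong_AE)
    show "AE x in std_normal. indicator {..t} x * x = x - indicator {t..} x * x"
      using AE_std_normal_neq[of t] by eventually_elim (auto simp: indicator_def)
  qed auto
  also have "\<dots> = - std_normal_density t"
    using ind[of "{t..}"] integrable_std_normal_power[of 1]
    by (simp add: std_normal_tail_moment integral_std_normal_id)
  finally show "has_bochner_integral std_normal (\<lambda>x. indicator {..t} x * (t - x)) (std_normal_density t + t * measure std_normal {..t})"
    unfolding e2 has_bochner_integral_iff using ind[of "{..t}"] ind'[of "{..t}"] by simp
qed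

lemma nn_integral_std_normal_pos_part:
  "(\<integral>\<^sup>+ x. ennreal (indicator {t..} x * (x - t)) \<partial>std_normal)
     = ennreal (std_normal_density t - t * measure std_normal {t..})"
  "(\<integral>\<^sup>+ x. ennreal (indicator {..t} x * (t - x)) \<partial>std_normal)
     = ennreal (std_normal_density t + t * measure std_normal {..t})"
  and std_normal_pos_part_nonneg:
    "0 \<le> std_normal_density t - t * measure std_normal {t..}"
    "0 \<le> std_normal_density t + t * measure std_normal {..t}"
proof -
  have pos: "indicator {t..} x * (x - t) \<ge> 0" "indicator {..t} x * (t - x) \<ge> 0" for x :: real
    by (auto simp: indicator_def)
  note 1 = has_integral_std_normal_pos_part[of t] and 2 = has_integral_std_normal_neg_part[of t]
  show "(\<integral>\<^sup>+ x. ennreal (indicator {t..} x * (x - t)) \<partial>std_normal)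
     = ennreal (std_normal_density t - t * measure std_normal {t..})"
    "(\<integral>\<^sup>+ x. ennreal (indicator {..t} x * (t - x)) \<partial>std_normal)
     = ennreal (std_normal_density t + t * measure std_normal {..t})"
    using 1 2 pos by (auto simp: has_bochner_integral_iff nn_integral_eq_integral)
  show "0 \<le> std_normal_density t - t * measure std_normal {t..}"
    "0 \<le> std_normal_density t + t * measure std_normal {..t}"
    unfolding has_bochner_integral_integral_eq[OF 1, symmetric] has_bochner_integral_integral_eq[OF 2, symmetric]
    by (intro integral_nonneg_AE AE_I2 pos)+
qed

lemma measure_std_normal_atMost_atLeast: "measure std_normal {..t} + measure std_normal {t..} = 1"
proof -
  have "measure std_normal {..t} = measure std_normal {..<t}"
    by (rule measure_eq_AE) (use AE_std_normal_neq[of t] in \<open>auto elim!: eventually_mono\<close>)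
  moreover have "measure std_normal {..<t} = 1 - measure std_normal {t..}"
    using std_normal.prob_compl[of "{t..}"] by (simp add: Compl_eq_Diff_UNIV[symmetric] Compl_atLeast)
  ultimately show ?thesis by simp
qed

lemma nn_integral_std_normal_chord:
  "(\<integral>\<^sup>+ x. \<integral>\<^sup>+ y. ennreal (indicator {t..} x * indicator {..t} y * (x - y)) \<partial>std_normal \<partial>std_normal)
     = ennreal (std_normal_density t)"
proof -
  let ?N = std_normal and ?a = "measure std_normal {t..}" and ?b = "measure std_normal {..t}"
  have pos: "0 \<le> std_normal_density t - t * ?a" "0 \<le> std_normal_density t + t * ?b"
    by (rule std_normal_pos_part_nonneg)+
  have "(\<integral>\<^sup>+ y. ennreal (indicator {t..} x * indicator {..t} y * (x - y)) \<partial>?N)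
      = ennreal (indicator {t..} x * (x - t)) * ennreal ?b + indicator {t..} x * ennreal (std_normal_density t + t * ?b)" for x
  proof -
    have "ennreal (indicator {t..} x * indicator {..t} y * (x - y))
        = ennreal (indicator {t..} x * (x - t)) * indicator {..t} y + indicator {t..} x * ennreal (indicator {..t} y * (t - y))" for y
      by (auto simp: indicator_def ennreal_plus[symmetric] simp del: ennreal_plus)
    then show ?thesis
      by (simp add: nn_integral_add nn_integral_cmult nn_integral_std_normal_pos_part std_normal.emeasure_eq_measure)
  qed
  then have "(\<integral>\<^sup>+ x. \<integral>\<^sup>+ y. ennreal (indicator {t..} x * indicator {..t} y * (x - y)) \<partial>?N \<partial>?N)
     = (\<integral>\<^sup>+ x. ennreal (indicator {t..} x * (x - t)) * ennreal ?b + indicator {t..} x * ennreal (std_normal_density t + t * ?b) \<partial>?N)"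
    by simp
  also have "\<dots> = ennreal (std_normal_density t - t * ?a) * ennreal ?b + ennreal ?a * ennreal (std_normal_density t + t * ?b)"
    by (subst nn_integral_add) (simp_all add: nn_integral_multc nn_integral_std_normal_pos_part std_normal.emeasure_eq_measure)
  also have "\<dots> = ennreal ((std_normal_density t - t * ?a) * ?b + ?a * (std_normal_density t + t * ?b))"
    using pos by (simp add: ennreal_mult ennreal_plus)
  also have "(std_normal_density t - t * ?a) * ?b + ?a * (std_normal_density t + t * ?b) = std_normal_density t * (?b + ?a)"
    by (simp add: algebra_simps)
  finally show ?thesis
    by (simp add: measure_std_normal_atMost_atLeast)
qed

lemma std_normal_poincare:
  fixes f g :: "real \<Rightarrow> real"
  assumes f [measurable]: "f \<in> borel_measurable borel" and g [measurable]: "g \<in> borel_measurable borel"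
    and g0: "\<And>t. 0 \<le> g t" and gK: "\<And>t. g t \<le> K"
    and fg: "\<And>a b. a \<le> b \<Longrightarrow> \<bar>f b - f a\<bar> \<le> (LINT t:{a..b}|lborel. g t)"
  shows "integrable std_normal f" "integrable std_normal (\<lambda>x. (f x)\<^sup>2)"
    "(LINT x|std_normal. (f x)\<^sup>2) - (LINT x|std_normal. f x)\<^sup>2 \<le> (LINT x|std_normal. (g x)\<^sup>2)"
proof -
  let ?N = std_normal
  interpret NN: pair_prob_space ?N ?N ..
  interpret NL: pair_sigma_finite ?N lborel ..
  have K: "K \<ge> 0" using g0 gK order_trans by blast
  have set_int: "set_integrable lborel {a..b} (\<lambda>t. g t)" "set_integrable lborel {a..b} (\<lambda>t. (g t)\<^sup>2)" for a b
  proof -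
    have fin: "emeasure lborel {a..b} < \<infinity>"
      by (simp add: emeasure_lborel_Icc_eq)
    show "set_integrable lborel {a..b} (\<lambda>t. g t)"
      unfolding set_integrable_def using g0 gK fin
      by (intro integrableI_bounded_set_indicator[where B = K]) auto
    show "set_integrable lborel {a..b} (\<lambda>t. (g t)\<^sup>2)"
      unfolding set_integrable_def using power_mono[OF gK g0, of _ 2] fin
      by (intro integrableI_bounded_set_indicator[where B = "K\<^sup>2"]) auto
  qed
  have lip: "\<bar>f b - f a\<bar> \<le> K * (b - a)" if "a \<le> b" for a b
  proof -
    have "(LINT t:{a..b}|lborel. g t) \<le> (LINT t:{a..b}|lborel. K)"
      by (intro set_integral_mono set_int gK borel_integrable_atLeastAtMost' continuous_intros)
    then show ?thesis
      using fg[OF that] that by (simp add: set_integral_const mult.commute)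
  qed
  have f_bound: "\<bar>f x\<bar> \<le> \<bar>f 0\<bar> + K * \<bar>x\<bar>" for x
    using lip[of 0 x] lip[of x 0] by (cases "0 \<le> x") (auto simp: abs_if split: if_splits)
  show int_f: "integrable ?N f"
    by (rule Bochner_Integration.integrable_bound[where f = "\<lambda>x. \<bar>f 0\<bar> + K * \<bar>x\<bar>"])
       (use f_bound K integrable_std_normal_abs in auto)
  have f2_bound: "(f x)\<^sup>2 \<le> 2 * (f 0)\<^sup>2 + 2 * K\<^sup>2 * x\<^sup>2" for x
  proof -
    have "(f x)\<^sup>2 \<le> (\<bar>f 0\<bar> + K * \<bar>x\<bar>)\<^sup>2"
      using power_mono[OF f_bound[of x], of 2] by simp
    also have "\<dots> \<le> 2 * (f 0)\<^sup>2 + 2 * (K * \<bar>x\<bar>)\<^sup>2"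
      using sum_squares_bound[of "\<bar>f 0\<bar>" "K * \<bar>x\<bar>"] by (simp add: power2_sum)
    finally show ?thesis by (simp add: power_mult_distrib)
  qed
  show int_f2: "integrable ?N (\<lambda>x. (f x)\<^sup>2)"
    by (rule Bochner_Integration.integrable_bound[where f = "\<lambda>x. 2 * (f 0)\<^sup>2 + 2 * K\<^sup>2 * x\<^sup>2"])
       (use f2_bound integrable_std_normal_power[of 2] in auto)
  have int_g2: "integrable ?N (\<lambda>x. (g x)\<^sup>2)"
    by (rule std_normal.integrable_const_bound[where B = "K\<^sup>2"]) (use power_mono[OF gK g0, of _ 2] in auto)
  define c where "c x y t = indicator {t..} x * indicator {..t} y * (x - y) * (g t)\<^sup>2" for x y t :: real
  have c_alt: "c x y t = (if t \<le> x \<and> y \<le> t then (x - y) * (g t)\<^sup>2 else 0)" for x y t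
    by (auto simp: c_def)
  have chord: "ennreal ((f x - f y)\<^sup>2) \<le> (\<integral>\<^sup>+ t. ennreal (c x y t) \<partial>lborel)" if "y < x" for x y
  proof -
    have "(f x - f y)\<^sup>2 \<le> (LINT t:{y..x}|lborel. g t)\<^sup>2"
      using fg[of y x] that power_mono[of "\<bar>f x - f y\<bar>" _ 2] by simp
    also have "\<dots> \<le> (x - y) * (LINT t:{y..x}|lborel. (g t)\<^sup>2)"
      by (rule set_integral_square_le[OF that set_int])
    also have "\<dots> = (LINT t|lborel. c x y t)"
      unfolding set_lebesgue_integral_def integral_mult_right_zero[symmetric]
      by (intro Bochner_Integration.integral_cong) (auto simp: c_def indicator_def)
    finally have "ennreal ((f x - f y)\<^sup>2) \<le> ennreal (LINT t|lborel. c x y t)"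
      by (rule ennreal_leI)
    also have "\<dots> = (\<integral>\<^sup>+ t. ennreal (c x y t) \<partial>lborel)"
    proof (rule nn_integral_eq_integral[symmetric])
      have "integrable lborel (\<lambda>t. (x - y) * (indicator {y..x} t *\<^sub>R (g t)\<^sup>2))"
        using set_int(2)[of y x] by (intro integrable_mult_right) (simp add: set_integrable_def)
      moreover have "c x y = (\<lambda>t. (x - y) * (indicator {y..x} t *\<^sub>R (g t)\<^sup>2))"
        by (auto simp: c_def indicator_def)
      ultimately show "integrable lborel (c x y)"
        by simp
      show "AE t in lborel. 0 \<le> c x y t"
        by (auto simp: c_def indicator_def)
    qed
    finally show ?thesis .
  qed
  have chord': "ennreal ((f x - f y)\<^sup>2) \<le> (\<integral>\<^sup>+ t. ennreal (c x y t) \<partial>lborel) + (\<integral>\<^sup>+ t. ennreal (c y x t) \<partial>lborel)" for x y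
    using chord[of x y] chord[of y x]
    by (cases x y rule: linorder_cases) (auto simp: power2_commute add_increasing add_increasing2)
  have tonelli: "(\<integral>\<^sup>+ x. \<integral>\<^sup>+ y. \<integral>\<^sup>+ t. ennreal (c x y t) \<partial>lborel \<partial>?N \<partial>?N) = (\<integral>\<^sup>+ t. ennreal ((g t)\<^sup>2) \<partial>?N)"
  proof -
    have "(\<integral>\<^sup>+ x. \<integral>\<^sup>+ y. \<integral>\<^sup>+ t. ennreal (c x y t) \<partial>lborel \<partial>?N \<partial>?N)
       = (\<integral>\<^sup>+ x. \<integral>\<^sup>+ t. \<integral>\<^sup>+ y. ennreal (c x y t) \<partial>?N \<partial>lborel \<partial>?N)"
      unfolding c_alt by (intro nn_integral_cong NL.Fubini'[symmetric]) measurable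
    also have "\<dots> = (\<integral>\<^sup>+ t. \<integral>\<^sup>+ x. \<integral>\<^sup>+ y. ennreal (c x y t) \<partial>?N \<partial>?N \<partial>lborel)"
      unfolding c_alt by (intro NL.Fubini'[symmetric]) measurable
    also have "\<dots> = (\<integral>\<^sup>+ t. ennreal ((g t)\<^sup>2) * ennreal (std_normal_density t) \<partial>lborel)"
    proof (rule nn_integral_cong)
      fix t
      have "ennreal (c x y t) = ennreal ((g t)\<^sup>2) * ennreal (indicator {t..} x * indicator {..t} y * (x - y))" for x y
        by (subst ennreal_mult''[symmetric]) (auto simp: c_def indicator_def)
      then show "(\<integral>\<^sup>+ x. \<integral>\<^sup>+ y. ennreal (c x y t) \<partial>?N \<partial>?N) = ennreal ((g t)\<^sup>2) * ennreal (std_normal_density t)"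
        by (simp add: nn_integral_cmult nn_integral_std_normal_chord)
    qed
    also have "\<dots> = (\<integral>\<^sup>+ t. ennreal ((g t)\<^sup>2) \<partial>?N)"
      by (subst nn_integral_density) (simp_all add: mult.commute)
    finally show ?thesis .
  qed
  have G: "(\<integral>\<^sup>+ t. ennreal ((g t)\<^sup>2) \<partial>?N) = ennreal (LINT t|?N. (g t)\<^sup>2)"
    by (intro nn_integral_eq_integral int_g2) auto
  have "(\<integral>\<^sup>+ x. \<integral>\<^sup>+ y. ennreal ((f x - f y)\<^sup>2) \<partial>?N \<partial>?N)
     \<le> (\<integral>\<^sup>+ x. \<integral>\<^sup>+ y. (\<integral>\<^sup>+ t. ennreal (c x y t) \<partial>lborel) + (\<integral>\<^sup>+ t. ennreal (c y x t) \<partial>lborel) \<partial>?N \<partial>?N)"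
    by (intro nn_integral_mono chord')
  also have "\<dots> = (\<integral>\<^sup>+ x. (\<integral>\<^sup>+ y. \<integral>\<^sup>+ t. ennreal (c x y t) \<partial>lborel \<partial>?N) + (\<integral>\<^sup>+ y. \<integral>\<^sup>+ t. ennreal (c y x t) \<partial>lborel \<partial>?N) \<partial>?N)"
    unfolding c_alt by (intro nn_integral_cong nn_integral_add) measurable
  also have "\<dots> = (\<integral>\<^sup>+ x. \<integral>\<^sup>+ y. \<integral>\<^sup>+ t. ennreal (c x y t) \<partial>lborel \<partial>?N \<partial>?N) + (\<integral>\<^sup>+ x. \<integral>\<^sup>+ y. \<integral>\<^sup>+ t. ennreal (c y x t) \<partial>lborel \<partial>?N \<partial>?N)"
    unfolding c_alt by (intro nn_integral_add) measurable
  also have "(\<integral>\<^sup>+ x. \<integral>\<^sup>+ y. \<integral>\<^sup>+ t. ennreal (c y x t) \<partial>lborel \<partial>?N \<partial>?N) = (\<integral>\<^sup>+ x. \<integral>\<^sup>+ y. \<integral>\<^sup>+ t. ennreal (c x y t) \<partial>lborel \<partial>?N \<partial>?N)"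
    unfolding c_alt by (intro NN.Fubini') measurable
  finally have le: "(\<integral>\<^sup>+ x. \<integral>\<^sup>+ y. ennreal ((f x - f y)\<^sup>2) \<partial>?N \<partial>?N) \<le> ennreal (2 * (LINT t|?N. (g t)\<^sup>2))"
    unfolding tonelli G by (simp add: ennreal_plus[symmetric] integral_nonneg_AE del: ennreal_plus)
  let ?m = "LINT y|?N. f y" and ?q = "LINT y|?N. (f y)\<^sup>2"
  have int_d: "integrable ?N (\<lambda>y. (f x - f y)\<^sup>2)" for x
    unfolding power2_diff using int_f int_f2 by auto
  have Ld: "(LINT y|?N. (f x - f y)\<^sup>2) = (f x)\<^sup>2 - 2 * f x * ?m + ?q" for x
    unfolding power2_diff using int_f int_f2 by (simp add: measure_std_normal_UNIV algebra_simps)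
  have inner: "(\<integral>\<^sup>+ y. ennreal ((f x - f y)\<^sup>2) \<partial>?N) = ennreal ((f x)\<^sup>2 - 2 * f x * ?m + ?q)" for x
    by (subst nn_integral_eq_integral[OF int_d]) (simp_all add: Ld)
  have nonneg: "0 \<le> (f x)\<^sup>2 - 2 * f x * ?m + ?q" for x
    unfolding Ld[symmetric] by (intro integral_nonneg_AE) auto
  have "(\<integral>\<^sup>+ x. \<integral>\<^sup>+ y. ennreal ((f x - f y)\<^sup>2) \<partial>?N \<partial>?N) = ennreal (LINT x|?N. (f x)\<^sup>2 - 2 * f x * ?m + ?q)"
    unfolding inner using int_f int_f2 nonneg by (intro nn_integral_eq_integral) auto
  also have "(LINT x|?N. (f x)\<^sup>2 - 2 * f x * ?m + ?q) = 2 * (?q - ?m\<^sup>2)"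
    using int_f int_f2 by (simp add: measure_std_normal_UNIV power2_eq_square)
  finally have "ennreal (2 * (?q - ?m\<^sup>2)) \<le> ennreal (2 * (LINT t|?N. (g t)\<^sup>2))"
    using le by simp
  then have "2 * (?q - ?m\<^sup>2) \<le> 2 * (LINT t|?N. (g t)\<^sup>2)"
    by (subst (asm) ennreal_le_iff) (auto intro: integral_nonneg_AE)
  then show "?q - ?m\<^sup>2 \<le> (LINT x|?N. (g x)\<^sup>2)" by simp
qed

abbreviation std_normals :: "'i set \<Rightarrow> ('i \<Rightarrow> real) measure" where
  "std_normals I \<equiv> PiM I (\<lambda>_. std_normal)"

interpretation std_normals: product_prob_space "\<lambda>_ :: 'i. std_normal" I for I :: "'i set"
  by standard

lemma integrable_std_normals_component:
  fixes h :: "real \<Rightarrow> real"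
  assumes "i \<in> I" "integrable std_normal h"
  shows "integrable (std_normals I) (\<lambda>x. h (x i))"
proof -
  have "integrable (distr (std_normals I) std_normal (\<lambda>x. x i)) h"
    using assms(2) by (subst std_normals.PiM_component[OF assms(1)])
  then show ?thesis
    by (rule integrable_distr[OF measurable_component_singleton[OF assms(1)]])
qed

lemma integrable_linear_growth:
  fixes f :: "('i \<Rightarrow> real) \<Rightarrow> real"
  assumes I: "finite I" and f [measurable]: "f \<in> borel_measurable (std_normals I)" and K: "K \<ge> 0"
    and bound: "\<And>x. x \<in> space (std_normals I) \<Longrightarrow> \<bar>f x\<bar> \<le> A + K * (\<Sum>i\<in>I. \<bar>x i\<bar>)"
  shows "integrable (std_normals I) f" "integrable (std_normals I) (\<lambda>x. (f x)\<^sup>2)"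
proof -
  have "integrable (std_normals I) (\<lambda>x. A + K * (\<Sum>i\<in>I. \<bar>x i\<bar>))"
    by (intro Bochner_Integration.integrable_add integrable_mult_right
         Bochner_Integration.integrable_sum integrable_std_normals_component[OF _ integrable_std_normal_abs]) simp_all
  then show "integrable (std_normals I) f"
  proof (rule Bochner_Integration.integrable_bound)
    show "AE x in std_normals I. norm (f x) \<le> norm (A + K * (\<Sum>i\<in>I. \<bar>x i\<bar>))"
      using bound by (intro AE_I2) fastforce
  qed simp
  have "integrable (std_normals I) (\<lambda>x. 2 * A\<^sup>2 + 2 * K\<^sup>2 * ((\<Sum>i\<in>I. (x i)\<^sup>2) * real (card I)))"
    by (intro Bochner_Integration.integrable_add integrable_mult_right integrable_mult_left
         Bochner_Integration.integrable_sum integrable_std_normals_component[OF _ integrable_std_normal_power]) simp_all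
  then show "integrable (std_normals I) (\<lambda>x. (f x)\<^sup>2)"
  proof (rule Bochner_Integration.integrable_bound)
    show "AE x in std_normals I. norm ((f x)\<^sup>2) \<le> norm (2 * A\<^sup>2 + 2 * K\<^sup>2 * ((\<Sum>i\<in>I. (x i)\<^sup>2) * real (card I)))"
    proof (rule AE_I2)
      fix x assume "x \<in> space (std_normals I)"
      let ?S = "\<Sum>i\<in>I. \<bar>x i\<bar>"
      have "(f x)\<^sup>2 \<le> (A + K * ?S)\<^sup>2"
        using power_mono[OF bound[OF \<open>x \<in> _\<close>], of 2] by simp
      also have "\<dots> \<le> 2 * A\<^sup>2 + 2 * (K * ?S)\<^sup>2"
        using sum_squares_bound[of A "K * ?S"] by (simp add: power2_sum)
      also have "(K * ?S)\<^sup>2 \<le> K\<^sup>2 * ((\<Sum>i\<in>I. (x i)\<^sup>2) * real (card I))"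
        using sum_squared_le_sum_of_squares[of "\<lambda>i. \<bar>x i\<bar>" I]
        by (simp add: power_mult_distrib mult_left_mono)
      finally show "norm ((f x)\<^sup>2) \<le> norm (2 * A\<^sup>2 + 2 * K\<^sup>2 * ((\<Sum>i\<in>I. (x i)\<^sup>2) * real (card I)))"
        by simp
    qed
  qed simp
qed

lemma integral_std_normals_insert:
  fixes F :: "('i \<Rightarrow> real) \<Rightarrow> real"
  assumes I: "finite I" "i \<notin> I" and F: "integrable (std_normals (insert i I)) F"
    and pos: "\<And>x. 0 \<le> F x" and sec: "\<And>x. x \<in> space (std_normals I) \<Longrightarrow> integrable std_normal (\<lambda>t. F (x(i := t)))"
  shows "integrable (std_normals I) (\<lambda>x. LINT t|std_normal. F (x(i := t)))"
    and "(LINT x|std_normals (insert i I). F x) = (LINT x|std_normals I. LINT t|std_normal. F (x(i := t)))"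
proof -
  have [measurable]: "F \<in> borel_measurable (std_normals (insert i I))"
    using F by auto
  show "(LINT x|std_normals (insert i I). F x) = (LINT x|std_normals I. LINT t|std_normal. F (x(i := t)))"
    by (rule std_normals.product_integral_insert[OF I F])
  have [measurable]: "(\<lambda>(x, t). F (x(i := t))) \<in> borel_measurable (std_normals I \<Otimes>\<^sub>M std_normal)"
    using measurable_compose[OF measurable_add_dim[of i I "\<lambda>_. std_normal"], of F borel]
    by (simp add: case_prod_unfold)
  show "integrable (std_normals I) (\<lambda>x. LINT t|std_normal. F (x(i := t)))"
  proof (rule integrableI_nonneg)
    show "(\<lambda>x. LINT t|std_normal. F (x(i := t))) \<in> borel_measurable (std_normals I)"
      by (rule std_normal.borel_measurable_lebesgue_integral) simp
    have "(\<integral>\<^sup>+ x. ennreal (LINT t|std_normal. F (x(i := t))) \<partial>std_normals I)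
      = (\<integral>\<^sup>+ x. \<integral>\<^sup>+ t. ennreal (F (x(i := t))) \<partial>std_normal \<partial>std_normals I)"
      using sec pos by (intro nn_integral_cong nn_integral_eq_integral[symmetric]) auto
    also have "\<dots> = (\<integral>\<^sup>+ x. ennreal (F x) \<partial>std_normals (insert i I))"
      by (rule std_normals.product_nn_integral_insert[OF I, symmetric]) simp
    also have "\<dots> < \<infinity>"
      using F pos by (simp add: integrable_iff_bounded)
    finally show "(\<integral>\<^sup>+ x. ennreal (LINT t|std_normal. F (x(i := t))) \<partial>std_normals I) < \<infinity>" .
  qed (use pos in \<open>auto intro: integral_nonneg_AE\<close>)
qed

lemma std_normal_integral_square_le:
  fixes g :: "real \<Rightarrow> real"
  assumes "g \<in> borel_measurable borel" "\<And>t. \<bar>g t\<bar> \<le> K"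
  shows "(LINT t|std_normal. g t)\<^sup>2 \<le> (LINT t|std_normal. (g t)\<^sup>2)"
proof -
  have 1: "integrable std_normal g"
    by (rule std_normal.integrable_const_bound[where B = K]) (use assms in auto)
  have 2: "integrable std_normal (\<lambda>t. (g t)\<^sup>2)"
    by (rule std_normal.integrable_const_bound[where B = "K\<^sup>2"])
       (use assms power_mono[OF assms(2) abs_ge_zero, of _ 2] in auto)
  have "0 \<le> std_normal.variance g"
    by (intro integral_nonneg_AE) auto
  then show ?thesis
    using std_normal.variance_eq[OF 1 2] by simp
qed

lemma std_normals_poincare:
  fixes f :: "('i \<Rightarrow> real) \<Rightarrow> real" and g :: "'i \<Rightarrow> ('i \<Rightarrow> real) \<Rightarrow> real"
  assumes "finite I" "f \<in> borel_measurable (std_normals I)"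
    and "\<And>i. i \<in> I \<Longrightarrow> g i \<in> borel_measurable (std_normals I)"
    and "\<And>i x. 0 \<le> g i x" "\<And>i x. g i x \<le> K"
    and "\<And>x. x \<in> space (std_normals I) \<Longrightarrow> \<bar>f x\<bar> \<le> A + K * (\<Sum>i\<in>I. \<bar>x i\<bar>)"
    and "\<And>i x a b. i \<in> I \<Longrightarrow> x \<in> space (std_normals I) \<Longrightarrow> a \<le> b \<Longrightarrow>
      \<bar>f (x(i := b)) - f (x(i := a))\<bar> \<le> (LINT t:{a..b}|lborel. g i (x(i := t)))"
  shows "(LINT x|std_normals I. (f x)\<^sup>2) - (LINT x|std_normals I. f x)\<^sup>2 \<le> (\<Sum>i\<in>I. LINT x|std_normals I. (g i x)\<^sup>2)"
  using assms
proof (induction I arbitrary: f g A rule: finite_induct)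
  case empty
  have "(LINT x|std_normals {}. h x) = h (\<lambda>_. undefined)" for h :: "('i \<Rightarrow> real) \<Rightarrow> real"
    unfolding PiM_empty by (subst lebesgue_integral_count_space_finite) simp_all
  then show ?case by simp
next
  case (insert i I)
  let ?N = std_normal and ?P = "std_normals I" and ?Q = "std_normals (insert i I)"
  note f [measurable] = insert.prems(1) and g0 = insert.prems(3) and gK = insert.prems(4)
  note g = insert.prems(2) and f_bound = insert.prems(5) and fg = insert.prems(6)
  have K: "K \<ge> 0"
    using g0 gK order_trans by blast
  have upd: "x(i := t) \<in> space ?Q" if "x \<in> space ?P" for x t
    using that by (auto simp: space_PiM PiE_iff extensional_def)
  have comp: "(\<lambda>(x, t). h (x(i := t))) \<in> borel_measurable (?P \<Otimes>\<^sub>M ?N)" if "h \<in> borel_measurable ?Q" for h :: "('i \<Rightarrow> real) \<Rightarrow> real"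
    using measurable_compose[OF measurable_add_dim[of i I "\<lambda>_. std_normal"] that]
    by (simp add: case_prod_unfold)
  have sec: "(\<lambda>t. h (x(i := t))) \<in> borel_measurable borel" if "h \<in> borel_measurable ?Q" "x \<in> space ?P" for h :: "('i \<Rightarrow> real) \<Rightarrow> real" and x
    using measurable_Pair2[OF comp[OF that(1)] that(2)] by simp
  have gi [measurable]: "g i \<in> borel_measurable ?Q"
    using g by simp
  define m where "m x = (LINT t|?N. f (x(i := t)))" for x
  define h where "h j x = (LINT t|?N. g j (x(i := t)))" for j x
  have P1: "integrable ?N (\<lambda>t. f (x(i := t)))" "integrable ?N (\<lambda>t. (f (x(i := t)))\<^sup>2)"
     "(LINT t|?N. (f (x(i := t)))\<^sup>2) - (m x)\<^sup>2 \<le> (LINT t|?N. (g i (x(i := t)))\<^sup>2)" if x: "x \<in> space ?P" for x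
  proof -
    have "\<bar>f (x(i := b)) - f (x(i := a))\<bar> \<le> (LINT t:{a..b}|lborel. g i (x(i := t)))" if "a \<le> b" for a b
      using fg[OF insertI1 upd[OF x] that, of 0] unfolding fun_upd_upd .
    from std_normal_poincare[of "\<lambda>t. f (x(i := t))" "\<lambda>t. g i (x(i := t))", OF sec[OF f x] sec[OF gi x] g0 gK this]
    show "integrable ?N (\<lambda>t. f (x(i := t)))" "integrable ?N (\<lambda>t. (f (x(i := t)))\<^sup>2)"
     "(LINT t|?N. (f (x(i := t)))\<^sup>2) - (m x)\<^sup>2 \<le> (LINT t|?N. (g i (x(i := t)))\<^sup>2)"
      unfolding m_def by auto
  qed
  have m_meas [measurable]: "m \<in> borel_measurable ?P"
    unfolding m_def[abs_def] using comp[OF f] by (rule std_normal.borel_measurable_lebesgue_integral)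
  have m_bound: "\<bar>m x\<bar> \<le> (A + K * (LINT t|?N. \<bar>t\<bar>)) + K * (\<Sum>i\<in>I. \<bar>x i\<bar>)" if x: "x \<in> space ?P" for x
  proof -
    have "\<bar>m x\<bar> \<le> (LINT t|?N. \<bar>f (x(i := t))\<bar>)"
      unfolding m_def by (rule integral_abs_bound)
    also have "\<dots> \<le> (LINT t|?N. A + K * (\<Sum>j\<in>I. \<bar>x j\<bar>) + K * \<bar>t\<bar>)"
    proof (rule integral_mono)
      show "integrable ?N (\<lambda>t. \<bar>f (x(i := t))\<bar>)"
        using P1(1)[OF x] by simp
      show "integrable ?N (\<lambda>t. A + K * (\<Sum>j\<in>I. \<bar>x j\<bar>) + K * \<bar>t\<bar>)"
        using integrable_std_normal_abs by simp
      show "\<bar>f (x(i := t))\<bar> \<le> A + K * (\<Sum>j\<in>I. \<bar>x j\<bar>) + K * \<bar>t\<bar>" for t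
      proof -
        have "(\<Sum>j\<in>I. \<bar>(x(i := t)) j\<bar>) = (\<Sum>j\<in>I. \<bar>x j\<bar>)"
          using insert.hyps(2) by (intro sum.cong) auto
        then have "(\<Sum>j\<in>insert i I. \<bar>(x(i := t)) j\<bar>) = \<bar>t\<bar> + (\<Sum>j\<in>I. \<bar>x j\<bar>)"
          unfolding sum.insert[OF insert.hyps] by (simp only: fun_upd_same)
        then show ?thesis
          using f_bound[OF upd[OF x], of t] by (simp only: distrib_left add.assoc add.commute[of "K * \<bar>t\<bar>"])
      qed
    qed
    also have "\<dots> = (A + K * (LINT t|?N. \<bar>t\<bar>)) + K * (\<Sum>i\<in>I. \<bar>x i\<bar>)"
      using integrable_std_normal_abs by (simp add: measure_std_normal_UNIV)
    finally show ?thesis .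
  qed
  have h_bounds: "0 \<le> h j x" "h j x \<le> K" for j x
  proof -
    show "0 \<le> h j x"
      unfolding h_def using g0 by (intro integral_nonneg_AE) auto
    show "h j x \<le> K"
    proof (cases "integrable ?N (\<lambda>t. g j (x(i := t)))")
      case True
      have "h j x \<le> (LINT t|?N. K)"
        unfolding h_def using gK by (intro integral_mono True) auto
      then show ?thesis by (simp add: measure_std_normal_UNIV)
    qed (simp add: h_def not_integrable_integral_eq K)
  qed
  have h_meas: "h j \<in> borel_measurable ?P" if "j \<in> I" for j
    unfolding h_def[abs_def] by (rule std_normal.borel_measurable_lebesgue_integral[OF comp[OF g[OF insertI2[OF that]]]])
  have mh: "\<bar>m (x(j := b)) - m (x(j := a))\<bar> \<le> (LINT s:{a..b}|lborel. h j (x(j := s)))"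
    if j: "j \<in> I" and x: "x \<in> space ?P" and ab: "a \<le> b" for j x a b
  proof -
    have ji: "j \<noteq> i" using j insert.hyps by auto
    have xj: "x(j := s) \<in> space ?P" for s
      using x j by (auto simp: space_PiM PiE_iff extensional_def)
    let ?G = "\<lambda>t s. indicator {a..b} s * g j (x(i := t, j := s))"
    interpret NL: pair_sigma_finite ?N lborel ..
    have "(\<lambda>z. x(i := fst z, j := snd z)) \<in> ?N \<Otimes>\<^sub>M lborel \<rightarrow>\<^sub>M ?Q"
    proof (rule measurable_PiM_single')
      show "(\<lambda>z. (x(i := fst z, j := snd z)) l) \<in> ?N \<Otimes>\<^sub>M lborel \<rightarrow>\<^sub>M std_normal" if "l \<in> insert i I" for l
        by (cases "l = i"; cases "l = j") auto
      show "(\<lambda>z. x(i := fst z, j := snd z)) \<in> space (?N \<Otimes>\<^sub>M lborel) \<rightarrow> insert i I \<rightarrow>\<^sub>E space std_normal"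
        using x j by (auto simp: space_PiM PiE_iff extensional_def)
    qed
    from measurable_compose[OF this g[OF insertI2[OF j]]]
    have meas [measurable]: "(\<lambda>z. g j (x(i := fst z, j := snd z))) \<in> borel_measurable (?N \<Otimes>\<^sub>M lborel)" .
    have intG: "integrable (?N \<Otimes>\<^sub>M lborel) (\<lambda>(t, s). ?G t s)"
    proof (rule integrableI_bounded_set[where A = "UNIV \<times> {a..b}" and B = K])
      show "emeasure (?N \<Otimes>\<^sub>M lborel) (UNIV \<times> {a..b}) < \<infinity>"
        using std_normal.emeasure_space_1 by (subst lborel.emeasure_pair_measure_Times) (auto simp: emeasure_lborel_Icc_eq)
    qed (use g0 gK K in \<open>auto simp: case_prod_unfold indicator_def\<close>)
    have fdiff: "\<bar>f (x(j := b, i := t)) - f (x(j := a, i := t))\<bar> \<le> (LINT s|lborel. ?G t s)" for t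
      using fg[OF insertI2[OF j] upd[OF x] ab, of t]
      unfolding set_lebesgue_integral_def real_scaleR_def fun_upd_twist[OF ji] .
    have "\<bar>m (x(j := b)) - m (x(j := a))\<bar> = \<bar>LINT t|?N. f (x(j := b, i := t)) - f (x(j := a, i := t))\<bar>"
      unfolding m_def using P1(1)[OF xj] by simp
    also have "\<dots> \<le> (LINT t|?N. \<bar>f (x(j := b, i := t)) - f (x(j := a, i := t))\<bar>)"
      by (rule integral_abs_bound)
    also have "\<dots> \<le> (LINT t|?N. LINT s|lborel. ?G t s)"
      using P1(1)[OF xj] NL.integrable_fst[OF intG] fdiff by (intro integral_mono) auto
    also have "\<dots> = (LINT s|lborel. LINT t|?N. ?G t s)"
      by (rule NL.Fubini_integral[OF intG, symmetric])
    also have "\<dots> = (LINT s:{a..b}|lborel. h j (x(j := s)))"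
      unfolding set_lebesgue_integral_def h_def fun_upd_twist[OF ji] by simp
    finally show ?thesis .
  qed
  have IH: "(LINT x|?P. (m x)\<^sup>2) - (LINT x|?P. m x)\<^sup>2 \<le> (\<Sum>j\<in>I. LINT x|?P. (h j x)\<^sup>2)"
    by (rule insert.IH[OF m_meas h_meas h_bounds m_bound mh])
  have fin: "finite (insert i I)" using insert.hyps by simp
  have int_f: "integrable ?Q f" "integrable ?Q (\<lambda>x. (f x)\<^sup>2)"
    by (rule integrable_linear_growth[OF fin f K f_bound]; assumption)+
  have int_m: "integrable ?P m" "integrable ?P (\<lambda>x. (m x)\<^sup>2)"
    by (rule integrable_linear_growth[OF insert.hyps(1) m_meas K m_bound]; assumption)+
  have F2: "integrable ?P (\<lambda>x. LINT t|?N. (f (x(i := t)))\<^sup>2)"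
    "(LINT x|?Q. (f x)\<^sup>2) = (LINT x|?P. LINT t|?N. (f (x(i := t)))\<^sup>2)"
    by (rule integral_std_normals_insert[OF insert.hyps int_f(2) zero_le_power2 P1(2)]; assumption)+
  have F1: "(LINT x|?Q. f x) = (LINT x|?P. m x)"
    unfolding m_def by (rule std_normals.product_integral_insert[OF insert.hyps int_f(1)])
  have g2_le: "(g j x)\<^sup>2 \<le> K\<^sup>2" for j x
    by (rule power_mono[OF gK g0])
  have int_g2: "integrable ?Q (\<lambda>x. (g j x)\<^sup>2)" if "j \<in> insert i I" for j
    using g[OF that] g2_le by (intro std_normals.integrable_const_bound[where B = "K\<^sup>2"]) auto
  have int_g2_sec: "integrable ?N (\<lambda>t. (g j (x(i := t)))\<^sup>2)" if "j \<in> insert i I" "x \<in> space ?P" for j x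
  proof (rule std_normal.integrable_const_bound[where B = "K\<^sup>2"])
    show "AE t in ?N. norm ((g j (x(i := t)))\<^sup>2) \<le> K\<^sup>2"
      by (intro AE_I2) (simp only: real_norm_def abs_power2 g2_le)
    have s: "sets ?N = sets borel" by simp
    show "(\<lambda>t. (g j (x(i := t)))\<^sup>2) \<in> borel_measurable ?N"
      unfolding measurable_cong_sets[OF s refl] by (intro borel_measurable_power sec[OF g[OF that(1)] that(2)])
  qed
  have G2: "integrable ?P (\<lambda>x. LINT t|?N. (g j (x(i := t)))\<^sup>2)"
    "(LINT x|?Q. (g j x)\<^sup>2) = (LINT x|?P. LINT t|?N. (g j (x(i := t)))\<^sup>2)" if "j \<in> insert i I" for j
    by (rule integral_std_normals_insert[OF insert.hyps int_g2[OF that] zero_le_power2 int_g2_sec[OF that]]; assumption)+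
  have "(LINT x|?Q. (f x)\<^sup>2) - (LINT x|?Q. f x)\<^sup>2
     = (LINT x|?P. (LINT t|?N. (f (x(i := t)))\<^sup>2) - (m x)\<^sup>2) + ((LINT x|?P. (m x)\<^sup>2) - (LINT x|?P. m x)\<^sup>2)"
    unfolding F1 F2(2) Bochner_Integration.integral_diff[OF F2(1) int_m(2)] by simp
  also have "\<dots> \<le> (LINT x|?P. LINT t|?N. (g i (x(i := t)))\<^sup>2) + (\<Sum>j\<in>I. LINT x|?P. LINT t|?N. (g j (x(i := t)))\<^sup>2)"
  proof (rule add_mono)
    show "(LINT x|?P. (LINT t|?N. (f (x(i := t)))\<^sup>2) - (m x)\<^sup>2) \<le> (LINT x|?P. LINT t|?N. (g i (x(i := t)))\<^sup>2)"
      by (rule integral_mono[OF Bochner_Integration.integrable_diff[OF F2(1) int_m(2)] G2(1)[OF insertI1] P1(3)])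
    have "(LINT x|?P. (h j x)\<^sup>2) \<le> (LINT x|?P. LINT t|?N. (g j (x(i := t)))\<^sup>2)" if j: "j \<in> I" for j
    proof (rule integral_mono)
      show "integrable ?P (\<lambda>x. (h j x)\<^sup>2)"
        using h_meas[OF j] power_mono[OF h_bounds(2,1), of j _ 2]
        by (intro std_normals.integrable_const_bound[where B = "K\<^sup>2"]) auto
      show "integrable ?P (\<lambda>x. LINT t|?N. (g j (x(i := t)))\<^sup>2)"
        by (rule G2(1)[OF insertI2[OF j]])
      fix x assume x: "x \<in> space ?P"
      show "(h j x)\<^sup>2 \<le> (LINT t|?N. (g j (x(i := t)))\<^sup>2)"
        unfolding h_def
        by (rule std_normal_integral_square_le[OF sec[OF g[OF insertI2[OF j]] x], where K = K])
           (simp only: abs_of_nonneg[OF g0] gK)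
    qed
    with IH show "(LINT x|?P. (m x)\<^sup>2) - (LINT x|?P. m x)\<^sup>2 \<le> (\<Sum>j\<in>I. LINT x|?P. LINT t|?N. (g j (x(i := t)))\<^sup>2)"
      by (rule order_trans[OF _ sum_mono])
  qed
  also have "\<dots> = (\<Sum>j\<in>insert i I. LINT x|?Q. (g j x)\<^sup>2)"
    unfolding sum.insert[OF insert.hyps]
    by (intro arg_cong2[of _ _ _ _ "(+)"] sum.cong refl G2(2)[symmetric]) simp_all
  finally show ?case .
qed

subsection \<open>Polar coordinates for the Gaussian measure\<close>

lemma nn_integral_lborel_scale:
  fixes H :: "'a::euclidean_space \<Rightarrow> ennreal"
  assumes [measurable]: "H \<in> borel_measurable borel" and c: "c > 0"
  shows "(\<integral>\<^sup>+ x. H x \<partial>lborel) = ennreal (c ^ DIM('a)) * (\<integral>\<^sup>+ x. H (c *\<^sub>R x) \<partial>lborel)"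
proof -
  have L: "(lborel :: 'a measure) = density (distr lborel borel (\<lambda>x. c *\<^sub>R x)) (\<lambda>_. \<bar>c\<bar> ^ DIM('a))"
    using lborel_affine[of c "0::'a"] c by simp
  show ?thesis
    using c by (subst L) (simp add: nn_integral_density nn_integral_distr nn_integral_cmult)
qed

lemma nn_integral_polar_scale_real:
  fixes H :: "real \<Rightarrow> ennreal"
  assumes "H \<in> borel_measurable borel" and c: "c > 0"
  shows "(\<integral>\<^sup>+ s. indicator {0<..} s * H s \<partial>lborel) = (\<integral>\<^sup>+ s. indicator {0<..} s * (ennreal c * H (c * s)) \<partial>lborel)"
proof -
  have "(\<integral>\<^sup>+ s. indicator {0<..} s * H s \<partial>lborel) = ennreal c * (\<integral>\<^sup>+ s. indicator {0<..} (c * s) * H (c * s) \<partial>lborel)"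
    using nn_integral_lborel_scale[of "\<lambda>s. indicator {0<..} s * H s" c] assms by simp
  also have "\<dots> = (\<integral>\<^sup>+ s. ennreal c * (indicator {0<..} (c * s) * H (c * s)) \<partial>lborel)"
    using assms by (intro nn_integral_cmult[symmetric]) simp
  also have "\<dots> = (\<integral>\<^sup>+ s. indicator {0<..} s * (ennreal c * H (c * s)) \<partial>lborel)"
    using c by (intro nn_integral_cong) (auto simp: indicator_def zero_less_mult_iff)
  finally show ?thesis .
qed

lemma nn_integral_polar_kernel:
  fixes \<rho> :: "real \<Rightarrow> ennreal"
  assumes \<rho> [measurable]: "\<rho> \<in> borel_measurable borel"
  defines "C \<equiv> (\<integral>\<^sup>+ \<tau>. indicator {0<..} \<tau> * (\<rho> (1 / \<tau>) * ennreal (1 / \<tau> ^ (DIM('a) + 1))) \<partial>lborel)"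
  shows "\<And>g :: 'a::euclidean_space \<Rightarrow> ennreal. g \<in> borel_measurable borel \<Longrightarrow>
    (\<integral>\<^sup>+ x. \<rho> (norm x) * (\<integral>\<^sup>+ s. indicator {0<..} s * (ennreal (s ^ (DIM('a) - 1)) * g (s *\<^sub>R sgn x)) \<partial>lborel) \<partial>lborel)
      = C * (\<integral>\<^sup>+ z. g z \<partial>lborel)"
proof -
  fix g :: "'a \<Rightarrow> ennreal" assume g [measurable]: "g \<in> borel_measurable borel"
  let ?n = "DIM('a)"
  let ?I = "indicator {0<..} :: real \<Rightarrow> ennreal"
  have n: "Suc (?n - 1) = ?n" by simp
  have AE0: "AE x in lborel. x \<noteq> (0 :: 'a)"
    by (rule AE_lborel_singleton)
  have "(\<integral>\<^sup>+ x. \<rho> (norm x) * (\<integral>\<^sup>+ s. ?I s * (ennreal (s ^ (?n - 1)) * g (s *\<^sub>R sgn x)) \<partial>lborel) \<partial>lborel)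
     = (\<integral>\<^sup>+ x. \<integral>\<^sup>+ \<tau>. ?I \<tau> * (\<rho> (norm x) * ennreal (norm x ^ ?n * \<tau> ^ (?n - 1)) * g (\<tau> *\<^sub>R x)) \<partial>lborel \<partial>lborel)"
  proof (intro nn_integral_cong_AE, use AE0 in eventually_elim)
    fix x :: 'a assume x: "x \<noteq> 0"
    have "(\<integral>\<^sup>+ s. ?I s * (ennreal (s ^ (?n - 1)) * g (s *\<^sub>R sgn x)) \<partial>lborel)
        = (\<integral>\<^sup>+ \<tau>. ?I \<tau> * (ennreal (norm x) * (ennreal ((norm x * \<tau>) ^ (?n - 1)) * g ((norm x * \<tau>) *\<^sub>R sgn x))) \<partial>lborel)"
      by (rule nn_integral_polar_scale_real) (use x in simp_all)
    also have "\<dots> = (\<integral>\<^sup>+ \<tau>. ?I \<tau> * (ennreal (norm x ^ ?n * \<tau> ^ (?n - 1)) * g (\<tau> *\<^sub>R x)) \<partial>lborel)"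
    proof (rule nn_integral_cong)
      fix \<tau> :: real
      have "(norm x * \<tau>) *\<^sub>R sgn x = \<tau> *\<^sub>R x"
        using x by (simp add: sgn_div_norm)
      moreover have "ennreal (norm x) * ennreal ((norm x * \<tau>) ^ (?n - 1)) = ennreal (norm x ^ ?n * \<tau> ^ (?n - 1))" if "\<tau> > 0"
      proof -
        have "norm x ^ ?n = norm x * norm x ^ (?n - 1)"
          using power_Suc[of "norm x" "?n - 1"] unfolding n .
        then have "norm x * (norm x * \<tau>) ^ (?n - 1) = norm x ^ ?n * \<tau> ^ (?n - 1)"
          by (simp add: power_mult_distrib)
        moreover have "0 \<le> (norm x * \<tau>) ^ (?n - 1)"
          using that by simp
        ultimately show ?thesis
          using ennreal_mult[of "norm x" "(norm x * \<tau>) ^ (?n - 1)"] by simp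
      qed
      ultimately show "?I \<tau> * (ennreal (norm x) * (ennreal ((norm x * \<tau>) ^ (?n - 1)) * g ((norm x * \<tau>) *\<^sub>R sgn x)))
         = ?I \<tau> * (ennreal (norm x ^ ?n * \<tau> ^ (?n - 1)) * g (\<tau> *\<^sub>R x))"
        by (auto simp: indicator_def mult.assoc[symmetric])
    qed
    finally show "\<rho> (norm x) * (\<integral>\<^sup>+ s. ?I s * (ennreal (s ^ (?n - 1)) * g (s *\<^sub>R sgn x)) \<partial>lborel)
        = (\<integral>\<^sup>+ \<tau>. ?I \<tau> * (\<rho> (norm x) * ennreal (norm x ^ ?n * \<tau> ^ (?n - 1)) * g (\<tau> *\<^sub>R x)) \<partial>lborel)"
      by (simp add: nn_integral_cmult[symmetric] mult_ac)
  qed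
  also have "\<dots> = (\<integral>\<^sup>+ \<tau>. \<integral>\<^sup>+ x. ?I \<tau> * (\<rho> (norm x) * ennreal (norm x ^ ?n * \<tau> ^ (?n - 1)) * g (\<tau> *\<^sub>R x)) \<partial>lborel \<partial>lborel)"
    by (intro lborel_pair.Fubini') measurable
  also have "\<dots> = (\<integral>\<^sup>+ \<tau>. \<integral>\<^sup>+ z. ?I \<tau> * (\<rho> (norm z / \<tau>) * ennreal (norm z ^ ?n / \<tau> ^ (?n + 1))) * g z \<partial>lborel \<partial>lborel)"
  proof (rule nn_integral_cong)
    fix \<tau> :: real
    show "(\<integral>\<^sup>+ x. ?I \<tau> * (\<rho> (norm x) * ennreal (norm x ^ ?n * \<tau> ^ (?n - 1)) * g (\<tau> *\<^sub>R x)) \<partial>lborel)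
      = (\<integral>\<^sup>+ z. ?I \<tau> * (\<rho> (norm z / \<tau>) * ennreal (norm z ^ ?n / \<tau> ^ (?n + 1))) * g z \<partial>lborel)"
    proof (cases "\<tau> > 0")
      case True
      have e: "ennreal (\<tau> ^ ?n) * ennreal ((\<tau> * norm x) ^ ?n / \<tau> ^ (?n + 1)) = ennreal (norm x ^ ?n * \<tau> ^ (?n - 1))" for x :: 'a
      proof -
        have "\<tau> ^ ?n * ((\<tau> * norm x) ^ ?n / \<tau> ^ (?n + 1)) = norm x ^ ?n * (\<tau> ^ ?n / \<tau>)"
          using True by (simp add: power_mult_distrib field_simps)
        also have "\<tau> ^ ?n / \<tau> = \<tau> ^ (?n - 1)"
          using True n by (metis nonzero_mult_div_cancel_left order_less_irrefl power_Suc)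
        finally show ?thesis
          using True by (subst ennreal_mult[symmetric]) simp_all
      qed
      have "(\<integral>\<^sup>+ z. ?I \<tau> * (\<rho> (norm z / \<tau>) * ennreal (norm z ^ ?n / \<tau> ^ (?n + 1))) * g z \<partial>lborel)
        = ennreal (\<tau> ^ ?n) * (\<integral>\<^sup>+ x. ?I \<tau> * (\<rho> (norm (\<tau> *\<^sub>R x) / \<tau>) * ennreal (norm (\<tau> *\<^sub>R x) ^ ?n / \<tau> ^ (?n + 1))) * g (\<tau> *\<^sub>R x) \<partial>lborel)"
        by (rule nn_integral_lborel_scale) (use True in simp_all)
      also have "\<dots> = (\<integral>\<^sup>+ x. ?I \<tau> * (\<rho> (norm x) * (ennreal (\<tau> ^ ?n) * ennreal ((\<tau> * norm x) ^ ?n / \<tau> ^ (?n + 1))) * g (\<tau> *\<^sub>R x)) \<partial>lborel)"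
        using True by (simp add: nn_integral_cmult[symmetric] mult_ac del: power_Suc)
      finally show ?thesis
        unfolding e by simp
    qed simp
  qed
  also have "\<dots> = (\<integral>\<^sup>+ z. \<integral>\<^sup>+ \<tau>. ?I \<tau> * (\<rho> (norm z / \<tau>) * ennreal (norm z ^ ?n / \<tau> ^ (?n + 1))) * g z \<partial>lborel \<partial>lborel)"
    by (intro lborel_pair.Fubini') measurable
  also have "\<dots> = (\<integral>\<^sup>+ z. C * g z \<partial>lborel)"
  proof (intro nn_integral_cong_AE, use AE0 in eventually_elim)
    fix z :: 'a assume z: "z \<noteq> 0"
    have "(\<integral>\<^sup>+ \<tau>. ?I \<tau> * (\<rho> (norm z / \<tau>) * ennreal (norm z ^ ?n / \<tau> ^ (?n + 1))) \<partial>lborel)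
      = (\<integral>\<^sup>+ \<tau>. ?I \<tau> * (ennreal (norm z) * (\<rho> (norm z / (norm z * \<tau>)) * ennreal (norm z ^ ?n / (norm z * \<tau>) ^ (?n + 1)))) \<partial>lborel)"
      by (rule nn_integral_polar_scale_real) (use z in simp_all)
    also have "\<dots> = C"
      unfolding C_def
    proof (rule nn_integral_cong)
      fix \<tau> :: real
      have "ennreal (norm z) * ennreal (norm z ^ ?n / (norm z * \<tau>) ^ (?n + 1)) = ennreal (1 / \<tau> ^ (?n + 1))" if "\<tau> > 0"
        using that z by (subst ennreal_mult[symmetric]) (simp_all add: power_mult_distrib field_simps)
      then show "?I \<tau> * (ennreal (norm z) * (\<rho> (norm z / (norm z * \<tau>)) * ennreal (norm z ^ ?n / (norm z * \<tau>) ^ (?n + 1))))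
        = ?I \<tau> * (\<rho> (1 / \<tau>) * ennreal (1 / \<tau> ^ (?n + 1)))"
      proof (cases "\<tau> > 0")
        case True
        have "norm z / (norm z * \<tau>) = 1 / \<tau>" using z by simp
        then show ?thesis
          using \<open>\<tau> > 0 \<Longrightarrow> _\<close>[OF True] by (simp only: mult.left_commute[of "ennreal (norm z)" "\<rho> _"])
      qed simp
    qed
    finally show "(\<integral>\<^sup>+ \<tau>. ?I \<tau> * (\<rho> (norm z / \<tau>) * ennreal (norm z ^ ?n / \<tau> ^ (?n + 1))) * g z \<partial>lborel) = C * g z"
      by (simp add: nn_integral_multc)
  qed
  also have "\<dots> = C * (\<integral>\<^sup>+ z. g z \<partial>lborel)"
    by (rule nn_integral_cmult) simp
  finally show "(\<integral>\<^sup>+ x. \<rho> (norm x) * (\<integral>\<^sup>+ s. ?I s * (ennreal (s ^ (?n - 1)) * g (s *\<^sub>R sgn x)) \<partial>lborel) \<partial>lborel)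
      = C * (\<integral>\<^sup>+ z. g z \<partial>lborel)" .
qed

definition gauss :: "(real ^ 'n) measure" where
  "gauss = distr (std_normals UNIV) borel (\<lambda>f. \<chi> i. f i)"

lemma sets_gauss [simp, measurable_cong]: "sets gauss = sets borel"
  and space_gauss [simp]: "space gauss = UNIV"
  by (simp_all add: gauss_def)

lemma measurable_vec_lambda_std_normals: "(\<lambda>f. (\<chi> i. f i) :: real ^ 'n) \<in> borel_measurable (std_normals UNIV)"
proof -
  have s: "sets (std_normals UNIV) = sets (\<Pi>\<^sub>M i \<in> (UNIV :: 'n set). lborel :: real measure)"
    by (rule sets_PiM_cong) simp_all
  show ?thesis
    unfolding measurable_cong_sets[OF s refl] by (rule borel_measurable_vec_lambda)
qed

interpretation gauss: prob_space "gauss :: (real ^ 'n) measure"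
  unfolding gauss_def by (rule std_normals.prob_space_distr[OF measurable_vec_lambda_std_normals])

lemma emeasure_gauss_UNIV [simp]: "emeasure (gauss :: (real ^ 'n) measure) UNIV = 1"
  and measure_gauss_UNIV [simp]: "measure (gauss :: (real ^ 'n) measure) UNIV = 1"
  using gauss.emeasure_space_1 gauss.prob_space by simp_all

definition gauss_density :: "real ^ 'n \<Rightarrow> real" where
  "gauss_density x = (1 / sqrt (2 * pi)) ^ CARD('n) * exp (- (norm x)\<^sup>2 / 2)"

lemma prod_std_normal_density: "(\<Prod>i\<in>UNIV. std_normal_density (f i)) = gauss_density (\<chi> i. f i)"
proof -
  have "(norm (\<chi> i. f i))\<^sup>2 = (\<Sum>i\<in>UNIV. (f i)\<^sup>2)"
    unfolding power2_norm_eq_inner by (simp add: inner_vec_def power2_eq_square)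
  moreover have "(\<Prod>i\<in>UNIV. exp (- (f i)\<^sup>2 / 2)) = exp (\<Sum>i\<in>UNIV. - (f i)\<^sup>2 / 2)"
    by (rule exp_sum[symmetric]) simp
  ultimately show ?thesis
    unfolding std_normal_density_def gauss_density_def prod.distrib prod_constant
    by (simp add: sum_negf sum_divide_distrib[symmetric])
qed

lemma std_normals_eq_density:
  "std_normals (UNIV :: 'n::finite set) = density (\<Pi>\<^sub>M i\<in>UNIV. lborel) (\<lambda>f. \<Prod>i\<in>UNIV. ennreal (std_normal_density (f i)))" (is "_ = ?D")
proof (rule std_normals.PiM_eqI[symmetric])
  show "sets ?D = sets (std_normals UNIV)"
    unfolding sets_density by (rule sets_PiM_cong) simp_all
  fix A :: "'n \<Rightarrow> real set"
  assume A: "\<And>i. i \<in> UNIV \<Longrightarrow> A i \<in> sets std_normal"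
  then have A' [measurable]: "A i \<in> sets borel" for i by simp
  have "emeasure ?D (\<Pi>\<^sub>E i\<in>UNIV. A i) = (\<integral>\<^sup>+ f. (\<Prod>i\<in>UNIV. ennreal (std_normal_density (f i))) * indicator (\<Pi>\<^sub>E i\<in>UNIV. A i) f \<partial>(\<Pi>\<^sub>M i\<in>UNIV. lborel))"
    by (rule emeasure_density) (auto intro!: sets_PiM_I_finite)
  also have "\<dots> = (\<integral>\<^sup>+ f. (\<Prod>i\<in>UNIV. ennreal (std_normal_density (f i)) * indicator (A i) (f i)) \<partial>(\<Pi>\<^sub>M i\<in>UNIV. lborel))"
    by (intro nn_integral_cong) (auto simp: prod.distrib indicator_def PiE_iff prod_zero_iff)
  also have "\<dots> = (\<Prod>i\<in>UNIV. \<integral>\<^sup>+ x. ennreal (std_normal_density x) * indicator (A i) x \<partial>lborel)"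
    by (rule lb.product_nn_integral_prod) auto
  also have "\<dots> = (\<Prod>i\<in>UNIV. emeasure std_normal (A i))"
    by (intro prod.cong refl emeasure_density[symmetric]) auto
  finally show "emeasure ?D (\<Pi>\<^sub>E i\<in>UNIV. A i) = (\<Prod>i\<in>UNIV. emeasure std_normal (A i))" .
qed simp

lemma gauss_density_borel [measurable]: "gauss_density \<in> borel_measurable borel"
  unfolding gauss_density_def[abs_def] by measurable

lemma nn_integral_gauss:
  fixes F :: "real ^ 'n \<Rightarrow> ennreal"
  assumes F [measurable]: "F \<in> borel_measurable borel"
  shows "(\<integral>\<^sup>+ x. F x \<partial>gauss) = (\<integral>\<^sup>+ x. ennreal (gauss_density x) * F x \<partial>lborel)"
proof -
  have 1: "(\<lambda>f. F (\<chi> i. f i)) \<in> borel_measurable (\<Pi>\<^sub>M i\<in>UNIV. lborel)"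
    by (rule measurable_compose[OF borel_measurable_vec_lambda F])
  have "(\<integral>\<^sup>+ x. F x \<partial>gauss) = (\<integral>\<^sup>+ f. F (\<chi> i. f i) \<partial>std_normals UNIV)"
    unfolding gauss_def by (rule nn_integral_distr[OF measurable_vec_lambda_std_normals]) simp
  also have "\<dots> = (\<integral>\<^sup>+ f. (\<Prod>i\<in>UNIV. ennreal (std_normal_density (f i))) * F (\<chi> i. f i) \<partial>(\<Pi>\<^sub>M i\<in>UNIV. lborel))"
    unfolding std_normals_eq_density by (rule nn_integral_density) (auto intro: 1)
  also have "\<dots> = (\<integral>\<^sup>+ f. ennreal (gauss_density (\<chi> i. f i)) * F (\<chi> i. f i) \<partial>(\<Pi>\<^sub>M i\<in>UNIV. lborel))"
    by (simp add: prod_ennreal prod_std_normal_density)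
  also have "\<dots> = (\<integral>\<^sup>+ x. ennreal (gauss_density x) * F x \<partial>lborel)"
    by (subst lborel_vec_eq_distr, subst nn_integral_distr[OF borel_measurable_vec_lambda]) simp_all
  finally show ?thesis .
qed

lemma AE_gauss_neq_0: "AE x in (gauss :: (real ^ 'n) measure). x \<noteq> 0"
proof -
  have "emeasure (gauss :: (real ^ 'n) measure) {0} = (\<integral>\<^sup>+ x. indicator {0 :: real ^ 'n} x \<partial>gauss)"
    by (rule nn_integral_indicator[symmetric]) simp
  also have "\<dots> = (\<integral>\<^sup>+ x. ennreal (gauss_density x) * indicator {0 :: real ^ 'n} x \<partial>lborel)"
    by (rule nn_integral_gauss) simp
  also have "\<dots> = (\<integral>\<^sup>+ x. 0 \<partial>(lborel :: (real ^ 'n) measure))"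
    using AE_lborel_singleton[of "0 :: real ^ 'n"] by (intro nn_integral_cong_AE) (auto elim!: eventually_mono)
  finally show ?thesis
    by (intro AE_I[of _ _ "{0}"]) auto
qed

lemma integral_gauss_norm_square:
  "integrable gauss (\<lambda>x :: real ^ 'n. (norm x)\<^sup>2)" "(LINT x|gauss. (norm (x :: real ^ 'n))\<^sup>2) = real CARD('n)"
proof -
  have e: "(norm (\<chi> i. f i :: real ^ 'n))\<^sup>2 = (\<Sum>i\<in>UNIV. (f i)\<^sup>2)" for f
    unfolding power2_norm_eq_inner by (simp add: inner_vec_def power2_eq_square)
  have one: "(LINT f|std_normals UNIV. (f i)\<^sup>2) = 1" for i :: 'n
  proof -
    have "(LINT f|std_normals UNIV. (f i)\<^sup>2) = (LINT x|distr (std_normals UNIV) std_normal (\<lambda>f. f i). x\<^sup>2)"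
      by (rule integral_distr[symmetric]) (auto intro!: measurable_component_singleton)
    also have "\<dots> = (LINT x|std_normal. x\<^sup>2)"
      by (subst std_normals.PiM_component) simp_all
    also have "\<dots> = 1"
      using integral_std_normal_moment_even[of 1] by (subst integral_std_normal) simp_all
    finally show ?thesis .
  qed
  have int: "integrable (std_normals UNIV) (\<lambda>f. (f i)\<^sup>2)" for i :: 'n
    by (rule integrable_std_normals_component[OF _ integrable_std_normal_power]) simp
  show "integrable gauss (\<lambda>x :: real ^ 'n. (norm x)\<^sup>2)"
    unfolding gauss_def by (subst integrable_distr_eq[OF measurable_vec_lambda_std_normals]) (simp_all add: e int)
  show "(LINT x|gauss. (norm (x :: real ^ 'n))\<^sup>2) = real CARD('n)"
    unfolding gauss_def by (subst integral_distr[OF measurable_vec_lambda_std_normals]) (simp_all add: e int one)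
qed

lemma nn_integral_power_01:
  assumes "n \<ge> 1"
  shows "(\<integral>\<^sup>+ s. indicator {0<..} s * (ennreal (s ^ (n - 1)) * (if s < 1 then c else 0)) \<partial>lborel) = ennreal (1 / real n) * c"
proof -
  have "(\<integral>\<^sup>+ s. indicator {0<..} s * (ennreal (s ^ (n - 1)) * (if s < 1 then c else 0)) \<partial>lborel)
    = (\<integral>\<^sup>+ s. (ennreal (s ^ (n - 1)) * indicator {0..1} s) * c \<partial>lborel)"
    using AE_lborel_singleton[of "0::real"] AE_lborel_singleton[of "1::real"]
    by (intro nn_integral_cong_AE, eventually_elim) (auto simp: indicator_def)
  also have "\<dots> = (\<integral>\<^sup>+ s. ennreal (s ^ (n - 1)) * indicator {0..1} s \<partial>lborel) * c"
    by (rule nn_integral_multc) simp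
  also have "(\<integral>\<^sup>+ s. ennreal (s ^ (n - 1)) * indicator {0..1} s \<partial>lborel) = ennreal (1 ^ n / real n - 0 ^ n / real n)"
  proof (rule nn_integral_FTC_Icc)
    show "DERIV (\<lambda>s. s ^ n / real n) s :> s ^ (n - 1)" for s :: real
      using assms by (auto intro!: derivative_eq_intros)
  qed auto
  finally show ?thesis
    using assms by (simp add: power_0_left)
qed

lemma ennreal_mult_eq_imp_eq_divide:
  assumes "C * ennreal b = ennreal a" "b > 0" "a \<ge> 0"
  shows "C = ennreal (a / b)"
proof (cases C)
  case (real c)
  then have "ennreal (c * b) = ennreal a"
    using assms by (simp add: ennreal_mult)
  then have "c * b = a"
    using assms real by simp
  then show ?thesis
    using assms real by (simp add: field_simps)
next
  case top
  then show ?thesis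
    using assms by (simp add: ennreal_top_mult ennreal_eq_0_iff not_le split: if_splits)
qed

lemma sgn_scaleR_sgn:
  fixes x :: "'a::real_normed_vector"
  assumes "s > 0"
  shows "sgn (s *\<^sub>R sgn x) = sgn x"
  using assms by (cases "x = 0") (simp_all add: sgn_scaleR sgn_div_norm field_simps)

lemma polar_gauss:
  obtains C :: real where "C > 0"
    "\<And>g :: real ^ 'n \<Rightarrow> ennreal. g \<in> borel_measurable borel \<Longrightarrow>
      (\<integral>\<^sup>+ x. (\<integral>\<^sup>+ s. indicator {0<..} s * (ennreal (s ^ (CARD('n) - 1)) * g (s *\<^sub>R sgn x)) \<partial>lborel) \<partial>gauss)
        = ennreal C * (\<integral>\<^sup>+ z. g z \<partial>lborel)"
    "\<And>h :: real ^ 'n \<Rightarrow> ennreal. h \<in> borel_measurable borel \<Longrightarrow>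
      (\<integral>\<^sup>+ x. ennreal ((norm x)\<^sup>2) * h (sgn x) \<partial>gauss) = ennreal (real CARD('n)) * (\<integral>\<^sup>+ x. h (sgn x) \<partial>gauss)"
proof -
  let ?n = "CARD('n)"
  let ?I = "\<lambda>g x. \<integral>\<^sup>+ s. indicator {0<..} s * (ennreal (s ^ (?n - 1)) * g (s *\<^sub>R sgn x)) \<partial>lborel"
  define \<rho> where "\<rho> t = (1 / sqrt (2 * pi)) ^ ?n * exp (- t\<^sup>2 / 2)" for t :: real
  have \<rho>_gauss: "\<rho> (norm x) = gauss_density x" for x :: "real ^ 'n"
    by (simp add: \<rho>_def gauss_density_def)
  have [measurable]: "\<rho> \<in> borel_measurable borel"
    unfolding \<rho>_def[abs_def] by measurable
  have \<rho>0: "\<rho> t \<ge> 0" for t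
    by (simp add: \<rho>_def)
  have sgn_m [measurable]: "sgn \<in> borel_measurable (borel :: (real ^ 'n) measure)"
    unfolding sgn_div_norm by measurable
  obtain C1 where C1: "\<And>g :: real ^ 'n \<Rightarrow> ennreal. g \<in> borel_measurable borel \<Longrightarrow>
     (\<integral>\<^sup>+ x. ennreal (\<rho> (norm x)) * ?I g x \<partial>lborel) = C1 * (\<integral>\<^sup>+ z. g z \<partial>lborel)"
    using nn_integral_polar_kernel[of "\<lambda>t. ennreal (\<rho> t)", where 'a = "real ^ 'n"] by simp
  obtain C2 where C2: "\<And>g :: real ^ 'n \<Rightarrow> ennreal. g \<in> borel_measurable borel \<Longrightarrow>
     (\<integral>\<^sup>+ x. ennreal (\<rho> (norm x) * (norm x)\<^sup>2) * ?I g x \<partial>lborel) = C2 * (\<integral>\<^sup>+ z. g z \<partial>lborel)"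
    using nn_integral_polar_kernel[of "\<lambda>t. ennreal (\<rho> t * t\<^sup>2)", where 'a = "real ^ 'n"] by simp
  have I_meas [measurable]: "?I g \<in> borel_measurable borel" if [measurable]: "g \<in> borel_measurable borel" for g :: "real ^ 'n \<Rightarrow> ennreal"
    by measurable
  have G1: "(\<integral>\<^sup>+ x. ?I g x \<partial>gauss) = C1 * (\<integral>\<^sup>+ z. g z \<partial>lborel)" if [measurable]: "g \<in> borel_measurable borel" for g :: "real ^ 'n \<Rightarrow> ennreal"
    unfolding C1[OF that, symmetric] \<rho>_gauss by (rule nn_integral_gauss) simp
  have G2: "(\<integral>\<^sup>+ x. ennreal ((norm x)\<^sup>2) * ?I g x \<partial>gauss) = C2 * (\<integral>\<^sup>+ z. g z \<partial>lborel)" if [measurable]: "g \<in> borel_measurable borel" for g :: "real ^ 'n \<Rightarrow> ennreal"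
    unfolding C2[OF that, symmetric] using \<rho>0
    by (subst nn_integral_gauss) (simp_all add: \<rho>_gauss[symmetric] ennreal_mult mult.assoc)
  define k where "k h z = (if norm z < 1 then h (sgn z) else 0)" for h :: "real ^ 'n \<Rightarrow> ennreal" and z
  have k_meas [measurable]: "k h \<in> borel_measurable borel" if [measurable]: "h \<in> borel_measurable borel" for h
    unfolding k_def[abs_def] by measurable
  have Ik: "AE x in gauss. ?I (k h) x = ennreal (1 / real ?n) * h (sgn x)" for h
    using AE_gauss_neq_0
  proof eventually_elim
    fix x :: "real ^ 'n" assume x: "x \<noteq> 0"
    have "?I (k h) x = (\<integral>\<^sup>+ s. indicator {0<..} s * (ennreal (s ^ (?n - 1)) * (if s < 1 then h (sgn x) else 0)) \<partial>lborel)"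
      using x by (intro nn_integral_cong) (auto simp: k_def indicator_def norm_sgn sgn_scaleR_sgn)
    then show "?I (k h) x = ennreal (1 / real ?n) * h (sgn x)"
      using nn_integral_power_01[of ?n "h (sgn x)"] by simp
  qed
  have k1: "(\<integral>\<^sup>+ z. k (\<lambda>_. 1) z \<partial>lborel) = emeasure lborel (ball (0 :: real ^ 'n) 1)"
  proof -
    have "k (\<lambda>_. 1) = indicator (ball (0 :: real ^ 'n) 1)"
      by (auto simp: k_def indicator_def)
    then show ?thesis by simp
  qed
  let ?b = "measure lborel (ball (0 :: real ^ 'n) 1)"
  have b: "emeasure lborel (ball (0 :: real ^ 'n) 1) = ennreal ?b" "?b > 0"
    using emeasure_bounded_finite[OF bounded_ball, of "0 :: real ^ 'n" 1] content_ball_pos[of 1 "0 :: real ^ 'n"]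
    by (auto simp: emeasure_eq_ennreal_measure less_top measure_completion)
  have E1: "ennreal (1 / real ?n) * (\<integral>\<^sup>+ x. h (sgn x) \<partial>gauss) = C1 * (\<integral>\<^sup>+ z. k h z \<partial>lborel)"
    if [measurable]: "h \<in> borel_measurable borel" for h
    unfolding G1[OF k_meas[OF that], symmetric]
    by (subst nn_integral_cong_AE[OF Ik]) (simp add: nn_integral_cmult)
  have E2: "ennreal (1 / real ?n) * (\<integral>\<^sup>+ x. ennreal ((norm x)\<^sup>2) * h (sgn x) \<partial>gauss) = C2 * (\<integral>\<^sup>+ z. k h z \<partial>lborel)"
    if [measurable]: "h \<in> borel_measurable borel" for h
  proof -
    have "AE x in gauss. ennreal ((norm x)\<^sup>2) * ?I (k h) x = ennreal (1 / real ?n) * (ennreal ((norm x)\<^sup>2) * h (sgn x))"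
      using Ik[of h] by eventually_elim (simp add: mult_ac)
    then show ?thesis
      unfolding G2[OF k_meas[OF that], symmetric]
      by (subst nn_integral_cong_AE) (auto simp: nn_integral_cmult)
  qed
  have 1: "ennreal (1 / real ?n) = C1 * ennreal ?b"
    using E1[of "\<lambda>_. 1"] by (simp add: k1 b)
  have C1_eq: "C1 = ennreal (1 / real ?n / ?b)"
    by (rule ennreal_mult_eq_imp_eq_divide[OF 1[symmetric] b(2)]) simp
  have nn2: "(\<integral>\<^sup>+ x. ennreal ((norm x)\<^sup>2) \<partial>(gauss :: (real ^ 'n) measure)) = ennreal (real ?n)"
    using integral_gauss_norm_square by (subst nn_integral_eq_integral) auto
  have "ennreal (1 / real ?n) * ennreal (real ?n) = C2 * ennreal ?b"
    using E2[of "\<lambda>_. 1"] by (simp add: k1 b nn2)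
  then have "C2 * ennreal ?b = ennreal 1"
    by (simp add: ennreal_mult[symmetric])
  from ennreal_mult_eq_imp_eq_divide[OF this b(2)] have C2_eq: "C2 = ennreal (real ?n) * C1"
    unfolding C1_eq by (simp add: ennreal_mult[symmetric])
  show ?thesis
  proof (rule that[of "1 / real ?n / ?b"])
    show "1 / real ?n / ?b > 0" using b(2) by simp
    show "(\<integral>\<^sup>+ x. ?I g x \<partial>gauss) = ennreal (1 / real ?n / ?b) * (\<integral>\<^sup>+ z. g z \<partial>lborel)" if "g \<in> borel_measurable borel" for g :: "real ^ 'n \<Rightarrow> ennreal"
      using G1[OF that] unfolding C1_eq .
    fix h :: "real ^ 'n \<Rightarrow> ennreal" assume h: "h \<in> borel_measurable borel"
    let ?X = "\<integral>\<^sup>+ x. ennreal ((norm x)\<^sup>2) * h (sgn x) \<partial>gauss" and ?Y = "\<integral>\<^sup>+ x. h (sgn x) \<partial>gauss"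
    have cancel: "ennreal (real ?n) * (ennreal (1 / real ?n) * z) = z" for z
      by (simp add: mult.assoc[symmetric] ennreal_mult[symmetric])
    have "?X = ennreal (real ?n) * (C2 * (\<integral>\<^sup>+ z. k h z \<partial>lborel))"
      by (simp only: E2[OF h, symmetric] cancel)
    also have "\<dots> = ennreal (real ?n) * (ennreal (real ?n) * (C1 * (\<integral>\<^sup>+ z. k h z \<partial>lborel)))"
      by (simp only: C2_eq mult.assoc)
    also have "\<dots> = ennreal (real ?n) * ?Y"
      by (simp only: E1[OF h, symmetric] cancel)
    finally show "?X = ennreal (real ?n) * ?Y" .
  qed
qed

lemma integral_gauss:
  fixes f :: "real ^ 'n \<Rightarrow> real"
  assumes "f \<in> borel_measurable borel"
  shows "(LINT x|gauss. f x) = (LINT h|std_normals UNIV. f (\<chi> i. h i))"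
  unfolding gauss_def by (rule integral_distr[OF measurable_vec_lambda_std_normals]) (use assms in simp)

lemma gauss_poincare:
  fixes f :: "real ^ 'n \<Rightarrow> real" and D :: "real ^ 'n \<Rightarrow> real ^ 'n"
  assumes f: "continuous_on UNIV f" and D: "\<And>x. x \<noteq> 0 \<Longrightarrow> GDERIV f x :> D x"
    and D_meas [measurable]: "D \<in> borel_measurable borel" and DK: "\<And>x. norm (D x) \<le> K"
    and fK: "\<And>x. \<bar>f x\<bar> \<le> A + K * norm x"
  shows "(LINT x|gauss. (f x)\<^sup>2) - (LINT x|gauss. f x)\<^sup>2 \<le> (LINT x|gauss. (norm (D x))\<^sup>2)"
proof -
  have [measurable]: "f \<in> borel_measurable borel"
    by (rule borel_measurable_continuous_onI[OF f])
  let ?v = "\<lambda>h :: 'n \<Rightarrow> real. (\<chi> i. h i)"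
  define g where "g i h = \<bar>D (?v h) $ i\<bar>" for i h
  have K: "K \<ge> 0" using norm_ge_zero DK order_trans by blast
  have gK: "g i h \<le> K" for i h
    using component_le_norm_cart[of "D (?v h)" i] DK[of "?v h"] by (simp add: g_def)
  have D_nth [measurable]: "(\<lambda>x. D x $ i) \<in> borel_measurable borel" for i
    by (rule borel_measurable_vec_nth) simp
  have P: "(LINT h|std_normals UNIV. (f (?v h))\<^sup>2) - (LINT h|std_normals UNIV. f (?v h))\<^sup>2 \<le> (\<Sum>i\<in>UNIV. LINT h|std_normals UNIV. (g i h)\<^sup>2)"
  proof (rule std_normals_poincare[where A = A and K = K])
    show "(\<lambda>h. f (?v h)) \<in> borel_measurable (std_normals UNIV)"
      by (rule measurable_compose[OF measurable_vec_lambda_std_normals]) simp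
    show "g i \<in> borel_measurable (std_normals UNIV)" for i
      unfolding g_def[abs_def]
      by (rule measurable_compose[OF measurable_vec_lambda_std_normals]) simp
    show "\<bar>f (?v h)\<bar> \<le> A + K * (\<Sum>i\<in>UNIV. \<bar>h i\<bar>)" for h
    proof -
      have "norm (?v h) \<le> (\<Sum>i\<in>UNIV. \<bar>h i\<bar>)"
        using norm_le_l1_cart[of "?v h"] by simp
      then show ?thesis
        using fK[of "?v h"] mult_left_mono[OF _ K, of "norm (?v h)"] by force
    qed
    fix i h a b assume ab: "a \<le> (b :: real)"
    define y where "y = ?v (h(i := 0))"
    have line: "?v (h(i := t)) = y + t *\<^sub>R axis i 1" for t
      by (auto simp: vec_eq_iff y_def axis_def)
    let ?\<phi> = "\<lambda>t. f (y + t *\<^sub>R axis i 1)" and ?\<phi>' = "\<lambda>t. D (y + t *\<^sub>R axis i 1) $ i"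
    have zero: "y + t *\<^sub>R axis i 1 \<noteq> 0" if "t \<noteq> 0" for t
      using that by (auto simp: y_def vec_eq_iff axis_def)
    have FTC: "(?\<phi>' has_integral (?\<phi> b - ?\<phi> a)) {a..b}"
    proof (rule fundamental_theorem_of_calculus_interior_strong[of "{0}"])
      show "continuous_on {a..b} ?\<phi>"
        by (rule continuous_on_compose2[OF f]) (auto intro!: continuous_intros)
      fix t assume "t \<in> {a<..<b} - {0}"
      then have D': "(f has_derivative (\<lambda>h. h \<bullet> D (y + t *\<^sub>R axis i 1))) (at (y + t *\<^sub>R axis i 1))"
        using D[OF zero] by (simp add: gderiv_def)
      have "(?\<phi> has_derivative (\<lambda>s. (s *\<^sub>R axis i 1) \<bullet> D (y + t *\<^sub>R axis i 1))) (at t)"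
        by (rule has_derivative_compose[where f = "\<lambda>t. y + t *\<^sub>R axis i 1" and f' = "\<lambda>s. s *\<^sub>R axis i 1" and g = f, OF _ D']) (auto intro!: derivative_eq_intros)
      then show "(?\<phi> has_vector_derivative ?\<phi>' t) (at t)"
        by (simp add: has_vector_derivative_def inner_axis' inner_axis)
    qed (use ab in auto)
    have int: "set_integrable lborel {a..b} ?\<phi>'"
      unfolding set_integrable_def
    proof (rule integrableI_bounded_set_indicator[where B = K])
      show "AE t in lborel. t \<in> {a..b} \<longrightarrow> norm (?\<phi>' t) \<le> K"
        using DK component_le_norm_cart order_trans by (intro AE_I2) (fastforce simp del: norm_conv_dist)
    qed (auto simp: emeasure_lborel_Icc_eq)
    have "\<bar>?\<phi> b - ?\<phi> a\<bar> = \<bar>LINT t:{a..b}|lborel. ?\<phi>' t\<bar>"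
      using set_borel_integral_eq_integral(2)[OF int] integral_unique[OF FTC] by simp
    also have "\<dots> \<le> (LINT t:{a..b}|lborel. \<bar>?\<phi>' t\<bar>)"
      using set_integral_norm_bound[OF int] by simp
    finally show "\<bar>f (?v (h(i := b))) - f (?v (h(i := a)))\<bar> \<le> (LINT t:{a..b}|lborel. g i (h(i := t)))"
      unfolding line g_def .
  qed (auto simp: g_def gK[unfolded g_def])
  have int: "integrable gauss (\<lambda>x. (D x $ i)\<^sup>2)" for i
  proof (rule gauss.integrable_const_bound[where B = "K\<^sup>2"])
    have "(D x $ i)\<^sup>2 \<le> K\<^sup>2" for x
      using power_mono[OF order_trans[OF component_le_norm_cart DK], of x i 2] by simp
    then show "AE x in gauss. norm ((D x $ i)\<^sup>2) \<le> K\<^sup>2" by simp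
  qed simp
  have "(\<Sum>i\<in>UNIV. LINT h|std_normals UNIV. (g i h)\<^sup>2) = (\<Sum>i\<in>UNIV. LINT x|gauss. (D x $ i)\<^sup>2)"
    by (simp add: g_def integral_gauss)
  also have "\<dots> = (LINT x|gauss. (norm (D x))\<^sup>2)"
    unfolding power2_norm_eq_inner inner_vec_def
    using int by (subst Bochner_Integration.integral_sum[symmetric]) (auto simp: power2_eq_square)
  finally show ?thesis
    using P by (simp add: integral_gauss)
qed

lemma GDERIV_sgn_compose:
  fixes u :: "'a::real_inner \<Rightarrow> real"
  assumes x: "x \<noteq> 0" and u: "GDERIV u (q + r *\<^sub>R sgn x) :> G"
  shows "GDERIV (\<lambda>x. u (q + r *\<^sub>R sgn x)) x :> (r / norm x) *\<^sub>R (G - (G \<bullet> sgn x) *\<^sub>R sgn x)"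
proof -
  have n: "(norm has_derivative (\<lambda>h. h \<bullet> sgn x)) (at x)"
    using GDERIV_norm[OF x] by (simp add: gderiv_def)
  have "((\<lambda>x. inverse (norm x) *\<^sub>R x) has_derivative
      (\<lambda>h. inverse (norm x) *\<^sub>R h + (- (inverse (norm x) * (h \<bullet> sgn x) * inverse (norm x))) *\<^sub>R x)) (at x)"
    by (rule has_derivative_scaleR[OF Deriv.has_derivative_inverse[OF _ n] has_derivative_ident]) (use x in simp)
  then have "(sgn has_derivative (\<lambda>h. inverse (norm x) *\<^sub>R (h - (h \<bullet> sgn x) *\<^sub>R sgn x))) (at x)"
    by (simp add: sgn_div_norm[abs_def] algebra_simps)
  then have "((\<lambda>x. q + r *\<^sub>R sgn x) has_derivative (\<lambda>h. r *\<^sub>R inverse (norm x) *\<^sub>R (h - (h \<bullet> sgn x) *\<^sub>R sgn x))) (at x)"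
    by (auto intro!: derivative_eq_intros)
  from has_derivative_compose[OF this u[unfolded gderiv_def]] show ?thesis
    by (simp add: gderiv_def inner_simps divide_inverse algebra_simps inner_commute)
qed

lemma sgn_borel_measurable [measurable]: "sgn \<in> borel_measurable (borel :: (real ^ 'n) measure)"
  unfolding sgn_div_norm by measurable

lemma gauss_sgn_moment:
  fixes h :: "real ^ 'n \<Rightarrow> real"
  assumes [measurable]: "h \<in> borel_measurable borel" and h: "\<And>x. 0 \<le> h x" "\<And>x. h x \<le> B"
  shows "(LINT x|gauss. (norm x)\<^sup>2 * h (sgn x)) = real CARD('n) * (LINT x|gauss. h (sgn x))"
proof -
  have B: "B \<ge> 0" using h order_trans by blast
  have int1: "integrable gauss (\<lambda>x. h (sgn x))"
    by (rule gauss.integrable_const_bound[where B = B]) (use h in auto)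
  have int2: "integrable gauss (\<lambda>x. (norm x)\<^sup>2 * h (sgn x))"
  proof (rule Bochner_Integration.integrable_bound)
    show "integrable gauss (\<lambda>x :: real ^ 'n. (norm x)\<^sup>2 * B)"
      by (rule integrable_mult_left[OF integral_gauss_norm_square(1)])
  qed (use h B in \<open>auto simp: mult_left_mono abs_mult\<close>)
  have "(\<integral>\<^sup>+ x. ennreal ((norm x)\<^sup>2) * ennreal (h (sgn x)) \<partial>gauss) = ennreal (real CARD('n)) * (\<integral>\<^sup>+ x. ennreal (h (sgn x)) \<partial>gauss)"
  proof (rule polar_gauss[where 'n = 'n])
    assume *: "\<And>h :: real ^ 'n \<Rightarrow> ennreal. h \<in> borel_measurable borel \<Longrightarrow>
      (\<integral>\<^sup>+ x. ennreal ((norm x)\<^sup>2) * h (sgn x) \<partial>gauss) = ennreal (real CARD('n)) * (\<integral>\<^sup>+ x. h (sgn x) \<partial>gauss)"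
    show ?thesis by (rule *) simp
  qed
  then have "ennreal (LINT x|gauss. (norm x)\<^sup>2 * h (sgn x)) = ennreal (real CARD('n) * (LINT x|gauss. h (sgn x)))"
    using h int1 int2 by (simp add: nn_integral_eq_integral ennreal_mult[symmetric] integral_nonneg_AE)
  then show ?thesis
    using h by (subst (asm) ennreal_inj) (auto intro!: integral_nonneg_AE mult_nonneg_nonneg)
qed

lemma sphere_poincare:
  fixes u :: "real ^ 'n \<Rightarrow> real" and G :: "real ^ 'n \<Rightarrow> real ^ 'n"
  assumes u [measurable]: "u \<in> borel_measurable borel" and G [measurable]: "G \<in> borel_measurable borel"
    and uB: "\<And>x. \<bar>u x\<bar> \<le> B" and GB: "\<And>x. norm (G x) \<le> B"
    and r: "r > 0" and uG: "\<And>x. norm (x - q) = r \<Longrightarrow> GDERIV u x :> G x"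
  shows "(real CARD('n) - 1) * ((LINT x|gauss. (u (q + r *\<^sub>R sgn x))\<^sup>2) - (LINT x|gauss. u (q + r *\<^sub>R sgn x))\<^sup>2)
    \<le> r\<^sup>2 * (LINT x|gauss. (norm (G (q + r *\<^sub>R sgn x)))\<^sup>2 - (G (q + r *\<^sub>R sgn x) \<bullet> sgn x)\<^sup>2)"
proof -
  let ?n = "real CARD('n)"
  let ?p = "\<lambda>x. q + r *\<^sub>R sgn x"
  define w where "w x = u (?p x)" for x
  define c where "c = (LINT x|gauss. norm x * w x) / (LINT x|gauss. norm (x :: real ^ 'n))"
  define f where "f x = norm x * (w x - c)" for x
  define D where "D x = (w x - c) *\<^sub>R sgn x + r *\<^sub>R (G (?p x) - (G (?p x) \<bullet> sgn x) *\<^sub>R sgn x)" for x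
  have [measurable]: "w \<in> borel_measurable borel" "f \<in> borel_measurable borel" "D \<in> borel_measurable borel"
    unfolding w_def[abs_def] f_def[abs_def] D_def[abs_def] by measurable
  have B: "B \<ge> 0" using uB abs_ge_zero order_trans by blast
  have wB: "\<bar>w x\<bar> \<le> B" for x
    by (simp add: w_def uB)
  have int_w: "integrable gauss w" "integrable gauss (\<lambda>x. (w x)\<^sup>2)"
    using wB power_mono[OF wB abs_ge_zero, of _ 2]
    by (intro gauss.integrable_const_bound[where B = B] AE_I2; simp)
       (intro gauss.integrable_const_bound[where B = "B\<^sup>2"] AE_I2;
        use power_mono[OF wB abs_ge_zero, of _ 2] in simp)
  have int_norm: "integrable gauss (\<lambda>x :: real ^ 'n. norm x)"
  proof (rule Bochner_Integration.integrable_bound)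
    show "integrable gauss (\<lambda>x :: real ^ 'n. 1 + (norm x)\<^sup>2)"
      using integral_gauss_norm_square(1) by (intro Bochner_Integration.integrable_add) auto
    have "norm x \<le> 1 + (norm x)\<^sup>2" for x :: "real ^ 'n"
    proof -
      have "2 * norm x \<le> 1 + (norm x)\<^sup>2"
        using sum_squares_bound[of 1 "norm x"] by simp
      then show ?thesis
        using norm_ge_zero[of x] by linarith
    qed
    then show "AE x :: real ^ 'n in gauss. norm (norm x) \<le> norm (1 + (norm x)\<^sup>2)"
      by (simp add: abs_of_nonneg)
  qed simp
  have int_norm_w: "integrable gauss (\<lambda>x. norm x * w x)"
  proof (rule Bochner_Integration.integrable_bound)
    show "integrable gauss (\<lambda>x :: real ^ 'n. norm x * B)"
      by (rule integrable_mult_left[OF int_norm])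
  qed (use wB B in \<open>auto simp: abs_mult mult_left_mono\<close>)
  have norm_pos: "(LINT x|gauss. norm (x :: real ^ 'n)) \<noteq> 0"
  proof
    assume "(LINT x|gauss. norm (x :: real ^ 'n)) = 0"
    then have "AE x in gauss. norm (x :: real ^ 'n) = 0"
      using integral_nonneg_eq_0_iff_AE[OF int_norm] by simp
    then have "AE x :: real ^ 'n in gauss. False"
      using AE_gauss_neq_0 by eventually_elim simp
    then show False
      by simp
  qed
  have "(LINT x|gauss. f x) = (LINT x|gauss. norm x * w x - c * norm x)"
    by (simp add: f_def algebra_simps)
  also have "\<dots> = 0"
    using int_norm int_norm_w norm_pos by (simp add: c_def)
  finally have f_mean: "(LINT x|gauss. f x) = 0" .
  define K where "K = B + \<bar>c\<bar> + r * (B + B)"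
  have K: "B + \<bar>c\<bar> \<le> K"
    using r B by (simp add: K_def)
  have f_bound: "\<bar>f x\<bar> \<le> 0 + K * norm x" for x
  proof -
    have "\<bar>w x - c\<bar> \<le> K"
      using wB[of x] K by linarith
    then show ?thesis
      by (simp add: f_def abs_mult mult.commute[of K] mult_left_mono)
  qed
  have fD: "GDERIV f x :> D x" if x: "x \<noteq> 0" for x
  proof -
    have "GDERIV u (?p x) :> G (?p x)"
      using x r by (intro uG) (simp add: norm_sgn)
    from GDERIV_mult[OF GDERIV_norm[OF x] GDERIV_diff[OF GDERIV_sgn_compose[OF x this] GDERIV_const[of c x]]]
    show ?thesis
      using x by (simp add: f_def[abs_def] w_def D_def add.commute)
  qed
  have f_cont: "continuous_on UNIV f"
  proof (intro continuous_at_imp_continuous_on ballI)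
    fix x :: "real ^ 'n"
    show "isCont f x"
    proof (cases "x = 0")
      case True
      have "(f \<longlongrightarrow> 0) (at 0)"
      proof (rule Lim_null_comparison)
        show "eventually (\<lambda>x. norm (f x) \<le> K * norm x) (at 0)"
          using f_bound by simp
        have "((\<lambda>x :: real ^ 'n. K * norm x) \<longlongrightarrow> K * norm (0 :: real ^ 'n)) (at 0)"
          by (intro tendsto_intros)
        then show "((\<lambda>x :: real ^ 'n. K * norm x) \<longlongrightarrow> 0) (at 0)" by simp
      qed
      then show ?thesis
        unfolding True isCont_def by (simp add: f_def)
    next
      case False
      then show ?thesis
        using fD has_derivative_continuous unfolding gderiv_def by blast
    qed
  qed
  have sgn_le: "norm (sgn x) \<le> 1" for x :: "real ^ 'n"
    by (simp add: norm_sgn)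
  have DK: "norm (D x) \<le> K" for x
  proof -
    have "\<bar>G (?p x) \<bullet> sgn x\<bar> \<le> norm (G (?p x)) * norm (sgn x)"
      by (rule Cauchy_Schwarz_ineq2)
    also have "\<dots> \<le> B * 1"
      by (intro mult_mono GB sgn_le B) simp
    finally have inner_le: "\<bar>G (?p x) \<bullet> sgn x\<bar> \<le> B" by simp
    have "norm (G (?p x) - (G (?p x) \<bullet> sgn x) *\<^sub>R sgn x) \<le> norm (G (?p x)) + norm ((G (?p x) \<bullet> sgn x) *\<^sub>R sgn x)"
      by (rule norm_triangle_ineq4)
    also have "\<dots> \<le> B + B * 1"
      unfolding norm_scaleR by (intro add_mono mult_mono GB sgn_le inner_le B) simp
    finally have 1: "norm (r *\<^sub>R (G (?p x) - (G (?p x) \<bullet> sgn x) *\<^sub>R sgn x)) \<le> r * (B + B)"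
      using r by simp
    have 2: "norm ((w x - c) *\<^sub>R sgn x) \<le> (B + \<bar>c\<bar>) * 1"
      unfolding norm_scaleR using wB[of x] B by (intro mult_mono sgn_le) auto
    have "norm (D x) \<le> norm ((w x - c) *\<^sub>R sgn x) + norm (r *\<^sub>R (G (?p x) - (G (?p x) \<bullet> sgn x) *\<^sub>R sgn x))"
      unfolding D_def by (rule norm_triangle_ineq)
    then show ?thesis
      using 1 2 by (simp add: K_def)
  qed
  define Q where "Q x = (norm (G (?p x)))\<^sup>2 - (G (?p x) \<bullet> sgn x)\<^sup>2" for x
  have [measurable]: "Q \<in> borel_measurable borel"
    unfolding Q_def[abs_def] by measurable
  have D_sq: "(norm (D x))\<^sup>2 = (w x - c)\<^sup>2 + r\<^sup>2 * Q x" if "x \<noteq> 0" for x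
  proof -
    have s: "sgn x \<bullet> sgn x = 1"
      using that by (simp add: norm_sgn norm_eq_1[symmetric])
    have "(norm (a *\<^sub>R sgn x + r *\<^sub>R (v - (v \<bullet> sgn x) *\<^sub>R sgn x)))\<^sup>2 = a\<^sup>2 + r\<^sup>2 * ((norm v)\<^sup>2 - (v \<bullet> sgn x)\<^sup>2)" for a v
      unfolding power2_norm_eq_inner
      by (simp add: inner_simps s inner_commute[of "sgn x" v] power2_eq_square algebra_simps)
    then show ?thesis
      by (simp add: D_def Q_def)
  qed
  have int_wc: "integrable gauss (\<lambda>x. (w x - c)\<^sup>2)"
    unfolding power2_diff using int_w by auto
  have Q_bound: "\<bar>Q x\<bar> \<le> B\<^sup>2" for x
  proof -
    have "(G (?p x) \<bullet> sgn x)\<^sup>2 \<le> (norm (G (?p x)))\<^sup>2"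
    proof -
      have "\<bar>G (?p x) \<bullet> sgn x\<bar> \<le> norm (G (?p x)) * 1"
        using order_trans[OF Cauchy_Schwarz_ineq2 mult_left_mono[OF sgn_le norm_ge_zero]] .
      then show ?thesis using power_mono[of "\<bar>G (?p x) \<bullet> sgn x\<bar>" "norm (G (?p x))" 2] by simp
    qed
    moreover have "(norm (G (?p x)))\<^sup>2 \<le> B\<^sup>2"
      by (intro power_mono GB) simp
    ultimately show ?thesis
      unfolding Q_def using zero_le_power2[of "G (?p x) \<bullet> sgn x"] by linarith
  qed
  have int_Q: "integrable gauss Q"
    by (rule gauss.integrable_const_bound[where B = "B\<^sup>2"]) (use Q_bound in auto)
  have "?n * (LINT x|gauss. (w x - c)\<^sup>2) = (LINT x|gauss. (norm x)\<^sup>2 * (w x - c)\<^sup>2)"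
    unfolding w_def
  proof (rule gauss_sgn_moment[where h = "\<lambda>y. (u (q + r *\<^sub>R y) - c)\<^sup>2" and B = "(B + \<bar>c\<bar>)\<^sup>2", symmetric])
    show "(u (q + r *\<^sub>R y) - c)\<^sup>2 \<le> (B + \<bar>c\<bar>)\<^sup>2" for y
      using uB[of "q + r *\<^sub>R y"] B by (intro abs_le_square_iff[THEN iffD1]) auto
  qed auto
  also have "\<dots> = (LINT x|gauss. (f x)\<^sup>2)"
    by (simp add: f_def power_mult_distrib)
  also have "\<dots> \<le> (LINT x|gauss. (norm (D x))\<^sup>2)"
    using gauss_poincare[OF f_cont fD _ DK f_bound] by (simp add: f_mean)
  also have "\<dots> = (LINT x|gauss. (w x - c)\<^sup>2 + r\<^sup>2 * Q x)"
  proof (rule integral_cong_AE)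
    show "AE x in gauss. (norm (D x))\<^sup>2 = (w x - c)\<^sup>2 + r\<^sup>2 * Q x"
      using AE_gauss_neq_0 by eventually_elim (rule D_sq)
  qed auto
  also have "\<dots> = (LINT x|gauss. (w x - c)\<^sup>2) + r\<^sup>2 * (LINT x|gauss. Q x)"
    using int_wc int_Q by simp
  finally have le: "(?n - 1) * (LINT x|gauss. (w x - c)\<^sup>2) \<le> r\<^sup>2 * (LINT x|gauss. Q x)"
    by (simp add: algebra_simps)
  have "(LINT x|gauss. (w x - c)\<^sup>2) = (LINT x|gauss. (w x)\<^sup>2) - 2 * c * (LINT x|gauss. w x) + c\<^sup>2"
    unfolding power2_diff using int_w by (simp add: algebra_simps)
  also have "\<dots> = ((LINT x|gauss. (w x)\<^sup>2) - (LINT x|gauss. w x)\<^sup>2) + ((LINT x|gauss. w x) - c)\<^sup>2"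
    by (simp add: power2_diff algebra_simps)
  finally have "(LINT x|gauss. (w x)\<^sup>2) - (LINT x|gauss. w x)\<^sup>2 \<le> (LINT x|gauss. (w x - c)\<^sup>2)"
    by simp
  moreover have "?n - 1 \<ge> 0"
    by (simp add: Suc_leI)
  ultimately have "(?n - 1) * ((LINT x|gauss. (w x)\<^sup>2) - (LINT x|gauss. w x)\<^sup>2) \<le> r\<^sup>2 * (LINT x|gauss. Q x)"
    using le mult_left_mono order_trans by blast
  then show ?thesis
    by (simp add: w_def Q_def)
qed

lemma set_integrable_bounded_Icc:
  fixes f :: "real \<Rightarrow> real"
  assumes "f \<in> borel_measurable borel" "\<And>s. s \<in> {a..b} \<Longrightarrow> \<bar>f s\<bar> \<le> B"
  shows "set_integrable lborel {a..b} f"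
  unfolding set_integrable_def
  by (rule integrableI_bounded_set_indicator[where B = B]) (use assms in \<open>auto simp: emeasure_lborel_Icc_eq\<close>)

lemma polar_integral:
  obtains C :: real where "C > 0"
    "\<And>(g :: real ^ 'n \<Rightarrow> real) B R. g \<in> borel_measurable borel \<Longrightarrow> (\<And>x. \<bar>g x\<bar> \<le> B) \<Longrightarrow> (\<And>x. norm x > R \<Longrightarrow> g x = 0) \<Longrightarrow>
      (LINT x|gauss. (LINT s:{0..R}|lborel. s ^ (CARD('n) - 1) * g (s *\<^sub>R sgn x))) = C * (LINT z|lborel. g z)"
    "\<And>(g :: real ^ 'n \<Rightarrow> real) B R. g \<in> borel_measurable borel \<Longrightarrow> (\<And>x. \<bar>g x\<bar> \<le> B) \<Longrightarrow> (\<And>x. norm x > R \<Longrightarrow> g x = 0) \<Longrightarrow>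
      (LINT s:{0..R}|lborel. s ^ (CARD('n) - 1) * (LINT x|gauss. g (s *\<^sub>R sgn x))) = C * (LINT z|lborel. g z)"
proof (rule polar_gauss[where 'n = 'n])
  let ?n = "CARD('n)"
  fix C :: real assume C: "C > 0"
    and polar: "\<And>g :: real ^ 'n \<Rightarrow> ennreal. g \<in> borel_measurable borel \<Longrightarrow>
      (\<integral>\<^sup>+ x. (\<integral>\<^sup>+ s. indicator {0<..} s * (ennreal (s ^ (?n - 1)) * g (s *\<^sub>R sgn x)) \<partial>lborel) \<partial>gauss)
        = ennreal C * (\<integral>\<^sup>+ z. g z \<partial>lborel)"
  interpret GL: pair_sigma_finite "gauss :: (real ^ 'n) measure" "lborel :: real measure" ..
  let ?k = "\<lambda>R (g :: real ^ 'n \<Rightarrow> real) x s. indicator {0..R} s *\<^sub>R (s ^ (?n - 1) * g (s *\<^sub>R sgn x))"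
  have int: "integrable (gauss \<Otimes>\<^sub>M lborel) (\<lambda>(x, s). ?k R g x s)"
    if [measurable]: "g \<in> borel_measurable borel" and B: "\<And>x. \<bar>g x\<bar> \<le> B" for g B R
  proof (rule integrableI_bounded_set[where A = "UNIV \<times> {0..R}" and B = "R ^ (?n - 1) * B"])
    show "emeasure (gauss \<Otimes>\<^sub>M lborel) ((UNIV :: (real ^ 'n) set) \<times> {0..R}) < \<infinity>"
      by (subst lborel.emeasure_pair_measure_Times) (auto simp: emeasure_lborel_Icc_eq)
    have "norm ((case z of (x, s) \<Rightarrow> ?k R g x s)) \<le> R ^ (?n - 1) * B" if hz: "z \<in> UNIV \<times> {0..R}" for z
    proof -
      obtain x s where z: "z = (x, s)" "0 \<le> s" "s \<le> R" using hz by auto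
      then show ?thesis
        using B[of "s *\<^sub>R sgn x"] by (auto simp: abs_mult intro!: mult_mono power_mono)
    qed
    then show "AE z in gauss \<Otimes>\<^sub>M lborel. z \<in> UNIV \<times> {0..R} \<longrightarrow> norm ((case z of (x, s) \<Rightarrow> ?k R g x s)) \<le> R ^ (?n - 1) * B"
      by simp
  qed (auto simp: case_prod_unfold indicator_def)
  have pos: "(LINT x|gauss. LINT s|lborel. ?k R g x s) = C * (LINT z|lborel. g z)"
    if [measurable]: "g \<in> borel_measurable borel" and B: "\<And>x. \<bar>g x\<bar> \<le> B" and R: "\<And>x. norm x > R \<Longrightarrow> g x = 0"
      and g0: "\<And>x. g x \<ge> 0" for g B R
  proof -
    have int_g: "integrable lborel g"
    proof (rule integrableI_bounded_set[where A = "cball 0 R" and B = B])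
      show "AE x in lborel. x \<notin> cball 0 R \<longrightarrow> g x = 0"
        using R by auto
      show "emeasure lborel (cball (0 :: real ^ 'n) R) < \<infinity>"
        by (rule emeasure_bounded_finite) simp
    qed (use B in auto)
    have nonneg: "0 \<le> ?k R g x s" for x s
      using g0 by (auto simp: indicator_def)
    have "ennreal (LINT x|gauss. LINT s|lborel. ?k R g x s) = ennreal (LINT z|(gauss \<Otimes>\<^sub>M lborel). (case z of (x, s) \<Rightarrow> ?k R g x s))"
      using GL.integral_fst'[OF int[OF that(1) B, of R]] by simp
    also have "\<dots> = (\<integral>\<^sup>+ z. ennreal ((case z of (x, s) \<Rightarrow> ?k R g x s)) \<partial>(gauss \<Otimes>\<^sub>M lborel))"
      by (rule nn_integral_eq_integral[symmetric, OF int[OF that(1) B]]) (use nonneg in \<open>simp add: case_prod_unfold\<close>)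
    also have "\<dots> = (\<integral>\<^sup>+ x. \<integral>\<^sup>+ s. ennreal (?k R g x s) \<partial>lborel \<partial>gauss)"
      by (subst lborel.nn_integral_fst[symmetric]) (simp_all add: case_prod_unfold)
    also have "\<dots> = (\<integral>\<^sup>+ x. \<integral>\<^sup>+ s. indicator {0<..} s * (ennreal (s ^ (?n - 1)) * ennreal (g (s *\<^sub>R sgn x))) \<partial>lborel \<partial>gauss)"
    proof (intro nn_integral_cong_AE, use AE_gauss_neq_0 in eventually_elim)
      fix x :: "real ^ 'n" assume x: "x \<noteq> 0"
      have "AE s in lborel. ennreal (?k R g x s) = indicator {0<..} s * (ennreal (s ^ (?n - 1)) * ennreal (g (s *\<^sub>R sgn x)))"
        using AE_lborel_singleton[of "0::real"]
      proof eventually_elim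
        fix s :: real assume s: "s \<noteq> 0"
        show "ennreal (?k R g x s) = indicator {0<..} s * (ennreal (s ^ (?n - 1)) * ennreal (g (s *\<^sub>R sgn x)))"
        proof (cases "s > R")
          case True
          then have "g (s *\<^sub>R sgn x) = 0" if "s > 0"
            using that x by (intro R) (simp add: norm_sgn)
          then show ?thesis using True by (auto simp: indicator_def)
        next
          case False
          then show ?thesis
            using s g0 by (auto simp: indicator_def ennreal_mult)
        qed
      qed
      then show "(\<integral>\<^sup>+ s. ennreal (?k R g x s) \<partial>lborel) = (\<integral>\<^sup>+ s. indicator {0<..} s * (ennreal (s ^ (?n - 1)) * ennreal (g (s *\<^sub>R sgn x))) \<partial>lborel)"
        by (rule nn_integral_cong_AE)
    qed
    also have "\<dots> = ennreal C * (\<integral>\<^sup>+ z. ennreal (g z) \<partial>lborel)"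
      by (rule polar) simp
    also have "\<dots> = ennreal (C * (LINT z|lborel. g z))"
      using int_g g0 C by (simp add: nn_integral_eq_integral ennreal_mult integral_nonneg_AE)
    finally show ?thesis
      using nonneg g0 C by (subst (asm) ennreal_inj) (auto intro!: integral_nonneg_AE mult_nonneg_nonneg)
  qed
  have main: "(LINT x|gauss. LINT s|lborel. ?k R g x s) = C * (LINT z|lborel. g z)"
    if g [measurable]: "g \<in> borel_measurable borel" and B: "\<And>x. \<bar>g x\<bar> \<le> B" and R: "\<And>x. norm x > R \<Longrightarrow> g x = 0" for g B R
  proof -
    let ?b = "\<lambda>x :: real ^ 'n. B * indicator (cball 0 R) x :: real"
    let ?h = "\<lambda>x. g x + ?b x"
    have B0: "B \<ge> 0" using B abs_ge_zero order_trans by blast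
    have [measurable]: "cball (0 :: real ^ 'n) R \<in> sets borel"
      by simp
    have h [measurable]: "?h \<in> borel_measurable borel" and b [measurable]: "?b \<in> borel_measurable borel"
      by measurable
    have hB: "\<bar>?h x\<bar> \<le> B + B" and bB: "\<bar>?b x\<bar> \<le> B" and h0: "?h x \<ge> 0" for x
      using B[of x] B0 R[of x] by (auto simp: indicator_def)
    have hR: "?h x = 0" and bR: "?b x = 0" if "norm x > R" for x
      using R[OF that] that by auto
    have i: "integrable lborel f" if [measurable]: "f \<in> borel_measurable borel" and "\<And>x. \<bar>f x\<bar> \<le> K" "\<And>x. norm x > R \<Longrightarrow> f x = 0" for f :: "real ^ 'n \<Rightarrow> real" and K
    proof (rule integrableI_bounded_set[where A = "cball 0 R" and B = K])
      show "emeasure lborel (cball (0 :: real ^ 'n) R) < \<infinity>"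
        by (rule emeasure_bounded_finite) simp
    qed (use that in auto)
    have ib: "integrable lborel ?b" by (rule i[OF b bB bR])
    have ig: "integrable lborel g" by (rule i[OF g B R])
    have "(LINT x|gauss. LINT s|lborel. ?k R ?h x s) = (LINT z|(gauss \<Otimes>\<^sub>M lborel). (case z of (x, s) \<Rightarrow> ?k R ?h x s))"
      using GL.integral_fst'[OF int[OF h hB, of R]] by simp
    also have "\<dots> = (LINT z|(gauss \<Otimes>\<^sub>M lborel). ((case z of (x, s) \<Rightarrow> ?k R g x s)) + (case z of (x, s) \<Rightarrow> ?k R ?b x s))"
      by (intro Bochner_Integration.integral_cong refl) (simp add: case_prod_unfold algebra_simps)
    also have "\<dots> = (LINT x|gauss. LINT s|lborel. ?k R g x s) + (LINT x|gauss. LINT s|lborel. ?k R ?b x s)"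
      using GL.integral_fst'[OF int[OF g B, of R]] GL.integral_fst'[OF int[OF b bB, of R]]
        int[OF g B, of R] int[OF b bB, of R] by simp
    finally have "C * (LINT z|lborel. ?h z) = (LINT x|gauss. LINT s|lborel. ?k R g x s) + C * (LINT z|lborel. ?b z)"
      using pos[OF h hB hR h0] pos[OF b bB bR] B0 by simp
    moreover have "(LINT z|lborel. ?h z) = (LINT z|lborel. g z) + (LINT z|lborel. ?b z)"
      by (rule Bochner_Integration.integral_add[OF ig ib])
    ultimately show ?thesis
      by (simp add: distrib_left)
  qed
  show ?thesis
  proof (rule that[OF C])
    fix g :: "real ^ 'n \<Rightarrow> real" and B R
    assume g: "g \<in> borel_measurable borel" and B: "\<And>x. \<bar>g x\<bar> \<le> B" and R: "\<And>x. norm x > R \<Longrightarrow> g x = 0"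
    show "(LINT x|gauss. (LINT s:{0..R}|lborel. s ^ (?n - 1) * g (s *\<^sub>R sgn x))) = C * (LINT z|lborel. g z)"
      unfolding set_lebesgue_integral_def by (rule main[OF g B R])
    have "(LINT s:{0..R}|lborel. s ^ (?n - 1) * (LINT x|gauss. g (s *\<^sub>R sgn x))) = (LINT s|lborel. LINT x|gauss. ?k R g x s)"
      unfolding set_lebesgue_integral_def by simp
    also have "\<dots> = (LINT x|gauss. LINT s|lborel. ?k R g x s)"
      by (rule GL.Fubini_integral[OF int[OF g B]])
    finally show "(LINT s:{0..R}|lborel. s ^ (?n - 1) * (LINT x|gauss. g (s *\<^sub>R sgn x))) = C * (LINT z|lborel. g z)"
      using main[OF g B R] by simp
  qed
qed

lemma radial_energy_le:
  fixes d d' :: "real \<Rightarrow> real"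
  assumes n: "n \<ge> 2" and \<epsilon>: "0 < \<epsilon>" "\<epsilon> \<le> \<rho>"
    and d: "\<And>s. \<epsilon> \<le> s \<Longrightarrow> s \<le> \<rho> \<Longrightarrow> (d has_real_derivative d' s) (at s)"
    and d': "continuous_on {\<epsilon>..\<rho>} d'"
  shows "\<rho> ^ (n - 2) * (d \<rho>)\<^sup>2 - \<epsilon> ^ (n - 2) * (d \<epsilon>)\<^sup>2
    \<le> (LINT s:{\<epsilon>..\<rho>}|lborel. (real n - 1) * (s ^ (n - 2) / s) * (d s)\<^sup>2 + s ^ (n - 1) * (d' s)\<^sup>2)"
proof -
  define F where "F s = s ^ (n - 2) * (d s)\<^sup>2" for s
  define F' where "F' s = real (n - 2) * s ^ (n - 2 - 1) * (d s)\<^sup>2 + s ^ (n - 2) * (2 * d s * d' s)" for s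
  have d_cont: "continuous_on {\<epsilon>..\<rho>} d"
    using d by (intro continuous_at_imp_continuous_on) (auto intro: DERIV_isCont[OF d])
  have F'_cont: "continuous_on {\<epsilon>..\<rho>} F'"
    unfolding F'_def[abs_def] by (intro continuous_intros d_cont d')
  have "\<rho> ^ (n - 2) * (d \<rho>)\<^sup>2 - \<epsilon> ^ (n - 2) * (d \<epsilon>)\<^sup>2 = (LINT s:{\<epsilon>..\<rho>}|lborel. F' s)"
    unfolding set_lebesgue_integral_def F_def[symmetric]
  proof (rule integral_FTC_atLeastAtMost[symmetric, OF \<epsilon>(2) _ F'_cont])
    fix s assume s: "\<epsilon> \<le> s" "s \<le> \<rho>"
    have "(F has_real_derivative F' s) (at s)"
      unfolding F_def[abs_def] F'_def
      by (rule derivative_eq_intros d[OF s] refl | simp)+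
    then show "(F has_vector_derivative F' s) (at s within {\<epsilon>..\<rho>})"
      by (simp add: has_real_derivative_iff_has_vector_derivative[symmetric] has_field_derivative_at_within)
  qed
  also have "\<dots> \<le> (LINT s:{\<epsilon>..\<rho>}|lborel. (real n - 1) * (s ^ (n - 2) / s) * (d s)\<^sup>2 + s ^ (n - 1) * (d' s)\<^sup>2)"
  proof (rule set_integral_mono)
    show "set_integrable lborel {\<epsilon>..\<rho>} F'"
      by (rule borel_integrable_atLeastAtMost'[OF F'_cont])
    show "set_integrable lborel {\<epsilon>..\<rho>} (\<lambda>s. (real n - 1) * (s ^ (n - 2) / s) * (d s)\<^sup>2 + s ^ (n - 1) * (d' s)\<^sup>2)"
      using \<epsilon> by (intro borel_integrable_atLeastAtMost' continuous_intros d_cont d') auto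
    fix s assume "s \<in> {\<epsilon>..\<rho>}"
    then have s: "s > 0" using \<epsilon> by auto
    have 1: "real (n - 2) * s ^ (n - 2 - 1) = (real n - 2) * (s ^ (n - 2) / s)"
    proof (cases "n = 2")
      case False
      then have e: "Suc (n - 2 - 1) = n - 2"
        using n by simp
      have "s ^ (n - 2) = s * s ^ (n - 2 - 1)"
        using power_Suc[of s "n - 2 - 1"] unfolding e .
      then show ?thesis
        using s n by (simp add: of_nat_diff)
    qed simp
    have 2: "s ^ (n - 1) = s ^ (n - 2) * s"
    proof -
      have e: "Suc (n - 2) = n - 1"
        using n by simp
      show ?thesis
        using power_Suc2[of s "n - 2"] unfolding e .
    qed
    have "2 * d s * d' s \<le> (d s)\<^sup>2 / s + s * (d' s)\<^sup>2"
    proof -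
      have "0 \<le> (d s - s * d' s)\<^sup>2 / s" using s by simp
      also have "\<dots> = (d s)\<^sup>2 / s + s * (d' s)\<^sup>2 - 2 * d s * d' s"
        using s by (simp add: power2_eq_square field_simps)
      finally show ?thesis by simp
    qed
    then have "s ^ (n - 2) * (2 * d s * d' s) \<le> s ^ (n - 2) * ((d s)\<^sup>2 / s + s * (d' s)\<^sup>2)"
      using s by (intro mult_left_mono) auto
    moreover define Z where "Z = (s ^ (n - 2) / s) * (d s)\<^sup>2"
    have "s ^ (n - 2) * ((d s)\<^sup>2 / s + s * (d' s)\<^sup>2) = Z + s ^ (n - 2) * s * (d' s)\<^sup>2"
      by (simp add: Z_def algebra_simps)
    moreover have "(real n - 1) * Z = (real n - 2) * Z + Z"
      by (simp add: left_diff_distrib)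
    ultimately show "F' s \<le> (real n - 1) * (s ^ (n - 2) / s) * (d s)\<^sup>2 + s ^ (n - 1) * (d' s)\<^sup>2"
      unfolding F'_def 1 2 mult.assoc[of _ "s ^ (n - 2) / s"] Z_def[symmetric] by linarith
  qed
  finally show ?thesis .
qed

lemma (in prob_space) integral_pair_diff_square:
  fixes U :: "'a \<Rightarrow> real"
  assumes [measurable]: "U \<in> borel_measurable M" and B: "\<And>x. \<bar>U x\<bar> \<le> B"
  shows "(LINT z|(M \<Otimes>\<^sub>M M). (U (fst z) - U (snd z))\<^sup>2) = 2 * ((LINT x|M. (U x)\<^sup>2) - (LINT x|M. U x)\<^sup>2)"
proof -
  interpret MM: pair_prob_space M M ..
  have i: "integrable M U" by (rule integrable_const_bound[where B = B]) (use B in auto)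
  have i2: "integrable M (\<lambda>x. (U x)\<^sup>2)"
    by (rule integrable_const_bound[where B = "B\<^sup>2"]) (use power_mono[OF B abs_ge_zero, of _ 2] in auto)
  have "\<bar>(U (fst z) - U (snd z))\<^sup>2\<bar> \<le> (B + B)\<^sup>2" for z
  proof -
    have "\<bar>U (fst z) - U (snd z)\<bar> \<le> \<bar>B + B\<bar>"
      using B[of "fst z"] B[of "snd z"] by linarith
    then show ?thesis
      unfolding abs_power2 by (rule abs_le_square_iff[THEN iffD1])
  qed
  then have int: "integrable (M \<Otimes>\<^sub>M M) (\<lambda>z. (U (fst z) - U (snd z))\<^sup>2)"
    by (intro MM.integrable_const_bound[where B = "(B + B)\<^sup>2"]) auto
  have "(LINT z|(M \<Otimes>\<^sub>M M). (U (fst z) - U (snd z))\<^sup>2) = (LINT x|M. LINT y|M. (U x - U y)\<^sup>2)"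
    using MM.integral_fst'[OF int] by simp
  also have "\<dots> = (LINT x|M. (U x)\<^sup>2 - 2 * U x * (LINT y|M. U y) + (LINT y|M. (U y)\<^sup>2))"
    unfolding power2_diff using i i2 by (simp add: prob_space algebra_simps)
  also have "\<dots> = 2 * ((LINT x|M. (U x)\<^sup>2) - (LINT x|M. U x)\<^sup>2)"
    using i i2 by (simp add: prob_space power2_eq_square)
  finally show ?thesis .
qed

subsection \<open>The trace inequality on a ball\<close>

lemma ball_trace:
  fixes u :: "real ^ 'n \<Rightarrow> real" and G :: "real ^ 'n \<Rightarrow> real ^ 'n"
  assumes n: "CARD('n) \<ge> 2" and R: "R > 0"
    and u [measurable]: "u \<in> borel_measurable borel" and G [measurable]: "G \<in> borel_measurable borel"
    and uB: "\<And>x. \<bar>u x\<bar> \<le> B" and GB: "\<And>x. norm (G x) \<le> B"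
    and uG: "\<And>x. x \<in> ball q R \<Longrightarrow> GDERIV u x :> G x"
    and G_cont: "continuous_on (ball q R) G" and u_cont: "continuous_on (cball q R) u"
  shows "R ^ (CARD('n) - 2) * ((LINT x|gauss. (u (q + R *\<^sub>R sgn x))\<^sup>2) - (LINT x|gauss. u (q + R *\<^sub>R sgn x))\<^sup>2)
    \<le> (LINT s:{0..R}|lborel. s ^ (CARD('n) - 1) * (LINT x|gauss. (norm (G (q + s *\<^sub>R sgn x)))\<^sup>2))"
proof -
  let ?n = "CARD('n)"
  let ?\<Gamma> = "(gauss :: (real ^ 'n) measure) \<Otimes>\<^sub>M (gauss :: (real ^ 'n) measure)"
  interpret \<Gamma>: pair_prob_space "gauss :: (real ^ 'n) measure" "gauss :: (real ^ 'n) measure" ..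
  interpret \<Gamma>L: pair_sigma_finite ?\<Gamma> "lborel :: real measure" ..
  have B: "B \<ge> 0" using uB abs_ge_zero order_trans by blast
  define U where "U s x = u (q + s *\<^sub>R sgn x)" for s and x :: "real ^ 'n"
  define P where "P s x = G (q + s *\<^sub>R sgn x) \<bullet> sgn x" for s and x :: "real ^ 'n"
  define d where "d z s = U s (fst z) - U s (snd z)" for z s
  define d' where "d' z s = P s (fst z) - P s (snd z)" for z s
  define W where "W s = (LINT z|?\<Gamma>. (d z s)\<^sup>2)" for s
  define I where "I s = (LINT x|gauss. (norm (G (q + s *\<^sub>R sgn x)))\<^sup>2)" for s
  define T where "T = (LINT s:{0..R}|lborel. s ^ (?n - 1) * I s)"
  define H where "H z s = (real ?n - 1) * (s ^ (?n - 2) / s) * (d z s)\<^sup>2 + s ^ (?n - 1) * (d' z s)\<^sup>2" for z s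
  have sgn_le: "norm (sgn x) \<le> 1" for x :: "real ^ 'n"
    by (simp add: norm_sgn)
  have UB: "\<bar>U s x\<bar> \<le> B" for s x
    by (simp add: U_def uB)
  have PB: "\<bar>P s x\<bar> \<le> B" for s x
  proof -
    have "\<bar>P s x\<bar> \<le> norm (G (q + s *\<^sub>R sgn x)) * norm (sgn x)"
      unfolding P_def by (rule Cauchy_Schwarz_ineq2)
    also have "\<dots> \<le> B * 1"
      by (intro mult_mono GB sgn_le B) simp
    finally show ?thesis by simp
  qed
  have U_m [measurable]: "U s \<in> borel_measurable borel" and P_m [measurable]: "P s \<in> borel_measurable borel" for s
    unfolding U_def[abs_def] P_def[abs_def] by measurable
  have d_m [measurable]: "(\<lambda>z. d z s) \<in> borel_measurable ?\<Gamma>" and d'_m [measurable]: "(\<lambda>z. d' z s) \<in> borel_measurable ?\<Gamma>" for s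
    unfolding d_def d'_def by measurable
  have H_m [measurable]: "(\<lambda>(z, s). H z s) \<in> borel_measurable (?\<Gamma> \<Otimes>\<^sub>M lborel)"
    unfolding H_def d_def d'_def U_def P_def by measurable
  have diffB: "(a - b)\<^sup>2 \<le> (2 * B)\<^sup>2" if "\<bar>a\<bar> \<le> B" "\<bar>b\<bar> \<le> B" for a b :: real
    using that B by (intro abs_le_square_iff[THEN iffD1]) linarith
  have d_sq: "(d z s)\<^sup>2 \<le> (2 * B)\<^sup>2" and d'_sq: "(d' z s)\<^sup>2 \<le> (2 * B)\<^sup>2" for z s
    unfolding d_def d'_def by (intro diffB UB PB)+
  have int_d: "integrable ?\<Gamma> (\<lambda>z. (d z s)\<^sup>2)" and int_d': "integrable ?\<Gamma> (\<lambda>z. (d' z s)\<^sup>2)" for s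
    using d_sq d'_sq by (intro \<Gamma>.integrable_const_bound[where B = "(2 * B)\<^sup>2"] AE_I2; simp)+
  have I_m [measurable]: "I \<in> borel_measurable borel"
  proof -
    have "(\<lambda>(s, x). (norm (G (q + s *\<^sub>R sgn x)))\<^sup>2) \<in> borel_measurable (borel \<Otimes>\<^sub>M gauss)"
      by measurable
    then show ?thesis
      unfolding I_def[abs_def] by (rule gauss.borel_measurable_lebesgue_integral)
  qed
  have G_sq: "(norm (G x))\<^sup>2 \<le> B\<^sup>2" for x
    by (intro power_mono GB) simp
  have int_G: "integrable gauss (\<lambda>x. (norm (G (q + s *\<^sub>R sgn x)))\<^sup>2)" for s
    using G_sq by (intro gauss.integrable_const_bound[where B = "B\<^sup>2"] AE_I2) simp_all
  have int_P: "integrable gauss (\<lambda>x. (P s x)\<^sup>2)" for s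
    using power_mono[OF PB abs_ge_zero, of _ _ 2] by (intro gauss.integrable_const_bound[where B = "B\<^sup>2"] AE_I2) simp_all
  have I0: "0 \<le> I s" and IB: "I s \<le> B\<^sup>2" for s
  proof -
    show "0 \<le> I s" unfolding I_def by (intro integral_nonneg_AE) auto
    have "I s \<le> (LINT x|(gauss :: (real ^ 'n) measure). B\<^sup>2)"
      unfolding I_def by (intro integral_mono int_G G_sq) simp
    then show "I s \<le> B\<^sup>2" by simp
  qed
  have int_T: "set_integrable lborel {0..R} (\<lambda>s. s ^ (?n - 1) * I s)"
  proof (rule set_integrable_bounded_Icc[where B = "R ^ (?n - 1) * B\<^sup>2"])
    show "\<bar>s ^ (?n - 1) * I s\<bar> \<le> R ^ (?n - 1) * B\<^sup>2" if "s \<in> {0..R}" for s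
      using that I0[of s] IB[of s] by (auto simp: abs_mult intro!: mult_mono power_mono)
  qed simp
  have W_var: "W s = 2 * ((LINT x|gauss. (U s x)\<^sup>2) - (LINT x|gauss. U s x)\<^sup>2)" for s
    unfolding W_def d_def by (rule gauss.integral_pair_diff_square[where B = B]) (simp_all add: UB)
  have H_le: "(LINT z|?\<Gamma>. H z s) \<le> 2 * (s ^ (?n - 1) * I s)" if s: "0 < s" "s < R" for s
  proof -
    have sp: "(real ?n - 1) * ((LINT x|gauss. (u (q + s *\<^sub>R sgn x))\<^sup>2) - (LINT x|gauss. u (q + s *\<^sub>R sgn x))\<^sup>2)
      \<le> s\<^sup>2 * (LINT x|gauss. (norm (G (q + s *\<^sub>R sgn x)))\<^sup>2 - (G (q + s *\<^sub>R sgn x) \<bullet> sgn x)\<^sup>2)"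
    proof (rule sphere_poincare[OF u G uB GB s(1)])
      show "GDERIV u x :> G x" if "norm (x - q) = s" for x
        using s that by (intro uG) (simp add: dist_norm norm_minus_commute)
    qed
    let ?J = "LINT x|gauss. (P s x)\<^sup>2"
    have v: "(real ?n - 1) * W s \<le> 2 * (s\<^sup>2 * (I s - ?J))"
    proof -
      have "(LINT x|gauss. (norm (G (q + s *\<^sub>R sgn x)))\<^sup>2 - (G (q + s *\<^sub>R sgn x) \<bullet> sgn x)\<^sup>2) = I s - ?J"
        unfolding I_def P_def[symmetric] by (rule Bochner_Integration.integral_diff[OF int_G int_P])
      then show ?thesis
        using sp unfolding W_var U_def by (simp only: mult.left_commute[of _ 2] mult_le_cancel_left_pos zero_less_numeral)
    qed
    have "(LINT z|?\<Gamma>. (d' z s)\<^sup>2) = 2 * (?J - (LINT x|gauss. P s x)\<^sup>2)"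
      unfolding d'_def by (rule gauss.integral_pair_diff_square[where B = B]) (simp_all add: PB)
    then have v': "(LINT z|?\<Gamma>. (d' z s)\<^sup>2) \<le> 2 * ?J" by simp
    have e: "s ^ (?n - 1) = s ^ (?n - 2) / s * s\<^sup>2"
    proof -
      have "Suc (?n - 2) = ?n - 1" using n by simp
      then have "s ^ (?n - 1) = s ^ (?n - 2) * s"
        using power_Suc2[of s "?n - 2"] by simp
      then show ?thesis using s by (simp add: power2_eq_square)
    qed
    have "(LINT z|?\<Gamma>. H z s) = (s ^ (?n - 2) / s) * ((real ?n - 1) * W s) + s ^ (?n - 1) * (LINT z|?\<Gamma>. (d' z s)\<^sup>2)"
      unfolding H_def W_def using int_d[of s] int_d'[of s] by simp
    also have "\<dots> \<le> (s ^ (?n - 2) / s) * (2 * (s\<^sup>2 * (I s - ?J))) + s ^ (?n - 1) * (2 * ?J)"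
      using s by (intro add_mono mult_left_mono v v') auto
    also have "\<dots> = 2 * (s ^ (?n - 1) * I s)"
      unfolding e by (simp add: algebra_simps)
    finally show ?thesis .
  qed
  have step: "\<rho> ^ (?n - 2) * W \<rho> - \<epsilon> ^ (?n - 2) * W \<epsilon> \<le> 2 * T" if \<epsilon>: "0 < \<epsilon>" "\<epsilon> \<le> \<rho>" "\<rho> < R" for \<epsilon> \<rho>
  proof -
    let ?K = "\<lambda>z s. indicator {\<epsilon>..\<rho>} s *\<^sub>R H z s"
    have H0: "0 \<le> H z s" if "s \<in> {\<epsilon>..\<rho>}" for z s
      using that \<epsilon> n unfolding H_def by (intro add_nonneg_nonneg mult_nonneg_nonneg) auto
    have int_H: "integrable (?\<Gamma> \<Otimes>\<^sub>M lborel) (\<lambda>(z, s). ?K z s)"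
    proof (rule integrableI_bounded_set[where A = "UNIV \<times> {\<epsilon>..\<rho>}" and B = "(real ?n - 1) * (\<rho> ^ (?n - 2) / \<epsilon>) * (2 * B)\<^sup>2 + \<rho> ^ (?n - 1) * (2 * B)\<^sup>2"])
      have sp: "space ?\<Gamma> = UNIV"
        by (simp add: space_pair_measure)
      have U\<Gamma>: "UNIV \<in> sets ?\<Gamma>"
        unfolding sp[symmetric] by (rule sets.top)
      have "emeasure (?\<Gamma> \<Otimes>\<^sub>M lborel) (UNIV \<times> {\<epsilon>..\<rho>}) = emeasure ?\<Gamma> UNIV * emeasure lborel {\<epsilon>..\<rho>}"
        by (rule lborel.emeasure_pair_measure_Times[OF U\<Gamma>]) simp
      also have "emeasure ?\<Gamma> UNIV = 1"
        using \<Gamma>.emeasure_space_1 unfolding sp .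
      finally show "emeasure (?\<Gamma> \<Otimes>\<^sub>M lborel) (UNIV \<times> {\<epsilon>..\<rho>}) < \<infinity>"
        by (simp add: emeasure_lborel_Icc_eq)
      show "UNIV \<times> {\<epsilon>..\<rho>} \<in> sets (?\<Gamma> \<Otimes>\<^sub>M lborel)"
        by (rule pair_measureI[OF U\<Gamma>]) simp
      have bound: "\<bar>H z s\<bar> \<le> (real ?n - 1) * (\<rho> ^ (?n - 2) / \<epsilon>) * (2 * B)\<^sup>2 + \<rho> ^ (?n - 1) * (2 * B)\<^sup>2" if s: "s \<in> {\<epsilon>..\<rho>}" for z s
        unfolding abs_of_nonneg[OF H0[OF s]] unfolding H_def using s \<epsilon> n
        by (intro add_mono mult_mono d_sq d'_sq frac_le power_mono) auto
      show "AE z in ?\<Gamma> \<Otimes>\<^sub>M lborel. z \<in> UNIV \<times> {\<epsilon>..\<rho>} \<longrightarrow> norm (case z of (z, s) \<Rightarrow> ?K z s) \<le> (real ?n - 1) * (\<rho> ^ (?n - 2) / \<epsilon>) * (2 * B)\<^sup>2 + \<rho> ^ (?n - 1) * (2 * B)\<^sup>2"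
        using bound by (intro AE_I2) (auto simp: indicator_def)
    qed (auto simp: case_prod_unfold indicator_def intro!: measurable_compose[OF _ H_m[unfolded case_prod_unfold]])
    have in_ball: "q + s *\<^sub>R sgn x \<in> ball q R" if "s \<in> {\<epsilon>..\<rho>}" for s and x :: "real ^ 'n"
    proof -
      have "norm (s *\<^sub>R sgn x) \<le> \<bar>s\<bar> * 1"
        unfolding norm_scaleR by (intro mult_left_mono sgn_le) simp
      then show ?thesis using that \<epsilon> by (simp add: dist_norm del: norm_scaleR)
    qed
    have DU: "((\<lambda>s. U s x) has_real_derivative P s x) (at s)" if s: "s \<in> {\<epsilon>..\<rho>}" for s x
    proof -
      have "((\<lambda>s. u (q + s *\<^sub>R sgn x)) has_derivative (\<lambda>h. (h *\<^sub>R sgn x) \<bullet> G (q + s *\<^sub>R sgn x))) (at s)"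
        by (rule has_derivative_compose[where f = "\<lambda>s. q + s *\<^sub>R sgn x" and f' = "\<lambda>h. h *\<^sub>R sgn x" and g = u,
              OF _ uG[OF in_ball[OF s, of x], unfolded gderiv_def]])
           (auto intro!: derivative_eq_intros)
      then show ?thesis
        unfolding U_def P_def by (simp add: has_field_derivative_def inner_commute mult_commute_abs)
    qed
    have P_cont: "continuous_on {\<epsilon>..\<rho>} (\<lambda>s. P s x)" for x
      unfolding P_def
      by (intro continuous_on_inner continuous_on_compose2[OF G_cont] continuous_intros) (use in_ball in blast)
    have "\<rho> ^ (?n - 2) * W \<rho> - \<epsilon> ^ (?n - 2) * W \<epsilon> = (LINT z|?\<Gamma>. \<rho> ^ (?n - 2) * (d z \<rho>)\<^sup>2 - \<epsilon> ^ (?n - 2) * (d z \<epsilon>)\<^sup>2)"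
      unfolding W_def using int_d[of \<rho>] int_d[of \<epsilon>] by simp
    also have "\<dots> \<le> (LINT z|?\<Gamma>. LINT s|lborel. ?K z s)"
    proof (rule integral_mono)
      show "integrable ?\<Gamma> (\<lambda>z. \<rho> ^ (?n - 2) * (d z \<rho>)\<^sup>2 - \<epsilon> ^ (?n - 2) * (d z \<epsilon>)\<^sup>2)"
        using int_d[of \<rho>] int_d[of \<epsilon>] by simp
      show "integrable ?\<Gamma> (\<lambda>z. LINT s|lborel. ?K z s)"
        using \<Gamma>L.integrable_fst'[OF int_H] by simp
      show "\<rho> ^ (?n - 2) * (d z \<rho>)\<^sup>2 - \<epsilon> ^ (?n - 2) * (d z \<epsilon>)\<^sup>2 \<le> (LINT s|lborel. ?K z s)" for z
        unfolding H_def set_lebesgue_integral_def[symmetric]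
      proof (rule radial_energy_le[OF n \<epsilon>(1,2)])
        show "(d z has_real_derivative d' z s) (at s)" if "\<epsilon> \<le> s" "s \<le> \<rho>" for s
          unfolding d_def[abs_def] d'_def using that by (intro derivative_intros DU) auto
        show "continuous_on {\<epsilon>..\<rho>} (d' z)"
          unfolding d'_def[abs_def] by (intro continuous_intros P_cont)
      qed
    qed
    also have "\<dots> = (LINT s|lborel. LINT z|?\<Gamma>. ?K z s)"
      by (rule \<Gamma>L.Fubini_integral[OF int_H, symmetric])
    also have "\<dots> \<le> (LINT s|lborel. indicator {0..R} s *\<^sub>R (2 * (s ^ (?n - 1) * I s)))"
    proof (rule integral_mono)
      show "integrable lborel (\<lambda>s. LINT z|?\<Gamma>. ?K z s)"
        using \<Gamma>L.integrable_snd[OF int_H] .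
      show "integrable lborel (\<lambda>s. indicator {0..R} s *\<^sub>R (2 * (s ^ (?n - 1) * I s)))"
        using integrable_mult_right[OF int_T[unfolded set_integrable_def], of 2] by (simp add: mult_ac)
      fix s
      show "(LINT z|?\<Gamma>. ?K z s) \<le> indicator {0..R} s *\<^sub>R (2 * (s ^ (?n - 1) * I s))"
        using H_le[of s] \<epsilon> I0[of s] by (auto simp: indicator_def)
    qed
    also have "\<dots> = 2 * T"
      unfolding T_def set_lebesgue_integral_def
      by (subst integral_mult_right_zero[symmetric]) (simp add: mult_ac)
    finally show ?thesis .
  qed
  define \<epsilon> where "\<epsilon> k = R / (real k + 3)" for k :: nat
  define \<rho> where "\<rho> k = R - \<epsilon> k" for k
  have \<epsilon>_bounds: "0 < \<epsilon> k" "\<epsilon> k \<le> R / 3" for k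
    using R by (auto simp: \<epsilon>_def field_simps)
  have \<epsilon>_lim: "\<epsilon> \<longlonglongrightarrow> 0"
    unfolding \<epsilon>_def[abs_def] by real_asymp
  have \<rho>_lim: "\<rho> \<longlonglongrightarrow> R"
    unfolding \<rho>_def[abs_def] using tendsto_diff[OF tendsto_const[of R] \<epsilon>_lim] by simp
  have U_lim: "(\<lambda>k. U (t k) x) \<longlonglongrightarrow> U t0 x" if t: "t \<longlonglongrightarrow> t0" "\<And>k. 0 \<le> t k" "\<And>k. t k \<le> R" "0 \<le> t0" "t0 \<le> R" for t t0 x
    unfolding U_def
  proof (rule continuous_on_tendsto_compose[OF u_cont])
    show "(\<lambda>k. q + t k *\<^sub>R sgn x) \<longlonglongrightarrow> q + t0 *\<^sub>R sgn x"
      by (intro tendsto_intros t(1))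
    have in_cball: "q + s *\<^sub>R sgn x \<in> cball q R" if "0 \<le> s" "s \<le> R" for s
    proof -
      have "norm (s *\<^sub>R sgn x) \<le> \<bar>s\<bar> * 1"
        unfolding norm_scaleR by (intro mult_left_mono sgn_le) simp
      then show ?thesis using that by (simp add: dist_norm del: norm_scaleR)
    qed
    show "q + t0 *\<^sub>R sgn x \<in> cball q R" by (rule in_cball[OF t(4,5)])
    show "\<forall>\<^sub>F k in sequentially. q + t k *\<^sub>R sgn x \<in> cball q R"
      using in_cball t(2,3) by simp
  qed
  have W_lim: "(\<lambda>k. W (t k)) \<longlonglongrightarrow> W t0" if t: "t \<longlonglongrightarrow> t0" "\<And>k. 0 \<le> t k" "\<And>k. t k \<le> R" "0 \<le> t0" "t0 \<le> R" for t t0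
    unfolding W_def
  proof (rule integral_dominated_convergence[where w = "\<lambda>_. (2 * B)\<^sup>2"])
    show "AE z in ?\<Gamma>. (\<lambda>k. (d z (t k))\<^sup>2) \<longlonglongrightarrow> (d z t0)\<^sup>2"
      unfolding d_def by (intro AE_I2 tendsto_intros U_lim[OF t])
    show "AE z in ?\<Gamma>. norm ((d z (t k))\<^sup>2) \<le> (2 * B)\<^sup>2" for k
      using d_sq by (intro AE_I2) simp
  qed auto
  have \<epsilon>R: "0 \<le> \<epsilon> k" "\<epsilon> k \<le> R" for k
    using \<epsilon>_bounds[of k] R by simp_all
  have W1: "(\<lambda>k. W (\<epsilon> k)) \<longlonglongrightarrow> W 0"
    by (rule W_lim[OF \<epsilon>_lim]) (use \<epsilon>R R in auto)
  have W2: "(\<lambda>k. W (\<rho> k)) \<longlonglongrightarrow> W R"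
    by (rule W_lim[OF \<rho>_lim]) (use \<epsilon>R R in \<open>auto simp: \<rho>_def\<close>)
  have "W 0 = 0"
    by (simp add: W_def d_def U_def)
  then have "(\<lambda>k. \<rho> k ^ (?n - 2) * W (\<rho> k) - \<epsilon> k ^ (?n - 2) * W (\<epsilon> k)) \<longlonglongrightarrow> R ^ (?n - 2) * W R - 0 ^ (?n - 2) * 0"
    using W1 W2 by (intro tendsto_diff tendsto_mult tendsto_power \<rho>_lim \<epsilon>_lim) simp_all
  moreover have "\<rho> k ^ (?n - 2) * W (\<rho> k) - \<epsilon> k ^ (?n - 2) * W (\<epsilon> k) \<le> 2 * T" for k
    using \<epsilon>_bounds[of k] R by (intro step) (auto simp: \<rho>_def)
  ultimately have "R ^ (?n - 2) * W R - 0 ^ (?n - 2) * 0 \<le> 2 * T"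
    by (intro LIMSEQ_le_const2) auto
  then have "R ^ (?n - 2) * W R \<le> 2 * T" by simp
  then have "R ^ (?n - 2) * ((LINT x|gauss. (U R x)\<^sup>2) - (LINT x|gauss. U R x)\<^sup>2) \<le> T"
    unfolding W_var mult.left_commute[of _ 2] by linarith
  then show ?thesis
    unfolding U_def T_def I_def .
qed

lemma divergence_radial:
  fixes \<phi> :: "real ^ 'n \<Rightarrow> real"
  assumes \<phi>: "C1 \<phi>"
  shows "C1_field (\<lambda>x. \<phi> x *\<^sub>R (x - q))"
    and "divergence (\<lambda>x. \<phi> x *\<^sub>R (x - q)) x = real CARD('n) * \<phi> x + grad \<phi> x \<bullet> (x - q)"
proof -
  have c: "C1 (\<lambda>x. x $ i - q $ i)" for i
    by (intro C1_diff C1_component C1_const)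
  show "C1_field (\<lambda>x. \<phi> x *\<^sub>R (x - q))"
    unfolding C1_field_def using C1_mult[OF \<phi> c] by simp
  have g: "grad (\<lambda>x. x $ i - q $ i) x = axis i 1" for i
    using grad_add[OF C1_component C1_const, of i "- q $ i" x] by (simp add: grad_component)
  show "divergence (\<lambda>x. \<phi> x *\<^sub>R (x - q)) x = real CARD('n) * \<phi> x + grad \<phi> x \<bullet> (x - q)"
  proof -
    have "grad (\<lambda>x. \<phi> x * (x $ i - q $ i)) x $ i = \<phi> x + grad \<phi> x $ i * (x $ i - q $ i)" for i
      by (simp add: grad_mult[OF \<phi> c] g)
    then show ?thesis
      unfolding divergence_def inner_vec_def by (simp add: sum.distrib)
  qed
qed

lemma integral_lborel_translate:
  fixes f :: "'a::euclidean_space \<Rightarrow> real"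
  assumes "f \<in> borel_measurable borel"
  shows "(LINT x|lborel. f (q + x)) = (LINT x|lborel. f x)"
  using integral_distr[of "(+) q" lborel borel f] assms by (simp add: lborel_distr_plus)

lemma C1_real_polynomial_function:
  fixes f :: "'a::euclidean_space \<Rightarrow> real"
  shows "real_polynomial_function f \<Longrightarrow> C1 f"
proof (induction rule: real_polynomial_function.induct)
  case (linear f)
  interpret f: bounded_linear f by fact
  have "f = (\<lambda>x. x \<bullet> (\<Sum>b\<in>Basis. f b *\<^sub>R b))"
  proof
    fix x
    have "f x = f (\<Sum>b\<in>Basis. (x \<bullet> b) *\<^sub>R b)"
      by (simp add: euclidean_representation)
    then show "f x = x \<bullet> (\<Sum>b\<in>Basis. f b *\<^sub>R b)"
      by (simp add: f.sum f.scaleR inner_sum_right mult.commute)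
  qed
  then show ?case
    using C1_inner by metis
qed (auto intro: C1_add C1_mult)

context smooth_domain
begin

lemma sphere_normal:
  assumes \<Omega>: "\<Omega> = ball q R" and R: "R > 0" and \<gamma>': "smooth_graph_function k \<gamma>"
    and os: "one_sided \<Omega> (ball c r) k \<gamma> s" and x: "x \<in> M" "x \<in> ball c r"
  shows "s * ((x - q) \<bullet> graph_normal k \<gamma> x) = R"
proof -
  note \<gamma> = smooth_graph_functionD(1)[OF \<gamma>']
  have C1\<gamma>: "C1 \<gamma>" and inv: "\<And>x t. \<gamma> (x + t *\<^sub>R axis k 1) = \<gamma> x"
    using \<gamma> by (auto simp: graph_function_def)
  have s: "s = 1 \<or> s = -1" by (rule one_sided_sign[OF os])
  have M: "y \<in> M \<longleftrightarrow> norm (y - q) = R" for y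
    using R by (simp add: \<Omega> dist_norm norm_minus_commute)
  have graphI: "y \<in> M" if "y \<in> ball c r" "y $ k = \<gamma> y" for y
    using frontier_one_sided[OF open_domain open_ball \<gamma> os] that by blast
  have xk: "x $ k = \<gamma> x"
    using frontier_one_sided[OF open_domain open_ball \<gamma> os] x by blast
  define S where "S y = y + (\<gamma> y - y $ k) *\<^sub>R axis k 1" for y
  define z where "z = x - q"
  have Sx: "S x = x" by (simp add: S_def xk)
  have S_cont: "continuous_on UNIV S"
    unfolding S_def[abs_def] using C1_continuous[OF C1\<gamma>]
    by (intro continuous_intros)
  have S_graph: "S y $ k = \<gamma> (S y)" for y
    by (simp add: S_def inv)
  have "open (S -` ball c r)"
    using S_cont by (simp add: open_vimage)
  moreover have "x \<in> S -` ball c r"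
    using x Sx by simp
  moreover have "(S y - q) \<bullet> (S y - q) = R\<^sup>2" if "y \<in> S -` ball c r" for y
    using graphI[OF _ S_graph, of y] that M by (simp add: power2_norm_eq_inner[symmetric])
  ultimately have const: "((\<lambda>y. (S y - q) \<bullet> (S y - q)) has_derivative (\<lambda>h. 0)) (at x)"
    by (intro has_derivative_transform_within_open[OF has_derivative_const, of "S -` ball c r" x "R\<^sup>2"]) auto
  have S_der: "(S has_derivative (\<lambda>h. h + (h \<bullet> grad \<gamma> x - h $ k) *\<^sub>R axis k 1)) (at x)"
    unfolding S_def[abs_def]
    by (auto intro!: derivative_eq_intros C1_has_derivative[OF C1\<gamma>] bounded_linear_imp_has_derivative)
  have "((\<lambda>y. (S y - q) \<bullet> (S y - q)) has_derivative
      (\<lambda>h. z \<bullet> (h + (h \<bullet> grad \<gamma> x - h $ k) *\<^sub>R axis k 1) + (h + (h \<bullet> grad \<gamma> x - h $ k) *\<^sub>R axis k 1) \<bullet> z)) (at x)"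
    using has_derivative_inner[OF has_derivative_diff[OF S_der has_derivative_const[of q]] has_derivative_diff[OF S_der has_derivative_const[of q]]]
    by (simp add: Sx z_def)
  from has_derivative_unique[OF this const]
  have "z \<bullet> (h + (h \<bullet> grad \<gamma> x - h $ k) *\<^sub>R axis k 1) = 0" for h
    by (auto simp: fun_eq_iff inner_commute)
  then have "h \<bullet> (z + (z $ k) *\<^sub>R (grad \<gamma> x - axis k 1)) = 0" for h
    by (simp add: inner_simps inner_axis algebra_simps inner_commute)
  from this[of "z + (z $ k) *\<^sub>R (grad \<gamma> x - axis k 1)"]
  have z_eq: "z = (- (z $ k)) *\<^sub>R (grad \<gamma> x - axis k 1)"
    by (simp add: eq_neg_iff_add_eq_0)
  define L where "L = sqrt (1 + (norm (grad \<gamma> x))\<^sup>2)"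
  have L: "L > 0" by (simp add: L_def add_pos_nonneg)
  have z_n: "z = (- (z $ k) * L) *\<^sub>R graph_normal k \<gamma> x"
    using L by (subst z_eq) (simp add: graph_normal_def L_def[symmetric])
  have norm_z: "norm z = R"
    using x M by (simp add: z_def)
  have abs: "\<bar>z $ k\<bar> * L = R"
    using norm_z L by (subst (asm) z_n) (simp add: norm_graph_normal[OF \<gamma>] abs_mult)
  have sign: "s * (z $ k) < 0"
  proof -
    obtain e where e: "e > 0" "\<And>t. \<bar>t\<bar> < e \<Longrightarrow> x + t *\<^sub>R axis k 1 \<in> ball c r"
      using open_contains_segment[OF open_ball x(2)] by blast
    let ?t = "s * (e / 2)"
    have "x + ?t *\<^sub>R axis k 1 \<in> ball c r"
      using s e(1) by (intro e(2)) auto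
    moreover have "s * ((x + ?t *\<^sub>R axis k 1) $ k - \<gamma> (x + ?t *\<^sub>R axis k 1)) > 0"
      using s e(1) xk by (auto simp: inv)
    ultimately have "x + ?t *\<^sub>R axis k 1 \<in> \<Omega>"
      using one_sided_iff[OF os] by blast
    then have "norm (z + ?t *\<^sub>R axis k 1) < R"
      by (simp add: \<Omega> z_def dist_norm norm_minus_commute[of q] algebra_simps)
    then have "(norm (z + ?t *\<^sub>R axis k 1))\<^sup>2 < (norm z)\<^sup>2"
      unfolding norm_z by (intro power_strict_mono) auto
    then have "2 * (?t * (z $ k)) + ?t * ?t < 0"
      unfolding power2_norm_eq_inner by (simp add: inner_simps inner_axis inner_axis' algebra_simps)
    then have "?t * (z $ k) < 0"
      using zero_le_square[of ?t] by linarith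
    then show ?thesis
      using e(1) by (simp add: mult_less_0_iff zero_less_mult_iff)
  qed
  have "s * (z \<bullet> graph_normal k \<gamma> x) = s * (- (z $ k) * L)"
    by (subst z_n) (simp add: graph_normal_unit[OF \<gamma>])
  also have "\<dots> = \<bar>z $ k\<bar> * L"
    using s sign by auto
  finally show ?thesis
    using abs by (simp add: z_def)
qed

lemma sphere_integral_C1:
  assumes \<Omega>: "\<Omega> = ball q R" and R: "R > 0" and \<phi>: "C1 \<phi>"
  shows "R * (LINT x|\<sigma>. \<phi> x) = (LINT x|lborel. indicator \<Omega> x * (real CARD('n) * \<phi> x + grad \<phi> x \<bullet> (x - q)))"
proof -
  have le: "(LINT x|lborel. indicator \<Omega> x * (real CARD('n) * \<phi> x + grad \<phi> x \<bullet> (x - q))) \<le> (LINT x|\<sigma>. R * \<phi> x)" if \<phi>: "C1 \<phi>" for \<phi>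
    unfolding divergence_radial(2)[OF \<phi>, symmetric]
  proof (rule integral_divergence_le[OF divergence_radial(1)[OF \<phi>]])
    show "continuous_on UNIV (\<lambda>x. R * \<phi> x)"
      using C1_continuous[OF \<phi>] by (intro continuous_intros)
    fix c r k \<gamma> s x
    assume "smooth_graph_function k \<gamma>" "one_sided \<Omega> (ball c r) k \<gamma> s" "x \<in> M" "x \<in> ball c r"
    then have e: "s * ((x - q) \<bullet> graph_normal k \<gamma> x) = R"
      by (rule sphere_normal[OF \<Omega> R])
    show "s * (\<phi> x *\<^sub>R (x - q) \<bullet> graph_normal k \<gamma> x) \<le> R * \<phi> x"
      unfolding inner_scaleR_left mult.left_commute[of s] e by (simp add: mult.commute)
  qed
  have "(LINT x|lborel. indicator \<Omega> x * (real CARD('n) * (- \<phi> x) + grad (\<lambda>x. - \<phi> x) x \<bullet> (x - q)))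
      = (LINT x|lborel. - (indicator \<Omega> x * (real CARD('n) * \<phi> x + grad \<phi> x \<bullet> (x - q))))"
    by (simp add: grad_minus[OF \<phi>] algebra_simps)
  then show ?thesis
    using le[OF \<phi>] le[OF C1_minus[OF \<phi>]] by simp
qed

lemma sphere_integral_polar_C1:
  fixes \<phi> :: "real ^ 'n \<Rightarrow> real"
  assumes \<Omega>: "\<Omega> = ball q R" and R: "R > 0" and \<phi>: "C1 \<phi>"
    and polar: "\<And>(g :: real ^ 'n \<Rightarrow> real) B R. g \<in> borel_measurable borel \<Longrightarrow> (\<And>x. \<bar>g x\<bar> \<le> B) \<Longrightarrow> (\<And>x. norm x > R \<Longrightarrow> g x = 0) \<Longrightarrow>
      (LINT x|gauss. (LINT s:{0..R}|lborel. s ^ (CARD('n) - 1) * g (s *\<^sub>R sgn x))) = C * (LINT z|lborel. g z)"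
  shows "C * (LINT x|\<sigma>. \<phi> x) = R ^ (CARD('n) - 1) * (LINT x|gauss. \<phi> (q + R *\<^sub>R sgn x))"
proof -
  let ?n = "CARD('n)"
  define v where "v x = real ?n * \<phi> x + grad \<phi> x \<bullet> (x - q)" for x
  have v_cont: "continuous_on UNIV v"
    unfolding v_def[abs_def] using C1_continuous[OF \<phi>] C1_continuous_grad[OF \<phi>] by (intro continuous_intros)
  have v_m [measurable]: "v \<in> borel_measurable borel"
    by (rule borel_measurable_continuous_onI[OF v_cont])
  have \<phi>_m [measurable]: "\<phi> \<in> borel_measurable borel"
    by (rule borel_measurable_continuous_onI[OF C1_continuous[OF \<phi>]])
  define g where "g y = indicator \<Omega> (q + y) * v (q + y)" for y
  have \<Omega>_m [measurable]: "\<Omega> \<in> sets borel" using open_domain by simp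
  have g_m [measurable]: "g \<in> borel_measurable borel"
    unfolding g_def[abs_def] by measurable
  have "compact (v ` cball q R)"
    using continuous_on_subset[OF v_cont] by (intro compact_continuous_image) auto
  from compact_imp_bounded[OF this] obtain B where B: "\<And>x. x \<in> cball q R \<Longrightarrow> \<bar>v x\<bar> \<le> B"
    unfolding bounded_iff by (metis imageI real_norm_def)
  have B0: "B \<ge> 0" using B[of q] R by (simp add: order_trans[OF abs_ge_zero])
  have gB: "\<bar>g y\<bar> \<le> B" for y
    using B[of "q + y"] B0 by (auto simp: g_def \<Omega> indicator_def dist_norm)
  have gR: "g y = 0" if "norm y > R" for y
    using that by (simp add: g_def \<Omega> dist_norm)
  have n: "Suc (?n - 1) = ?n" by simp
  have inner: "(LINT s:{0..R}|lborel. s ^ (?n - 1) * g (s *\<^sub>R sgn x)) = R ^ ?n * \<phi> (q + R *\<^sub>R sgn x)" if x: "x \<noteq> 0" for x :: "real ^ 'n"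
  proof -
    have "(LINT s:{0..R}|lborel. s ^ (?n - 1) * g (s *\<^sub>R sgn x)) = (LINT s|lborel. indicator {0..R} s *\<^sub>R (s ^ (?n - 1) * v (q + s *\<^sub>R sgn x)))"
      unfolding set_lebesgue_integral_def
    proof (rule integral_cong_AE)
      show "AE s in lborel. indicator {0..R} s *\<^sub>R (s ^ (?n - 1) * g (s *\<^sub>R sgn x)) = indicator {0..R} s *\<^sub>R (s ^ (?n - 1) * v (q + s *\<^sub>R sgn x))"
        using AE_lborel_singleton[of R]
      proof eventually_elim
        fix s :: real assume "s \<noteq> R"
        then show "indicator {0..R} s *\<^sub>R (s ^ (?n - 1) * g (s *\<^sub>R sgn x)) = indicator {0..R} s *\<^sub>R (s ^ (?n - 1) * v (q + s *\<^sub>R sgn x))"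
          using x by (auto simp: g_def \<Omega> indicator_def dist_norm norm_sgn)
      qed
    qed auto
    also have "\<dots> = R ^ ?n * \<phi> (q + R *\<^sub>R sgn x) - 0 ^ ?n * \<phi> (q + 0 *\<^sub>R sgn x)"
    proof (rule integral_FTC_atLeastAtMost)
      show "0 \<le> R" using R by simp
      show "continuous_on {0..R} (\<lambda>s. s ^ (?n - 1) * v (q + s *\<^sub>R sgn x))"
        by (intro continuous_intros continuous_on_compose2[OF v_cont]) auto
      fix s
      have "((\<lambda>s. s ^ ?n * \<phi> (q + s *\<^sub>R sgn x)) has_real_derivative
          (real ?n * s ^ (?n - 1) * \<phi> (q + s *\<^sub>R sgn x) + (grad \<phi> (q + s *\<^sub>R sgn x) \<bullet> sgn x) * s ^ ?n)) (at s)"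
        using DERIV_mult[OF DERIV_pow[of ?n s] C1_DERIV_line[OF \<phi>, of q "sgn x" s]] by simp
      moreover have "real ?n * s ^ (?n - 1) * \<phi> (q + s *\<^sub>R sgn x) + (grad \<phi> (q + s *\<^sub>R sgn x) \<bullet> sgn x) * s ^ ?n
          = s ^ (?n - 1) * v (q + s *\<^sub>R sgn x)"
      proof -
        have "s ^ ?n = s ^ (?n - 1) * s"
          using power_Suc2[of s "?n - 1"] unfolding n .
        then show ?thesis
          by (simp add: v_def algebra_simps)
      qed
      ultimately show "((\<lambda>s. s ^ ?n * \<phi> (q + s *\<^sub>R sgn x)) has_vector_derivative s ^ (?n - 1) * v (q + s *\<^sub>R sgn x)) (at s within {0..R})"
        by (simp add: has_real_derivative_iff_has_vector_derivative[symmetric] has_field_derivative_at_within)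
    qed
    finally show ?thesis by (simp add: power_0_left)
  qed
  have "R ^ ?n * (LINT x|gauss. \<phi> (q + R *\<^sub>R sgn x)) = (LINT x|gauss. R ^ ?n * \<phi> (q + R *\<^sub>R sgn x))"
    by simp
  also have "\<dots> = (LINT x|gauss. (LINT s:{0..R}|lborel. s ^ (?n - 1) * g (s *\<^sub>R sgn x)))"
  proof (rule integral_cong_AE)
    show "AE x in gauss. R ^ ?n * \<phi> (q + R *\<^sub>R sgn x) = (LINT s:{0..R}|lborel. s ^ (?n - 1) * g (s *\<^sub>R sgn x))"
      using AE_gauss_neq_0 by eventually_elim (rule inner[symmetric])
    show "(\<lambda>x :: real ^ 'n. LINT s:{0..R}|lborel. s ^ (?n - 1) * g (s *\<^sub>R sgn x)) \<in> borel_measurable gauss"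
      unfolding set_lebesgue_integral_def
      by (rule lborel.borel_measurable_lebesgue_integral) measurable
  qed auto
  also have "\<dots> = C * (LINT z|lborel. g z)"
    by (rule polar[OF g_m gB gR])
  also have "(LINT z|lborel. g z) = (LINT x|lborel. indicator \<Omega> x * v x)"
    unfolding g_def by (rule integral_lborel_translate) simp
  also have "\<dots> = R * (LINT x|\<sigma>. \<phi> x)"
    unfolding v_def by (rule sphere_integral_C1[OF \<Omega> R \<phi>, symmetric])
  also have "R ^ ?n = R * R ^ (?n - 1)"
    using power_Suc[of R "?n - 1"] unfolding n .
  finally show ?thesis
    using R by simp
qed

lemma sphere_integral_polar:
  fixes \<phi> :: "real ^ 'n \<Rightarrow> real"
  assumes \<Omega>: "\<Omega> = ball q R" and R: "R > 0" and \<phi>: "continuous_on M \<phi>"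
    and \<phi>_m [measurable]: "\<phi> \<in> borel_measurable borel" and C: "C > 0"
    and polar: "\<And>(g :: real ^ 'n \<Rightarrow> real) B R. g \<in> borel_measurable borel \<Longrightarrow> (\<And>x. \<bar>g x\<bar> \<le> B) \<Longrightarrow> (\<And>x. norm x > R \<Longrightarrow> g x = 0) \<Longrightarrow>
      (LINT x|gauss. (LINT s:{0..R}|lborel. s ^ (CARD('n) - 1) * g (s *\<^sub>R sgn x))) = C * (LINT z|lborel. g z)"
  shows "C * (LINT x|\<sigma>. \<phi> x) = R ^ (CARD('n) - 1) * (LINT x|gauss. \<phi> (q + R *\<^sub>R sgn x))"
proof -
  let ?K = "R ^ (CARD('n) - 1)"
  let ?p = "\<lambda>x. q + R *\<^sub>R sgn x"
  interpret finite_measure \<sigma> by (rule finite_surface_measure)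
  have pM: "AE x in gauss. ?p x \<in> M"
    using AE_gauss_neq_0
  proof eventually_elim
    fix x :: "real ^ 'n" assume "x \<noteq> 0"
    then show "?p x \<in> M" using R by (simp add: \<Omega> dist_norm norm_sgn)
  qed
  have int_p: "integrable gauss (\<lambda>x. f (?p x))" if f: "continuous_on M f" and [measurable]: "f \<in> borel_measurable borel" for f :: "real ^ 'n \<Rightarrow> real"
  proof -
    from compact_imp_bounded[OF compact_continuous_image[OF f compact_boundary]]
    obtain B where B: "\<And>x. x \<in> M \<Longrightarrow> norm (f x) \<le> B"
      unfolding bounded_iff by (metis imageI)
    show ?thesis
    proof (rule gauss.integrable_const_bound[where B = B])
      show "AE x in gauss. norm (f (?p x)) \<le> B"
        using pM by eventually_elim (rule B)
    qed simp
  qed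
  have approx: "\<bar>C * (LINT x|\<sigma>. \<phi> x) - ?K * (LINT x|gauss. \<phi> (?p x))\<bar> \<le> e * (C * measure \<sigma> M + ?K)" if e: "e > 0" for e
  proof -
    obtain f where f: "real_polynomial_function f" "\<And>x. x \<in> M \<Longrightarrow> \<bar>\<phi> x - f x\<bar> < e"
      using Stone_Weierstrass_real_polynomial_function[OF compact_boundary \<phi> e] by metis
    have C1f: "C1 f" by (rule C1_real_polynomial_function[OF f(1)])
    have fc: "continuous_on M f"
      by (rule continuous_on_subset[OF C1_continuous[OF C1f]]) simp
    have fm: "f \<in> borel_measurable borel"
      by (rule borel_measurable_continuous_onI[OF C1_continuous[OF C1f]])
    have "\<bar>(LINT x|\<sigma>. \<phi> x) - (LINT x|\<sigma>. f x)\<bar> = \<bar>LINT x|\<sigma>. \<phi> x - f x\<bar>"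
      using integrable_surface_measure[OF \<phi>] integrable_surface_measure[OF fc] by simp
    also have "\<dots> \<le> (LINT x|\<sigma>. \<bar>\<phi> x - f x\<bar>)"
      by (rule integral_abs_bound)
    also have "\<dots> \<le> (LINT x|\<sigma>. e)"
      using integrable_surface_measure[OF \<phi>] integrable_surface_measure[OF fc] f(2)
      by (intro integral_mono) (auto intro: less_imp_le)
    finally have 1: "\<bar>(LINT x|\<sigma>. \<phi> x) - (LINT x|\<sigma>. f x)\<bar> \<le> e * measure \<sigma> M"
      by (simp add: mult.commute)
    have "\<bar>(LINT x|gauss. \<phi> (?p x)) - (LINT x|gauss. f (?p x))\<bar> = \<bar>LINT x|gauss. \<phi> (?p x) - f (?p x)\<bar>"
      using int_p[OF \<phi> \<phi>_m] int_p[OF fc fm] by simp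
    also have "\<dots> \<le> (LINT x|gauss. \<bar>\<phi> (?p x) - f (?p x)\<bar>)"
      by (rule integral_abs_bound)
    also have "\<dots> \<le> (LINT x|(gauss :: (real ^ 'n) measure). e)"
    proof (rule integral_mono_AE)
      show "AE x in gauss. \<bar>\<phi> (?p x) - f (?p x)\<bar> \<le> e"
        using pM by eventually_elim (use f(2) in \<open>auto intro: less_imp_le\<close>)
    qed (use int_p[OF \<phi> \<phi>_m] int_p[OF fc fm] in auto)
    finally have 2: "\<bar>(LINT x|gauss. \<phi> (?p x)) - (LINT x|gauss. f (?p x))\<bar> \<le> e"
      by simp
    let ?a = "LINT x|\<sigma>. \<phi> x" and ?b = "LINT x|\<sigma>. f x" and ?c = "LINT x|gauss. \<phi> (?p x)" and ?d = "LINT x|gauss. f (?p x)"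
    have eq: "C * ?b = ?K * ?d"
      by (rule sphere_integral_polar_C1[OF \<Omega> R C1f polar])
    have "C * ?a - ?K * ?c = C * (?a - ?b) - ?K * (?c - ?d)"
      using eq by (simp add: algebra_simps)
    then have "\<bar>C * ?a - ?K * ?c\<bar> \<le> \<bar>C * (?a - ?b)\<bar> + \<bar>?K * (?c - ?d)\<bar>"
      by linarith
    also have "\<dots> = C * \<bar>?a - ?b\<bar> + ?K * \<bar>?c - ?d\<bar>"
      using C R by (simp add: abs_mult)
    also have "\<dots> \<le> C * (e * measure \<sigma> M) + ?K * e"
      using C R 1 2 by (intro add_mono mult_left_mono) auto
    finally show ?thesis by (simp add: algebra_simps)
  qed
  let ?D = "\<bar>C * (LINT x|\<sigma>. \<phi> x) - ?K * (LINT x|gauss. \<phi> (?p x))\<bar>"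
  define A where "A = C * measure \<sigma> M + ?K"
  have A: "A > 0"
    using C R by (simp add: A_def add_nonneg_pos)
  have "?D \<le> 0 + e" if "e > 0" for e
    using approx[of "e / A", folded A_def] that A by simp
  then have "?D \<le> 0"
    by (rule field_le_epsilon)
  then show ?thesis by simp
qed

end

subsection \<open>Moments of the boundary\<close>

lemma open_null_imp_empty:
  fixes S :: "'a::euclidean_space set"
  assumes "open S" "emeasure lborel S = 0"
  shows "S = {}"
proof (rule ccontr)
  assume "S \<noteq> {}"
  then have "\<not> negligible S"
    using assms(1) by (rule open_not_negligible[rotated])
  moreover have "S \<in> null_sets lborel"
    using assms by (intro null_setsI) auto
  ultimately show False
    by (simp add: negligible_iff_null_sets null_sets_completionI)
qed

lemma ray_meets_frontier:
  fixes \<Omega> :: "'a::euclidean_space set"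
  assumes \<Omega>: "open \<Omega>" "bounded \<Omega>" and x: "x \<in> \<Omega>" and d: "d \<noteq> 0"
  obtains t where "t > 0" "x + t *\<^sub>R d \<in> frontier \<Omega>"
proof -
  obtain B where B: "\<And>y. y \<in> \<Omega> \<Longrightarrow> norm y \<le> B"
    using \<Omega>(2) unfolding bounded_iff by blast
  define T where "T = (B + norm x + 1) / norm d"
  have B0: "B \<ge> 0" using B[OF x] norm_ge_zero order_trans by blast
  then have T: "T > 0" using d by (simp add: T_def add_nonneg_pos)
  have "x + T *\<^sub>R d \<notin> \<Omega>"
  proof
    assume "x + T *\<^sub>R d \<in> \<Omega>"
    from B[OF this] have "norm (x + T *\<^sub>R d) \<le> B" .
    moreover have "norm (T *\<^sub>R d) \<le> norm (x + T *\<^sub>R d) + norm x"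
      using norm_triangle_ineq4[of "x + T *\<^sub>R d" x] by simp
    moreover have "norm (T *\<^sub>R d) = B + norm x + 1"
      using d T B0 by (simp add: T_def)
    ultimately show False by simp
  qed
  let ?S = "(\<lambda>t. x + t *\<^sub>R d) ` {0..T}"
  have "connected ?S"
    by (intro connected_continuous_image continuous_intros) auto
  moreover have "?S \<inter> \<Omega> \<noteq> {}"
    using x T by (intro ex_in_conv[THEN iffD1] exI[of _ x]) (auto intro!: rev_image_eqI[of 0])
  moreover have "?S - \<Omega> \<noteq> {}"
  proof -
    have "x + T *\<^sub>R d \<in> ?S" using T by (intro imageI) simp
    then show ?thesis using \<open>x + T *\<^sub>R d \<notin> \<Omega>\<close> by blast
  qed
  ultimately have "?S \<inter> frontier \<Omega> \<noteq> {}"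
    by (rule connected_Int_frontier)
  then obtain t where t: "0 \<le> t" "x + t *\<^sub>R d \<in> frontier \<Omega>" by auto
  have "t \<noteq> 0"
    using t(2) x \<Omega>(1) by (auto simp: frontier_def interior_open)
  then show ?thesis
    by (intro that[of t]) (use t in auto)
qed

context smooth_domain
begin

lemma emeasure_surface_measure_pos:
  assumes x0: "x0 \<in> M" and r: "r > 0"
  shows "emeasure \<sigma> (M \<inter> ball x0 r) > 0"
proof (rule ccontr)
  assume "\<not> emeasure \<sigma> (M \<inter> ball x0 r) > 0"
  then have 0: "emeasure \<sigma> (M \<inter> ball x0 r) = 0" by simp
  obtain r' k \<gamma> s where r': "r' > 0" and \<gamma>': "smooth_graph_function k \<gamma>"
    and p: "graph_patch M (ball x0 r') k \<gamma>"
    using smooth_boundary_patch[OF open_domain smooth x0] by metis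
  note \<gamma> = smooth_graph_functionD(1)[OF \<gamma>']
  have C1\<gamma>: "C1 \<gamma>" and inv: "\<And>x t. \<gamma> (x + t *\<^sub>R axis k 1) = \<gamma> x"
    using \<gamma> by (auto simp: graph_function_def)
  note [measurable] = graph_function_borel[OF \<gamma>]
  have MW: "M \<inter> ball x0 r' = {x \<in> ball x0 r'. x $ k = \<gamma> x}"
    using p unfolding graph_patch_def by blast
  let ?U = "ball x0 (min r r')"
  let ?A = "M \<inter> ?U"
  have A: "?A \<in> sets borel" "?A \<subseteq> M \<inter> ball x0 r'"
    by (auto simp: boundary_borel)
  have [measurable]: "?A \<in> sets borel" by (rule A(1))
  have "emeasure \<sigma> ?A \<le> emeasure \<sigma> (M \<inter> ball x0 r)"
    by (rule emeasure_mono) (auto simp: in_sets_surface_measure boundary_borel)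
  then have "graph_area k \<gamma> ?A = 0"
    using 0 emeasure_surface_measure[OF p A] emeasure_graph_measure[OF \<gamma> A(1)] by simp
  then have AE1: "AE y in hyperplane_lborel k. ennreal (sqrt (1 + (norm (grad \<gamma> y))\<^sup>2)) * indicator ?A (y + \<gamma> y *\<^sub>R axis k 1) = 0"
    unfolding graph_area_def by (subst (asm) nn_integral_0_iff_AE) auto
  define S where "S y = y + (\<gamma> y - y $ k) *\<^sub>R axis k 1" for y
  have S_cont: "continuous_on UNIV S"
    unfolding S_def[abs_def] using C1_continuous[OF C1\<gamma>] by (intro continuous_intros)
  have xk: "x0 $ k = \<gamma> x0"
  proof -
    have "x0 \<in> M \<inter> ball x0 r'" using x0 r' by simp
    then show ?thesis unfolding MW by blast
  qed
  let ?O = "S -` ?U"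
  have O: "open ?O" using S_cont by (simp add: open_vimage)
  then have [measurable]: "?O \<in> sets borel" by simp
  have "x0 \<in> ?O" using xk r r' by (simp add: S_def)
  have "emeasure lborel ?O = (\<integral>\<^sup>+ x. indicator ?O x \<partial>lborel)"
    by simp
  also have "\<dots> = (\<integral>\<^sup>+ y. \<integral>\<^sup>+ t. indicator ?O (y + t *\<^sub>R axis k 1) \<partial>lborel \<partial>hyperplane_lborel k)"
    by (rule nn_integral_hyperplane_lborel) simp
  also have "\<dots> = (\<integral>\<^sup>+ y. 0 \<partial>hyperplane_lborel k)"
  proof (rule nn_integral_cong_AE)
    show "AE y in hyperplane_lborel k. (\<integral>\<^sup>+ t. indicator ?O (y + t *\<^sub>R axis k 1) \<partial>lborel) = 0"
      using AE1 AE_hyperplane_lborel[of k]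
    proof eventually_elim
      fix y assume a: "ennreal (sqrt (1 + (norm (grad \<gamma> y))\<^sup>2)) * indicator ?A (y + \<gamma> y *\<^sub>R axis k 1) = 0" and y: "y $ k = 0"
      have "\<not> 1 + (norm (grad \<gamma> y))\<^sup>2 \<le> 0"
        using zero_le_power2[of "norm (grad \<gamma> y)"] by linarith
      then have notA: "y + \<gamma> y *\<^sub>R axis k 1 \<notin> ?A"
        using a by (auto simp: indicator_def ennreal_eq_0_iff split: if_splits)
      have Sy: "S (y + t *\<^sub>R axis k 1) = y + \<gamma> y *\<^sub>R axis k 1" for t
        using y by (simp add: S_def inv algebra_simps)
      have "y + t *\<^sub>R axis k 1 \<notin> ?O" for t
      proof
        assume "y + t *\<^sub>R axis k 1 \<in> ?O"
        then have U: "y + \<gamma> y *\<^sub>R axis k 1 \<in> ?U" by (simp only: vimage_eq Sy)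
        moreover have "y + \<gamma> y *\<^sub>R axis k 1 \<in> M \<inter> ball x0 r'"
          unfolding MW using U y by (simp add: inv)
        ultimately show False using notA by blast
      qed
      then have "indicator ?O (y + t *\<^sub>R axis k 1) = (0::ennreal)" for t
        by (rule indicator_simps(2))
      then show "(\<integral>\<^sup>+ t. indicator ?O (y + t *\<^sub>R axis k 1) \<partial>lborel) = 0"
        by (simp only: nn_integral_const mult_zero_left)
    qed
  qed
  finally have "?O = {}"
    by (intro open_null_imp_empty[OF O]) simp
  with \<open>x0 \<in> ?O\<close> show False by blast
qed

lemma integral_surface_measure_pos:
  fixes f :: "real ^ 'n \<Rightarrow> real"
  assumes f: "continuous_on M f" "\<And>x. x \<in> M \<Longrightarrow> f x \<ge> 0" and x0: "x0 \<in> M" "f x0 > 0"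
  shows "(LINT x|\<sigma>. f x) > 0"
proof (rule ccontr)
  have int: "integrable \<sigma> f" by (rule integrable_surface_measure[OF f(1)])
  assume "\<not> (LINT x|\<sigma>. f x) > 0"
  moreover have "(LINT x|\<sigma>. f x) \<ge> 0"
    using f(2) by (intro integral_nonneg_AE AE_I2) simp
  ultimately have "(LINT x|\<sigma>. f x) = 0" by simp
  moreover have "AE x in \<sigma>. 0 \<le> f x"
    by (intro AE_I2) (simp add: f(2))
  ultimately have AE: "AE x in \<sigma>. f x = 0"
    using integral_nonneg_eq_0_iff_AE[OF int] by simp
  obtain e where e: "e > 0" "\<And>x. x \<in> M \<Longrightarrow> dist x x0 < e \<Longrightarrow> dist (f x) (f x0) < f x0"
    using f(1) x0 unfolding continuous_on_iff by metis
  have "M \<inter> ball x0 e \<in> sets \<sigma>"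
    by (auto simp: in_sets_surface_measure boundary_borel)
  moreover have "AE x in \<sigma>. x \<notin> M \<inter> ball x0 e"
    using AE
  proof eventually_elim
    fix x assume "f x = 0"
    then show "x \<notin> M \<inter> ball x0 e"
      using e(2)[of x] x0(2) by (auto simp: dist_commute dist_real_def)
  qed
  ultimately have "M \<inter> ball x0 e \<in> null_sets \<sigma>"
    using AE_iff_null_sets by blast
  then have "emeasure \<sigma> (M \<inter> ball x0 e) = 0"
    by (rule null_setsD1)
  then show False
    using emeasure_surface_measure_pos[OF x0(1) e(1)] by simp
qed

end

lemma continuous_on_norm_powr:
  fixes q :: "'a::real_normed_vector"
  assumes "a > 0"
  shows "continuous_on A (\<lambda>x. norm (x - q) powr a)"
  using assms by (intro continuous_on_powr' continuous_intros) auto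

lemma radial_power_field:
  fixes q :: "real ^ 'n"
  assumes a: "a > 0"
  shows "C1_field (\<lambda>x. norm (x - q) powr a *\<^sub>R (x - q))"
    and "divergence (\<lambda>x. norm (x - q) powr a *\<^sub>R (x - q)) x = (real CARD('n) + a) * norm (x - q) powr a"
proof -
  define f where "f i x = norm (x - q) powr a * (x - q) $ i" for i x
  define D where "D i x = norm (x - q) powr a *\<^sub>R axis i 1 + (a * norm (x - q) powr (a - 2) * (x - q) $ i) *\<^sub>R (x - q)" for i x
  have bound: "norm ((a * norm z powr (a - 2) * z $ i) *\<^sub>R z) \<le> a * norm z powr a" for z :: "real ^ 'n" and i
  proof (cases "z = 0")
    case False
    have "norm ((a * norm z powr (a - 2) * z $ i) *\<^sub>R z) = a * norm z powr (a - 2) * (\<bar>z $ i\<bar> * norm z)"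
      using a by (simp add: abs_mult)
    also have "\<dots> \<le> a * norm z powr (a - 2) * (norm z * norm z)"
      using a component_le_norm_cart[of z i] by (intro mult_left_mono mult_right_mono) auto
    also have "\<dots> = a * norm z powr a"
    proof -
      have e: "norm z * norm z = norm z powr 2"
        using False by (simp add: powr_numeral power2_eq_square)
      show ?thesis
        unfolding e mult.assoc powr_add[symmetric] by simp
    qed
    finally show ?thesis .
  qed simp
  have GD: "GDERIV (f i) x :> D i x" for i x
  proof (cases "x = q")
    case True
    have "isCont (\<lambda>h. norm (h - 0 :: real ^ 'n) powr a) 0"
      by (rule continuous_on_interior[OF continuous_on_norm_powr[OF a, of UNIV]]) simp
    then have lim: "((\<lambda>h :: real ^ 'n. norm h powr a) \<longlongrightarrow> 0) (at 0)" by (simp add: isCont_def)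
    have "((\<lambda>h. norm (f i (q + h) - f i q - h \<bullet> 0) / norm h) \<longlongrightarrow> 0) (at 0)"
    proof (rule Lim_null_comparison[OF _ lim], rule always_eventually, rule allI)
      fix h :: "real ^ 'n"
      show "norm (norm (f i (q + h) - f i q - h \<bullet> 0) / norm h) \<le> norm h powr a"
      proof (cases "h = 0")
        case False
        have "\<bar>h $ i\<bar> * norm h powr a \<le> norm h * norm h powr a"
          by (intro mult_right_mono component_le_norm_cart) simp
        then show ?thesis
          using False by (simp add: f_def abs_mult pos_divide_le_eq mult.commute)
      qed simp
    qed
    then have "(f i has_derivative (\<lambda>h. h \<bullet> 0)) (at q)"
      by (simp add: has_derivative_at)
    then show ?thesis
      using True by (simp add: gderiv_def D_def)
  next
    case False
    then have z: "x - q \<noteq> 0" by simp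
    have "GDERIV (\<lambda>x. norm (x - q)) x :> sgn (x - q)"
    proof -
      have "((\<lambda>x. x - q) has_derivative (\<lambda>h. h)) (at x)"
        by (auto intro!: derivative_eq_intros)
      from has_derivative_compose[OF this GDERIV_norm[OF z, unfolded gderiv_def]]
      show ?thesis by (simp add: gderiv_def)
    qed
    from GDERIV_DERIV_compose[OF this has_real_derivative_powr[of "norm (x - q)" a]] z
    have 1: "GDERIV (\<lambda>x. norm (x - q) powr a) x :> (a * norm (x - q) powr (a - 1)) *\<^sub>R sgn (x - q)"
      by simp
    have 2: "GDERIV (\<lambda>x. (x - q) $ i) x :> axis i 1"
    proof -
      have "GDERIV (\<lambda>x. x $ i - q $ i) x :> axis i 1 - 0"
        by (intro GDERIV_diff GDERIV_const) (auto simp: gderiv_def inner_axis intro: bounded_linear_imp_has_derivative)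
      then show ?thesis by simp
    qed
    have "norm (x - q) powr (a - 1) / norm (x - q) = norm (x - q) powr (a - 2)"
      using z powr_diff[of "norm (x - q)" "a - 1" 1] by simp
    then have "(a * norm (x - q) powr (a - 1)) *\<^sub>R sgn (x - q) = (a * norm (x - q) powr (a - 2)) *\<^sub>R (x - q)"
      by (simp add: sgn_div_norm divide_inverse[symmetric] field_simps)
    then show ?thesis
      using GDERIV_mult[OF 1 2] by (simp add: f_def[abs_def] D_def mult_ac)
  qed
  have D_cont: "continuous_on UNIV (D i)" for i
  proof (intro continuous_at_imp_continuous_on ballI)
    fix x
    have c1: "isCont (\<lambda>x. norm (x - q) powr a *\<^sub>R axis i (1::real)) x"
      using continuous_on_norm_powr[OF a, of UNIV q]
      unfolding continuous_on_eq_continuous_at[OF open_UNIV]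
      by (intro continuous_scaleR continuous_const) blast
    have c2: "isCont (\<lambda>x. (a * norm (x - q) powr (a - 2) * (x - q) $ i) *\<^sub>R (x - q)) x"
    proof (cases "x = q")
      case True
      have "((\<lambda>x. a * norm (x - q) powr a) \<longlongrightarrow> 0) (at q)"
      proof -
        have "((\<lambda>x. a * norm (x - q) powr a) \<longlongrightarrow> a * norm (q - q) powr a) (at q)"
          using continuous_on_norm_powr[OF a, of UNIV q]
          unfolding continuous_on_eq_continuous_at[OF open_UNIV] isCont_def
          by (intro tendsto_mult_left) blast
        then show ?thesis by simp
      qed
      then have "((\<lambda>x. (a * norm (x - q) powr (a - 2) * (x - q) $ i) *\<^sub>R (x - q)) \<longlongrightarrow> 0) (at q)"
        by (rule Lim_null_comparison[OF always_eventually, rotated]) (intro allI bound)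
      then show ?thesis
        using True by (simp add: isCont_def)
    next
      case False
      have cc: "isCont (\<lambda>x :: real ^ 'n. (x - q) $ i) x"
        using continuous_on_component[OF continuous_on_diff[OF continuous_on_id continuous_on_const], of UNIV q i]
        by (simp add: continuous_on_eq_continuous_at)
      have cp: "isCont (\<lambda>x. norm (x - q) powr (a - 2)) x"
        unfolding isCont_def using False
        by (intro tendsto_powr tendsto_norm tendsto_diff tendsto_ident_at tendsto_const) simp
      show ?thesis
        by (intro continuous_scaleR continuous_mult continuous_const continuous_diff continuous_ident cc cp)
    qed
    show "isCont (D i) x"
      unfolding D_def[abs_def] by (rule continuous_add[OF c1 c2])
  qed
  have nth: "(norm (x - q) powr a *\<^sub>R (x - q)) $ i = f i x" for i x
    by (simp add: f_def)
  show "C1_field (\<lambda>x. norm (x - q) powr a *\<^sub>R (x - q))"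
    unfolding C1_field_def nth using C1I[OF GD D_cont] by blast
  have "divergence (\<lambda>x. norm (x - q) powr a *\<^sub>R (x - q)) x = (\<Sum>i\<in>UNIV. D i x $ i)"
    unfolding divergence_def nth by (simp add: grad_eqI[OF GD])
  also have "\<dots> = real CARD('n) * norm (x - q) powr a + a * norm (x - q) powr (a - 2) * ((x - q) \<bullet> (x - q))"
    by (simp add: D_def sum.distrib inner_vec_def sum_distrib_left mult_ac)
  finally have d: "divergence (\<lambda>x. norm (x - q) powr a *\<^sub>R (x - q)) x
      = real CARD('n) * norm (x - q) powr a + a * norm (x - q) powr (a - 2) * ((x - q) \<bullet> (x - q))" .
  have e: "norm (x - q) powr (a - 2) * ((x - q) \<bullet> (x - q)) = norm (x - q) powr a"
  proof (cases "x = q")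
    case False
    then have e': "(x - q) \<bullet> (x - q) = norm (x - q) powr 2"
      by (simp add: powr_numeral power2_norm_eq_inner)
    show ?thesis
      unfolding e' powr_add[symmetric] by simp
  qed simp
  show "divergence (\<lambda>x. norm (x - q) powr a *\<^sub>R (x - q)) x = (real CARD('n) + a) * norm (x - q) powr a"
    unfolding d mult.assoc e by (simp add: algebra_simps)
qed

lemma (in smooth_domain) surface_moment_ge:
  assumes p: "1 < p"
  shows "(real CARD('n) + (p - 1)) * (LINT x|lborel. indicator \<Omega> x * norm (x - q) powr (p - 1)) \<le> (LINT x|\<sigma>. norm (x - q) powr p)"
proof -
  have a: "p - 1 > 0" using p by simp
  have "(LINT x|lborel. indicator \<Omega> x * divergence (\<lambda>x. norm (x - q) powr (p - 1) *\<^sub>R (x - q)) x) \<le> (LINT x|\<sigma>. norm (x - q) powr p)"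
  proof (rule integral_divergence_le[OF radial_power_field(1)[OF a]])
    show "continuous_on UNIV (\<lambda>x. norm (x - q) powr p)"
      using p by (intro continuous_on_norm_powr) simp
    fix c r k \<gamma> s x
    assume \<gamma>: "smooth_graph_function k \<gamma>" and os: "one_sided \<Omega> (ball c r) k \<gamma> s"
    let ?F = "norm (x - q) powr (p - 1) *\<^sub>R (x - q)" and ?n = "graph_normal k \<gamma> x"
    have "s * (?F \<bullet> ?n) \<le> \<bar>?F \<bullet> ?n\<bar>"
      using one_sided_sign[OF os] by auto
    also have "\<dots> \<le> norm ?F * norm ?n"
      by (rule Cauchy_Schwarz_ineq2)
    also have "\<dots> = norm (x - q) powr (p - 1) * norm (x - q) powr 1"
      by (simp add: norm_graph_normal[OF smooth_graph_functionD(1)[OF \<gamma>]])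
    also have "\<dots> = norm (x - q) powr p"
      unfolding powr_add[symmetric] by simp
    finally show "s * (?F \<bullet> ?n) \<le> norm (x - q) powr p" .
  qed
  moreover have "(LINT x|lborel. indicator \<Omega> x * divergence (\<lambda>x. norm (x - q) powr (p - 1) *\<^sub>R (x - q)) x)
     = (LINT x|lborel. (real CARD('n) + (p - 1)) * (indicator \<Omega> x * norm (x - q) powr (p - 1)))"
    unfolding radial_power_field(2)[OF a] by (simp add: mult_ac)
  ultimately show ?thesis by simp
qed

lemma integral_powr_Icc:
  fixes b R :: real
  assumes "b > -1" "R \<ge> 0"
  shows "(LINT s:{0..R}|lborel. s powr b) = R powr (b + 1) / (b + 1)"
proof -
  have hk: "((\<lambda>s. s powr b) has_integral (R powr (b + 1) / (b + 1))) {0..R}"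
    using has_integral_powr_from_0[OF assms] .
  have "(\<lambda>s. s powr b) absolutely_integrable_on {0..R}"
    by (rule nonnegative_absolutely_integrable_1) (use hk in \<open>auto intro: has_integral_integrable\<close>)
  then have "set_integrable lborel {0..R} (\<lambda>s. s powr b)"
    unfolding set_integrable_def by (subst (asm) integrable_completion) auto
  then show ?thesis
    using set_borel_integral_eq_integral(2) integral_unique[OF hk] by metis
qed

lemma ball_moment:
  fixes q :: "real ^ 'n"
  assumes R: "R > 0" and a: "a \<ge> 0"
  shows "(real CARD('n) + a) * (LINT x|lborel. indicator (ball q R) x * norm (x - q) powr a)
    = real CARD('n) * R powr a * measure lborel (ball q R)"
proof (rule polar_integral[where 'n = 'n])
  let ?n = "CARD('n)"
  fix C :: real assume C: "C > 0"
    and polar: "\<And>(g :: real ^ 'n \<Rightarrow> real) B R. g \<in> borel_measurable borel \<Longrightarrow> (\<And>x. \<bar>g x\<bar> \<le> B) \<Longrightarrow> (\<And>x. norm x > R \<Longrightarrow> g x = 0) \<Longrightarrow>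
      (LINT x|gauss. (LINT s:{0..R}|lborel. s ^ (CARD('n) - 1) * g (s *\<^sub>R sgn x))) = C * (LINT z|lborel. g z)"
  have [measurable]: "ball q R \<in> sets borel" by simp
  have main: "C * (LINT x|lborel. indicator (ball q R) x * norm (x - q) powr b) = R powr (real ?n + b) / (real ?n + b)" if b: "b \<ge> 0" for b
  proof -
    define g :: "real ^ 'n \<Rightarrow> real" where "g z = (if norm z < R then norm z powr b else 0)" for z
    have g_m [measurable]: "g \<in> borel_measurable borel"
      unfolding g_def[abs_def] by measurable
    have gB: "\<bar>g z\<bar> \<le> R powr b" for z
      using b by (auto simp: g_def intro: powr_mono2)
    have gR: "g z = 0" if "norm z > R" for z
      using that by (simp add: g_def)
    have inner: "(LINT s:{0..R}|lborel. s ^ (?n - 1) * g (s *\<^sub>R sgn x)) = R powr (real ?n + b) / (real ?n + b)" if x: "x \<noteq> 0" for x :: "real ^ 'n"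
    proof -
      have "(LINT s:{0..R}|lborel. s ^ (?n - 1) * g (s *\<^sub>R sgn x)) = (LINT s:{0..R}|lborel. s powr (real ?n - 1 + b))"
        unfolding set_lebesgue_integral_def
      proof (rule integral_cong_AE)
        show "AE s in lborel. indicator {0..R} s *\<^sub>R (s ^ (?n - 1) * g (s *\<^sub>R sgn x)) = indicator {0..R} s *\<^sub>R s powr (real ?n - 1 + b)"
          using AE_lborel_singleton[of R] AE_lborel_singleton[of "0::real"]
        proof eventually_elim
          fix s :: real assume s: "s \<noteq> R" "s \<noteq> 0"
          show "indicator {0..R} s *\<^sub>R (s ^ (?n - 1) * g (s *\<^sub>R sgn x)) = indicator {0..R} s *\<^sub>R s powr (real ?n - 1 + b)"
          proof (cases "s \<in> {0..R}")
            case True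
            then have s': "0 < s" "s < R" using s by auto
            have "s ^ (?n - 1) = s powr (real ?n - 1)"
              using s' by (simp add: powr_realpow[symmetric] of_nat_diff Suc_leI)
            moreover have "g (s *\<^sub>R sgn x) = s powr b"
              using s' x by (simp add: g_def norm_sgn)
            ultimately show ?thesis
              by (simp only: powr_add)
          qed simp
        qed
      qed auto
      also have "\<dots> = R powr (real ?n + b) / (real ?n + b)"
        using integral_powr_Icc[of "real ?n - 1 + b" R] R b add_pos_nonneg[of "real ?n" b] by simp
      finally show ?thesis .
    qed
    have "R powr (real ?n + b) / (real ?n + b) = (LINT x|(gauss :: (real ^ 'n) measure). R powr (real ?n + b) / (real ?n + b))"
      by simp
    also have "\<dots> = (LINT x|gauss. (LINT s:{0..R}|lborel. s ^ (?n - 1) * g (s *\<^sub>R sgn x)))"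
    proof (rule integral_cong_AE)
      show "AE x in gauss. R powr (real ?n + b) / (real ?n + b) = (LINT s:{0..R}|lborel. s ^ (?n - 1) * g (s *\<^sub>R sgn x))"
        using AE_gauss_neq_0 by eventually_elim (rule inner[symmetric])
      show "(\<lambda>x :: real ^ 'n. LINT s:{0..R}|lborel. s ^ (?n - 1) * g (s *\<^sub>R sgn x)) \<in> borel_measurable gauss"
        unfolding set_lebesgue_integral_def
        by (rule lborel.borel_measurable_lebesgue_integral) measurable
    qed auto
    also have "\<dots> = C * (LINT z|lborel. g z)"
      by (rule polar[OF g_m gB gR])
    also have "(LINT z|lborel. g z) = (LINT x|lborel. indicator (ball q R) (q + x) * norm (q + x - q) powr b)"
      by (intro Bochner_Integration.integral_cong) (auto simp: g_def dist_norm)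
    also have "\<dots> = (LINT x|lborel. indicator (ball q R) x * norm (x - q) powr b)"
      by (rule integral_lborel_translate) measurable
    finally show ?thesis by simp
  qed
  have "(LINT x|lborel. indicator (ball q R) x * norm (x - q) powr 0) = (LINT x|lborel. indicator (ball q R) x)"
  proof (intro integral_cong_AE)
    show "AE x in lborel. indicator (ball q R) x * norm (x - q) powr 0 = indicator (ball q R) x"
      using AE_lborel_singleton[of q] by eventually_elim simp
  qed auto
  then have "C * measure lborel (ball q R) = R powr real ?n / real ?n"
    using main[of 0] by simp
  then have "C * (real ?n * R powr a * measure lborel (ball q R)) = R powr (real ?n + a)"
    by (simp add: powr_add field_simps)
  also have "\<dots> = C * ((real ?n + a) * (LINT x|lborel. indicator (ball q R) x * norm (x - q) powr a))"
  proof -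
    have c: "real ?n + a > 0" using a by (simp add: add_pos_nonneg)
    have cancel: "c > 0 \<Longrightarrow> c * (P / c) = P" for c P :: real by simp
    show ?thesis
      unfolding mult.left_commute[of C] main[OF a] by (rule cancel[OF c, symmetric])
  qed
  finally show ?thesis
    using C by simp
qed

lemma AE_not_sphere:
  fixes q :: "'a::euclidean_space"
  shows "AE x in lborel. x \<notin> sphere q R"
proof -
  have "sphere q R \<in> null_sets lebesgue"
    using negligible_sphere[of q R] by (simp add: negligible_iff_null_sets)
  then show ?thesis
    by (intro AE_not_in) (simp add: null_sets_completion_iff)
qed

lemma rearrangement:
  fixes \<Omega> :: "(real ^ 'n) set"
  assumes \<Omega>: "open \<Omega>" "bounded \<Omega>" and R: "R > 0" and a: "a > 0"
    and vol: "measure lborel \<Omega> = measure lborel (ball q R)"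
  shows "(LINT x|lborel. indicator (ball q R) x * norm (x - q) powr a) \<le> (LINT x|lborel. indicator \<Omega> x * norm (x - q) powr a)"
    and "(LINT x|lborel. indicator \<Omega> x * norm (x - q) powr a) \<le> (LINT x|lborel. indicator (ball q R) x * norm (x - q) powr a)
      \<Longrightarrow> AE x in lborel. x \<in> \<Omega> \<longleftrightarrow> x \<in> ball q R"
proof -
  let ?B = "ball q R"
  let ?f = "\<lambda>x. norm (x - q) powr a"
  have int: "integrable lborel (\<lambda>x. indicator S x * f x)" if "open S" "bounded S" "continuous_on UNIV f" for S and f :: "real ^ 'n \<Rightarrow> real"
  proof -
    have "compact (closure S)" using that(2) by simp
    from compact_imp_bounded[OF compact_continuous_image[OF continuous_on_subset[OF that(3)] this]]
    obtain K where K: "\<And>x. x \<in> closure S \<Longrightarrow> norm (f x) \<le> K"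
      unfolding bounded_iff by (metis imageI subset_UNIV)
    have [measurable]: "f \<in> borel_measurable borel"
      by (rule borel_measurable_continuous_onI[OF that(3)])
    show ?thesis
    proof (rule integrableI_bounded_set[where A = S and B = K])
      show "emeasure lborel S < \<infinity>" by (rule emeasure_bounded_finite[OF that(2)])
      show "AE x in lborel. x \<in> S \<longrightarrow> norm (indicator S x * f x) \<le> K"
        using K closure_subset by (intro AE_I2) auto
    qed (use that(1) in auto)
  qed
  have f_cont: "continuous_on UNIV ?f"
    by (rule continuous_on_norm_powr[OF a])
  note i1 = int[OF \<Omega> f_cont] and i2 = int[OF open_ball bounded_ball f_cont, of q R]
  have c1: "integrable lborel (\<lambda>x. indicator \<Omega> x * R powr a)" and c2: "integrable lborel (\<lambda>x. indicator ?B x * R powr a)"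
    by (intro int \<Omega> open_ball bounded_ball continuous_on_const)+
  have l: "(LINT x|lborel. indicator S x * R powr a) = measure lborel S * R powr a" if "open S" for S :: "(real ^ 'n) set"
    using that by simp
  define w where "w x = (indicator \<Omega> x * ?f x - indicator ?B x * ?f x) - (indicator \<Omega> x * R powr a - indicator ?B x * R powr a)" for x
  have w_int: "integrable lborel w"
    unfolding w_def[abs_def] by (intro Bochner_Integration.integrable_diff i1 i2 c1 c2)
  have w_val: "(LINT x|lborel. w x) = (LINT x|lborel. indicator \<Omega> x * ?f x) - (LINT x|lborel. indicator ?B x * ?f x)"
    unfolding w_def using i1 i2 c1 c2 l[OF \<Omega>(1)] l[OF open_ball, of q R] vol by simp
  have in_B: "?f x < R powr a" if "x \<in> ?B" for x
    using that a R by (intro powr_less_mono2) (auto simp: dist_norm norm_minus_commute)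
  have out_B: "?f x \<ge> R powr a" if "x \<notin> ?B" for x
    using that a R by (intro powr_mono2) (auto simp: dist_norm norm_minus_commute)
  have w0: "w x \<ge> 0" for x
    using in_B[of x] out_B[of x] by (cases "x \<in> \<Omega>"; cases "x \<in> ?B") (auto simp: w_def simp del: mem_ball)
  have "(LINT x|lborel. w x) \<ge> 0"
    by (intro integral_nonneg_AE AE_I2 w0)
  then show "(LINT x|lborel. indicator ?B x * ?f x) \<le> (LINT x|lborel. indicator \<Omega> x * ?f x)"
    by (simp add: w_val)
  show "AE x in lborel. x \<in> \<Omega> \<longleftrightarrow> x \<in> ?B" if "(LINT x|lborel. indicator \<Omega> x * ?f x) \<le> (LINT x|lborel. indicator ?B x * ?f x)"
  proof -
    have "(LINT x|lborel. w x) = 0"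
      using \<open>(LINT x|lborel. w x) \<ge> 0\<close> that by (simp add: w_val)
    then have AE_w: "AE x in lborel. w x = 0"
      using integral_nonneg_eq_0_iff_AE[OF w_int] w0 by simp
    from AE_w AE_not_sphere[of q R] show ?thesis
    proof eventually_elim
      fix x assume w: "w x = 0" and ns: "x \<notin> sphere q R"
      show "x \<in> \<Omega> \<longleftrightarrow> x \<in> ?B"
      proof (cases "x \<in> ?B")
        case True
        then show ?thesis using w in_B[OF True] by (cases "x \<in> \<Omega>") (auto simp: w_def simp del: mem_ball)
      next
        case False
        then have "norm (x - q) > R"
          using ns by (simp add: dist_norm norm_minus_commute)
        then have "?f x > R powr a"
          using a R by (intro powr_less_mono2) auto
        then show ?thesis using w False by (cases "x \<in> \<Omega>") (auto simp: w_def simp del: mem_ball)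
      qed
    qed
  qed
qed

lemma (in smooth_domain) AE_ball_imp_sphere:
  assumes R: "R > 0" and AE: "AE x in lborel. x \<in> \<Omega> \<longleftrightarrow> x \<in> ball q R"
  shows "M = sphere q R"
proof -
  have null: "S = {}" if "open S" "\<And>x. x \<in> S \<Longrightarrow> \<not> (x \<in> \<Omega> \<longleftrightarrow> x \<in> ball q R)" for S
  proof (rule open_null_imp_empty[OF that(1)])
    have "AE x in lborel. x \<notin> S"
      using AE that(2) by (auto elim!: eventually_mono)
    then have "S \<in> null_sets lborel"
      using that(1) by (subst AE_iff_null_sets) auto
    then show "emeasure lborel S = 0" by (rule null_setsD1)
  qed
  have "\<Omega> - cball q R = {}"
    using open_domain by (intro null) auto
  then have "\<Omega> \<subseteq> ball q R"
    using open_domain interior_maximal[of \<Omega> "cball q R"] by auto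
  moreover have "ball q R \<subseteq> \<Omega>"
  proof
    fix x assume x: "x \<in> ball q R"
    have "ball q R - closure \<Omega> = {}"
      using closure_subset[of \<Omega>] by (intro null) auto
    with x have xc: "x \<in> closure \<Omega>" by blast
    show "x \<in> \<Omega>"
    proof (rule ccontr)
      assume "x \<notin> \<Omega>"
      then have xM: "x \<in> M"
        using xc open_domain by (simp add: frontier_def interior_open)
      obtain r k \<gamma> s where r: "r > 0" and \<gamma>': "smooth_graph_function k \<gamma>" and os: "one_sided \<Omega> (ball x r) k \<gamma> s"
        and p: "graph_patch M (ball x r) k \<gamma>"
        using smooth_boundary_patch[OF open_domain smooth xM] by metis
      note \<gamma> = smooth_graph_functionD(1)[OF \<gamma>']
      have inv: "\<And>x t. \<gamma> (x + t *\<^sub>R axis k 1) = \<gamma> x"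
        using \<gamma> by (auto simp: graph_function_def)
      have s: "s = 1 \<or> s = -1" by (rule one_sided_sign[OF os])
      have "x \<in> M \<inter> ball x r" using xM r by simp
      then have xk: "x $ k = \<gamma> x" using p unfolding graph_patch_def by blast
      let ?O = "ball x r \<inter> ball q R \<inter> {y. s * (y $ k - \<gamma> y) < 0}"
      have "?O = {}"
      proof (rule null)
        show "open ?O"
          by (intro open_Int open_ball open_Collect_less continuous_intros graph_function_continuous[OF \<gamma>])
        show "\<not> (y \<in> \<Omega> \<longleftrightarrow> y \<in> ball q R)" if "y \<in> ?O" for y
          using that one_sided_iff[OF os, of y] by auto
      qed
      obtain e where e: "e > 0" "\<And>t. \<bar>t\<bar> < e \<Longrightarrow> x + t *\<^sub>R axis k 1 \<in> ball x r \<inter> ball q R"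
        using open_contains_segment[of "ball x r \<inter> ball q R" x "axis k 1"] x r by auto
      have "x + (- s * (e / 2)) *\<^sub>R axis k 1 \<in> ball x r \<inter> ball q R"
        using s e(1) by (intro e(2)) auto
      moreover have "s * ((x + (- s * (e / 2)) *\<^sub>R axis k 1) $ k - \<gamma> (x + (- s * (e / 2)) *\<^sub>R axis k 1)) < 0"
        unfolding inv using s e(1) xk by auto
      ultimately have "x + (- s * (e / 2)) *\<^sub>R axis k 1 \<in> ?O" by blast
      with \<open>?O = {}\<close> show False by blast
    qed
  qed
  ultimately have "\<Omega> = ball q R" by blast
  then show ?thesis using R by simp
qed

lemma sum_powr_ge_le2:
  fixes z :: "real ^ 'n"
  assumes p: "0 < p" "p \<le> 2"
  shows "norm z powr p \<le> (\<Sum>i\<in>UNIV. \<bar>z $ i\<bar> powr p)"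
    and "p < 2 \<Longrightarrow> z $ i \<noteq> 0 \<Longrightarrow> z $ j \<noteq> 0 \<Longrightarrow> i \<noteq> j \<Longrightarrow> norm z powr p < (\<Sum>i\<in>UNIV. \<bar>z $ i\<bar> powr p)"
proof -
  have key: "norm z powr p * (z $ l / norm z)\<^sup>2 \<le> \<bar>z $ l\<bar> powr p" if z: "z \<noteq> 0" for l
  proof -
    define t where "t = \<bar>z $ l\<bar> / norm z"
    have t: "0 \<le> t" "t \<le> 1"
      using z component_le_norm_cart[of z l] by (auto simp: t_def)
    have "t\<^sup>2 \<le> t powr p"
    proof (cases "t = 0")
      case False
      then have "t powr 2 \<le> t powr p" using t p by (intro powr_mono') auto
      then show ?thesis using t False by (simp add: powr_numeral)
    qed simp
    then have "norm z powr p * t\<^sup>2 \<le> norm z powr p * t powr p"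
      by (intro mult_left_mono) auto
    also have "\<dots> = (norm z * t) powr p"
      using t by (simp add: powr_mult)
    also have "norm z * t = \<bar>z $ l\<bar>"
      using z by (simp add: t_def)
    finally show ?thesis by (simp add: t_def power_divide)
  qed
  have sum1: "(\<Sum>l\<in>UNIV. norm z powr p * (z $ l / norm z)\<^sup>2) = norm z powr p" if "z \<noteq> 0"
  proof -
    have "(\<Sum>l\<in>UNIV. (z $ l / norm z)\<^sup>2) = (\<Sum>l\<in>UNIV. (z $ l)\<^sup>2) / (norm z)\<^sup>2"
      by (simp add: power_divide sum_divide_distrib)
    also have "(\<Sum>l\<in>UNIV. (z $ l)\<^sup>2) = (norm z)\<^sup>2"
      unfolding power2_norm_eq_inner inner_vec_def by (simp add: power2_eq_square)
    finally show ?thesis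
      using that by (simp add: sum_distrib_left[symmetric])
  qed
  show "norm z powr p \<le> (\<Sum>i\<in>UNIV. \<bar>z $ i\<bar> powr p)"
  proof (cases "z = 0")
    case False
    have "(\<Sum>l\<in>UNIV. norm z powr p * (z $ l / norm z)\<^sup>2) \<le> (\<Sum>i\<in>UNIV. \<bar>z $ i\<bar> powr p)"
      by (intro sum_mono key False)
    then show ?thesis
      by (simp only: sum1[OF False])
  qed (use p in \<open>simp add: sum_nonneg\<close>)
  assume p2: "p < 2" and z: "z $ i \<noteq> 0" "z $ j \<noteq> 0" "i \<noteq> j"
  then have z0: "z \<noteq> 0" by auto
  have lt: "\<bar>z $ i\<bar> < norm z"
  proof -
    have "(z $ i)\<^sup>2 + (z $ j)\<^sup>2 = (\<Sum>l\<in>{i, j}. (z $ l)\<^sup>2)" using z by simp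
    also have "\<dots> \<le> (\<Sum>l\<in>UNIV. (z $ l)\<^sup>2)" by (intro sum_mono2) auto
    also have "\<dots> = (norm z)\<^sup>2"
      unfolding power2_norm_eq_inner inner_vec_def by (simp add: power2_eq_square)
    finally have "(z $ i)\<^sup>2 < (norm z)\<^sup>2"
      using z zero_less_power2[of "z $ j"] by linarith
    then show ?thesis
      by (intro power2_less_imp_less[of _ "norm z"]) auto
  qed
  have "norm z powr p * (z $ i / norm z)\<^sup>2 < \<bar>z $ i\<bar> powr p"
  proof -
    define t where "t = \<bar>z $ i\<bar> / norm z"
    have t: "0 < t" "t < 1"
      using z z0 lt by (auto simp: t_def)
    have "t powr 2 < t powr p" using t p2 by (intro powr_less_mono') auto
    then have "norm z powr p * t\<^sup>2 < norm z powr p * t powr p"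
      using z0 t by (simp add: powr_numeral)
    also have "\<dots> = (norm z * t) powr p"
      using t by (simp add: powr_mult)
    also have "norm z * t = \<bar>z $ i\<bar>"
      using z0 by (simp add: t_def)
    finally show ?thesis by (simp add: t_def power_divide)
  qed
  then have "(\<Sum>l\<in>UNIV. norm z powr p * (z $ l / norm z)\<^sup>2) < (\<Sum>i\<in>UNIV. \<bar>z $ i\<bar> powr p)"
    by (intro sum_strict_mono_ex1 ballI key z0) auto
  then show "norm z powr p < (\<Sum>i\<in>UNIV. \<bar>z $ i\<bar> powr p)"
    by (simp only: sum1[OF z0])
qed

lemma sum_powr_ge_ge2:
  fixes z :: "real ^ 'n"
  assumes p: "2 \<le> p"
  shows "real CARD('n) powr (1 - p / 2) * norm z powr p \<le> (\<Sum>i\<in>UNIV. \<bar>z $ i\<bar> powr p)"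
proof (cases "z = 0")
  case False
  define r where "r = p / 2"
  have r: "r \<ge> 1" using p by (simp add: r_def)
  have bern: "1 + r * (w - 1) \<le> w powr r" if "w \<ge> 0" for w :: real
  proof (cases "w = 0")
    case False
    with that have w: "w > 0" by simp
    have "(w powr r) powr (1 / r) * 1 powr (1 - 1 / r) \<le> (1 / r) * (w powr r) + (1 - 1 / r) * 1"
      using w r by (intro Youngs_inequality_0) auto
    then have "w \<le> w powr r / r + (1 - 1 / r)"
      using w r by (simp add: powr_powr)
    then have "w * r \<le> (w powr r / r + (1 - 1 / r)) * r"
      using r by (intro mult_right_mono) auto
    also have "\<dots> = w powr r + r - 1"
      using r by (simp add: field_simps)
    finally show ?thesis
      by (simp add: algebra_simps)
  qed (use r in simp)
  let ?n = "real CARD('n)"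
  define m where "m = (norm z)\<^sup>2 / ?n"
  have m: "m > 0" using False by (simp add: m_def)
  have e: "\<bar>z $ i\<bar> powr p = m powr r * ((z $ i)\<^sup>2 / m) powr r" for i
  proof -
    have "\<bar>z $ i\<bar> powr p = (\<bar>z $ i\<bar> powr 2) powr r"
      unfolding powr_powr r_def by simp
    also have "\<bar>z $ i\<bar> powr 2 = (z $ i)\<^sup>2"
      by (cases "z $ i = 0") (simp_all add: powr_numeral)
    finally have *: "\<bar>z $ i\<bar> powr p = (z $ i)\<^sup>2 powr r" .
    have "m powr r * ((z $ i)\<^sup>2 / m) powr r = (m * ((z $ i)\<^sup>2 / m)) powr r"
      by (rule powr_mult[symmetric])
    also have "m * ((z $ i)\<^sup>2 / m) = (z $ i)\<^sup>2"
      using m by simp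
    finally show ?thesis by (simp only: *)
  qed
  have "(\<Sum>i\<in>UNIV. 1 + r * ((z $ i)\<^sup>2 / m - 1)) = ?n"
  proof -
    have "(\<Sum>i\<in>UNIV. (z $ i)\<^sup>2 / m) = (norm z)\<^sup>2 / m"
      unfolding sum_divide_distrib[symmetric] power2_norm_eq_inner inner_vec_def by (simp add: power2_eq_square)
    also have "\<dots> = ?n" using False by (simp add: m_def)
    finally show ?thesis
      by (simp add: sum.distrib sum_distrib_left[symmetric] sum_subtractf)
  qed
  then have "?n \<le> (\<Sum>i\<in>UNIV. ((z $ i)\<^sup>2 / m) powr r)"
    using sum_mono[of UNIV "\<lambda>i. 1 + r * ((z $ i)\<^sup>2 / m - 1)" "\<lambda>i. ((z $ i)\<^sup>2 / m) powr r"] bern m by simp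
  then have "m powr r * ?n \<le> (\<Sum>i\<in>UNIV. \<bar>z $ i\<bar> powr p)"
    unfolding e sum_distrib_left[symmetric] by (intro mult_left_mono) auto
  moreover have "m powr r * ?n = ?n powr (1 - p / 2) * norm z powr p"
  proof -
    have "norm z powr p = (norm z powr 2) powr r"
      unfolding powr_powr r_def by simp
    also have "norm z powr 2 = (norm z)\<^sup>2" using False by (simp add: powr_numeral)
    finally have "m powr r = norm z powr p / ?n powr r"
      by (simp add: m_def powr_divide)
    moreover have "?n powr (1 - p / 2) = ?n / ?n powr r"
      by (simp add: powr_diff r_def)
    ultimately show ?thesis by simp
  qed
  ultimately show ?thesis by simp
qed (use p in \<open>simp add: sum_nonneg\<close>)

subsection \<open>Coordinates as test functions\<close>

lemma exists_other_index: "CARD('n) \<ge> 2 \<Longrightarrow> \<exists>j :: 'n::finite. j \<noteq> i"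
proof (rule ccontr)
  assume n: "CARD('n) \<ge> 2" and "\<nexists>j :: 'n. j \<noteq> i"
  then have "(UNIV :: 'n set) = {i}" by auto
  then have "CARD('n) = card {i}" by (rule arg_cong)
  with n show False by simp
qed

lemma continuous_on_signed_powr:
  fixes p :: real
  assumes p: "1 < p"
  shows "continuous_on UNIV (\<lambda>s. \<bar>s\<bar> powr (p - 2) * s)"
proof -
  have pos: "s powr (p - 2) * s = s powr (p - 1)" if "s > 0" for s :: real
  proof -
    have "s powr (p - 2) * s powr 1 = s powr (p - 2 + 1)"
      by (rule powr_add[symmetric])
    then show ?thesis using that by simp
  qed
  have "\<bar>s\<bar> powr (p - 2) * s = max 0 s powr (p - 1) - max 0 (- s) powr (p - 1)" for s :: real
    using pos[of s] pos[of "- s"] by (cases s "0 :: real" rule: linorder_cases) auto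
  moreover have "continuous_on UNIV (\<lambda>s :: real. max 0 s powr (p - 1) - max 0 (- s) powr (p - 1))"
    using p by (intro continuous_intros continuous_on_powr') auto
  ultimately show ?thesis by presburger
qed

lemma gderiv_coordinate: "GDERIV (\<lambda>x :: real ^ 'n. x $ i - t) x :> axis i 1"
proof -
  have "GDERIV (\<lambda>x. x $ i) x :> (axis i 1 :: real ^ 'n)"
    by (auto simp: gderiv_def inner_axis intro: bounded_linear_imp_has_derivative)
  from GDERIV_diff[OF this GDERIV_const[of t]] show ?thesis by simp
qed

lemma steklov_quotient_nonneg: "steklov_quotient p \<Omega> u \<ge> 0"
  unfolding steklov_quotient_def set_lebesgue_integral_def
  by (intro divide_nonneg_nonneg integral_nonneg_AE AE_I2) auto

lemma steklov_mu1_le: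
  assumes "steklov_admissible p \<Omega> u"
  shows "steklov_mu1 p \<Omega> \<le> steklov_quotient p \<Omega> u"
  unfolding steklov_mu1_def
proof (rule cInf_lower)
  show "bdd_below {steklov_quotient p \<Omega> u |u. steklov_admissible p \<Omega> u}"
    by (rule bdd_belowI[of _ 0]) (auto simp: steklov_quotient_nonneg)
qed (use assms in blast)

lemma eq_ball_if_frontier_eq_sphere:
  fixes \<Omega> :: "'a::euclidean_space set"
  assumes \<Omega>: "open \<Omega>" "connected \<Omega>" "bounded \<Omega>" and R: "R > 0" and fr: "frontier \<Omega> = sphere q R"
  shows "\<Omega> = ball q R"
proof -
  have fb: "frontier (ball q R) = sphere q R" using R by (simp add: frontier_ball)
  have disj: "\<Omega> \<inter> sphere q R = {}"
    using \<Omega>(1) unfolding fr[symmetric] frontier_def by (simp add: interior_open)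
  have 1: "\<Omega> \<inter> ball q R = {} \<or> \<Omega> \<subseteq> ball q R"
    using connected_Int_frontier[OF \<Omega>(2), of "ball q R"] disj unfolding fb by blast
  have 2: "\<Omega> \<inter> ball q R = {} \<or> ball q R \<subseteq> \<Omega>"
  proof -
    have "ball q R \<inter> sphere q R = {}" by auto
    then show ?thesis
      using connected_Int_frontier[OF connected_ball, of q R \<Omega>] unfolding fr by blast
  qed
  have "\<Omega> \<inter> ball q R \<noteq> {}"
  proof
    assume e: "\<Omega> \<inter> ball q R = {}"
    have "\<Omega> \<noteq> {}"
    proof
      assume "\<Omega> = {}"
      then have "sphere q R = {}" using fr by simp
      then show False using R by simp
    qed
    then obtain x where x: "x \<in> \<Omega>" by blast
    then have "x \<notin> ball q R" "x \<notin> sphere q R" using e disj by blast+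
    then have n: "norm (x - q) > R" by (simp add: dist_norm norm_minus_commute)
    then have "x - q \<noteq> 0" using R by auto
    from ray_meets_frontier[OF \<Omega>(1,3) x this] obtain t where t: "t > 0" and "x + t *\<^sub>R (x - q) \<in> sphere q R"
      unfolding fr by blast
    then have "norm (x + t *\<^sub>R (x - q) - q) = R" by (simp add: dist_norm norm_minus_commute)
    moreover have "x + t *\<^sub>R (x - q) - q = (1 + t) *\<^sub>R (x - q)" by (simp add: algebra_simps)
    ultimately have "(1 + t) * norm (x - q) = R" using t by simp
    moreover have "1 * norm (x - q) \<le> (1 + t) * norm (x - q)"
      using t by (intro mult_right_mono) auto
    ultimately show False using n by linarith
  qed
  with 1 2 show ?thesis by blast
qed

context smooth_domain
begin

lemma balancing:
  assumes p: "1 < p"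
  obtains t where "(LINT x|\<sigma>. \<bar>x $ i - t\<bar> powr (p - 2) * (x $ i - t)) = 0"
proof -
  interpret finite_measure \<sigma> by (rule finite_surface_measure)
  define g where "g s = \<bar>s\<bar> powr (p - 2) * s" for s :: real
  have g: "continuous_on UNIV g"
    unfolding g_def[abs_def] by (rule continuous_on_signed_powr[OF p])
  obtain N where N: "N > 0" "\<And>x. x \<in> M \<Longrightarrow> norm x \<le> N"
    using compact_imp_bounded[OF compact_boundary] unfolding bounded_pos by blast
  have comp: "\<bar>x $ i\<bar> \<le> N" if "x \<in> M" for x
    using component_le_norm_cart[of x i] N(2)[OF that] by linarith
  obtain K where K: "\<And>s. s \<in> {- (2 * N)..2 * N} \<Longrightarrow> norm (g s) \<le> K"
    using compact_imp_bounded[OF compact_continuous_image[OF continuous_on_subset[OF g subset_UNIV] compact_Icc], of "- (2 * N)" "2 * N"]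
    unfolding bounded_iff by blast
  have gM: "continuous_on M (\<lambda>x. g (x $ i - t))" for t
    by (intro continuous_on_compose2[OF g] continuous_intros) auto
  have int: "integrable \<sigma> (\<lambda>x. g (x $ i - t))" for t
    by (rule integrable_surface_measure[OF gM])
  define \<Phi> where "\<Phi> t = (LINT x|\<sigma>. g (x $ i - t))" for t
  have "continuous_on {- N..N} \<Phi>"
  proof (rule continuous_on_sequentiallyI)
    fix u a assume u: "\<forall>n. u n \<in> {- N..N}" and a: "a \<in> {- N..N}" and ua: "u \<longlonglongrightarrow> a"
    show "(\<lambda>n. \<Phi> (u n)) \<longlonglongrightarrow> \<Phi> a"
      unfolding \<Phi>_def
    proof (rule integral_dominated_convergence[where w = "\<lambda>_. K"])
      show "AE x in \<sigma>. (\<lambda>n. g (x $ i - u n)) \<longlonglongrightarrow> g (x $ i - a)"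
      proof (rule AE_I2)
        fix x
        have "isCont g (x $ i - a)"
          using g by (simp add: continuous_on_eq_continuous_at)
        then show "(\<lambda>n. g (x $ i - u n)) \<longlonglongrightarrow> g (x $ i - a)"
          by (rule isCont_tendsto_compose) (intro tendsto_diff tendsto_const ua)
      qed
      show "AE x in \<sigma>. norm (g (x $ i - u n)) \<le> K" for n
      proof (rule AE_I2)
        fix x assume "x \<in> space \<sigma>"
        then have "\<bar>x $ i\<bar> \<le> N" using comp by simp
        moreover have "- N \<le> u n" "u n \<le> N" using u by auto
        ultimately show "norm (g (x $ i - u n)) \<le> K"
          by (intro K) auto
      qed
    qed (use int in auto)
  qed
  moreover have "\<Phi> (- N) \<ge> 0"
    unfolding \<Phi>_def
  proof (intro integral_nonneg_AE AE_I2)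
    fix x assume "x \<in> space \<sigma>"
    then have "\<bar>x $ i\<bar> \<le> N" using comp by simp
    then show "g (x $ i - - N) \<ge> 0" by (auto simp: g_def)
  qed
  moreover have "(LINT x|\<sigma>. - g (x $ i - N)) \<ge> 0"
  proof (intro integral_nonneg_AE AE_I2)
    fix x assume "x \<in> space \<sigma>"
    then have "\<bar>x $ i\<bar> \<le> N" using comp by simp
    then have "\<bar>x $ i - N\<bar> powr (p - 2) * (N - x $ i) \<ge> 0"
      by (intro mult_nonneg_nonneg) auto
    then show "- g (x $ i - N) \<ge> 0" by (simp add: g_def algebra_simps)
  qed
  then have "\<Phi> N \<le> 0"
    by (simp add: \<Phi>_def)
  ultimately obtain t where "\<Phi> t = 0"
    using IVT2'[of \<Phi> N 0 "- N"] N(1) by auto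
  then show ?thesis
    using that unfolding \<Phi>_def g_def by blast
qed

lemma coordinate_admissible:
  assumes n: "CARD('n) \<ge> 2" and ne: "\<Omega> \<noteq> {}"
    and bal: "(LINT x|\<sigma>. \<bar>x $ i - t\<bar> powr (p - 2) * (x $ i - t)) = 0"
  shows "steklov_admissible p \<Omega> (\<lambda>x. x $ i - t)"
proof -
  have "C1_closure \<Omega> (\<lambda>x. x $ i - t)"
    unfolding C1_closure_def
  proof (intro conjI ballI exI[of _ "\<lambda>_. axis i 1"])
    show "continuous_on (closure \<Omega>) (\<lambda>x. x $ i - t)" by (intro continuous_intros)
    show "(\<lambda>x :: real ^ 'n. x $ i - t) differentiable (at x)" for x
      using gderiv_coordinate[of i t x] unfolding gderiv_def by (rule differentiableI)
    show "axis i 1 = grad (\<lambda>x. x $ i - t) x" for x :: "real ^ 'n"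
      by (rule grad_eqI[OF gderiv_coordinate, symmetric])
  qed auto
  moreover have "\<exists>x\<in>M. x $ i - t \<noteq> 0"
  proof -
    obtain x0 where x0: "x0 \<in> \<Omega>" using ne by blast
    obtain e where e: "e > 0" "\<And>s. \<bar>s\<bar> < e \<Longrightarrow> x0 + s *\<^sub>R axis i 1 \<in> \<Omega>"
      using open_contains_segment[OF open_domain x0] by metis
    have "\<exists>x\<in>\<Omega>. x $ i \<noteq> t"
    proof (cases "x0 $ i = t")
      case True
      have "x0 + (e / 2) *\<^sub>R axis i 1 \<in> \<Omega>" using e(1) by (intro e(2)) auto
      moreover have "(x0 + (e / 2) *\<^sub>R axis i 1) $ i \<noteq> t" using True e(1) by (simp add: axis_def)
      ultimately show ?thesis by blast
    qed (use x0 in blast)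
    then obtain x where x: "x \<in> \<Omega>" "x $ i \<noteq> t" by blast
    obtain j where j: "j \<noteq> i" using exists_other_index[OF n] by blast
    have "axis j 1 \<noteq> (0 :: real ^ 'n)" by (simp add: axis_eq_0_iff)
    from ray_meets_frontier[OF open_domain bounded_domain x(1) this]
    obtain s where "x + s *\<^sub>R axis j 1 \<in> M" by blast
    moreover have "(x + s *\<^sub>R axis j 1) $ i - t \<noteq> 0" using x(2) j by (simp add: axis_def)
    ultimately show ?thesis by blast
  qed
  ultimately show ?thesis
    using bal by (simp add: steklov_admissible_def)
qed

lemma coordinate_bound:
  assumes n: "CARD('n) \<ge> 2" and p: "1 < p" and ne: "\<Omega> \<noteq> {}"
    and bal: "(LINT x|\<sigma>. \<bar>x $ i - t\<bar> powr (p - 2) * (x $ i - t)) = 0"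
  shows "steklov_mu1 p \<Omega> * (LINT x|\<sigma>. \<bar>x $ i - t\<bar> powr p) \<le> measure lborel \<Omega>"
proof -
  note adm = coordinate_admissible[OF n ne bal]
  let ?A = "LINT x|\<sigma>. \<bar>x $ i - t\<bar> powr p"
  have "(LINT x:\<Omega>|lebesgue. norm (grad (\<lambda>x. x $ i - t) x) powr p) = (LINT x|lebesgue. indicator \<Omega> x)"
    unfolding set_lebesgue_integral_def grad_eqI[OF gderiv_coordinate] by simp
  also have "\<dots> = measure lebesgue \<Omega>" by simp
  also have "\<dots> = measure lborel \<Omega>" using open_domain by (simp add: measure_completion)
  finally have q: "steklov_quotient p \<Omega> (\<lambda>x. x $ i - t) = measure lborel \<Omega> / ?A"
    by (simp add: steklov_quotient_def)
  obtain y where y: "y \<in> M" "y $ i - t \<noteq> 0"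
    using adm by (auto simp: steklov_admissible_def)
  have "?A > 0"
  proof (rule integral_surface_measure_pos)
    show "continuous_on M (\<lambda>x. \<bar>x $ i - t\<bar> powr p)"
      using p by (intro continuous_on_powr' continuous_intros) auto
    show "\<bar>y $ i - t\<bar> powr p > 0" using y(2) by simp
  qed (use y(1) in auto)
  then show ?thesis
    using steklov_mu1_le[OF adm] unfolding q by (simp add: pos_le_divide_eq)
qed

lemma integrable_coordinate_powr:
  assumes "1 < p"
  shows "integrable \<sigma> (\<lambda>x. \<bar>(x - q) $ i\<bar> powr p)"
  using assms by (intro integrable_surface_measure continuous_on_powr' continuous_intros) auto

lemma mu1_bound:
  assumes n: "CARD('n) \<ge> 2" and p: "1 < p" and ne: "\<Omega> \<noteq> {}"
  obtains q where "steklov_mu1 p \<Omega> * (LINT x|\<sigma>. (\<Sum>i\<in>UNIV. \<bar>(x - q) $ i\<bar> powr p)) \<le> real CARD('n) * measure lborel \<Omega>"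
    and "\<exists>u. steklov_admissible p \<Omega> u"
proof -
  have "\<forall>i. \<exists>t. (LINT x|\<sigma>. \<bar>x $ i - t\<bar> powr (p - 2) * (x $ i - t)) = 0"
    by (intro allI) (rule balancing[OF p], rule exI, assumption)
  from choice[OF this] obtain t where "\<forall>i. (LINT x|\<sigma>. \<bar>x $ i - t i\<bar> powr (p - 2) * (x $ i - t i)) = 0"
    by (rule exE)
  note t = this[rule_format]
  define q :: "real ^ 'n" where "q = (\<chi> i. t i)"
  have qi: "(x - q) $ i = x $ i - t i" for x i by (simp add: q_def)
  have "steklov_mu1 p \<Omega> * (LINT x|\<sigma>. (\<Sum>i\<in>UNIV. \<bar>(x - q) $ i\<bar> powr p))
      = (\<Sum>i\<in>UNIV. steklov_mu1 p \<Omega> * (LINT x|\<sigma>. \<bar>(x - q) $ i\<bar> powr p))"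
    unfolding sum_distrib_left[symmetric]
    by (subst Bochner_Integration.integral_sum) (simp_all only: integrable_coordinate_powr[OF p])
  also have "\<dots> \<le> (\<Sum>i\<in>(UNIV :: 'n set). measure lborel \<Omega>)"
    unfolding qi by (intro sum_mono coordinate_bound[OF n p ne t])
  also have "\<dots> = real CARD('n) * measure lborel \<Omega>" by simp
  finally show ?thesis
  proof (rule that)
    show "\<exists>u. steklov_admissible p \<Omega> u"
      by (intro exI) (rule coordinate_admissible[OF n ne t])
  qed
qed

lemma off_axis_point:
  assumes n: "CARD('n) \<ge> 2" and ne: "\<Omega> \<noteq> {}"
  obtains x i j where "x \<in> M" "i \<noteq> j" "(x - q) $ i \<noteq> 0" "(x - q) $ j \<noteq> 0"
proof -
  obtain i j :: 'n where ij: "i \<noteq> j" using exists_other_index[OF n] by metis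
  obtain x0 where x0: "x0 \<in> \<Omega>" using ne by blast
  let ?d = "axis i 1 + axis j 1 :: real ^ 'n"
  obtain e where e: "e > 0" "\<And>s. \<bar>s\<bar> < e \<Longrightarrow> x0 + s *\<^sub>R ?d \<in> \<Omega>"
    using open_contains_segment[OF open_domain x0] by metis
  have "infinite ({0<..<e} - {(q - x0) $ i, (q - x0) $ j})"
    using e(1) by (intro Diff_infinite_finite) (auto simp: infinite_Ioo)
  then have "{0<..<e} - {(q - x0) $ i, (q - x0) $ j} \<noteq> {}"
    by (rule infinite_imp_nonempty)
  then obtain s where "s \<in> {0<..<e} - {(q - x0) $ i, (q - x0) $ j}" by blast
  then have s: "0 < s" "s < e" "s \<noteq> (q - x0) $ i" "s \<noteq> (q - x0) $ j"
    by auto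
  define x where "x = x0 + s *\<^sub>R ?d"
  have x: "x \<in> \<Omega>" using s e(2)[of s] by (simp add: x_def)
  have xi: "(x - q) $ i \<noteq> 0" and xj: "(x - q) $ j \<noteq> 0"
    using s(3,4) ij by (auto simp: x_def axis_def algebra_simps)
  let ?v = "(x - q) $ i *\<^sub>R axis i 1 :: real ^ 'n"
  have "?v \<noteq> 0" using xi by (simp add: axis_eq_0_iff)
  from ray_meets_frontier[OF open_domain bounded_domain x this]
  obtain t where t: "t > 0" "x + t *\<^sub>R ?v \<in> M" by blast
  have "(x + t *\<^sub>R ?v - q) $ i = (1 + t) * (x - q) $ i"
    by (simp add: axis_def algebra_simps)
  then have "(x + t *\<^sub>R ?v - q) $ i \<noteq> 0" using xi t(1) by simp
  moreover have "(x + t *\<^sub>R ?v - q) $ j \<noteq> 0"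
    using xj ij by (simp add: axis_def)
  ultimately show ?thesis using that t(2) ij by blast
qed

lemma moment_lower_bound:
  assumes p: "1 < p" and R: "R > 0" and vol: "measure lborel \<Omega> = measure lborel (ball q R)"
  shows "real CARD('n) * R powr (p - 1) * measure lborel \<Omega> \<le> (LINT x|\<sigma>. norm (x - q) powr p)"
    and "(LINT x|\<sigma>. norm (x - q) powr p) \<le> real CARD('n) * R powr (p - 1) * measure lborel \<Omega> \<Longrightarrow> M = sphere q R"
proof -
  let ?c = "real CARD('n) + (p - 1)"
  let ?J = "\<lambda>S. LINT x|lborel. indicator S x * norm (x - q) powr (p - 1)"
  have a: "p - 1 > 0" using p by simp
  then have c: "?c > 0" by (simp add: add_nonneg_pos)
  note le = surface_moment_ge[OF p, of q]
  note re = rearrangement[OF open_domain bounded_domain R a vol]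
  have B: "?c * ?J (ball q R) = real CARD('n) * R powr (p - 1) * measure lborel \<Omega>"
    using ball_moment[OF R, of "p - 1" q] a vol by simp
  have "?c * ?J (ball q R) \<le> ?c * ?J \<Omega>"
    using re(1) c by (intro mult_left_mono) auto
  then show "real CARD('n) * R powr (p - 1) * measure lborel \<Omega> \<le> (LINT x|\<sigma>. norm (x - q) powr p)"
    using le B by linarith
  assume "(LINT x|\<sigma>. norm (x - q) powr p) \<le> real CARD('n) * R powr (p - 1) * measure lborel \<Omega>"
  then have "?c * ?J \<Omega> \<le> ?c * ?J (ball q R)"
    using le B by linarith
  then have "?J \<Omega> \<le> ?J (ball q R)"
    using c by (rule mult_left_le_imp_le)
  then show "M = sphere q R"
    by (intro AE_ball_imp_sphere[OF R] re(2))
qed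

lemma ball_quotient_ge:
  assumes n: "CARD('n) \<ge> 2" and R: "R > 0" and \<Omega>: "\<Omega> = ball q R" and adm: "steklov_admissible 2 \<Omega> u"
  shows "1 / R \<le> steklov_quotient 2 \<Omega> u"
proof (rule polar_integral[where 'n = 'n])
  fix C :: real assume C: "C > 0"
    and polar1: "\<And>(g :: real ^ 'n \<Rightarrow> real) B R. g \<in> borel_measurable borel \<Longrightarrow> (\<And>x. \<bar>g x\<bar> \<le> B) \<Longrightarrow> (\<And>x. norm x > R \<Longrightarrow> g x = 0) \<Longrightarrow>
      (LINT x|gauss. (LINT s:{0..R}|lborel. s ^ (CARD('n) - 1) * g (s *\<^sub>R sgn x))) = C * (LINT z|lborel. g z)"
    and polar2: "\<And>(g :: real ^ 'n \<Rightarrow> real) B R. g \<in> borel_measurable borel \<Longrightarrow> (\<And>x. \<bar>g x\<bar> \<le> B) \<Longrightarrow> (\<And>x. norm x > R \<Longrightarrow> g x = 0) \<Longrightarrow>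
      (LINT s:{0..R}|lborel. s ^ (CARD('n) - 1) * (LINT x|gauss. g (s *\<^sub>R sgn x))) = C * (LINT z|lborel. g z)"
  have M_sphere: "M = sphere q R" using \<Omega> R by (simp add: frontier_ball)
  have cl: "closure \<Omega> = cball q R" using \<Omega> R by simp
  obtain G where u_cont: "continuous_on (cball q R) u" and u_diff: "\<And>x. x \<in> \<Omega> \<Longrightarrow> u differentiable (at x)"
    and G_cont: "continuous_on (cball q R) G" and G: "\<And>x. x \<in> \<Omega> \<Longrightarrow> G x = grad u x"
    using adm unfolding steklov_admissible_def C1_closure_def cl by blast
  define u' where "u' x = indicator (cball q R) x *\<^sub>R u x" for x
  define G' where "G' x = indicator (cball q R) x *\<^sub>R G x" for x
  have u'_eq: "u' x = u x" and G'_eq: "G' x = G x" if "x \<in> cball q R" for x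
    using that by (simp_all add: u'_def G'_def)
  have u'_m [measurable]: "u' \<in> borel_measurable borel"
    unfolding u'_def[abs_def] by (intro borel_measurable_continuous_on_indicator u_cont) simp
  have G'_m [measurable]: "G' \<in> borel_measurable borel"
    unfolding G'_def[abs_def] by (intro borel_measurable_continuous_on_indicator G_cont) simp
  obtain B1 where B1: "\<And>x. x \<in> cball q R \<Longrightarrow> norm (u x) \<le> B1"
    using compact_imp_bounded[OF compact_continuous_image[OF u_cont compact_cball]] unfolding bounded_iff by blast
  obtain B2 where B2: "\<And>x. x \<in> cball q R \<Longrightarrow> norm (G x) \<le> B2"
    using compact_imp_bounded[OF compact_continuous_image[OF G_cont compact_cball]] unfolding bounded_iff by blast
  define B where "B = \<bar>B1\<bar> + \<bar>B2\<bar>"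
  have uB: "\<bar>u' x\<bar> \<le> B" for x
  proof (cases "x \<in> cball q R")
    case True
    then show ?thesis using B1[OF True] u'_eq[OF True] by (simp add: B_def)
  qed (simp add: u'_def B_def)
  have GB: "norm (G' x) \<le> B" for x
  proof (cases "x \<in> cball q R")
    case True
    then show ?thesis using B2[OF True] G'_eq[OF True] by (simp add: B_def)
  qed (simp add: G'_def B_def)
  have GD: "GDERIV u' x :> G' x" if x: "x \<in> ball q R" for x
  proof -
    have xc: "x \<in> cball q R" using x by simp
    have "(u has_derivative (\<lambda>h. h \<bullet> G' x)) (at x)"
      using GDERIV_grad[OF u_diff] x G \<Omega> G'_eq[OF xc] unfolding gderiv_def by simp
    then show ?thesis
      unfolding gderiv_def
      by (rule has_derivative_transform_within_open[OF _ open_ball x]) (simp add: u'_eq)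
  qed
  have G'_cont: "continuous_on (ball q R) G'"
    using continuous_on_subset[OF G_cont ball_subset_cball]
    by (rule continuous_on_eq) (simp add: G'_eq)
  have u'_cont: "continuous_on (cball q R) u'"
    using u_cont by (rule continuous_on_eq) (simp add: u'_eq)
  then have u'_M: "continuous_on M u'"
    by (rule continuous_on_subset) (simp add: M_sphere sphere_cball)
  let ?K = "R ^ (CARD('n) - 1)" and ?L = "R ^ (CARD('n) - 2)"
  let ?E = "\<lambda>f :: real ^ 'n \<Rightarrow> real. LINT x|gauss. f (q + R *\<^sub>R sgn x)"
  have uM: "u' x = u x" if "x \<in> space \<sigma>" for x
  proof (rule u'_eq)
    have "x \<in> M" using that by simp
    then show "x \<in> cball q R" unfolding M_sphere by simp
  qed
  have "C * (LINT x|\<sigma>. u' x) = ?K * ?E u'"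
    by (rule sphere_integral_polar[OF \<Omega> R u'_M u'_m C polar1]; assumption?)
  moreover have "(LINT x|\<sigma>. u' x) = 0"
  proof -
    have "(LINT x|\<sigma>. u' x) = (LINT x|\<sigma>. \<bar>u x\<bar> powr (2 - 2) * u x)"
      by (intro Bochner_Integration.integral_cong) (auto simp: uM)
    then show ?thesis using adm by (simp only: steklov_admissible_def)
  qed
  ultimately have E0: "?E u' = 0" using R by simp
  have sq: "C * (LINT x|\<sigma>. (u' x)\<^sup>2) = ?K * ?E (\<lambda>x. (u' x)\<^sup>2)"
    by (rule sphere_integral_polar[OF \<Omega> R continuous_on_power[OF u'_M] _ C polar1]; assumption?) measurable
  define D where "D = (LINT z|lborel. (norm (G' z))\<^sup>2)"
  have "?L * (?E (\<lambda>x. (u' x)\<^sup>2) - (?E u')\<^sup>2)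
      \<le> (LINT s:{0..R}|lborel. s ^ (CARD('n) - 1) * (LINT x|gauss. (norm (G' (q + s *\<^sub>R sgn x)))\<^sup>2))"
    by (rule ball_trace[OF n R u'_m G'_m uB GB GD G'_cont u'_cont])
  also have "\<dots> = C * (LINT z|lborel. (norm (G' (q + z)))\<^sup>2)"
  proof (rule polar2[where B = "B\<^sup>2"])
    show "\<bar>(norm (G' (q + x)))\<^sup>2\<bar> \<le> B\<^sup>2" for x
      using GB[of "q + x"] by (simp add: power_mono)
    show "(norm (G' (q + x)))\<^sup>2 = 0" if "norm x > R" for x
      using that by (simp add: G'_def dist_norm)
  qed measurable
  also have "(LINT z|lborel. (norm (G' (q + z)))\<^sup>2) = D"
    unfolding D_def by (rule integral_lborel_translate) measurable
  finally have tr: "?L * ?E (\<lambda>x. (u' x)\<^sup>2) \<le> C * D" by (simp add: E0)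
  have "C * (LINT x|\<sigma>. (u' x)\<^sup>2) = R * (?L * ?E (\<lambda>x. (u' x)\<^sup>2))"
  proof -
    have "CARD('n) - 1 = Suc (CARD('n) - 2)" using n by simp
    then have "?K = R * ?L" by (simp only: power_Suc)
    then show ?thesis by (simp only: sq mult.assoc)
  qed
  also have "\<dots> \<le> R * (C * D)" using tr R by (intro mult_left_mono) auto
  also have "\<dots> = C * (R * D)" by simp
  finally have le: "(LINT x|\<sigma>. (u' x)\<^sup>2) \<le> R * D"
    using C by (simp add: mult_le_cancel_left_pos)
  have den: "(LINT x|\<sigma>. \<bar>u x\<bar> powr 2) = (LINT x|\<sigma>. (u' x)\<^sup>2)"
  proof (intro Bochner_Integration.integral_cong refl)
    show "\<bar>u x\<bar> powr 2 = (u' x)\<^sup>2" if "x \<in> space \<sigma>" for x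
      by (cases "u x = 0") (simp_all add: uM[OF that] powr_numeral)
  qed
  obtain y where y: "y \<in> M" "u y \<noteq> 0" using adm by (auto simp: steklov_admissible_def)
  have pos: "(LINT x|\<sigma>. (u' x)\<^sup>2) > 0"
  proof (rule integral_surface_measure_pos)
    show "continuous_on M (\<lambda>x. (u' x)\<^sup>2)" by (rule continuous_on_power[OF u'_M])
    show "(u' y)\<^sup>2 > 0" using y uM[of y] by simp
  qed (use y in auto)
  have num: "(LINT x:\<Omega>|lebesgue. norm (grad u x) powr 2) = D"
  proof -
    have m2: "(\<lambda>x. (norm (G' x))\<^sup>2) \<in> borel_measurable borel"
      by measurable
    then have m: "(\<lambda>x. indicator (ball q R) x * (norm (G' x))\<^sup>2) \<in> borel_measurable borel"
      by (intro borel_measurable_times borel_measurable_indicator) simp_all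
    have "(LINT x:\<Omega>|lebesgue. norm (grad u x) powr 2) = (LINT x|lebesgue. indicator (ball q R) x * (norm (G' x))\<^sup>2)"
      unfolding set_lebesgue_integral_def
    proof (intro Bochner_Integration.integral_cong refl)
      fix x
      show "indicator \<Omega> x *\<^sub>R norm (grad u x) powr 2 = indicator (ball q R) x * (norm (G' x))\<^sup>2"
      proof (cases "x \<in> ball q R")
        case True
        then have "G' x = grad u x" using G[of x] G'_eq[of x] \<Omega> by simp
        then show ?thesis
          using True \<Omega> by (cases "grad u x = 0") (simp_all add: powr_numeral)
      qed (simp add: \<Omega>)
    qed
    also have "\<dots> = (LINT x|lborel. indicator (ball q R) x * (norm (G' x))\<^sup>2)"
      by (rule integral_completion) (simp add: m)
    also have "\<dots> = D"
      unfolding D_def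
    proof (rule integral_cong_AE)
      show "AE x in lborel. indicator (ball q R) x * (norm (G' x))\<^sup>2 = (norm (G' x))\<^sup>2"
        using AE_not_sphere[of q R] by eventually_elim (auto simp: G'_def indicator_def)
    qed (simp_all add: m m2)
    finally show ?thesis .
  qed
  show ?thesis
    unfolding steklov_quotient_def num den using le pos R by (simp add: field_simps)
qed

end

theorem theorem3:
  fixes \<Omega> :: "(real ^ 'n) set" and p R :: real
  assumes "CARD('n) \<ge> 2"
    and "1 < p"
    and "open \<Omega>" and "connected \<Omega>" and "bounded \<Omega>"
    and "smooth_boundary \<Omega>"
    and "R > 0"
    and "measure lebesgue \<Omega> = measure lebesgue (ball (0 :: real ^ 'n) R)"
  shows "(p < 2 \<longrightarrow> steklov_mu1 p \<Omega> \<le> 1 / R powr (p - 1)) \<and>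
    (p \<ge> 2 \<longrightarrow> steklov_mu1 p \<Omega> \<le> real CARD('n) powr (p - 2) / R powr (p - 1)) \<and>
    (p = 2 \<longrightarrow> (steklov_mu1 p \<Omega> = 1 / R \<longleftrightarrow> is_geodesic_sphere R (frontier \<Omega>))) \<and>
    ((p < 2 \<and> steklov_mu1 p \<Omega> = 1 / R powr (p - 1)) \<or>
     (p \<ge> 2 \<and> steklov_mu1 p \<Omega> = real CARD('n) powr (p - 2) / R powr (p - 1))
       \<longrightarrow> is_geodesic_sphere R (frontier \<Omega>) \<and> p = 2)"
proof -
  interpret smooth_domain \<Omega>
    using assms by unfold_locales
  note n = assms(1) and p = assms(2) and R = assms(7)
  let ?n = "real CARD('n)" and ?V = "measure lborel \<Omega>" and ?\<mu> = "steklov_mu1 p \<Omega>"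
  have n0: "?n \<ge> 2" using n by simp
  have vol: "?V = measure lborel (ball q R)" for q :: "real ^ 'n"
    using assms(8) content_ball_conv_unit_ball[of R q] content_ball_conv_unit_ball[of R "0 :: real ^ 'n"] R
      open_domain by (simp add: measure_completion)
  have V: "?V > 0"
    unfolding vol[of 0] by (rule content_ball_pos[OF R])
  then have ne: "\<Omega> \<noteq> {}" by auto
  obtain q where q: "?\<mu> * (LINT x|\<sigma>. (\<Sum>i\<in>UNIV. \<bar>(x - q) $ i\<bar> powr p)) \<le> ?n * ?V"
    and adm: "\<exists>u. steklov_admissible p \<Omega> u"
    by (rule mu1_bound[OF n p ne])
  let ?S = "LINT x|\<sigma>. (\<Sum>i\<in>UNIV. \<bar>(x - q) $ i\<bar> powr p)"
  let ?I = "LINT x|\<sigma>. norm (x - q) powr p"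
  let ?k = "1 / R powr (p - 1)"
  note moment = moment_lower_bound[OF p R vol[of q]]
  have k: "?k > 0" using R by simp
  have kI: "?n * ?V \<le> ?k * ?I"
    using moment(1) R by (simp add: field_simps)
  have I: "?I > 0"
  proof -
    have "?n * R powr (p - 1) * ?V > 0" using n0 V R by simp
    then show ?thesis using moment(1) by linarith
  qed
  have S_int: "integrable \<sigma> (\<lambda>x. \<Sum>i\<in>UNIV. \<bar>(x - q) $ i\<bar> powr p)"
    by (intro Bochner_Integration.integrable_sum integrable_coordinate_powr[OF p])
  have I_cont: "continuous_on A (\<lambda>x. norm (x - q) powr p)" for A
    using p by (intro continuous_on_norm_powr) simp
  have I_int: "integrable \<sigma> (\<lambda>x. norm (x - q) powr p)"
    by (rule integrable_surface_measure[OF I_cont])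
  have less: "?\<mu> < ?k" if p2: "p < 2"
  proof -
    have le: "norm z powr p \<le> (\<Sum>i\<in>UNIV. \<bar>z $ i\<bar> powr p)" for z :: "real ^ 'n"
      using p p2 by (intro sum_powr_ge_le2(1)) auto
    obtain x i j where x: "x \<in> M" "i \<noteq> j" "(x - q) $ i \<noteq> 0" "(x - q) $ j \<noteq> 0"
      by (rule off_axis_point[OF n ne])
    have "(LINT x|\<sigma>. (\<Sum>i\<in>UNIV. \<bar>(x - q) $ i\<bar> powr p) - norm (x - q) powr p) > 0"
    proof (rule integral_surface_measure_pos)
      show "continuous_on M (\<lambda>x. (\<Sum>i\<in>UNIV. \<bar>(x - q) $ i\<bar> powr p) - norm (x - q) powr p)"
        using p by (intro continuous_on_diff I_cont continuous_on_sum continuous_on_powr' continuous_intros) auto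
      show "(\<Sum>i\<in>UNIV. \<bar>(y - q) $ i\<bar> powr p) - norm (y - q) powr p \<ge> 0" for y
        using le[of "y - q"] by simp
      have "norm (x - q) powr p < (\<Sum>i\<in>UNIV. \<bar>(x - q) $ i\<bar> powr p)"
        using p p2 by (intro sum_powr_ge_le2(2)[OF _ _ _ x(3,4,2)]) auto
      then show "(\<Sum>i\<in>UNIV. \<bar>(x - q) $ i\<bar> powr p) - norm (x - q) powr p > 0" by simp
    qed (rule x(1))
    then have IS: "?I < ?S"
      using Bochner_Integration.integral_diff[OF S_int I_int] by linarith
    then have "?k * ?I < ?k * ?S"
      using k by (rule mult_strict_left_mono)
    then have "?\<mu> * ?S < ?k * ?S" using q kI by linarith
    moreover have "?S \<ge> 0" using IS I by linarith
    ultimately show ?thesis by (rule mult_right_less_imp_less)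
  qed
  let ?c = "?n powr (p / 2 - 1)"
  have le: "?\<mu> \<le> ?c * ?k" and IS: "?I \<le> ?c * ?S" if p2: "p \<ge> 2"
  proof -
    have c: "?c > 0" using n0 by simp
    have c1: "?c * ?n powr (1 - p / 2) = 1"
      using n0 unfolding powr_add[symmetric] by simp
    have "norm z powr p \<le> ?c * (\<Sum>i\<in>UNIV. \<bar>z $ i\<bar> powr p)" for z :: "real ^ 'n"
    proof -
      have "?c * (?n powr (1 - p / 2) * norm z powr p) \<le> ?c * (\<Sum>i\<in>UNIV. \<bar>z $ i\<bar> powr p)"
        using sum_powr_ge_ge2[OF p2, of z] c by (intro mult_left_mono) auto
      then show ?thesis unfolding mult.assoc[symmetric] c1 by simp
    qed
    then have "?I \<le> (LINT x|\<sigma>. ?c * (\<Sum>i\<in>UNIV. \<bar>(x - q) $ i\<bar> powr p))"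
      by (intro integral_mono I_int integrable_mult_right S_int)
    then show IS: "?I \<le> ?c * ?S" by simp
    then have "?c * ?S > 0" using I by linarith
    then have S: "?S > 0" using c zero_less_mult_pos by blast
    have "?k * ?I \<le> ?k * (?c * ?S)"
      using IS k by (intro mult_left_mono) auto
    also have "\<dots> = (?c * ?k) * ?S" by simp
    finally have "?\<mu> * ?S \<le> (?c * ?k) * ?S" using q kI by linarith
    then show "?\<mu> \<le> ?c * ?k" using S by (rule mult_right_le_imp_le)
  qed
  have gt: "?\<mu> < ?n powr (p - 2) / R powr (p - 1)" if "p > 2"
  proof -
    have "?c < ?n powr (p - 2)" using that n0 by (intro powr_less_mono) auto
    then have "?c * ?k < ?n powr (p - 2) * ?k" using k by (rule mult_strict_right_mono)
    then show ?thesis using le that by simp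
  qed
  have eq2: "?\<mu> \<le> 1 / R" "?\<mu> = 1 / R \<longleftrightarrow> is_geodesic_sphere R M" if p2: "p = 2"
  proof -
    have c1: "?c = 1" using p2 n0 by simp
    have k1: "?k = 1 / R" using p2 R by simp
    show le1: "?\<mu> \<le> 1 / R" using le p2 unfolding c1 k1 by simp
    show "?\<mu> = 1 / R \<longleftrightarrow> is_geodesic_sphere R M"
    proof
      assume \<mu>: "?\<mu> = 1 / R"
      have "?S \<le> R * (?n * ?V)"
        using q R unfolding \<mu> by (simp add: field_simps)
      moreover have "R powr (p - 1) = R" using p2 R by simp
      ultimately have "?I \<le> ?n * R powr (p - 1) * ?V"
        using IS p2 unfolding c1 by (simp add: mult_ac)
      then show "is_geodesic_sphere R M"
        using moment(2) unfolding is_geodesic_sphere_def by blast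
    next
      assume "is_geodesic_sphere R M"
      then obtain c where "M = sphere c R" unfolding is_geodesic_sphere_def by blast
      from eq_ball_if_frontier_eq_sphere[OF open_domain assms(4) bounded_domain R this]
      have ball: "\<Omega> = ball c R" .
      have "1 / R \<le> ?\<mu>"
        unfolding steklov_mu1_def
      proof (rule cInf_greatest)
        show "{steklov_quotient p \<Omega> u |u. steklov_admissible p \<Omega> u} \<noteq> {}"
          using adm by blast
        show "1 / R \<le> v" if "v \<in> {steklov_quotient p \<Omega> u |u. steklov_admissible p \<Omega> u}" for v
          using that ball_quotient_ge[OF n R ball] unfolding p2 by blast
      qed
      with le1 show "?\<mu> = 1 / R" by simp
    qed
  qed
  consider "p < 2" | "p = 2" | "p > 2" by linarith
  then show ?thesis
  proof cases
    case 1
    then show ?thesis using less by auto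
  next
    case 2
    have "?n powr (p - 2) / R powr (p - 1) = 1 / R" using 2 R n0 by simp
    then show ?thesis using eq2[OF 2] 2 by simp
  next
    case 3
    then show ?thesis using gt by auto
  qed
qed

end
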